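(* Let $0<\delta\le1$ and $T\in\mathrm{SK}^{-1}(\delta)$ be such that for every $Q\in\mathcal D$, $$\int_{\mathbb R^n}T(\psi_Q)(x)\,dx=\int_{\mathbb R^n}T^t(\varphi_Q)(x)\,dx=0.$$ Then $T\in\mathrm{ADP}(\delta)$. In particular, $T$ and $T^t$ have bounded extensions $\dot F^{\alpha q}_p\to\dot F^{1+\alpha,q}_p$ for all $1\le p,q<\infty$ and $-1\le\alpha\le0$.
   Context: Work on $\mathbb R^n$, $n\ge2$. $\mathcal S$ is the Schwartz class, $\hat f(\xi)=(2\pi)^{-n/2}\int f(x)e^{-ix\cdot\xi}dx$; $\mathcal S_0=\{\varphi\in\mathcal S:\partial^\alpha\hat\varphi(0)=0\text{ for all }\alpha\}$; $\mathcal S'/\mathcal P$ is identified with the dual of $\mathcal S_0$; $\langle\cdot,\cdot\rangle$ is the bilinear pairing. $f_\nu(x)=2^{\nu n}f(2^\nu x)$. Dyadic cubes: $Q_{\nu k}=\{x: k_i\le 2^\nu x_i<k_i+1\}$, $x_Q=2^{-\nu}k$, $l(Q)=2^{-\nu}$, $\mathcal D$ the set of dyadic cubes, $f_Q(x)=|Q|^{-1/2}f(2^\nu x-k)$ for $Q=Q_{\nu k}$. Littlewood–Paley function: $\varphi\in\mathcal S_0$ with $\hat\varphi$ real-valued and radial, $\operatorname{supp}\hat\varphi\subset\{1/2<|\xi|<2\}$, $|\hat\varphi(\xi)|\ge c>0$ for $3/5\le|\xi|\le5/3$; its dual $\psi$: $\hat\psi=\hat\varphi/\rho$, $\rho(\xi)=\sum_\nu\hat\varphi(2^\nu\xi)^2$.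 A dual pair $\varphi,\psi$ is fixed. $\mathrm{SK}^{-1}(\delta)$: linear $T:\mathcal S_0\to\mathcal S'/\mathcal P$ with $Tf(x)=\int K(x,y)f(y)dy$, $K$ continuous off the diagonal, and for $x\neq y$, $0<|h|\le|x-y|/2$: $|K(x,y)|\le C_K|x-y|^{1-n}$, $|K(x+h,y)+K(x-h,y)-2K(x,y)|\le C_K|h|^{1+\delta}|x-y|^{-n-\delta}$, $|K(x,y+h)+K(x,y-h)-2K(x,y)|\le C_K|h|^{1+\delta}|x-y|^{-n-\delta}$; $T^t$ has kernel $K(y,x)$. $\dot F^{\alpha q}_p$ ($1\le p,q<\infty$): $f\in\mathcal S'/\mathcal P$ with $\|(\sum_{\nu\in\mathbb Z}(2^{\nu\alpha}|\varphi_\nu*f|)^q)^{1/q}\|_{L^p}<\infty$. For $\varepsilon>0$, $P,Q\in\mathcal D$: $\omega_{P,Q}(\varepsilon)=\frac{(l(P)\wedge l(Q))^{1+(n+\varepsilon)/2}}{(l(P)\vee l(Q))^{(n+\varepsilon)/2}}\big(1+\frac{|x_P-x_Q|}{l(P)\vee l(Q)}\big)^{-(n+\varepsilon)}$. $\mathrm{ADP}(\varepsilon)$ is the set of continuous linear $T:\mathcal S_0\to\mathcal S'/\mathcal P$ with continuous transpose $T^t:\mathcal S_0\to\mathcal S'/\mathcal P$ and $\sup_{P,Q\in\mathcal D}|\langle T(\psi_P),\varphi_Q\rangle|/\omega_{P,Q}(\varepsilon)<\infty$. *)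

theory Defs
  imports "HOL-Analysis.Analysis"
begin

type_synonym 'n fn = "real^'n \<Rightarrow> complex"

text \<open>Partial derivative in direction of the i-th coordinate, and iterated partial
  derivatives (a multi-index is represented by the list of directions).\<close>
definition pdiff :: "'n::finite \<Rightarrow> 'n fn \<Rightarrow> 'n fn" where
  "pdiff i f x = frechet_derivative f (at x) (axis i 1)"

fun pdiffs :: "'n::finite list \<Rightarrow> 'n fn \<Rightarrow> 'n fn" where
  "pdiffs [] f = f"
| "pdiffs (i # is) f = pdiff i (pdiffs is f)"

definition smooth_fn :: "'n::finite fn \<Rightarrow> bool" where
  "smooth_fn f \<longleftrightarrow> (\<forall>is x. pdiffs is f differentiable (at x))"

definition schwartz :: "'n::finite fn set" where
  "schwartz = {f. smooth_fn f \<and>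
     (\<forall>is (m::nat). bounded (range (\<lambda>x. (norm x) ^ m * norm (pdiffs is f x))))}"

definition fourier :: "'n::finite fn \<Rightarrow> 'n fn" where
  "fourier f \<xi> = complex_of_real ((2 * pi) powr (- real CARD('n) / 2)) *
      (LINT x|lborel. f x * exp (- \<i> * complex_of_real (x \<bullet> \<xi>)))"

definition schwartz0 :: "'n::finite fn set" where
  "schwartz0 = {f \<in> schwartz. \<forall>is. pdiffs is (fourier f) 0 = 0}"

definition seminorm_S :: "nat \<Rightarrow> 'n::finite list \<Rightarrow> 'n fn \<Rightarrow> real" where
  "seminorm_S m is f = (SUP x. (1 + norm x) ^ m * norm (pdiffs is f x))"

definition lin_on_S0 :: "('n::finite fn \<Rightarrow> complex) \<Rightarrow> bool" where
  "lin_on_S0 u \<longleftrightarrow> (\<forall>f\<in>schwartz0. \<forall>g\<in>schwartz0. \<forall>a b.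
       u (\<lambda>x. a * f x + b * g x) = a * u f + b * u g)"

definition cont_on_S0 :: "('n::finite fn \<Rightarrow> complex) \<Rightarrow> bool" where
  "cont_on_S0 u \<longleftrightarrow> (\<exists>C N. \<forall>f\<in>schwartz0.
       norm (u f) \<le> C * (\<Sum>m\<le>N. \<Sum>is\<in>{is::'n list. length is \<le> N}. seminorm_S m is f))"

text \<open>Elements of S'/P, identified with continuous linear functionals on S_0;
  the pairing is <u, g> = u g.\<close>
definition SP :: "('n::finite fn \<Rightarrow> complex) set" where
  "SP = {u. lin_on_S0 u \<and> cont_on_S0 u}"

type_synonym 'n op = "'n fn \<Rightarrow> 'n fn \<Rightarrow> complex"

definition lin_op :: "'n::finite op \<Rightarrow> bool" where
  "lin_op T \<longleftrightarrow> (\<forall>f\<in>schwartz0. T f \<in> SP) \<and>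
     (\<forall>f\<in>schwartz0. \<forall>g\<in>schwartz0. \<forall>a b. \<forall>h\<in>schwartz0.
        T (\<lambda>x. a * f x + b * g x) h = a * T f h + b * T g h)"

definition transp :: "'n::finite op \<Rightarrow> 'n op" where
  "transp T = (\<lambda>g f. T f g)"

text \<open>Continuity of T : S_0 -> S'/P (S'/P with its weak-* topology).\<close>
definition cont_op :: "'n::finite op \<Rightarrow> bool" where
  "cont_op T \<longleftrightarrow> lin_op T \<and> (\<forall>g\<in>schwartz0. cont_on_S0 (\<lambda>f. T f g))"

definition dil :: "'n::finite fn \<Rightarrow> int \<Rightarrow> 'n fn" where
  "dil f \<nu> x = complex_of_real (2 powr (real_of_int \<nu> * real CARD('n))) * f ((2 powr real_of_int \<nu>) *\<^sub>R x)"

text \<open>Dyadic cube Q_{nu k} is represented by the pair (nu, k).\<close>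
type_synonym 'n cube = "int \<times> (int^'n)"

definition cvec :: "int^'n::finite \<Rightarrow> real^'n" where
  "cvec k = (\<chi> i. real_of_int (k $ i))"

definition side :: "'n::finite cube \<Rightarrow> real" where
  "side Q = 2 powr (- real_of_int (fst Q))"

definition corner :: "'n::finite cube \<Rightarrow> real^'n" where
  "corner Q = (2 powr (- real_of_int (fst Q))) *\<^sub>R cvec (snd Q)"

definition cubefn :: "'n::finite fn \<Rightarrow> 'n cube \<Rightarrow> 'n fn" where
  "cubefn f Q x = complex_of_real (2 powr (real_of_int (fst Q) * real CARD('n) / 2)) *
      f ((2 powr real_of_int (fst Q)) *\<^sub>R x - cvec (snd Q))"

definition LP_fun :: "'n::finite fn \<Rightarrow> bool" where
  "LP_fun \<phi> \<longleftrightarrow> \<phi> \<in> schwartz0 \<and>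
     (\<forall>\<xi>. Im (fourier \<phi> \<xi>) = 0) \<and>
     (\<forall>\<xi> \<eta>. norm \<xi> = norm \<eta> \<longrightarrow> fourier \<phi> \<xi> = fourier \<phi> \<eta>) \<and>
     closure {\<xi>. fourier \<phi> \<xi> \<noteq> 0} \<subseteq> {\<xi>. 1/2 < norm \<xi> \<and> norm \<xi> < 2} \<and>
     (\<exists>c>0. \<forall>\<xi>. 3/5 \<le> norm \<xi> \<and> norm \<xi> \<le> 5/3 \<longrightarrow> c \<le> norm (fourier \<phi> \<xi>))"

definition rho :: "'n::finite fn \<Rightarrow> 'n fn" where
  "rho \<phi> \<xi> = (\<Sum>\<^sub>\<infinity>\<nu>::int. (fourier \<phi> ((2 powr real_of_int \<nu>) *\<^sub>R \<xi>)) ^ 2)"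

definition dual_pair :: "'n::finite fn \<Rightarrow> 'n fn \<Rightarrow> bool" where
  "dual_pair \<phi> \<psi> \<longleftrightarrow> LP_fun \<phi> \<and> \<psi> \<in> schwartz \<and>
     (\<forall>\<xi>. fourier \<psi> \<xi> = fourier \<phi> \<xi> / rho \<phi> \<xi>)"

definition SKm1 :: "real \<Rightarrow> 'n::finite op \<Rightarrow> (real^'n \<Rightarrow> real^'n \<Rightarrow> complex) \<Rightarrow> bool" where
  "SKm1 \<delta> T K \<longleftrightarrow> lin_op T \<and>
     (\<forall>f\<in>schwartz0. \<forall>g\<in>schwartz0.
        T f g = (LINT x|lborel. (LINT y|lborel. K x y * f y) * g x)) \<and>
     continuous_on {(x, y). x \<noteq> y} (\<lambda>(x, y). K x y) \<and>
     (\<exists>C. \<forall>x y h. x \<noteq> y \<and> 0 < norm h \<and> norm h \<le> norm (x - y) / 2 \<longrightarrow>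
        norm (K x y) \<le> C * norm (x - y) powr (1 - real CARD('n)) \<and>
        norm (K (x + h) y + K (x - h) y - 2 * K x y)
          \<le> C * norm h powr (1 + \<delta>) * norm (x - y) powr (- real CARD('n) - \<delta>) \<and>
        norm (K x (y + h) + K x (y - h) - 2 * K x y)
          \<le> C * norm h powr (1 + \<delta>) * norm (x - y) powr (- real CARD('n) - \<delta>))"

definition omega :: "real \<Rightarrow> 'n::finite cube \<Rightarrow> 'n cube \<Rightarrow> real" where
  "omega \<epsilon> P Q =
     (let n = real CARD('n); lmin = min (side P) (side Q); lmax = max (side P) (side Q) in
      lmin powr (1 + (n + \<epsilon>) / 2) / lmax powr ((n + \<epsilon>) / 2) *
      (1 + norm (corner P - corner Q) / lmax) powr (- (n + \<epsilon>)))"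

definition ADP :: "'n::finite fn \<Rightarrow> 'n fn \<Rightarrow> real \<Rightarrow> 'n op \<Rightarrow> bool" where
  "ADP \<phi> \<psi> \<epsilon> T \<longleftrightarrow> cont_op T \<and> cont_op (transp T) \<and>
     (\<exists>C. \<forall>P Q. norm (T (cubefn \<psi> P) (cubefn \<phi> Q)) \<le> C * omega \<epsilon> P Q)"

definition LPconv :: "'n::finite fn \<Rightarrow> int \<Rightarrow> ('n fn \<Rightarrow> complex) \<Rightarrow> 'n fn" where
  "LPconv \<phi> \<nu> u x = u (\<lambda>y. dil \<phi> \<nu> (x - y))"

text \<open>p-th power of the F^{alpha q}_p quasi-norm (possibly infinite).\<close>
definition TL_normp :: "'n::finite fn \<Rightarrow> real \<Rightarrow> real \<Rightarrow> real \<Rightarrow> ('n fn \<Rightarrow> complex) \<Rightarrow> ennreal" where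
  "TL_normp \<phi> \<alpha> q p u =
     (\<integral>\<^sup>+ x. (let S = (\<integral>\<^sup>+ \<nu>. ennreal ((2 powr (real_of_int \<nu> * \<alpha>) * norm (LPconv \<phi> \<nu> u x)) powr q)
                        \<partial>count_space (UNIV::int set))
             in if S = (\<infinity>::ennreal) then (\<infinity>::ennreal) else ennreal (enn2real S powr (p / q))) \<partial>lborel)"

definition TL :: "'n::finite fn \<Rightarrow> real \<Rightarrow> real \<Rightarrow> real \<Rightarrow> ('n fn \<Rightarrow> complex) set" where
  "TL \<phi> \<alpha> q p = {u \<in> SP. TL_normp \<phi> \<alpha> q p u < (\<infinity>::ennreal)}"

definition emb :: "'n::finite fn \<Rightarrow> ('n fn \<Rightarrow> complex)" where
  "emb f = (\<lambda>g. LINT x|lborel. f x * g x)"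

definition bdd_ext :: "'n::finite fn \<Rightarrow> real \<Rightarrow> real \<Rightarrow> real \<Rightarrow> 'n op \<Rightarrow> bool" where
  "bdd_ext \<phi> \<alpha> q p T \<longleftrightarrow> (\<exists>(E :: ('n fn \<Rightarrow> complex) \<Rightarrow> ('n fn \<Rightarrow> complex)) (C::real).
     (\<forall>f\<in>schwartz0. \<forall>g\<in>schwartz0. E (emb f) g = T f g) \<and>
     (\<forall>u\<in>TL \<phi> \<alpha> q p. \<forall>v\<in>TL \<phi> \<alpha> q p. \<forall>a b. \<forall>g\<in>schwartz0.
        E (\<lambda>h. a * u h + b * v h) g = a * E u g + b * E v g) \<and>
     (\<forall>u\<in>TL \<phi> \<alpha> q p. E u \<in> TL \<phi> (1 + \<alpha>) q p \<and>
        TL_normp \<phi> (1 + \<alpha>) q p (E u) \<le> ennreal C * TL_normp \<phi> \<alpha> q p u))"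

end

theory Submission
  imports Defs
begin

text \<open>
  Testing the kernel bounds against the even mean zero functions \<open>\<phi>\<^sub>Q\<close> turns the second order
  differences into decay of order \<open>n + \<delta>\<close> of \<open>T\<^sup>t \<phi>\<^sub>Q\<close> away from \<open>Q\<close>; evenness is what allows symmetric
  differences only. Since \<open>T\<^sup>t \<phi>\<^sub>Q\<close> and \<open>T \<psi>\<^sub>P\<close> have mean zero, pairing with the wavelet of the
  larger cube gains the power of the ratio of the side lengths that almost diagonality asks for.

  The extension is the almost diagonal matrix conjugated by the wavelet transform. The Calderon
  formula \<open>f = (2\<pi>)\<^sup>-\<^sup>n \<Sum> <f, \<phi>\<^sub>P> \<psi>\<^sub>P\<close> follows from sampling of band limited functions, hence from
  Poisson summation. Sampling also bounds \<open>|<u, \<phi>\<^sub>P>|\<^sup>r\<close> for some \<open>r < 1\<close> by averages of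
  \<open>|\<phi>\<^sub>\<nu> * u|\<^sup>r\<close>, so the matrix is controlled by ball averages of \<open>r\<close>-th powers, to which the
  Fefferman--Stein inequality applies with the exponents \<open>p/r, q/r > 1\<close> even if \<open>p = 1\<close> or
  \<open>q = 1\<close>. That inequality is needed only for averages at one dyadic radius per scale, so no maximal
  function occurs.
\<close>

text \<open>Where \<delta> is spent: a mean zero function with decay of order n + \<delta> need not
  have a moment of order \<delta>, so cancellation is used at order \<delta> / 2 and produces the
  exponent (n + \<delta>) / 2 of \<open>omega\<close>. The number r is fixed by n / r = n + \<delta>
  / 4: the r-th power of the remaining decay stays integrable, and replacing samples by averages
  costs only half of the gain \<delta> / 2, so that a factor decaying in the distance of the scales
  survives. Both ends of -1 \<le> \<alpha> \<le> 0 enter there: a finer input contributes 1 +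
  \<alpha>, a finer output contributes -\<alpha>, and both are nonnegative in this range. The
  operator is given on \<open>schwartz0\<close> only, and the extension is not obtained by density.
  It is defined for each u in \<open>TL\<close> by an absolutely convergent double series, and it
  agrees with \<open>T\<close> because the Calderon formula sums this series once in the input and
  once in the output. Hence convergence and continuity of the series against every function in
  \<open>schwartz0\<close> need a proof of their own. Fourier inversion is avoided: uniqueness of
  the transform follows from Poisson summation on lattices of growing mesh.\<close>

abbreviation count_nn_integral :: "('a => ennreal) => ennreal" (binder "NS " 10) where
  "count_nn_integral f == nn_integral (count_space UNIV) f"

abbreviation lborel_nn_integral :: "('a::euclidean_space => ennreal) => ennreal" (binder "NI " 10) where
  "lborel_nn_integral f == nn_integral lborel f"

abbreviation count_integral :: "('a => 'b::{banach, second_countable_topology}) => 'b" (binder "LC " [60] 60) where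
  "count_integral f == integral\<^sup>L (count_space UNIV) f"

abbreviation lborel_integral :: "('a::euclidean_space => 'b::{banach, second_countable_topology}) => 'b" (binder "LI " [60] 60) where
  "lborel_integral f == integral\<^sup>L lborel f"

abbreviation "ri == real_of_int"

abbreviation "cr == complex_of_real"

abbreviation "p2 x == (2::real) powr x"

abbreviation "tp j == p2 (ri j)"

abbreviation "tm j == p2 (- ri j)"

abbreviation "ind == indicator"

abbreviation "bm == borel_measurable"

abbreviation "intc == integrable (count_space UNIV)"

abbreviation "intl == integrable lborel"

lemmas int_cong = Bochner_Integration.integral_cong[OF refl]

abbreviation "en == ennreal"

abbreviation "BM == bm borel"

notation scaleR (infixr "*R" 75)

section \<open>Polynomial weights and the integrals they control\<close>

definition wt :: "real => 'a::real_normed_vector => real" where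
 "wt m x = (1 + norm x) powr (- m)"

lemma wt_pos [simp]: "0 < wt m x"
proof -
 have "1 + norm x > 0" by (simp add: add_pos_nonneg)
 thus ?thesis by (simp add: wt_def)
qed

lemma wt_nonneg [simp]: "0 <= wt m x"
 using wt_pos less_imp_le by blast

lemma wt_0 [simp]: "wt m 0 = 1"
 by (simp add: wt_def)

lemma wt_minus [simp]: "wt m (- x) = wt m x"
 by (simp add: wt_def)

lemma wt_diff_commute: "wt m (x - y) = wt m (y - x)"
 by (simp add: wt_def norm_minus_commute)

lemma wt_mono: "m <= m' ==> wt m' x <= wt m x"
 by (simp add: wt_def powr_mono)

lemma wt_antimono_norm: "0 <= m ==> norm x <= norm y ==> wt m y <= wt m x"
 unfolding wt_def by (rule powr_mono2') (auto simp: add_pos_nonneg)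

lemma wt_le_1: "0 <= m ==> wt m x <= 1"
 using wt_antimono_norm[of m 0 x] by simp

lemma wt_mult: "wt a x * wt b x = wt (a + b) x"
 by (simp add: wt_def powr_add[symmetric] algebra_simps)

text \<open>Peetre's inequality, from
  \<open>1 + norm (x + y) \<le> (1 + norm x) * (1 + norm y)\<close>. Transfers of decay from one
  point to another rest on it.\<close>

lemma wt_add_ge:
 assumes "0 <= m" shows "wt m x * wt m y <= wt m (x + y)"
proof -
 have "1 + norm (x + y) <= (1 + norm x) * (1 + norm y)"
 proof -
 have "0 <= norm x * norm y" by simp
 hence "norm (x + y) <= norm x + norm y + norm x * norm y" using norm_triangle_ineq[of x y] by linarith
 thus ?thesis by (simp add: algebra_simps)
 qed
 hence "((1 + norm x) * (1 + norm y)) powr (- m) <= (1 + norm (x + y)) powr (- m)"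
 using assms by (intro powr_mono2') (auto simp: add_pos_nonneg)
 thus ?thesis by (simp add: wt_def powr_mult)
qed

lemma wt_powr: "wt m x powr t = wt (m * t) x"
 by (simp add: wt_def powr_powr)

lemma wt_measurable [measurable]: "wt m : BM"
 unfolding wt_def by measurable

lemma continuous_on_wt: "continuous_on A (wt m)"
proof -
 have "!!x::'a. 1 + norm x ~= 0" by (metis add_pos_nonneg norm_ge_zero less_irrefl zero_less_one)
 thus ?thesis unfolding wt_def by (intro continuous_intros) auto
qed

lemma norm_pow_wt: "norm x powr a * wt m x <= wt (m - a) x" if "0 <= a"
proof -
 have "norm x powr a <= (1 + norm x) powr a" using that by (intro powr_mono2) auto
 hence "norm x powr a * wt m x <= (1 + norm x) powr a * wt m x"
 by (intro mult_right_mono) auto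
 also have "... = wt (m - a) x" by (simp add: wt_def powr_add[symmetric])
 finally show ?thesis .
qed

lemma ennreal_suminf_ge_term: "f i <= (\<Sum>i. f i)" for f :: "nat => ennreal"
proof -
 have "sum f {i} <= suminf f" by (rule sum_le_suminf) auto
 thus ?thesis by simp
qed

text \<open>The space is peeled into the balls of radius \<open>2 ^ i\<close>. The same majorant
  yields integrability of the weight and, later, the passage from weighted integrals to sums of ball
  averages.\<close>

lemma wt_le_dyadic_sum:
 fixes x :: "'a::euclidean_space"
 assumes m: "0 <= m"
 shows "en (wt m x) <= (\<Sum>i. en (2 powr m * p2 (- (real i * m))) * ind (ball 0 (2 ^ i)) x)"
proof -
 obtain N where N: "norm x < 2 ^ N" using real_arch_pow[of 2 "norm x"] by auto
 define i where "i = (LEAST i. norm x < 2 ^ i)"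
 have i: "norm x < 2 ^ i" unfolding i_def by (rule LeastI[of _ N]) (rule N)
 \<comment> \<open>For \<open>i = 0\<close> the left side is 1/2 and the summand 1 suffices; for
   larger \<open>i\<close> minimality gives \<open>2 ^ (i - 1) \<le> norm x\<close>.\<close>
 have low: "p2 (real i - 1) <= 1 + norm x"
 proof (cases "i = 0")
 case True thus ?thesis by (simp add: powr_minus field_simps add_increasing2)
 next
 case False
 hence "~ norm x < 2 ^ (i - 1)" using not_less_Least[of "i - 1" "%i. norm x < 2 ^ i"]
 by (simp add: i_def[symmetric])
 moreover have "p2 (real i - 1) = 2 ^ (i - 1)"
 using False powr_realpow[of 2 "i - 1"] by (simp add: of_nat_diff)
 ultimately show ?thesis by simp
 qed
 have "wt m x <= (p2 (real i - 1)) powr (- m)"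
 unfolding wt_def using low m by (intro powr_mono2') auto
 also have "... = 2 powr m * p2 (- (real i * m))"
 by (simp add: powr_powr powr_add[symmetric] algebra_simps)
 finally have "en (wt m x) <= en (2 powr m * p2 (- (real i * m))) * ind (ball 0 (2 ^ i)) x"
 using i by (simp add: ennreal_leI)
 also have "... <= (\<Sum>i. en (2 powr m * p2 (- (real i * m))) * ind (ball 0 (2 ^ i)) x)"
 by (rule ennreal_suminf_ge_term)
 finally show ?thesis .
qed

definition ubv :: "'a::euclidean_space itself => real" where
 "ubv _ = unit_ball_vol (real DIM('a))"

lemma ubv_pos [simp]: "0 < ubv TYPE('a::euclidean_space)"
 by (simp add: ubv_def)

lemma emeasure_ball_ubv:
 "0 <= r ==> emeasure lborel (ball (c::'a::euclidean_space) r) = en (ubv TYPE('a) * r ^ DIM('a))"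
 by (simp add: ubv_def emeasure_ball)

lemma suminf_geometric_finite:
 assumes "0 < a" "0 <= C"
 shows "(\<Sum>i. en (C * p2 (- (real i * a)))) < \<infinity>"
proof -
 have *: "p2 (- (real i * a)) = (p2 (- a)) ^ i" for i
 by (simp add: powr_powr powr_realpow[symmetric] mult.commute)
 have "summable (%i. C * (p2 (- a)) ^ i)"
 using assms by (intro summable_mult summable_geometric) (simp add: powr_less_one)
 thus ?thesis unfolding * using assms
 by (subst suminf_ennreal2) auto
qed

lemma ball_sets_borel [measurable]: "ball (a::'a::real_normed_vector) r : sets borel"
 by auto

lemma borel_measurable_cmult_indicator_ball:
 "(%x. c * ind (ball (a::'a::euclidean_space) r) x :: ennreal) : bm lborel"
 by (intro borel_measurable_times_ennreal borel_measurable_const borel_measurable_indicator) auto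

lemma nn_integral_wt:
 assumes m: "real DIM('a::euclidean_space) < m"
 shows "(NI x. en (wt m (x::'a))) < \<infinity>"
proof -
 let ?n = "real DIM('a)"
 have m0: "0 <= m" using m by (meson of_nat_0_le_iff le_less_trans less_imp_le)
 have "(NI x. en (wt m (x::'a)))
 <= (NI x. (\<Sum>i. en (2 powr m * p2 (- (real i * m))) * ind (ball (0::'a) (2 ^ i)) x))"
 by (intro nn_integral_mono wt_le_dyadic_sum m0)
 also have "... = (\<Sum>i. en (2 powr m * p2 (- (real i * m))) * emeasure lborel (ball (0::'a) (2 ^ i)))"
 by (subst nn_integral_suminf, rule borel_measurable_cmult_indicator_ball)
 (subst nn_integral_cmult_indicator, simp, rule refl)
 also have "... = (\<Sum>i. en ((2 powr m * ubv TYPE('a)) * p2 (- (real i * (m - ?n)))))"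
 proof (intro suminf_cong)
 fix i
 have "(2 ^ i) ^ DIM('a) = (p2 (real i * ?n) :: real)"
 by (simp add: powr_realpow[symmetric] powr_powr)
 hence "2 powr m * p2 (- (real i * m)) * (ubv TYPE('a) * (2 ^ i) ^ DIM('a))
 = (2 powr m * ubv TYPE('a)) * p2 (- (real i * m) + real i * ?n)"
 by (simp only: powr_add) (simp add: mult_ac)
 also have "- (real i * m) + real i * ?n = - (real i * (m - ?n))" by (simp add: algebra_simps)
 finally have eq: "2 powr m * p2 (- (real i * m)) * (ubv TYPE('a) * (2 ^ i) ^ DIM('a))
 = (2 powr m * ubv TYPE('a)) * p2 (- (real i * (m - ?n)))" .
 show "en (2 powr m * p2 (- (real i * m))) * emeasure lborel (ball (0::'a) (2 ^ i))
 = en ((2 powr m * ubv TYPE('a)) * p2 (- (real i * (m - ?n))))"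
 unfolding eq[symmetric] by (simp add: emeasure_ball_ubv ennreal_mult'[symmetric])
 qed
 also have "... < \<infinity>"
 using m by (intro suminf_geometric_finite) (auto intro!: mult_nonneg_nonneg less_imp_le[OF ubv_pos])
 finally show ?thesis .
qed

lemma integrable_wt:
 assumes m: "real DIM('a::euclidean_space) < m"
 shows "intl (wt m :: 'a => real)"
 using nn_integral_wt[OF m] by (intro integrableI_nonneg) (auto simp: AE_I2)

lemma nn_integral_affine:
 fixes f :: "'a::euclidean_space => ennreal"
 assumes [measurable]: "f : BM" and c: "c ~= 0"
 shows "(NI x. f x) = en (\<bar>c\<bar> ^ DIM('a)) * (NI x. f (t + c *R x))"
 by (subst lborel_affine[OF c, of t])
 (simp add: nn_integral_density nn_integral_distr nn_integral_cmult)

lemma integrable_affine: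
 fixes f :: "'a::euclidean_space => 'b::{banach, second_countable_topology}"
 assumes f: "intl f" and c: "c ~= 0"
 shows "intl (%x. f (t + c *R x))"
proof -
 have [measurable]: "f : BM" using f by auto
 have "en (\<bar>c\<bar> ^ DIM('a)) * (NI x. norm (f (t + c *R x))) < \<infinity>"
 using f c by (subst nn_integral_affine[symmetric]) (auto simp: integrable_iff_bounded)
 hence "(NI x. norm (f (t + c *R x))) < \<infinity>"
 using c by (auto simp: ennreal_mult_less_top)
 thus ?thesis by (simp add: integrable_iff_bounded)
qed

lemma integral_affine:
 fixes f :: "'a::euclidean_space => 'b::{banach, second_countable_topology}"
 assumes c: "c ~= 0"
 shows "(LI x. f (t + c *R x)) = (1 / \<bar>c\<bar> ^ DIM('a)) *R (LI x. f x)"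
proof (cases "intl f")
 case True
 hence [measurable]: "f : BM" by auto
 have "(LI x. f x) = (\<bar>c\<bar> ^ DIM('a)) *R (LI x. f (t + c *R x))"
 by (subst lborel_affine[OF c, of t], subst integral_density)
 (auto simp: integral_distr)
 thus ?thesis using c by simp
next
 case False
 have "~ intl (%x. f (t + c *R x))"
 proof
 assume "intl (%x. f (t + c *R x))"
 from integrable_affine[OF this, of "1 / c" "- (1 / c) *R t"] c
 have "intl f" by (simp add: algebra_simps)
 with False show False ..
 qed
 with False show ?thesis by (simp add: not_integrable_integral_eq)
qed

lemma integral_shift:
 fixes f :: "'a::euclidean_space => 'b::{banach, second_countable_topology}"
 shows "(LI x. f (t + x)) = (LI x. f x)"
 using integral_affine[of 1 f t] by simp

lemma integral_reflect:
 fixes f :: "'a::euclidean_space => 'b::{banach, second_countable_topology}"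
 shows "(LI x. f (t - x)) = (LI x. f x)"
 using integral_affine[of "-1" f t] by simp

lemma nn_integral_shift:
 fixes f :: "'a::euclidean_space => ennreal"
 assumes "f : BM"
 shows "(NI x. f (t + x)) = (NI x. f x)"
 using nn_integral_affine[OF assms, of 1 t] by simp

lemma half_power_eq_powr: "(1/2::real) ^ k = p2 (- real k)"
 by (simp add: powr_minus powr_realpow power_one_over inverse_eq_divide)

lemma two_powr_power: "(p2 a) ^ k = (p2 (real k * a) :: real)"
 by (simp add: powr_realpow[symmetric] powr_powr mult.commute)

text \<open>Shells shrinking to the origin: where \<open>norm x\<close> is about 2^(-i) the
  integrand is about 2^(i (n - 1)) on a ball of volume about 2^(-i n), which leaves a geometric
  series of ratio 1/2.\<close>

lemma nn_integral_riesz_ball: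
 "(NI x. en (norm (x::'a::euclidean_space) powr (1 - real DIM('a))) * ind (ball 0 1) x) < \<infinity>"
proof -
 let ?n = "real DIM('a)"
 let ?A = "%i. (real i + 1) * (?n - 1)"
 let ?B = "p2 (?n - 1) * ubv TYPE('a)"
 let ?C = "%x. \<Sum>i. en (p2 (?A i)) * ind (ball 0 ((1/2) ^ i)) x"
 let ?D = "%i. ball (0::'a) ((1/2) ^ i)"
 let ?E = "%i. ubv TYPE('a) * ((1/2) ^ i) ^ DIM('a)"
 have n1: "?n >= 1" using DIM_positive[where 'a='a] by linarith
 have "en (norm x powr (1 - ?n)) * ind (ball 0 1) x
 <= ?C x" if "x ~= 0" for x :: 'a
 proof (cases "norm x < 1")
 case True
 obtain N where N: "(1/2) ^ N < norm x" using real_arch_pow_inv[of "norm x" "1/2"] \<open>x ~= 0\<close> by auto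
 define i where "i = (LEAST i. (1/2) ^ (Suc i) <= norm x)"
 have "(1/2) ^ (Suc N) <= norm x"
 using N by (intro order.trans[OF power_decreasing[of N "Suc N"] less_imp_le]) auto
 hence i: "(1/2) ^ (Suc i) <= norm x" unfolding i_def by (rule LeastI)
 have up: "norm x < (1/2) ^ i"
 proof (cases i)
 case 0 thus ?thesis using True by simp
 next
 case (Suc j)
 hence "j < (LEAST i. (1/2) ^ (Suc i) <= norm x)" unfolding i_def[symmetric] by simp
 hence "~ (1/2) ^ (Suc j) <= norm x" by (rule not_less_Least)
 thus ?thesis by (simp add: Suc)
 qed
 have "norm x powr (1 - ?n) <= ((1/2) ^ (Suc i)) powr (1 - ?n)"
 using i n1 by (intro powr_mono2') auto
 also have "((1/2) ^ (Suc i)) powr (1 - ?n) = p2 (?A i)"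
 proof -
 have "(1/2::real) ^ (Suc i) = p2 (- (real i + 1))"
 unfolding half_power_eq_powr by (simp add: algebra_simps)
 thus ?thesis by (simp only: powr_powr) (simp add: algebra_simps)
 qed
 finally have "en (norm x powr (1 - ?n)) * ind (ball 0 1) x
 <= en (p2 (?A i)) * ind (ball 0 ((1/2) ^ i)) x"
 using up True by (simp add: ennreal_leI)
 also have "... <= ?C x"
 by (rule ennreal_suminf_ge_term)
 finally show ?thesis .
 qed auto
 note star = this
 have "AE x in lborel. x ~= (0::'a)" by (rule AE_lborel_singleton)
 hence "(NI x. en (norm (x::'a) powr (1 - ?n)) * ind (ball 0 1) x)
 <= (NI x. (\<Sum>i. en (p2 (?A i)) * ind (?D i) x))"
 by (intro nn_integral_mono_AE) (erule eventually_mono, erule star)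
 also have "... = (\<Sum>i. en (p2 (?A i)) * emeasure lborel (?D i))"
 by (subst nn_integral_suminf, rule borel_measurable_cmult_indicator_ball)
 (subst nn_integral_cmult_indicator, simp, rule refl)
 also have "... = (\<Sum>i. en (?B * p2 (- (real i * 1))))"
 proof (intro suminf_cong)
 fix i
 have "((1/2) ^ i) ^ DIM('a) = (p2 (- (real i * ?n)) :: real)"
 unfolding half_power_eq_powr two_powr_power by (simp add: mult.commute)
 hence "p2 (?A i) * (?E i)
 = ubv TYPE('a) * p2 ((real i + 1) * (?n - 1) + - (real i * ?n))" by (simp only: powr_add) (simp add: mult_ac)
 also have "(real i + 1) * (?n - 1) + - (real i * ?n) = (?n - 1) + (- (real i * 1))" by (simp add: algebra_simps)
 also have "ubv TYPE('a) * p2 ((?n - 1) + (- (real i * 1))) = ?B * p2 (- (real i * 1))"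
 by (simp only: powr_add) (simp add: mult_ac)
 finally have eq: "p2 (?A i) * (?E i)
 = ?B * p2 (- (real i * 1))" .
 show "en (p2 (?A i)) * emeasure lborel (?D i)
 = en (?B * p2 (- (real i * 1)))"
 unfolding eq[symmetric] by (simp add: emeasure_ball_ubv ennreal_mult'[symmetric])
 qed
 also have "... < \<infinity>"
 by (intro suminf_geometric_finite) (auto intro!: mult_nonneg_nonneg less_imp_le[OF ubv_pos])
 finally show ?thesis .
qed

text \<open>The bound has to be uniform in the singularity \<open>y\<close>. Within distance 1 of
  \<open>y\<close> the weight is at most 1 and the translated integral over the unit ball appears;
  farther away the singular factor is at most 1 and the weight is integrable.\<close>

lemma nn_integral_riesz_wt_bound:
 assumes m: "real DIM('a::euclidean_space) < m"
 obtains C where "0 <= C" "!!y::'a. (NI x. en (norm (x - y) powr (1 - real DIM('a)) * wt m x)) <= en C"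
proof -
 let ?n = "real DIM('a)"
 have n1: "?n >= 1" using DIM_positive[where 'a='a] by linarith
 let ?A = "(NI x. en (norm (x::'a) powr (1 - ?n)) * ind (ball 0 1) x)"
 let ?B = "(NI x. en (wt m (x::'a)))"
 have fin: "?A + ?B < \<infinity>"
 using nn_integral_riesz_ball[where 'a='a] nn_integral_wt[OF m] by simp
 have "(NI x. en (norm (x - y) powr (1 - ?n) * wt m x)) <= ?A + ?B" for y :: 'a
 proof -
 have "en (norm (x - y) powr (1 - ?n) * wt m x)
 <= en (norm (x - y) powr (1 - ?n)) * ind (ball 0 1) (x - y) + en (wt m x)" for x
 proof (cases "norm (x - y) < 1")
 case True
 have "norm (x - y) powr (1 - ?n) * wt m x <= norm (x - y) powr (1 - ?n) * 1"
 using m n1 by (intro mult_left_mono wt_le_1) auto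
 thus ?thesis using True by (auto intro!: add_increasing2 ennreal_leI)
 next
 case False
 hence "norm (x - y) powr (1 - ?n) <= 1 powr (1 - ?n)"
 using n1 by (intro powr_mono2') auto
 hence "norm (x - y) powr (1 - ?n) * wt m x <= 1 * wt m x"
 by (intro mult_right_mono) auto
 thus ?thesis by (intro add_increasing ennreal_leI) auto
 qed
 moreover have [measurable]: "(%x. ind (ball 0 1) (x - y) :: ennreal) : BM"
 by (rule measurable_compose[of "%x. x - y" borel borel]) (auto intro!: borel_measurable_indicator)
 ultimately have "(NI x. en (norm (x - y) powr (1 - ?n) * wt m x))
 <= (NI x. (en (norm (x - y) powr (1 - ?n)) * ind (ball 0 1) (x - y) + en (wt m x)))"
 by (intro nn_integral_mono)
 also have "... = (NI x. en (norm (x - y) powr (1 - ?n)) * ind (ball 0 1) (x - y)) + ?B"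
 by (intro nn_integral_add) auto
 also have "(NI x. en (norm (x - y) powr (1 - ?n)) * ind (ball 0 1) (x - y)) = ?A"
 using nn_integral_shift[of "%x. en (norm x powr (1 - ?n)) * ind (ball (0::'a) 1) x" "- y"] by simp
 finally show ?thesis .
 qed
 thus ?thesis using that[of "enn2real (?A + ?B)"] fin by simp
qed

section \<open>Unit cube, lattice tiling and Riemann sums\<close>

text \<open>Half-open, so that the lattice translates cover each point exactly once; centred, so
  that the origin, where Poisson summation is proved first, is an interior point.\<close>

definition ucube :: "(real^'n::finite) set" where
 "ucube = {y. ALL i. - 1/2 <= y $ i & y $ i < 1/2}"

lemma ucube_sets [measurable]: "ucube : sets borel"
proof -
 have "ucube = (\<Inter>i. {y. - 1/2 <= y $ i} \<inter> {y. y $ i < 1/2})" by (auto simp: ucube_def)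
 also have "... : sets borel"
 by (intro sets.countable_INT'' sets.Int borel_closed borel_open)
 (auto intro!: closed_Collect_le open_Collect_less continuous_intros)
 finally show ?thesis .
qed

lemma ucube_norm: "y : ucube ==> norm y <= real CARD('n)" for y :: "real^'n::finite"
proof -
 assume "y : ucube"
 hence "\<bar>y $ i\<bar> <= 1" for i by (auto simp: ucube_def abs_le_iff intro: order.trans less_imp_le dest!: spec[of _ i])
 hence "(SUM i:UNIV. \<bar>y $ i\<bar>) <= (SUM i:(UNIV::'n set). 1)" by (intro sum_mono) auto
 thus ?thesis using norm_le_l1_cart[of y] by simp
qed

lemma ucube_lattice_ex1: "EX! k. x - cvec k : ucube"
proof (rule ex1I)
 show "x - cvec (\<chi> i. \<lfloor>x $ i + 1/2\<rfloor>) : ucube"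
 proof -
 have "- 1/2 <= x $ i - of_int \<lfloor>x $ i + 1/2\<rfloor> & x $ i - of_int \<lfloor>x $ i + 1/2\<rfloor> < 1/2" for i by linarith
 thus ?thesis by (simp add: ucube_def cvec_def)
 qed
 fix k assume "x - cvec k : ucube"
 hence "- 1/2 <= x $ i - of_int (k $ i) & x $ i - of_int (k $ i) < 1/2" for i
 by (simp add: ucube_def cvec_def)
 hence "\<lfloor>x $ i + 1/2\<rfloor> = k $ i" for i
 unfolding floor_eq_iff by (smt (verit, best) \<open>!!i. - 1 / 2 <= x $ i - ri (k $ i) & x $ i - ri (k $ i) < 1 / 2\<close> field_sum_of_halves)
 thus "k = (\<chi> i. \<lfloor>x $ i + 1/2\<rfloor>)" by (simp add: vec_eq_iff)
qed

lemma cvec_add: "cvec (k + l) = cvec k + cvec l"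
 by (simp add: cvec_def vec_eq_iff)

lemma cvec_minus: "cvec (- k) = - cvec k"
 by (simp add: cvec_def vec_eq_iff)

text \<open>Besides unfolding integrals, this is used from right to left: an estimate of a fixed
  quantity by lattice sums with arbitrary offset \<open>y\<close> becomes an estimate by an integral
  over the whole space.\<close>

lemma nn_integral_lattice:
 fixes f :: "real^'n::finite => ennreal"
 assumes [measurable]: "f : BM"
 shows "(NI x. f x) = (NI y. (NS k. f (y + cvec k)) * ind ucube y)"
proof -
 have one: "(NS k. ind ucube (x - cvec k)) = (1::ennreal)" for x :: "real^'n"
 proof -
 obtain k0 where k0: "x - cvec k0 : ucube" "!!k. x - cvec k : ucube ==> k = k0"
 using ucube_lattice_ex1[of x] unfolding Ex1_def by blast
 hence k0': "x - cvec k : ucube \<longleftrightarrow> k = k0" for k by blast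
 have "ind ucube (x - cvec k) = (ind {k0} k :: ennreal)" for k
 by (simp add: indicator_def k0')
 thus ?thesis by simp
 qed
 have "(NI x. f x) = (NI x. (NS k. f x * ind ucube (x - cvec k)))"
 by (simp add: nn_integral_cmult one)
 also have "... = (NS k. (NI x. f x * ind ucube (x - cvec k)))"
 by (subst nn_integral_count_space_nn_integral) auto
 also have "... = (NS k. (NI y. f (y + cvec k) * ind ucube y))"
 proof (rule nn_integral_cong)
 fix k
 show "(NI x. f x * ind ucube (x - cvec k)) = (NI y. f (y + cvec k) * ind ucube y)"
 using nn_integral_shift[of "%x. f x * ind ucube (x - cvec k)" "cvec k"] by (simp add: add.commute)
 qed
 also have "... = (NI y. (NS k. f (y + cvec k) * ind ucube y))"
 by (subst nn_integral_count_space_nn_integral) auto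
 also have "... = (NI y. (NS k. f (y + cvec k)) * ind ucube y)"
 by (simp add: nn_integral_multc)
 finally show ?thesis .
qed

lemma sigma_finite_count_space: "sigma_finite_measure (count_space (UNIV::'a::countable set))"
 by (rule sigma_finite_measure_count_space_countable) auto

lemma emeasure_ucube: "emeasure lborel (ucube :: (real^'n::finite) set) = 1"
proof -
 have "emeasure lborel (ucube :: (real^'n) set) <= emeasure lborel (cbox (\<chi> i. -1/2) (\<chi> i. 1/2) :: (real^'n) set)"
 by (rule emeasure_mono) (auto simp: ucube_def mem_box_cart less_imp_le)
 also have "... = 1" by (subst emeasure_lborel_cbox) (auto simp: Basis_vec_def inner_axis intro!: prod.neutral)
 finally have le: "emeasure lborel (ucube :: (real^'n) set) <= 1" .
 have "1 = emeasure lborel (box (\<chi> i. -1/2) (\<chi> i. 1/2) :: (real^'n) set)"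
 by (subst emeasure_lborel_box) (auto simp: Basis_vec_def inner_axis inner_diff_left intro!: prod.neutral)
 also have "... <= emeasure lborel (ucube :: (real^'n) set)"
 by (rule emeasure_mono) (auto simp: ucube_def mem_box_cart less_imp_le)
 finally show ?thesis using le by simp
qed

text \<open>The sum is a Riemann sum. On the cube of side \<open>h\<close> around a lattice point
  the weight changes at most by a factor depending on \<open>m\<close> and n, since
  \<open>h \<le> 1\<close>, so the integral of the weight controls the sum uniformly in
  \<open>h\<close> and in the shift \<open>x\<close>.\<close>

lemma lattice_sum_wt_bound:
 assumes m: "real CARD('n::finite) < m"
 obtains C where "0 <= C" "!!h (x::real^'n). 0 < h ==> h <= 1 ==>
 (NS k. en (h ^ CARD('n) * wt m (h *R cvec k + x))) <= en C"
proof -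
 let ?n = "real CARD('n)"
 let ?B = "(NI x. en (wt m (x::real^'n)))"
 let ?D = "(1 + ?n) powr m"
 have fin: "?B < \<infinity>" using m by (intro nn_integral_wt) simp
 have m0: "0 <= m" using m by (meson less_le_trans of_nat_0_le_iff less_imp_le order.trans)
 have "(NS k. en (h ^ CARD('n) * wt m (h *R cvec k + x))) <= en ?D * ?B"
 if h: "0 < h" "h <= 1" for h and x :: "real^'n"
 proof -
 have *: "wt m (h *R cvec k + x) <= ?D * wt m (x + h *R (y + cvec k))" if y: "y : ucube" for y k
 proof -
 have "norm (h *R y) <= 1 * ?n"
 using mult_mono[OF h(2) ucube_norm[OF y]] h by simp
 hence "1 / ?D <= wt m (h *R y)"
 using m0 wt_antimono_norm[of m "h *R y" "?n"] by (simp add: wt_def powr_minus_divide)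
 hence "1 / ?D * wt m (h *R cvec k + x) <= wt m (h *R y) * wt m (h *R cvec k + x)"
 by (intro mult_right_mono) auto
 also have "... <= wt m (h *R y + (h *R cvec k + x))" by (rule wt_add_ge[OF m0])
 finally show ?thesis by (simp add: field_simps scaleR_add_right)
 qed
 have "(NS k. en (h ^ CARD('n) * wt m (h *R cvec k + x)))
 = (NI y. (NS k. en (h ^ CARD('n) * wt m (h *R cvec k + x))) * ind (ucube::(real^'n) set) y)"
 by (simp add: nn_integral_cmult emeasure_ucube)
 also have "... <= (NI y. (NS k. en ?D * en (h ^ CARD('n) * wt m (x + h *R (y + cvec k)))) * ind (ucube::(real^'n) set) y)"
 proof (rule nn_integral_mono)
 fix y :: "real^'n"
 show "(NS k. en (h ^ CARD('n) * wt m (h *R cvec k + x))) * ind ucube y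
 <= (NS k. en ?D * en (h ^ CARD('n) * wt m (x + h *R (y + cvec k)))) * ind ucube y"
 proof (cases "y : ucube")
 case True
 have "en (h ^ CARD('n) * wt m (h *R cvec k + x)) <= en ?D * en (h ^ CARD('n) * wt m (x + h *R (y + cvec k)))" for k
 proof -
 have "h ^ CARD('n) * wt m (h *R cvec k + x) <= h ^ CARD('n) * (?D * wt m (x + h *R (y + cvec k)))"
 using *[OF True] h by (intro mult_left_mono) auto
 thus ?thesis using h by (subst ennreal_mult'[symmetric]) (auto intro!: ennreal_leI simp: mult_ac)
 qed
 thus ?thesis using True by (auto intro!: nn_integral_mono)
 qed auto
 qed
 also have "... = (NI z. en ?D * en (h ^ CARD('n) * wt m (x + h *R z)))"
 by (subst nn_integral_lattice) auto
 also have "... = en ?D * (en (\<bar>h\<bar> ^ DIM(real^'n)) * (NI z. en (wt m (x + h *R z))))"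
 using h by (simp add: nn_integral_cmult ennreal_mult')
 also have "... = en ?D * ?B"
 using h by (subst nn_integral_affine[symmetric]) auto
 finally show ?thesis .
 qed
 thus ?thesis using that[of "enn2real (en ?D * ?B)"] fin by (simp add: ennreal_mult_less_top)
qed

lemma integral_lattice:
 fixes f :: "real^'n::finite => complex"
 assumes f: "intl f"
 shows "(LI x. f x) = (LI y. (LC k. f (y + cvec k)) * ind ucube y)"
proof -
 have [measurable]: "f : BM" using f by auto
 interpret C: sigma_finite_measure "count_space (UNIV::(int^'n) set)" by (rule sigma_finite_count_space)
 interpret pair_sigma_finite "count_space (UNIV::(int^'n) set)" "lborel :: (real^'n) measure" by standard
 let ?M = "count_space (UNIV::(int^'n) set) \<Otimes>\<^sub>M (lborel :: (real^'n) measure)"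
 let ?g = "%(k, y). f (y + cvec k) * ind ucube (y::real^'n)"
 have gm [measurable]: "?g : bm ?M"
 by (rule measurable_pair_measure_countable1) auto
 have "(\<integral>\<^sup>+p. norm (?g p) \<partial>?M) = (NI y. (NS k. norm (?g (k, y))))"
 by (rule nn_integral_snd[symmetric]) auto
 also have "... = (NI y. (NS k. en (norm (f (y + cvec k)))) * ind ucube y)"
 by (intro nn_integral_cong) (auto simp: norm_mult indicator_def)
 also have "... = (NI x. norm (f x))"
 by (subst nn_integral_lattice) auto
 finally have gi: "integrable ?M ?g" using f by (simp add: integrable_iff_bounded)
 have one: "(LC k. f x * ind ucube (x - cvec k)) = f x" for x
 proof -
 obtain k0 where k0: "x - cvec k0 : ucube" "!!k. x - cvec k : ucube ==> k = k0"
 using ucube_lattice_ex1[of x] unfolding Ex1_def by blast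
 hence k0': "x - cvec k : ucube \<longleftrightarrow> k = k0" for k by blast
 have "f x * ind ucube (x - cvec k) = ind {k0} k *R f x" for k
 by (simp add: indicator_def k0')
 thus ?thesis by simp
 qed
 let ?h = "%(k, y). f y * ind ucube (y - cvec k :: real^'n)"
 have hm [measurable]: "?h : bm ?M"
 by (rule measurable_pair_measure_countable1) auto
 have "(\<integral>\<^sup>+p. norm (?h p) \<partial>?M) = (NS k. (NI y. norm (?h (k, y))))"
 by (rule lborel.nn_integral_fst[symmetric]) auto
 also have "... = (NS k. (NI y. norm (?g (k, y))))"
 proof (rule nn_integral_cong)
 fix k
 show "(NI y. norm (?h (k, y))) = (NI y. norm (?g (k, y)))"
 using nn_integral_shift[of "%y. en (norm (f y * ind ucube (y - cvec k)))" "cvec k"] by (simp add: add.commute)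
 qed
 also have "... = (\<integral>\<^sup>+p. norm (?g p) \<partial>?M)"
 by (rule lborel.nn_integral_fst) auto
 finally have hi: "integrable ?M ?h" using gi by (simp add: integrable_iff_bounded)
 have "(LI x. f x) = (LI y. (LC k. ?h (k, y)))" by (simp only: one prod.case)
 also have "... = (LC k. (LI y. ?h (k, y)))"
 using Fubini_integral[of "%k y. ?h (k, y)"] hi by (simp add: case_prod_beta')
 also have "... = (LC k. (LI y. ?g (k, y)))"
 proof (rule int_cong)
 fix k
 show "(LI y. ?h (k, y)) = (LI y. ?g (k, y))"
 using integral_shift[of "%y. f y * ind ucube (y - cvec k)" "cvec k"] by (simp add: add.commute)
 qed
 also have "... = (LI y. (LC k. ?g (k, y)))"
 using Fubini_integral[of "%k y. ?g (k, y)"] gi by (simp add: case_prod_beta')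
 also have "... = (LI y. (LC k. f (y + cvec k)) * ind ucube y)"
 by simp
 finally show ?thesis .
qed

section \<open>Characters, Fourier transform and decay classes\<close>

lemma integrable_dominated:
 fixes f :: "'a => 'b::{banach, second_countable_topology}"
 assumes g: "integrable M g" and f: "f : bm M" and le: "!!x. norm (f x) <= g x"
 shows "integrable M f"
proof (rule Bochner_Integration.integrable_bound[OF g f])
 have "norm (f x) <= norm (g x)" for x using le[of x] by simp
 thus "AE x in M. norm (f x) <= norm (g x)" by (intro AE_I2)
qed

definition ech :: "real^'n::finite => real^'n => complex" where
 "ech xi x = exp (- \<i> * cr (x \<bullet> xi))"

text \<open>Without the factor of \<open>fourier\<close>, so that convolutions turn into products
  with no constant. The lost normalisation returns as the constant in \<open>PU\<close>.\<close>

definition ft :: "'n::finite fn => 'n fn" where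
 "ft f xi = (LI x. f x * ech xi x)"

lemma fourier_ft: "fourier f xi = cr ((2 * pi) powr (- real CARD('n) / 2)) * ft f xi"
 for f :: "'n::finite fn"
 by (simp add: fourier_def ft_def ech_def)

lemma fourier_eq_0_iff: "fourier f xi = 0 \<longleftrightarrow> ft f xi = 0"
 by (simp add: fourier_ft)

lemma norm_ech [simp]: "norm (ech xi x) = 1"
proof -
 have "norm (exp (\<i> * cr (- (x \<bullet> xi)))) = 1" by (rule norm_exp_i_times)
 thus ?thesis by (simp add: ech_def)
qed

lemma ech_add: "ech xi (x + y) = ech xi x * ech xi y"
 by (simp add: ech_def inner_add_left exp_add[symmetric] algebra_simps)

lemma ech_add_freq: "ech (xi + et) x = ech xi x * ech et x"
 by (simp add: ech_def inner_add_right exp_add[symmetric] algebra_simps)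

lemma ech_0 [simp]: "ech xi 0 = 1" "ech 0 x = 1"
 by (simp_all add: ech_def)

lemma ech_scaleR: "ech (c *R xi) x = ech xi (c *R x)"
 by (simp add: ech_def)

lemma continuous_on_ech: "continuous_on A (ech xi)"
 unfolding ech_def by (intro continuous_intros)

lemma ech_measurable [measurable]: "ech xi : BM"
 by (rule borel_measurable_continuous_onI[OF continuous_on_ech])

lemma ech_lattice: "ech ((2 * pi) *R cvec m) (cvec k) = 1"
proof -
 have "cvec k \<bullet> ((2 * pi) *R cvec m) = 2 * pi * of_int (SUM i:UNIV. k $ i * m $ i)"
 by (simp add: inner_vec_def cvec_def sum_distrib_left mult_ac)
 hence "ech ((2 * pi) *R cvec m) (cvec k) = cis (2 * pi * of_int (- (SUM i:UNIV. k $ i * m $ i)))"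
 by (simp add: ech_def cis_conv_exp)
 also have "... = 1" by (rule cis_multiple_2pi) (rule Ints_of_int)
 finally show ?thesis .
qed

definition dec :: "real => 'n::finite fn => bool" where
 "dec m f = (continuous_on UNIV f & (EX C. ALL x. norm (f x) <= C * wt m x))"

text \<open>Rapid decay without smoothness: enough for the Fourier arguments below, and preserved by
  convolutions with integrals or lattice sums, which then need not be differentiated.\<close>

definition rd :: "'n::finite fn => bool" where
 "rd f = ((ALL m. dec m f))"

lemma decE:
 fixes f :: "'n::finite fn"
 assumes "dec m f" obtains C where "0 <= C" "!!x. norm (f x) <= C * wt m x"
proof -
 obtain C where C: "!!x. norm (f x) <= C * wt m x" using assms unfolding dec_def by blast
 have "0 <= C * wt m (0::real^'n)" by (rule order.trans[OF norm_ge_zero C[of 0]])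
 hence "0 <= C" by simp
 thus ?thesis using C that by blast
qed

lemma decI: "continuous_on UNIV f ==> (!!x. norm (f x) <= C * wt m x) ==> dec m f"
 by (auto simp: dec_def)

lemma dec_continuous: "dec m f ==> continuous_on UNIV f"
 by (simp add: dec_def)

lemma dec_mono: assumes "dec m' f" "m <= m'" shows "dec m f"
proof -
 obtain C where C: "0 <= C" "!!x. norm (f x) <= C * wt m' x" using decE[OF assms(1)] by blast
 have "norm (f x) <= C * wt m x" for x
 using C(2)[of x] mult_left_mono[OF wt_mono[OF assms(2), of x] C(1)] by linarith
 thus ?thesis using dec_continuous[OF assms(1)] by (intro decI)
qed

lemma dec_measurable: "dec m f ==> f : BM"
 by (simp add: dec_def borel_measurable_continuous_onI)

lemma dec_integrable:
 fixes f :: "'n::finite fn"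
 assumes "dec m f" "real CARD('n) < m" shows "intl f"
proof -
 obtain C where C: "0 <= C" "!!x. norm (f x) <= C * wt m x" using decE[OF assms(1)] by blast
 have "intl (%x::real^'n. C * wt m x)" using assms(2) by (intro integrable_mult_right integrable_wt) simp
 thus ?thesis
 by (rule Bochner_Integration.integrable_bound) (use dec_measurable[OF assms(1)] C in auto)
qed

lemma dec_mult_ech: "dec m f ==> dec m (%x. f x * ech xi x)"
 unfolding dec_def by (auto simp: norm_mult intro!: continuous_on_mult continuous_on_ech)

lemma rd_dec: "rd f ==> dec m f" by (simp add: rd_def)
lemma rd_continuous: "rd f ==> continuous_on UNIV f" using rd_dec dec_continuous by blast
lemma rd_measurable: "rd f ==> f : BM" using rd_dec dec_measurable by blast
lemma rd_integrable: "rd f ==> intl f" for f :: "'n::finite fn"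
 using dec_integrable[OF rd_dec, of f "real CARD('n) + 1"] by simp

lemma rd_mult_ech: "rd f ==> rd (%x. f x * ech xi x)"
 by (simp add: rd_def dec_mult_ech)

lemma dec_affine:
 fixes f :: "'n::finite fn"
 assumes "dec m f" "c ~= 0" "0 <= m" shows "dec m (%x. f (t + c *R x))"
proof -
 let ?A = "%x. 1 + norm (t + c *R x)"
 let ?B = "%x. norm (t + c *R x) + norm t"
 obtain C where C: "0 <= C" "!!x. norm (f x) <= C * wt m x" using decE[OF assms(1)] by blast
 define D where "D = (1 + norm t) * (1 + 1 / \<bar>c\<bar>)"
 have "norm x <= 1 / \<bar>c\<bar> * norm (c *R x)" for x :: "real^'n" using assms(2) by simp
 also have "1 / \<bar>c\<bar> * norm (c *R x) <= 1 / \<bar>c\<bar> * ?B x" for x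
 using norm_triangle_ineq4[of "t + c *R x" t] by (intro mult_left_mono) auto
 finally have *: "norm x <= 1 / \<bar>c\<bar> * ?B x" for x .
 have "1 + norm x <= D * ?A x" for x
 proof -
 have "D * ?A x = (1 + norm t) * ?A x + 1 / \<bar>c\<bar> * ((1 + norm t) * ?A x)"
 by (simp add: D_def algebra_simps add_divide_distrib)
 moreover have "1 <= (1 + norm t) * ?A x"
 using mult_mono[of 1 "1 + norm t" 1 "1 + norm (t + c *R x)"] by simp
 moreover have "1 / \<bar>c\<bar> * ?B x <= 1 / \<bar>c\<bar> * ((1 + norm t) * ?A x)"
 by (intro mult_left_mono) (auto simp: algebra_simps)
 ultimately show ?thesis using *[of x] by linarith
 qed
 hence "wt m (t + c *R x) <= D powr m * wt m x" for x
 proof -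
 assume A: "!!x. 1 + norm x <= D * ?A x"
 have D: "0 < D" by (simp add: D_def add_pos_nonneg)
 have "(1 + norm x) powr m <= (D * ?A x) powr m"
 using A[of x] assms(3) by (intro powr_mono2) auto
 also have "... = D powr m * (?A x) powr m" using D by (simp add: powr_mult)
 finally have "1 <= D powr m * ((?A x) powr m * wt m x)"
 using wt_pos[of m x] by (simp add: wt_def powr_minus field_simps)
 hence "wt m (t + c *R x) * 1 <= wt m (t + c *R x) * (D powr m * ((?A x) powr m * wt m x))"
 by (intro mult_left_mono) auto
 also have "... = D powr m * wt m x * (wt m (t + c *R x) * (?A x) powr m)" by (simp only: mult_ac)
 also have "wt m (t + c *R x) * (?A x) powr m = 1"
 proof -
 have "1 + norm (t + c *R x) ~= 0" using norm_ge_zero[of "t + c *R x"] by linarith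
 thus ?thesis by (simp add: wt_def powr_add[symmetric])
 qed
 finally show ?thesis by simp
 qed
 hence "norm (f (t + c *R x)) <= C * D powr m * wt m x" for x
 using C(2)[of "t + c *R x"] mult_left_mono[OF _ C(1), of "wt m (t + c *R x)" "D powr m * wt m x"] by (simp add: mult.assoc order.trans)
 moreover have "continuous_on UNIV (%x. f (t + c *R x))"
 by (rule continuous_on_compose2[OF dec_continuous[OF assms(1)]]) (auto intro!: continuous_intros)
 ultimately show ?thesis by (intro decI)
qed

lemma rd_affine: "rd f ==> c ~= 0 ==> rd (%x. f (t + c *R x))"
proof -
 assume f: "rd f" and c: "c ~= 0"
 have "dec (max 0 m) (%x. f (t + c *R x))" for m by (rule dec_affine[OF rd_dec[OF f] c]) simp
 thus ?thesis unfolding rd_def using dec_mono by (meson max.cobounded2)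
qed

lemma rd_shift: "rd f ==> rd (%x. f (t + x))" using rd_affine[of f 1 t] by simp

lemma ft_affine:
 fixes f :: "'n::finite fn"
 assumes c: "c ~= 0"
 shows "ft (%x. f (t + c *R x)) xi = cr (1 / \<bar>c\<bar> ^ CARD('n)) * ech xi (- (1 / c) *R t) * ft f ((1 / c) *R xi)"
proof -
 have "f (t + c *R x) * ech xi x = ech xi (- (1 / c) *R t) * (f (t + c *R x) * ech ((1 / c) *R xi) (t + c *R x))" for x
 using c by (simp add: ech_scaleR scaleR_add_right ech_add mult_ac) (simp add: ech_add[symmetric] mult.assoc[symmetric])
 hence "ft (%x. f (t + c *R x)) xi
 = ech xi (- (1 / c) *R t) * (LI x. (%x. f x * ech ((1 / c) *R xi) x) (t + c *R x))"
 by (simp only: ft_def integral_mult_right_zero)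
 also have "... = ech xi (- (1 / c) *R t) * ((1 / \<bar>c\<bar> ^ CARD('n)) *R ft f ((1 / c) *R xi))"
 by (subst integral_affine[OF c]) (simp add: ft_def)
 finally show ?thesis by (simp add: scaleR_conv_of_real)
qed

lemma ft_shift: "ft (%x. f (t + x)) xi = ech xi (- t) * ft f xi"
 using ft_affine[of 1 f t xi] by simp

lemma continuous_on_integral_dominated:
 fixes g :: "'a::metric_space => 'b => complex"
 assumes "!!y. continuous_on S (%x. g x y)" and meas: "!!x. x : S ==> g x : bm M"
 and w: "integrable M w" "!!x y. x : S ==> norm (g x y) <= w y"
 shows "continuous_on S (%x. LINT y|M. g x y)"
 unfolding continuous_on_sequentially
proof (intro allI impI ballI, elim conjE)
 fix x and a assume a: "a : S" and x: "ALL n::nat. x n : S" "x \<longlonglongrightarrow> a"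
 have "(%n. LINT y|M. g (x n) y) \<longlonglongrightarrow> (LINT y|M. g a y)"
 proof (rule integral_dominated_convergence[where w=w])
 show "AE y in M. (%n. g (x n) y) \<longlonglongrightarrow> g a y"
 proof (rule AE_I2)
 fix y
 have "continuous_on S (%x. g x y)" by (rule assms(1))
 thus "(%n. g (x n) y) \<longlonglongrightarrow> g a y"
 using a x unfolding continuous_on_sequentially by (auto simp: o_def)
 qed
 qed (use a x w meas in auto)
 thus "((%x. LINT y|M. g x y) \<circ> x) \<longlonglongrightarrow> (LINT y|M. g a y)" by (simp add: o_def)
qed

section \<open>Trigonometric polynomials and Poisson summation\<close>

inductive trig_poly :: "'n::finite fn => bool" where
 trig_ech: "trig_poly (%x. ech ((2 * pi) *R cvec m) x)"
| trig_lin: "trig_poly p ==> trig_poly q ==> trig_poly (%x. a * p x + b * q x)"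

lemma trig_poly_const: "trig_poly (%x. c)"
proof -
 have e0: "trig_poly (%x::real^'a. 1)" using trig_ech[of "0::int^'a"] by (simp add: cvec_def zero_vec_def[symmetric])
 show ?thesis using trig_lin[OF e0 e0, of c 0] by simp
qed

lemma trig_poly_mult:
 assumes "trig_poly p" "trig_poly q" shows "trig_poly (%x. p x * q x)"
 using assms(1)
proof induction
 case (trig_ech m)
 show ?case using assms(2)
 proof induction
 case (trig_ech l)
 have "trig_poly (%x. ech ((2 * pi) *R cvec (m + l)) x)" by (rule trig_poly.trig_ech)
 thus ?case by (simp add: cvec_add scaleR_add_right ech_add_freq)
 next
 case (trig_lin p q a b)
 from trig_poly.trig_lin[OF trig_lin.IH, of a b] show ?case by (simp add: algebra_simps)
 qed
next
 case (trig_lin p q' a b)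
 from trig_poly.trig_lin[OF trig_lin.IH, of a b] show ?case by (simp add: algebra_simps)
qed

lemma trig_poly_power: "trig_poly p ==> trig_poly (%x. p x ^ N)"
 by (induction N) (auto intro: trig_poly_const trig_poly_mult)

lemma trig_poly_prod: "finite A ==> (!!i. i : A ==> trig_poly (p i)) ==> trig_poly (%x. \<Prod>i\<in>A. p i x)"
 by (induction A rule: finite_induct) (auto intro: trig_poly_const trig_poly_mult)

lemma trig_poly_periodic: "trig_poly p ==> p (y + cvec k) = p y"
 by (induction rule: trig_poly.induct) (auto simp: ech_add ech_lattice)

lemma trig_poly_continuous: "trig_poly p ==> continuous_on UNIV p"
 by (induction rule: trig_poly.induct) (auto intro!: continuous_intros continuous_on_ech)

lemma trig_poly_bounded: "trig_poly p ==> EX B. ALL x. norm (p x) <= B"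
proof (induction rule: trig_poly.induct)
 case (trig_ech m) show ?case by (intro exI[of _ 1]) simp
next
 case (trig_lin p q a b)
 then obtain B1 B2 where "!!x. norm (p x) <= B1" "!!x. norm (q x) <= B2" by blast
 hence "norm (a * p x + b * q x) <= norm a * B1 + norm b * B2" for x
 by (intro norm_triangle_le add_mono) (auto simp: norm_mult mult_left_mono)
 thus ?case by blast
qed

lemma trig_poly_integrable:
 fixes p f :: "'n::finite fn"
 assumes "trig_poly p" "intl f" shows "intl (%x. f x * p x)"
proof -
 obtain B where B: "!!x. norm (p x) <= B" using trig_poly_bounded[OF assms(1)] by blast
 have [measurable]: "p : BM" using trig_poly_continuous[OF assms(1)] by (rule borel_measurable_continuous_onI)
 have "0 <= B" by (rule order.trans[OF norm_ge_zero B[of 0]])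
 have "intl (%x. B * norm (f x))" using assms(2) by auto
 thus ?thesis
 by (rule Bochner_Integration.integrable_bound)
 (use assms(2) B \<open>0 <= B\<close> in \<open>auto simp: norm_mult mult.commute[of B] intro!: AE_I2 mult_left_mono\<close>)
qed

lemma integrable_indicator_ucube: "intl (%y::real^'n::finite. ind ucube (y - t) :: complex)"
proof -
 have "intl (ind (ucube::(real^'n) set) :: _ => complex)"
 proof -
 have "intl (ind (ucube::(real^'n) set) :: _ => real)"
 by (rule integrable_real_indicator) (auto simp: emeasure_ucube ucube_sets)
 hence "intl (%x. cr (ind (ucube::(real^'n) set) x))" by simp
 thus ?thesis by (rule Bochner_Integration.integrable_cong[THEN iffD1, rotated 2]) (auto simp: indicator_def)
 qed
 from integrable_affine[OF this, of 1 "-t"] show ?thesis by simp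
qed

text \<open>Translate the cube by \<open>t\<close>, half a period of the character in a coordinate
  \<open>i\<close> with \<open>m $ i \<noteq> 0\<close>. The translate is again a fundamental domain
  of the lattice, so the integral does not change; but the character changes sign. Hence the
  integral equals its negative.\<close>

lemma integral_ucube_ech:
 assumes "m ~= 0"
 shows "(LI y. ech ((2 * pi) *R cvec m) y * ind (ucube::(real^'n::finite) set) y) = 0"
proof -
 let ?e = "ech ((2 * pi) *R cvec m) :: real^'n => complex"
 obtain i where i: "m $ i ~= 0" using assms by (auto simp: vec_eq_iff)
 define t :: "real^'n" where "t = axis i (1 / (2 * of_int (m $ i)))"
 have "t \<bullet> ((2 * pi) *R cvec m) = pi"
 using i by (simp add: t_def inner_axis inner_commute[of "axis _ _"] cvec_def)
 hence "?e t = exp (- (\<i> * cr pi))" unfolding ech_def by (simp only: mult_minus_left)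
 hence et: "?e t = - 1" by (simp add: exp_minus)
 define f where "f = (%y. ind ucube (y - t) * ?e y)"
 have fi: "intl f" unfolding f_def
 by (rule trig_poly_integrable[OF trig_ech integrable_indicator_ucube])
 have one: "(LC k. ind ucube (y + cvec k - t) :: complex) = 1" for y
 proof -
 obtain k0 where k0: "y - t - cvec k0 : ucube" "!!k. y - t - cvec k : ucube ==> k = k0"
 using ucube_lattice_ex1[of "y - t"] unfolding Ex1_def by blast
 have "y + cvec k - t : ucube \<longleftrightarrow> k = - k0" for k
 using k0(1) k0(2)[of "- k"] by (auto simp: cvec_minus algebra_simps)
 hence "ind ucube (y + cvec k - t) = ind {- k0} k *R (1 :: complex)" for k
 by (simp add: indicator_def)
 thus ?thesis by (simp only: integral_indicator) (simp add: measure_def)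
 qed
 have "(LI x. f x) = (LI y. (LC k. f (y + cvec k)) * ind ucube y)"
 by (rule integral_lattice[OF fi])
 also have "... = (LI y. ?e y * ind ucube y)"
 by (simp add: f_def trig_poly_periodic[OF trig_ech] one)
 finally have 1: "(LI x. f x) = (LI y. ?e y * ind ucube y)" .
 have "(LI x. f x) = (LI x. f (t + x))" by (rule integral_shift[symmetric])
 also have "(%x. f (t + x)) = (%x. - (?e x * ind ucube x))"
 unfolding f_def ech_add et add_diff_cancel_left' by (simp add: mult.commute)
 also have "(LI x. - (?e x * ind ucube x)) = - (LI y. ?e y * ind ucube y)"
 by (rule Bochner_Integration.integral_minus)
 finally show ?thesis using 1 by simp
qed

lemma integral_ucube_1: "(LI y. ind (ucube::(real^'n::finite) set) y :: complex) = 1"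
proof -
 have "(LI y. ind (ucube::(real^'n) set) y :: complex) = (LI y. cr (ind (ucube::(real^'n) set) y))"
 by (rule Bochner_Integration.integral_cong) (auto simp: indicator_def)
 also have "... = 1" by (simp add: measure_def emeasure_ucube)
 finally show ?thesis .
qed

lemma lattice_wt_integrable:
 assumes "real CARD('n::finite) < m"
 shows "intc (%k. wt m (cvec k :: real^'n))"
proof -
 obtain C where "0 <= C" and C: "!!h (x::real^'n). 0 < h ==> h <= 1 ==>
 (NS k. en (h ^ CARD('n) * wt m (h *R cvec k + x))) <= en C"
 by (rule lattice_sum_wt_bound[OF assms]) (rule that)
 from C[of 1 0] have "(NS k. en (wt m (cvec k :: real^'n))) < \<infinity>"
 by (simp add: order.strict_trans1)
 thus ?thesis by (intro integrableI_nonneg) auto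
qed

lemma wt_shift_le:
 assumes "0 <= m" shows "wt m (x + z) <= (1 + norm x) powr m * wt m z"
proof -
 have "wt m (x + z) * wt m (- x) <= wt m z" using wt_add_ge[OF assms, of "x + z" "- x"] by simp
 hence "(1 + norm x) powr m * (wt m (x + z) * wt m (- x)) <= (1 + norm x) powr m * wt m z"
 by (rule mult_left_mono) simp
 moreover have "(1 + norm x) powr m * wt m (- x) = 1"
 proof -
 have "1 + norm x ~= 0" using norm_ge_zero[of x] by linarith
 thus ?thesis by (simp add: wt_def powr_add[symmetric])
 qed
 moreover have "(1 + norm x) powr m * (wt m (x + z) * wt m (- x)) = wt m (x + z) * ((1 + norm x) powr m * wt m (- x))"
 by (simp only: mult_ac)
 ultimately show ?thesis by (simp only: mult_1_right)
qed

lemma dec_lattice_integrable: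
 fixes H :: "'n::finite fn"
 assumes H: "dec m H" and m: "real CARD('n) < m"
 shows "intc (%k. H (y + cvec k))"
proof -
 have m0: "0 <= m" using m by (meson of_nat_0_le_iff le_less_trans less_imp_le)
 obtain C where C: "0 <= C" "!!x. norm (H x) <= C * wt m x" using decE[OF H] by blast
 have le: "norm (H (y + cvec k)) <= C * ((1 + norm y) powr m * wt m (cvec k))" for k
 using C(2)[of "y + cvec k"] mult_left_mono[OF wt_shift_le[OF m0, of y "cvec k"] C(1)] by linarith
 have "intc (%k. C * ((1 + norm y) powr m * wt m (cvec k :: real^'n)))"
 by (intro integrable_mult_right lattice_wt_integrable m)
 thus ?thesis by (rule integrable_dominated[OF _ _ le]) simp
qed

text \<open>A single character reads off the transform of \<open>H\<close> at a point of the dual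
  lattice, where by \<open>supp\<close> only the origin contributes. The right side behaves alike by
  orthogonality of the characters on the cube; linearity does the rest.\<close>

lemma poisson_trig_poly:
 fixes H :: "'n::finite fn"
 assumes H: "dec m H" and m: "real CARD('n) < m"
 and supp: "!!l. l ~= 0 ==> ft H ((2 * pi) *R cvec l) = 0"
 and p: "trig_poly p"
 shows "(LI x. H x * p x) = ft H 0 * (LI y. p y * ind ucube y)"
 using p
proof induction
 case (trig_ech l)
 show ?case
 proof (cases "l = 0")
 case True
 thus ?thesis by (simp add: ft_def cvec_def zero_vec_def[symmetric] integral_ucube_1)
 next
 case False
 thus ?thesis using supp[OF False] by (simp add: ft_def[symmetric] integral_ucube_ech)
 qed
next
 case (trig_lin p q a b)
 note Hi = dec_integrable[OF H m]
 have ind: "intl (ind (ucube::(real^'n) set) :: _ => complex)"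
 using integrable_indicator_ucube[of 0] by simp
 have I: "intl (%x. H x * p x)" "intl (%x. H x * q x)"
 using trig_lin.hyps trig_poly_integrable Hi by blast+
 have I': "intl (%x. ind ucube x * p x)" "intl (%x. ind ucube x * q x)"
 using trig_lin.hyps trig_poly_integrable ind by blast+
 have "(LI x. H x * (a * p x + b * q x)) = (LI x. a * (H x * p x) + b * (H x * q x))"
 by (simp add: algebra_simps)
 also have "... = a * (LI x. H x * p x) + b * (LI x. H x * q x)"
 using I by simp
 also have "... = ft H 0 * (a * (LI y. ind ucube y * p y) + b * (LI y. ind ucube y * q y))"
 by (simp only: trig_lin.IH mult.commute[of "ind _ _"]) (simp add: algebra_simps)
 also have "a * (LI y. ind ucube y * p y) + b * (LI y. ind ucube y * q y)
 = (LI y. a * (ind ucube y * p y) + b * (ind ucube y * q y))"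
 using I' by simp
 also have "... = (LI y. (a * p y + b * q y) * ind ucube y)"
 by (simp add: algebra_simps)
 finally show ?case .
qed

text \<open>Each factor is the square of \<open>cos (pi * (y $ i))\<close>. The product takes the
  value 1 at lattice points only and is a trigonometric polynomial, so that its powers serve as a
  peaking kernel without any normalisation.\<close>

definition ckern :: "real^'n::finite => real" where
 "ckern y = (\<Prod>i\<in>UNIV. (1 + cos (2 * pi * (y $ i))) / 2)"

lemma ckern_factor: "0 <= (1 + cos a) / 2" "(1 + cos a) / 2 <= 1" for a :: real
proof -
 have "0 <= 1 + cos a" using cos_ge_minus_one[of a] by linarith
 thus "0 <= (1 + cos a) / 2" by simp
 have "1 + cos a <= 2" using cos_le_one[of a] by linarith
 thus "(1 + cos a) / 2 <= 1" by simp
qed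

lemma ckern_nonneg: "0 <= ckern y"
 unfolding ckern_def by (intro prod_nonneg ckern_factor ballI)

lemma continuous_on_ckern: "continuous_on A ckern"
 unfolding ckern_def by (intro continuous_intros) auto

lemma ckern_0: "ckern 0 = 1" by (simp add: ckern_def)

lemma ckern_less_1:
 assumes y: "!!i. \<bar>y $ i\<bar> <= 1/2" "y ~= 0" shows "ckern y < 1"
proof -
 obtain i where i: "y $ i ~= 0" using y(2) by (auto simp: vec_eq_iff)
 have "cos (2 * pi * (y $ i)) < 1"
 proof -
 have "cos (2 * pi * \<bar>y $ i\<bar>) < cos 0"
 using i y(1)[of i] by (intro cos_monotone_0_pi) (auto simp: field_simps)
 thus ?thesis by (cases "0 <= y $ i") auto
 qed
 hence 1: "(1 + cos (2 * pi * (y $ i))) / 2 < 1" by simp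
 have "ckern y = (1 + cos (2 * pi * (y $ i))) / 2 * (\<Prod>j\<in>UNIV - {i}. (1 + cos (2 * pi * (y $ j))) / 2)"
 unfolding ckern_def by (rule prod.remove) auto
 also have "... <= (1 + cos (2 * pi * (y $ i))) / 2 * 1"
 using ckern_factor by (intro mult_left_mono prod_le_1) auto
 finally show ?thesis using 1 by simp
qed

lemma trig_poly_ckern: "trig_poly (%y. cr (ckern y))"
proof -
 have "trig_poly (%y::real^'a. cr ((1 + cos (2 * pi * (y $ i))) / 2))" for i
 proof -
 let ?m = "axis i 1 :: int^'a"
 have c: "cvec ?m = axis i 1" "cvec (- ?m) = - axis i 1" by (simp_all add: cvec_def vec_eq_iff axis_def)
 have eq: "cr ((1 + cos (2 * pi * (y $ i))) / 2)
 = 1 * (1/2) + 1 * (1/4 * ech ((2 * pi) *R cvec ?m) y + 1/4 * ech ((2 * pi) *R cvec (- ?m)) y)" for y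
 proof -
 have "cr (cos (2 * pi * (y $ i))) = (exp (\<i> * cr (2 * pi * (y $ i))) + exp (- (\<i> * cr (2 * pi * (y $ i))))) / 2"
 by (simp only: cos_of_real[symmetric] cos_exp_eq)
 hence "2 * cr (cos (2 * pi * (y $ i))) = ech ((2 * pi) *R cvec ?m) y + ech ((2 * pi) *R cvec (- ?m)) y"
 by (simp add: ech_def c inner_axis algebra_simps)
 hence "cr (cos (2 * pi * (y $ i))) = (ech ((2 * pi) *R cvec ?m) y + ech ((2 * pi) *R cvec (- ?m)) y) / 2"
 by (simp add: mult.commute)
 thus ?thesis by (simp add: add_divide_distrib)
 qed
 show ?thesis unfolding eq by (intro trig_poly.intros trig_poly_const)
 qed
 hence "trig_poly (%y::real^'a. \<Prod>i\<in>UNIV. cr ((1 + cos (2 * pi * (y $ i))) / 2))"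
 by (intro trig_poly_prod) auto
 thus ?thesis by (simp add: ckern_def)
qed

lemma ucube_closure_bound: "y : ucube ==> \<bar>y $ i\<bar> <= 1/2"
 by (auto simp: ucube_def abs_le_iff less_imp_le dest!: spec[of _ i])

text \<open>Powers of \<^term>\<open>ckern\<close> are trigonometric polynomials that concentrate at the origin, so a
 continuous function orthogonal to all of them on the cube cannot be positive at the origin.\<close>
lemma trig_poly_orthogonal_imp_nonpos:
 fixes R :: "real^'n::finite => real"
 assumes cont: "continuous_on (cbox (\<chi> i. -1/2) (\<chi> i. 1/2)) R"
 and meas: "(%y. R y * ind ucube y) : BM"
 and orth: "!!N. (LI y. R y * ckern y ^ N * ind ucube y) = 0"
 shows "R 0 <= 0"
proof (rule ccontr)
 assume "~ R 0 <= 0"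
 define c where "c = R 0 / 2"
 have c: "0 < c" "c < R 0" using \<open>~ R 0 <= 0\<close> by (auto simp: c_def)
 let ?Q = "cbox (\<chi> i. -1/2) (\<chi> i. 1/2) :: (real^'n) set"
 have uQ: "ucube \<subseteq> ?Q" by (auto simp: ucube_def mem_box_cart less_imp_le)
 have Qb: "\<bar>y $ i\<bar> <= 1/2" if "y : ?Q" for y i
 using that by (auto simp: mem_box_cart abs_le_iff dest!: spec[of _ i])
 have cQ: "compact ?Q" by (rule compact_cbox)
 define V where "V = {y : ?Q. R y <= c}"
 have "closed V" unfolding V_def
 using continuous_closed_preimage[OF cont compact_imp_closed[OF cQ] closed_atMost[of c]]
 by (simp add: vimage_def Int_def)
 hence cV: "compact V" using compact_Int_closed[OF cQ \<open>closed V\<close>] by (simp add: V_def Int_def conj_ac)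
 have V0: "0 ~: V" using c by (simp add: V_def)
 obtain a where a: "0 <= a" "a < 1" "!!y. y : V ==> ckern y <= a"
 proof (cases "V = {}")
 case True thus ?thesis using that[of 0] by auto
 next
 case False
 obtain y0 where y0: "y0 : V" "!!y. y : V ==> ckern y <= ckern y0"
 using continuous_attains_sup[OF cV False continuous_on_ckern] by blast
 have "ckern y0 < 1"
 proof (rule ckern_less_1)
 show "\<bar>y0 $ i\<bar> <= 1/2" for i using y0(1) unfolding V_def by (intro Qb) blast
 show "y0 ~= 0" using y0(1) V0 by blast
 qed
 thus ?thesis using that[of "ckern y0"] y0 ckern_nonneg by blast
 qed
 \<comment> \<open>A value strictly between the maximum of \<open>ckern\<close> on \<open>V\<close>,
   where \<open>R\<close> may be negative, and its value 1 at the origin. As \<open>N\<close> grows,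
   the contribution of \<open>U\<close> outweighs that of \<open>V\<close>.\<close>
 define b where "b = (1 + a) / 2"
 have b: "a < b" "b < 1" "0 < b" using a by (auto simp: b_def)
 define U :: "(real^'n) set" where "U = {y. b < ckern y} \<inter> box (\<chi> i. -1/2) (\<chi> i. 1/2)"
 have oU: "open U" unfolding U_def
 by (intro open_Int open_box open_Collect_less continuous_on_const continuous_on_ckern)
 have "0 : U" using b by (simp add: U_def ckern_0 mem_box_cart)
 have U_sub: "U \<subseteq> ucube" by (auto simp: U_def ucube_def mem_box_cart less_imp_le)
 have "emeasure lborel U ~= 0"
 proof
 assume "emeasure lborel U = 0"
 hence "U : null_sets lborel" using oU by (auto simp: null_sets_def)
 hence "U : null_sets lebesgue" by (rule null_sets_completionI)
 hence "negligible U" by (simp add: negligible_iff_null_sets)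
 thus False using open_not_negligible[OF oU] \<open>0 : U\<close> by blast
 qed
 moreover have Ufin: "emeasure lborel U <= 1" using emeasure_mono[OF U_sub, of lborel] by (simp add: emeasure_ucube ucube_sets)
 ultimately have mU: "0 < measure lborel U"
 by (metis ennreal_one_less_top enn2real_positive_iff infinity_ennreal_def le_less_trans measure_def zero_less_iff_neq_zero)
 obtain M where M: "0 < M" "!!y. y : ?Q ==> \<bar>R y\<bar> <= M"
 proof -
 have "bounded (R ` ?Q)" using compact_continuous_image[OF cont cQ] by (rule compact_imp_bounded)
 then obtain B where "B > 0" "!!x. x : R ` ?Q ==> norm x <= B" by (auto simp: bounded_pos)
 thus ?thesis using that[of B] by auto
 qed
 have k1: "ckern y <= 1" if "y : ucube" for y :: "real^'n"
 using ckern_less_1[of y] ucube_closure_bound[OF that] by (cases "y = 0") (auto simp: ckern_0 intro: less_imp_le)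
 have ineq: "c * b ^ N * measure lborel U <= M * a ^ N" for N
 proof -
 have pt: "c * b ^ N * ind U y - M * a ^ N * ind ucube y <= R y * ckern y ^ N * ind ucube y" for y
 proof (cases "y : ucube")
 case False thus ?thesis using U_sub by (auto simp: indicator_def)
 next
 case True
 hence yQ: "y : ?Q" using uQ by blast
 show ?thesis
 proof (cases "y : V")
 case yV: True
 have "y ~: U" using a(3)[OF yV] b by (auto simp: U_def)
 have "- (M * a ^ N) <= - (\<bar>R y\<bar> * ckern y ^ N)"
 using M(2)[OF yQ] a(3)[OF yV] ckern_nonneg[of y] M(1) by (auto intro!: mult_mono power_mono)
 also have "... <= R y * ckern y ^ N" using ckern_nonneg[of y] abs_ge_minus_self[of "R y"]
 by (metis abs_mult abs_of_nonneg minus_le_iff neg_le_iff_le zero_le_power abs_le_D2 abs_ge_minus_self)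
 finally show ?thesis using \<open>y ~: U\<close> True by simp
 next
 case yV: False
 hence Ry: "c < R y" using yQ by (auto simp: V_def)
 have "c * b ^ N * ind U y <= R y * ckern y ^ N"
 proof (cases "y : U")
 case yU: True
 hence "b ^ N <= ckern y ^ N" using b by (intro power_mono) (auto simp: U_def)
 thus ?thesis using yU Ry c b by (auto intro!: mult_mono)
 qed (use Ry c ckern_nonneg[of y] in auto)
 moreover have "0 <= M * a ^ N" using M(1) a(1) by simp
 ultimately show ?thesis using True by simp
 qed
 qed
 have iU: "intl (ind U :: _ => real)"
 using oU Ufin by (intro integrable_real_indicator) (auto intro: le_less_trans)
 have iC: "intl (ind (ucube::(real^'n) set) :: _ => real)"
 by (rule integrable_real_indicator) (auto simp: emeasure_ucube ucube_sets)
 have [measurable]: "ckern : bm (borel :: (real^'n) measure)"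
 by (rule borel_measurable_continuous_onI[OF continuous_on_ckern])
 have "(%y. (R y * ind ucube y) * ckern y ^ N) : BM"
 using meas by measurable
 hence m': "(%y. R y * ckern y ^ N * ind ucube y) : BM" by (simp add: mult_ac)
 have iR: "intl (%y. R y * ckern y ^ N * ind ucube y)"
 proof (rule Bochner_Integration.integrable_bound[OF integrable_mult_right[OF iC, of M]])
 show "AE y in lborel. norm (R y * ckern y ^ N * ind ucube y) <= norm (M * ind ucube y)"
 proof (rule AE_I2)
 fix y :: "real^'n"
 show "norm (R y * ckern y ^ N * ind ucube y) <= norm (M * ind ucube y)"
 proof (cases "y : ucube")
 case True
 hence "\<bar>R y\<bar> * ckern y ^ N <= M * 1"
 using M uQ k1[OF True] ckern_nonneg[of y] by (intro mult_mono power_le_one) auto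
 thus ?thesis using True M(1) ckern_nonneg[of y] by (simp add: abs_mult)
 qed simp
 qed
 qed (use m' in simp)
 have "c * b ^ N * measure lborel U - M * a ^ N = (LI y. c * b ^ N * ind U y - M * a ^ N * ind (ucube::(real^'n) set) y)"
 using iU iC by (simp add: measure_def emeasure_ucube)
 also have "... <= (LI y. R y * ckern y ^ N * ind ucube y)"
 by (rule integral_mono) (use iU iC iR pt in auto)
 also have "... = 0" by (rule orth)
 finally show ?thesis by simp
 qed
 have "(%N. (a / b) ^ N) \<longlonglongrightarrow> 0" using a b by (intro LIMSEQ_realpow_zero) auto
 hence "(%N. M * (a / b) ^ N) \<longlonglongrightarrow> M * 0" by (intro tendsto_mult tendsto_const)
 moreover have "c * measure lborel U <= M * (a / b) ^ N" for N
 using ineq[of N] b by (simp add: power_divide field_simps)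
 ultimately have "c * measure lborel U <= M * 0" by (intro LIMSEQ_le_const) auto
 thus False using c mU by (simp add: mult_le_0_iff)
qed

lemma integrable_continuous_ucube:
 fixes g :: "'n::finite fn"
 assumes g: "continuous_on UNIV g"
 shows "intl (%y. g y * ind ucube y)"
proof -
 have "bounded (g ` cball 0 (real CARD('n)))"
 by (intro compact_imp_bounded compact_continuous_image compact_cball continuous_on_subset[OF g]) auto
 then obtain D where D: "D > 0" "!!x. x : g ` cball 0 (real CARD('n)) ==> norm x <= D" by (auto simp: bounded_pos)
 have [measurable]: "g : BM" using g by (rule borel_measurable_continuous_onI)
 have iC: "intl (%y. D * ind (ucube::(real^'n) set) y)"
 by (intro integrable_mult_right integrable_real_indicator) (auto simp: emeasure_ucube ucube_sets)
 show ?thesis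
 proof (rule Bochner_Integration.integrable_bound[OF iC])
 have "norm (g y * ind ucube y) <= norm (D * ind (ucube::(real^'n) set) y)" for y
 proof (cases "y : ucube")
 case True
 have "norm (g y) <= D" using ucube_norm[OF True] by (intro D(2) imageI) simp
 thus ?thesis using True D(1) by simp
 qed simp
 thus "AE y in lborel. norm (g y * ind ucube y) <= norm (D * ind (ucube::(real^'n) set) y)"
 by (intro AE_I2)
 qed simp
qed

text \<open>The periodisation \<open>h\<close> has the same integrals against trigonometric
  polynomials as the constant \<open>ft H 0\<close>. The difference is therefore orthogonal to all
  powers of \<open>ckern\<close>, and the peaking argument applies at the origin.\<close>

lemma poisson_0:
 fixes H :: "'n::finite fn"
 assumes H: "dec m H" and m: "real CARD('n) < m"
 and supp: "!!l. l ~= 0 ==> ft H ((2 * pi) *R cvec l) = 0"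
 shows "(LC k. H (cvec k)) = ft H 0"
proof -
 have m0: "0 <= m" using m by (meson of_nat_0_le_iff le_less_trans less_imp_le)
 define h where "h y = (LC k. H (y + cvec k))" for y
 define z where "z = h 0 - ft H 0"
 \<comment> \<open>The factor \<open>cnj z\<close> turns the value at the origin into the squared
   modulus of \<open>z\<close>, so that nonpositivity there forces \<open>z = 0\<close>.\<close>
 define R where "R y = Re (cnj z * (h y - ft H 0))" for y
 note Hi = dec_integrable[OF H m]
 obtain C where C: "0 <= C" "!!x. norm (H x) <= C * wt m x" using decE[OF H] by blast
 have hc: "continuous_on (cball 0 r) h" for r
 unfolding h_def
 proof (rule continuous_on_integral_dominated)
 show "continuous_on (cball 0 r) (%y. H (y + cvec k))" for k
 by (rule continuous_on_compose2[OF dec_continuous[OF H]]) (auto intro!: continuous_intros)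
 show "intc (%k. C * ((1 + r) powr m * wt m (cvec k :: real^'n)))"
 by (intro integrable_mult_right lattice_wt_integrable m)
 fix y :: "real^'n" and k assume y: "y : cball 0 r"
 have "wt m (y + cvec k) <= (1 + norm y) powr m * wt m (cvec k)" by (rule wt_shift_le[OF m0])
 also have "... <= (1 + r) powr m * wt m (cvec k)"
 using y m0 by (intro mult_right_mono powr_mono2) auto
 finally show "norm (H (y + cvec k)) <= C * ((1 + r) powr m * wt m (cvec k))"
 using C(2)[of "y + cvec k"] mult_left_mono[OF _ C(1)] by (meson order.trans)
 qed auto
 have hc': "continuous_on UNIV h"
 proof -
 have "isCont h x" for x
 using continuous_on_interior[OF hc[of "norm x + 1"], of x] by simp
 thus ?thesis by (simp add: continuous_at_imp_continuous_on)
 qed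
 have key: "(LI y. (h y - ft H 0) * p y * ind ucube y) = 0" if p: "trig_poly p" for p
 proof -
 have "(LI x. H x * p x) = (LI y. (LC k. H (y + cvec k) * p (y + cvec k)) * ind ucube y)"
 by (rule integral_lattice[OF trig_poly_integrable[OF p Hi]])
 also have "... = (LI y. h y * p y * ind ucube y)"
 by (simp add: trig_poly_periodic[OF p] h_def)
 finally have 1: "(LI y. h y * p y * ind ucube y) = ft H 0 * (LI y. p y * ind ucube y)"
 using poisson_trig_poly[OF H m supp p] by simp
 obtain B where B: "!!x. norm (p x) <= B" using trig_poly_bounded[OF p] by blast
 have pc: "continuous_on UNIV p" by (rule trig_poly_continuous[OF p])
 note bi = integrable_continuous_ucube
 have "(LI y. (h y - ft H 0) * p y * ind ucube y)
 = (LI y. h y * p y * ind ucube y - ft H 0 * (p y * ind ucube y))"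
 by (simp add: algebra_simps)
 also have "... = (LI y. h y * p y * ind ucube y) - ft H 0 * (LI y. p y * ind ucube y)"
 by (subst Bochner_Integration.integral_diff) (auto intro!: bi continuous_intros pc hc')
 finally show ?thesis using 1 by simp
 qed
 have "R 0 <= 0"
 proof (rule trig_poly_orthogonal_imp_nonpos)
 have Rc: "continuous_on UNIV R" unfolding R_def by (intro continuous_intros hc')
 thus "continuous_on (cbox (\<chi> i. -1/2) (\<chi> i. 1/2)) R" by (rule continuous_on_subset) simp
 have [measurable]: "R : BM" using Rc by (rule borel_measurable_continuous_onI)
 show "(%y. R y * ind ucube y) : BM" by measurable
 fix N
 have tp: "trig_poly (%y::real^'n. cnj z * cr (ckern y) ^ N)"
 by (intro trig_poly_mult trig_poly_const trig_poly_power trig_poly_ckern)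
 have eq: "R y * ckern y ^ N * ind ucube y = Re ((h y - ft H 0) * (cnj z * cr (ckern y) ^ N) * ind ucube y)" for y
 proof -
 have "(h y - ft H 0) * (cnj z * cr (ckern y) ^ N) * ind ucube y
 = (ckern y ^ N * ind ucube y) *R (cnj z * (h y - ft H 0))"
 by (auto simp: indicator_def scaleR_conv_of_real)
 thus ?thesis by (simp only: scaleR_complex.sel R_def mult_ac)
 qed
 show "(LI y. R y * ckern y ^ N * ind ucube y) = 0"
 proof -
 have "intl (%y. (h y - ft H 0) * (cnj z * cr (ckern y) ^ N) * ind ucube y)"
 by (intro integrable_continuous_ucube continuous_intros hc' continuous_on_ckern)
 hence "(LI y. Re ((h y - ft H 0) * (cnj z * cr (ckern y) ^ N) * ind ucube y)) = Re 0"
 using key[OF tp] by (subst integral_Re) auto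
 thus ?thesis unfolding eq by simp
 qed
 qed
 hence "norm z ^ 2 <= 0" by (simp add: R_def z_def[symmetric] complex_norm_square[symmetric] mult.commute cmod_power2 power2_eq_square)
 thus ?thesis by (simp add: z_def h_def)
qed

lemma norm_integral_le:
 fixes f :: "'a => 'b::{banach, second_countable_topology}"
 assumes g: "integrable M g" and f: "f : bm M" and le: "!!x. norm (f x) <= g x"
 shows "norm (LINT x|M. f x) <= (LINT x|M. g x)"
proof -
 have "integrable M f" by (rule integrable_dominated[OF g f le])
 hence "norm (LINT x|M. f x) <= (LINT x|M. norm (f x))" by (intro integral_norm_bound)
 also have "... <= (LINT x|M. g x)" by (rule integral_mono[OF integrable_norm[OF \<open>integrable M f\<close>] g le])
 finally show ?thesis .
qed

lemma poisson_summation: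
 fixes H :: "'n::finite fn"
 assumes H: "dec m H" and m: "real CARD('n) < m"
 and supp: "!!l. l ~= 0 ==> ft H ((2 * pi) *R cvec l) = 0"
 shows "(LC k. H (y + cvec k)) = ft H 0"
proof -
 have m0: "0 <= m" using m by (meson of_nat_0_le_iff le_less_trans less_imp_le)
 have "dec m (%x. H (y + x))" using dec_affine[OF H, of 1 y] m0 by simp
 hence "(LC k. H (y + cvec k)) = ft (%x. H (y + x)) 0"
 using m by (rule poisson_0) (simp add: ft_shift supp)
 thus ?thesis by (simp add: ft_shift)
qed

lemma norm_cvec_ge_1: assumes "k ~= 0" shows "1 <= norm (cvec k)"
proof -
 obtain i where i: "k $ i ~= 0" using assms by (auto simp: vec_eq_iff)
 have "1 <= \<bar>ri (k $ i)\<bar>" using i by linarith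
 also have "... = \<bar>cvec k $ i\<bar>" by (simp add: cvec_def)
 also have "... <= norm (cvec k)" by (rule component_le_norm_cart)
 finally show ?thesis .
qed

lemma cvec_0 [simp]: "cvec 0 = 0" by (simp add: cvec_def vec_eq_iff)

lemma tendsto_wt_infinity:
 assumes "0 < m" "filterlim (%j. norm (X j)) at_top F"
 shows "((%j. wt m (X j)) \<longlongrightarrow> 0) F"
proof -
 have "filterlim (%j. 1 + norm (X j)) at_top F"
 by (rule filterlim_tendsto_add_at_top[OF tendsto_const assms(2)])
 thus ?thesis unfolding wt_def using assms(1) by (intro tendsto_neg_powr) auto
qed

text \<open>Poisson summation on the lattice of mesh \<open>R j\<close> through \<open>x\<close>
  gives a vanishing sum of values of \<open>f\<close>. As the mesh tends to infinity all terms but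
  \<open>f x\<close> tend to zero, and the sums are dominated because
  \<open>R j \<ge> 1\<close>.\<close>

theorem ft_unique:
 fixes f :: "'n::finite fn"
 assumes f: "dec m f" and m: "real CARD('n) < m" and ft: "!!xi. ft f xi = 0"
 shows "f x = 0"
proof -
 have m0: "0 < m" using m by (meson of_nat_0_le_iff le_less_trans)
 obtain C where C: "0 <= C" "!!x. norm (f x) <= C * wt m x" using decE[OF f] by blast
 define R where "R j = real (Suc j)" for j
 have R1: "1 <= R j" for j by (simp add: R_def)
 have zero: "(LC k. f (x + R j *R cvec k)) = 0" for j
 proof -
 have "dec m (%y. f (0 + R j *R y))" using R1[of j] m0 by (intro dec_affine[OF f]) auto
 moreover have "ft (%y. f (0 + R j *R y)) xi = 0" for xi
 using R1[of j] ft by (subst ft_affine) auto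
 ultimately have "(LC k. (%y. f (0 + R j *R y)) ((1 / R j) *R x + cvec k)) = 0"
 by (subst poisson_summation[of m]) (use m in simp_all)
 thus ?thesis using R1[of j] by (simp add: scaleR_add_right)
 qed
 have le: "norm (f (x + R j *R cvec k)) <= C * ((1 + norm x) powr m * wt m (cvec k))" for j k
 proof -
 have "wt m (x + R j *R cvec k) <= (1 + norm x) powr m * wt m (R j *R cvec k)"
 using m0 by (intro wt_shift_le) simp
 also have "... <= (1 + norm x) powr m * wt m (cvec k)"
 proof (intro mult_left_mono wt_antimono_norm)
 show "norm (cvec k) <= norm (R j *R cvec k)" using mult_right_mono[OF R1[of j] norm_ge_zero[of "cvec k"]] R1[of j] by simp
 qed (use m0 in auto)
 finally show ?thesis using C(2)[of "x + R j *R cvec k"] mult_left_mono[OF _ C(1)] by (meson order.trans)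
 qed
 have int: "intc (%k. C * ((1 + norm x) powr m * wt m (cvec k :: real^'n)))"
 by (intro integrable_mult_right lattice_wt_integrable m)
 have lim: "(%j. f (x + R j *R cvec k)) \<longlonglongrightarrow> ind {0} k *R f x" for k
 proof (cases "k = 0")
 case False
 have n1: "1 <= norm (cvec k)" using False by (rule norm_cvec_ge_1)
 have "filterlim (%j. norm (x + R j *R cvec k)) at_top sequentially"
 proof (rule filterlim_at_top_mono)
 show "filterlim (%j. - norm x + real j) at_top sequentially"
 by (rule filterlim_tendsto_add_at_top[OF tendsto_const filterlim_real_sequentially])
 have "- norm x + real j <= norm (x + R j *R cvec k)" for j
 proof -
 have "real j * 1 <= R j * norm (cvec k)" using n1 by (intro mult_mono) (auto simp: R_def)
 hence "real j <= norm (R j *R cvec k)" using R1[of j] by simp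
 moreover have "norm (R j *R cvec k) <= norm (x + R j *R cvec k) + norm x"
 using norm_triangle_ineq4[of "x + R j *R cvec k" x] by simp
 ultimately show ?thesis by linarith
 qed
 thus "\<forall>\<^sub>F j in sequentially. - norm x + real j <= norm (x + R j *R cvec k)" by simp
 qed
 from tendsto_mult[OF tendsto_const[of C] tendsto_wt_infinity[OF m0 this]]
 have "(%j. C * wt m (x + R j *R cvec k)) \<longlonglongrightarrow> 0" by simp
 hence "(%j. f (x + R j *R cvec k)) \<longlonglongrightarrow> 0"
 by (rule Lim_null_comparison[rotated]) (simp add: C(2))
 thus ?thesis using False by simp
 qed simp
 have "(%j. LC k. f (x + R j *R cvec k)) \<longlonglongrightarrow> (LC k::int^'n. ind {0} k *R f x)"
 by (rule integral_dominated_convergence[OF _ _ int]) (use lim le in \<open>auto simp: AE_count_space\<close>)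
 hence "(%j::nat. 0) \<longlonglongrightarrow> (LC k::int^'n. ind {0} k *R f x)" by (simp only: zero)
 moreover have "(LC k::int^'n. ind {0} k *R f x) = f x"
 by simp
 ultimately show ?thesis using LIMSEQ_unique tendsto_const by metis
qed

section \<open>Convolutions, lattice convolutions and sampling\<close>

lemma ft_inject:
 fixes f g :: "'n::finite fn"
 assumes f: "dec m f" and g: "dec m g" and m: "real CARD('n) < m" and ft: "!!xi. ft f xi = ft g xi"
 shows "f x = g x"
proof -
 obtain C where C: "0 <= C" "!!x. norm (f x) <= C * wt m x" using decE[OF f] by blast
 obtain D where D: "0 <= D" "!!x. norm (g x) <= D * wt m x" using decE[OF g] by blast
 have "dec m (%x. f x - g x)"
 proof (rule decI[where C="C + D"])
 show "continuous_on UNIV (%x. f x - g x)" by (intro continuous_intros dec_continuous[OF f] dec_continuous[OF g])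
 show "norm (f x - g x) <= (C + D) * wt m x" for x
 using norm_triangle_ineq4[of "f x" "g x"] C(2)[of x] D(2)[of x] by (simp add: algebra_simps)
 qed
 moreover have "ft (%x. f x - g x) xi = 0" for xi
 proof -
 have "ft (%x. f x - g x) xi = (LI x. f x * ech xi x - g x * ech xi x)" by (simp add: ft_def algebra_simps)
 also have "... = ft f xi - ft g xi" unfolding ft_def
 by (rule Bochner_Integration.integral_diff[OF dec_integrable[OF dec_mult_ech[OF f] m] dec_integrable[OF dec_mult_ech[OF g] m]])
 finally show ?thesis using ft by simp
 qed
 ultimately have "f x - g x = 0" using m by (intro ft_unique[of m "%x. f x - g x"])
 thus ?thesis by simp
qed

text \<open>Convolutions against Lebesgue measure and sums over the lattice are treated simultaneously.\<close>
locale gen_conv = sigma_finite_measure M for M :: "'b measure" +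
 fixes ka :: "'b => real^'n::finite"
 assumes kappa [measurable]: "ka : measurable M borel"
begin

text \<open>For Lebesgue measure the first factor is \<open>ft F\<close>; for the lattice it is the
  Fourier series whose coefficients are the samples \<open>F\<close>.\<close>

lemma gconv_ft:
 assumes F: "integrable M F" and G: "rd G"
 shows "ft (%x. LINT y|M. F y * G (x - ka y)) xi = (LINT y|M. F y * ech xi (ka y)) * ft G xi"
proof -
 interpret pair_sigma_finite M "lborel :: (real^'n) measure" by standard
 have [measurable]: "G : BM" using G by (rule rd_measurable)
 have [measurable]: "F : bm M" using F by simp
 let ?h = "%y x. F y * G (x - ka y) * ech xi x"
 have meas [measurable]: "case_prod ?h : bm (M \<Otimes>\<^sub>M lborel)" by measurable
 have Gn: "(NI x. norm (G (x - a))) = (NI x. norm (G x))" for a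
 using nn_integral_shift[of "%x. en (norm (G x))" "- a"] by simp
 have "(\<integral>\<^sup>+p. norm (case_prod ?h p) \<partial>(M \<Otimes>\<^sub>M lborel)) = (\<integral>\<^sup>+y. (NI x. norm (?h y x)) \<partial>M)"
 by (subst lborel.nn_integral_fst[symmetric]) auto
 also have "... = (\<integral>\<^sup>+y. en (norm (F y)) * (NI x. norm (G x)) \<partial>M)"
 by (intro nn_integral_cong) (simp add: norm_mult ennreal_mult' nn_integral_cmult Gn)
 also have "... = (\<integral>\<^sup>+y. en (norm (F y)) \<partial>M) * (NI x. norm (G x))"
 by (rule nn_integral_multc) simp
 also have "... < \<infinity>" using F rd_integrable[OF G] by (simp add: integrable_iff_bounded ennreal_mult_less_top)
 finally have int: "integrable (M \<Otimes>\<^sub>M lborel) (case_prod ?h)" by (simp add: integrable_iff_bounded)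
 have "ft (%x. LINT y|M. F y * G (x - ka y)) xi = (LI x. (LINT y|M. ?h y x))"
 unfolding ft_def by (simp only: integral_mult_left_zero)
 also have "... = (LINT y|M. (LI x. ?h y x))" by (rule Fubini_integral[OF int])
 also have "... = (LINT y|M. F y * ech xi (ka y) * ft G xi)"
 proof (rule int_cong)
 fix y
 have "(LI x. ?h y x) = F y * (LI x. G (- ka y + x) * ech xi x)"
 by (simp add: mult.assoc)
 also have "(LI x. G (- ka y + x) * ech xi x) = ech xi (ka y) * ft G xi"
 using ft_shift[of G "- ka y" xi] by (simp add: ft_def)
 finally show "(LI x. ?h y x) = F y * ech xi (ka y) * ft G xi" by (simp add: mult.assoc)
 qed
 finally show ?thesis by (simp only: integral_mult_left_zero)
qed

lemma gconv_dec:
 assumes F [measurable]: "F : bm M" and w: "integrable M w" and Fw: "!!y. norm (F y) <= w y * wt m (ka y)"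
 and G: "rd G" and m: "0 <= m"
 shows "dec m (%x. LINT y|M. F y * G (x - ka y))"
proof -
 have [measurable]: "G : BM" using G by (rule rd_measurable)
 obtain C where C: "0 <= C" "!!x. norm (G x) <= C * wt m x" using decE[OF rd_dec[OF G]] by blast
 have w0: "0 <= w y" for y
 proof -
 have "0 <= w y * wt m (ka y)" by (rule order.trans[OF norm_ge_zero Fw])
 thus ?thesis by (simp add: zero_le_mult_iff) (metis wt_pos less_le_not_le)
 qed
 have le: "norm (F y * G (x - ka y)) <= C * wt m x * w y" for x y
 proof -
 have "norm (F y * G (x - ka y)) <= (w y * wt m (ka y)) * (C * wt m (x - ka y))"
 unfolding norm_mult using w0 by (intro mult_mono Fw C) auto
 also have "... = C * w y * (wt m (ka y) * wt m (x - ka y))" by (simp add: mult_ac)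
 also have "... <= C * w y * wt m (ka y + (x - ka y))"
 using w0 C(1) by (intro mult_left_mono wt_add_ge m) auto
 finally show ?thesis by (simp add: mult_ac)
 qed
 have Gb: "norm (F y * G (x - ka y)) <= C * w y" for x y
 proof -
 have "C * wt m x * w y <= C * 1 * w y" using w0 C(1) wt_le_1[OF m, of x] by (intro mult_right_mono mult_left_mono) auto
 thus ?thesis using le[of y x] by simp
 qed
 show ?thesis
 proof (rule decI[where C="C * (LINT y|M. w y)"])
 show "continuous_on UNIV (%x. LINT y|M. F y * G (x - ka y))"
 proof (rule continuous_on_integral_dominated[OF _ _ integrable_mult_right[OF w, of C] Gb])
 show "continuous_on UNIV (%x. F y * G (x - ka y))" for y
 by (intro continuous_on_mult continuous_on_const continuous_on_compose2[OF rd_continuous[OF G]] continuous_intros) auto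
 qed measurable
 fix x
 have "norm (LINT y|M. F y * G (x - ka y)) <= (LINT y|M. C * wt m x * w y)"
 by (rule norm_integral_le[OF integrable_mult_right[OF w] _ le]) measurable
 thus "norm (LINT y|M. F y * G (x - ka y)) <= C * (LINT y|M. w y) * wt m x" by (simp add: mult_ac)
 qed
qed

end

interpretation leb: gen_conv lborel "%x::real^'n::finite. x"
 by standard simp

lemma gen_conv_lattice: "gen_conv (count_space UNIV) (cvec :: int^'n::finite => real^'n)"
proof -
 interpret sigma_finite_measure "count_space (UNIV::(int^'n) set)" by (rule sigma_finite_count_space)
 show ?thesis by standard simp
qed

interpretation latt: gen_conv "count_space UNIV" "cvec :: int^'n::finite => real^'n"
 by (rule gen_conv_lattice)

definition conv :: "'n::finite fn => 'n fn => 'n fn" where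
 "conv f g x = (LI y. f y * g (x - y))"

lemma rdI: assumes "!!m. 0 <= m ==> dec m f" shows "rd f"
 unfolding rd_def
proof
 fix m show "dec m f" by (rule dec_mono[OF assms[of "max 0 m"]]) auto
qed

lemma rd_conv:
 fixes f :: "'n::finite fn"
 assumes f: "rd f" and g: "rd g" shows "rd (conv f g)"
proof (rule rdI)
 fix m :: real assume m: "0 <= m"
 let ?k = "real CARD('n) + 1"
 obtain C where C: "0 <= C" "!!x. norm (f x) <= C * wt (m + ?k) x" using decE[OF rd_dec[OF f]] by blast
 have "dec m (%x. LI y. f y * g (x - y))"
 proof (rule leb.gconv_dec[OF _ _ _ g m, where w="%y. C * wt ?k y"])
 show "intl (%y::real^'n. C * wt ?k y)" by (intro integrable_mult_right integrable_wt) simp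
 show "norm (f y) <= C * wt ?k y * wt m y" for y using C(2)[of y] by (simp add: mult.assoc wt_mult add.commute)
 qed (use rd_measurable[OF f] in simp)
 thus "dec m (conv f g)" by (simp add: conv_def[abs_def])
qed

lemma ft_conv: "rd f ==> rd g ==> ft (conv f g) xi = ft f xi * ft g xi"
 using leb.gconv_ft[OF rd_integrable, of f g xi] by (simp add: conv_def[abs_def] ft_def)

lemma rd_lattice_conv:
 fixes f :: "'n::finite fn"
 assumes f: "rd f" and g: "rd g" shows "rd (%x. LC k. f (cvec k) * g (x - cvec k))"
proof (rule rdI)
 fix m :: real assume m: "0 <= m"
 let ?k = "real CARD('n) + 1"
 obtain C where C: "0 <= C" "!!x. norm (f x) <= C * wt (m + ?k) x" using decE[OF rd_dec[OF f]] by blast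
 show "dec m (%x. LC k. f (cvec k) * g (x - cvec k))"
 proof (rule latt.gconv_dec[OF _ _ _ g m, where w="%k. C * wt ?k (cvec k)"])
 show "intc (%k. C * wt ?k (cvec k :: real^'n))"
 by (intro integrable_mult_right lattice_wt_integrable) simp
 show "norm (f (cvec y)) <= C * wt ?k (cvec y) * wt m (cvec y)" for y
 using C(2)[of "cvec y"] by (simp add: mult.assoc wt_mult add.commute)
 qed simp
qed

text \<open>Sampling: both sides have the same Fourier transform, because by Poisson summation the Fourier
 series of the samples reproduces the transform of \<open>f\<close> on the ball of radius \<open>2 < 2\<pi> - 2\<close>.\<close>
lemma sampling_0:
 fixes f g :: "'n::finite fn"
 assumes f: "rd f" and g: "rd g"
 and sf: "!!xi. ft f xi ~= 0 ==> norm xi < 2" and sg: "!!xi. ft g xi ~= 0 ==> norm xi < 2"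
 shows "(LC k. f (cvec k) * g (x - cvec k)) = conv f g x"
proof (rule ft_inject[of "real CARD('n) + 1" "%x. LC k. f (cvec k) * g (x - cvec k)"])
 fix xi
 have fi: "intc (%k. f (cvec k))"
 using dec_lattice_integrable[OF rd_dec[OF f, of "real CARD('n) + 1"], of 0] by simp
 have "ft (%x. LC k. f (cvec k) * g (x - cvec k)) xi
 = (LC k. f (cvec k) * ech xi (cvec k)) * ft g xi"
 by (rule latt.gconv_ft[OF fi g])
 also have "... = ft f xi * ft g xi"
 proof (cases "ft g xi = 0")
 case False
 hence nxi: "norm xi < 2" by (rule sg)
 have shift: "ft (%x. f x * ech xi x) et = ft f (xi + et)" for et
 by (simp add: ft_def ech_add_freq mult.assoc)
 have "(LC k. (%x. f x * ech xi x) (0 + cvec k)) = ft (%x. f x * ech xi x) 0"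
 proof (rule poisson_summation[OF rd_dec[OF rd_mult_ech[OF f]], of "real CARD('n) + 1"])
 fix l :: "int^'n" assume "l ~= 0"
 hence "1 <= norm (cvec l)" by (rule norm_cvec_ge_1)
 hence "2 * pi <= norm ((2 * pi) *R cvec l)" by simp
 moreover have "norm ((2 * pi) *R cvec l) <= norm (xi + (2 * pi) *R cvec l) + norm xi"
 using norm_triangle_ineq4[of "xi + (2 * pi) *R cvec l" xi] by simp
 ultimately have "~ norm (xi + (2 * pi) *R cvec l) < 2" using nxi pi_ge_two by linarith
 thus "ft (%x. f x * ech xi x) ((2 * pi) *R cvec l) = 0" unfolding shift using sf by blast
 qed simp
 thus ?thesis unfolding shift by simp
 qed simp
 also have "... = ft (conv f g) xi" by (simp add: ft_conv f g)
 finally show "ft (%x. LC k. f (cvec k) * g (x - cvec k)) xi = ft (conv f g) xi" .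
qed (use rd_dec[OF rd_lattice_conv[OF f g]] rd_dec[OF rd_conv[OF f g]] in auto)

text \<open>The right side does not involve the offset \<open>y\<close>. This freedom is what later
  allows averages over \<open>y\<close>.\<close>

theorem sampling:
 fixes f g :: "'n::finite fn"
 assumes f: "rd f" and g: "rd g"
 and sf: "!!xi. ft f xi ~= 0 ==> norm xi < 2" and sg: "!!xi. ft g xi ~= 0 ==> norm xi < 2"
 shows "(LC k. f (y + cvec k) * g (x - (y + cvec k))) = conv f g x"
proof -
 have "(LC k. (%t. f (y + t)) (cvec k) * g ((x - y) - cvec k)) = conv (%t. f (y + t)) g (x - y)"
 by (rule sampling_0[OF rd_shift[OF f] g _ sg]) (simp add: ft_shift sf)
 also have "... = (LI t. (%t. f t * g (x - t)) (y + t))" by (simp add: conv_def algebra_simps)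
 also have "... = conv f g x" by (subst integral_shift) (simp add: conv_def)
 finally show ?thesis by (simp add: algebra_simps)
qed

lemma rd_mult: "rd f ==> rd (%x. c * f x)"
 unfolding rd_def
proof
 fix m assume f: "ALL m. dec m f"
 obtain C where C: "0 <= C" "!!x. norm (f x) <= C * wt m x" using decE[OF f[rule_format]] by blast
 show "dec m (%x. c * f x)"
 proof (rule decI[where C="norm c * C"])
 show "continuous_on UNIV (%x. c * f x)" using f dec_continuous by (intro continuous_intros) blast
 show "norm (c * f x) <= norm c * C * wt m x" for x
 using mult_left_mono[OF C(2)[of x] norm_ge_zero[of c]] by (simp add: norm_mult mult.assoc)
 qed
qed

lemma rd_add: assumes "rd f" "rd g" shows "rd (%x. f x + g x)"
 unfolding rd_def
proof
 fix m
 obtain C where C: "0 <= C" "!!x. norm (f x) <= C * wt m x" using decE[OF rd_dec[OF assms(1)]] by blast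
 obtain D where D: "0 <= D" "!!x. norm (g x) <= D * wt m x" using decE[OF rd_dec[OF assms(2)]] by blast
 show "dec m (%x. f x + g x)"
 proof (rule decI[where C="C + D"])
 show "continuous_on UNIV (%x. f x + g x)" using assms rd_continuous by (intro continuous_intros) blast+
 show "norm (f x + g x) <= (C + D) * wt m x" for x
 using norm_triangle_ineq[of "f x" "g x"] C(2)[of x] D(2)[of x] by (simp add: algebra_simps)
 qed
qed

lemma ft_mult: "ft (%x. c * f x) xi = c * ft f xi"
 by (simp add: ft_def mult.assoc)

lemma ft_add: "rd f ==> rd g ==> ft (%x. f x + g x) xi = ft f xi + ft g xi"
 unfolding ft_def distrib_right
 by (rule Bochner_Integration.integral_add[OF rd_integrable[OF rd_mult_ech] rd_integrable[OF rd_mult_ech]])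

section \<open>Averages over dyadic balls\<close>

lemma ubv_neq_0: "ubv TYPE('a::euclidean_space) ~= 0"
 using ubv_pos[where 'a='a] by linarith

text \<open>A class stable under sums, nonnegative powers and ball averages on which all averages
  are finite. Averages can thus be real numbers, while integrals over the whole space are taken in
  \<open>ennreal\<close>.\<close>

definition LB :: "('a::euclidean_space => real) => bool" where
 "LB h = (h : BM & (ALL x. 0 <= h x) & (ALL R. EX C. ALL x. norm x <= R --> h x <= C))"

lemma LB_measurable [measurable_dest]: "LB h ==> h : BM" by (simp add: LB_def)
lemma LB_nonneg: "LB h ==> 0 <= h x" by (simp add: LB_def)
lemma LB_bound: "LB h ==> EX C. ALL x. norm x <= R --> h x <= C" by (simp add: LB_def)

lemma LB_dominated:
 assumes "LB h" "g : BM" "!!x. 0 <= g x" "!!x. g x <= h x"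
 shows "LB g"
 unfolding LB_def using assms(2,3)
proof (intro conjI allI)
 fix R
 obtain C where "ALL x. norm x <= R --> h x <= C" using LB_bound[OF assms(1)] by blast
 thus "EX C. ALL x. norm x <= R --> g x <= C" using assms(4) order.trans by meson
qed auto

lemma LB_powr: assumes h: "LB h" and t: "0 <= t" shows "LB (%x. h x powr t)"
 unfolding LB_def
proof (intro conjI allI)
 show "(%x. h x powr t) : BM" using LB_measurable[OF h] by measurable
 fix R
 obtain C where "ALL x. norm x <= R --> h x <= C" using LB_bound[OF h] by blast
 hence "ALL x. norm x <= R --> h x powr t <= C powr t"
 using LB_nonneg[OF h] t by (auto intro: powr_mono2)
 thus "EX C. ALL x. norm x <= R --> h x powr t <= C" by blast
qed auto

lemma LB_add: assumes h: "LB h" and g: "LB g" shows "LB (%x. h x + g x)"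
 unfolding LB_def
proof (intro conjI allI)
 show "(%x. h x + g x) : BM" using LB_measurable[OF h] LB_measurable[OF g] by measurable
 show "0 <= h x + g x" for x using LB_nonneg[OF h] LB_nonneg[OF g] by simp
 fix R
 obtain C where C: "ALL x. norm x <= R --> h x <= C" using LB_bound[OF h] by blast
 obtain D where D: "ALL x. norm x <= R --> g x <= D" using LB_bound[OF g] by blast
 have "ALL x. norm x <= R --> h x + g x <= C + D" using C D by (simp add: add_mono)
 thus "EX C. ALL x. norm x <= R --> h x + g x <= C" by blast
qed

lemma LB_zero: "LB (%x. 0)" by (auto simp: LB_def)

lemma LB_sum: "finite J ==> (!!j. j : J ==> LB (h j)) ==> LB (%x. SUM j:J. h j x)"
 by (induction J rule: finite_induct) (auto simp: LB_zero intro: LB_add)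

text \<open>Normalised by a power of two and not by the volume of the ball, which is why powers of
  \<open>ubv\<close> accompany the estimates. A larger \<open>j\<close> means a smaller
  ball.\<close>

definition bavg :: "int => ('a::euclidean_space => real) => 'a => real" where
 "bavg j h x = p2 (ri j * real DIM('a)) *
 (LI z. ind (ball x (tm j)) z * h z)"

lemma LB_integrable_ball:
 fixes h :: "'a::euclidean_space => real"
 assumes h: "LB h" shows "intl (%z. ind (ball x r) z * h z)"
proof -
 obtain C where C: "ALL z. norm z <= norm x + r --> h z <= C" using LB_bound[OF h] by blast
 have "intl (%z. ind (ball x r) z *R h z)"
 proof (rule integrableI_bounded_set_indicator[where B=C])
 show "emeasure lborel (ball x r) < \<infinity>" using emeasure_bounded_finite[OF bounded_ball] by (simp add: less_top)
 have "norm (h z) <= C" if "z : ball x r" for z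
 proof -
 have "norm z <= norm x + r" using that norm_triangle_ineq2[of z x] by (simp add: dist_norm norm_minus_commute)
 thus ?thesis using C LB_nonneg[OF h, of z] by simp
 qed
 thus "AE z in lborel. z : ball x r --> norm (h z) <= C" by simp
 qed (use LB_measurable[OF h] in auto)
 thus ?thesis by simp
qed

lemma bavg_nn:
 fixes h :: "'a::euclidean_space => real"
 assumes h: "LB h"
 shows "en (bavg j h x) = en (p2 (ri j * real DIM('a))) *
 (NI z. ind (ball x (tm j)) z * en (h z))"
proof -
 have "(NI z. ind (ball x (tm j)) z * en (h z))
 = (NI z. en (ind (ball x (tm j)) z * h z))"
 by (intro nn_integral_cong) (auto simp: indicator_def)
 also have "... = en (LI z. ind (ball x (tm j)) z * h z)"
 by (rule nn_integral_eq_integral[OF LB_integrable_ball[OF h]]) (auto simp: LB_nonneg[OF h])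
 finally show ?thesis by (simp add: bavg_def ennreal_mult')
qed

lemma bavg_nonneg: "LB h ==> 0 <= bavg j h x"
 unfolding bavg_def by (intro mult_nonneg_nonneg integral_nonneg_AE) (auto simp: LB_nonneg)

lemma bavg_le_const:
 fixes h :: "'a::euclidean_space => real"
 assumes h: "LB h" and c: "!!z. dist x z < tm j ==> h z <= c" "0 <= c"
 shows "bavg j h x <= ubv TYPE('a) * c"
proof -
 let ?B = "ball x (tm j)"
 have iB: "intl (%z. ind ?B z * c)"
 using emeasure_bounded_finite[OF bounded_ball, of x "tm j"] by (intro integrable_mult_left integrable_real_indicator) (auto simp: less_top)
 have "(LI z. ind ?B z * h z) <= (LI z. ind ?B z * c)"
 by (rule integral_mono[OF LB_integrable_ball[OF h] iB]) (auto simp: indicator_def c)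
 also have "... = measure lborel ?B * c" by simp
 also have "measure lborel ?B = ubv TYPE('a) * tm j ^ DIM('a)"
 by (simp add: measure_def emeasure_ball_ubv)
 finally have "bavg j h x <= p2 (ri j * real DIM('a)) * (ubv TYPE('a) * tm j ^ DIM('a) * c)"
 unfolding bavg_def by (rule mult_left_mono) simp
 also have "... = ubv TYPE('a) * c * (p2 (ri j * real DIM('a)) * p2 (real DIM('a) * - ri j))"
 by (simp only: two_powr_power mult_ac)
 also have "p2 (ri j * real DIM('a)) * p2 (real DIM('a) * - ri j) = (1::real)"
 by (subst powr_add[symmetric]) simp
 finally show ?thesis by simp
qed

lemma bavg_mono_ball:
 fixes h :: "'a::euclidean_space => real"
 assumes h: "LB h" and sub: "ball z (tm j) \<subseteq> ball x (tm i)"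
 shows "bavg j h z <= p2 (ri (j - i) * real DIM('a)) * bavg i h x"
proof -
 have "(LI y. ind (ball z (tm j)) y * h y) <= (LI y. ind (ball x (tm i)) y * h y)"
 by (rule integral_mono[OF LB_integrable_ball[OF h] LB_integrable_ball[OF h]])
 (use sub LB_nonneg[OF h] in \<open>auto simp: indicator_def\<close>)
 hence "bavg j h z <= p2 (ri j * real DIM('a)) * (LI y. ind (ball x (tm i)) y * h y)"
 unfolding bavg_def by (rule mult_left_mono) simp
 also have "p2 (ri j * real DIM('a)) = p2 (ri (j - i) * real DIM('a)) * p2 (ri i * real DIM('a))"
 by (subst powr_add[symmetric]) (simp add: algebra_simps)
 finally show ?thesis by (simp add: bavg_def mult.assoc)
qed

lemma borel_measurable_ball_integral:
 fixes g :: "'a::euclidean_space => ennreal"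
 assumes [measurable]: "g : BM"
 shows "(%x. (NI z. ind (ball x r) z * g z)) : BM"
proof -
 have eq: "ind (ball x r) z = (ind {p. dist (fst p) (snd p) < r} (x, z) :: ennreal)" for x z :: 'a
 by (simp add: indicator_def)
 have [measurable]: "{p. dist (fst p) (snd p) < r} : sets (borel \<Otimes>\<^sub>M borel :: ('a \<times> 'a) measure)"
 unfolding borel_prod by (intro borel_open open_Collect_less continuous_intros)
 show ?thesis unfolding eq by measurable
qed

lemma LB_bavg:
 fixes h :: "'a::euclidean_space => real"
 assumes h: "LB h" shows "LB (bavg j h)"
 unfolding LB_def
proof (intro conjI allI)
 show "0 <= bavg j h x" for x by (rule bavg_nonneg[OF h])
 have "(%x. enn2real (en (p2 (ri j * real DIM('a))) *
 (NI z. ind (ball x (tm j)) z * en (h z)))) : BM"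
 using LB_measurable[OF h] by (intro borel_measurable_enn2real borel_measurable_times_ennreal borel_measurable_const borel_measurable_ball_integral) measurable
 thus "bavg j h : BM"
 unfolding bavg_nn[OF h, symmetric] by (simp add: bavg_nonneg[OF h])
 fix R
 obtain C where C: "ALL z. norm z <= R + tm j --> h z <= C" using LB_bound[OF h] by blast
 have "bavg j h x <= ubv TYPE('a) * max C 0" if x: "norm x <= R" for x
 proof (rule bavg_le_const[OF h])
 fix z assume "dist x z < tm j"
 hence "norm z <= R + tm j" using x norm_triangle_ineq2[of z x] by (simp add: dist_norm norm_minus_commute)
 thus "h z <= max C 0" using C by (simp add: le_max_iff_disj)
 qed simp
 thus "EX C. ALL x. norm x <= R --> bavg j h x <= C" by blast
qed

text \<open>Tonelli and the symmetry of the relation \<open>dist x z < r\<close>: averaging at one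
  radius is self-adjoint, which a maximal operator is not.\<close>

lemma bavg_swap:
 fixes g h :: "'a::euclidean_space => real"
 assumes g: "LB g" and h: "LB h"
 shows "(NI x. en (g x * bavg j h x)) = (NI x. en (bavg j g x * h x))"
proof -
 let ?c = "en (p2 (ri j * real DIM('a)))" and ?r = "tm j"
 let ?A = "%x z. en (g x) * (ind (ball x ?r) z * en (h z))"
 have [measurable]: "g : BM" "h : BM" using g h by (auto dest: LB_measurable)
 have eq: "ind (ball x ?r) z = (ind {p. dist (fst p) (snd p) < ?r} (x, z) :: ennreal)" for x z :: 'a
 by (simp add: indicator_def)
 have sym: "ind (ball x ?r) z = (ind (ball z ?r) x :: ennreal)" for x z :: 'a
 by (simp add: indicator_def dist_commute)
 have S: "{p. dist (fst p) (snd p) < ?r} : sets (borel \<Otimes>\<^sub>M borel :: ('a \<times> 'a) measure)"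
 unfolding borel_prod by (intro borel_open open_Collect_less continuous_intros)
 have S' [measurable]: "{p. dist (fst p) (snd p) < ?r} : sets (lborel \<Otimes>\<^sub>M lborel :: ('a \<times> 'a) measure)"
 using S by (simp cong: sets_pair_measure_cong)
 have "(%x. ind (ball x ?r) z :: ennreal) = ind (ball z ?r)" for z :: 'a
 by (rule ext) (rule sym)
 hence [measurable]: "(%x. ind (ball x ?r) z :: ennreal) : BM" for z :: 'a
 by simp
 have "(NI x. en (g x * bavg j h x))
 = (NI x. (NI z. ?c * ?A x z))"
 proof (rule nn_integral_cong)
 fix x
 have "en (g x * bavg j h x) = en (g x) * (?c * (NI z. ind (ball x ?r) z * en (h z)))"
 by (simp add: ennreal_mult' LB_nonneg[OF g] bavg_nn[OF h])
 also have "... = ?c * (en (g x) * (NI z. ind (ball x ?r) z * en (h z)))"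
 by (rule mult.left_commute)
 also have "... = (NI z. ?c * ?A x z)"
 by (simp add: nn_integral_cmult)
 finally show "en (g x * bavg j h x) = (NI z. ?c * ?A x z)" .
 qed
 also have "... = (NI z. (NI x. ?c * ?A x z))"
 unfolding eq by (rule lborel_pair.Fubini') measurable
 also have "... = (NI z. en (bavg j g z * h z))"
 proof (rule nn_integral_cong)
 fix z
 have "(NI x. ?c * ?A x z)
 = (NI x. ?c * (ind (ball z ?r) x * en (g x)) * en (h z))"
 proof (rule nn_integral_cong)
 fix x
 show "?c * ?A x z = ?c * (ind (ball z ?r) x * en (g x)) * en (h z)"
 unfolding sym[of x z] by (simp only: mult_ac)
 qed
 also have "... = en (bavg j g z * h z)"
 by (simp add: nn_integral_multc nn_integral_cmult ennreal_mult' LB_nonneg[OF h] bavg_nonneg[OF g] ennreal_mult bavg_nn[OF g])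
 finally show "(NI x. ?c * ?A x z) = en (bavg j g z * h z)" .
 qed
 finally show ?thesis .
qed

section \<open>Fefferman-Stein inequality with one radius per scale\<close>

text \<open>Convexity of the power function, read off from Young's inequality with the exponents
  \<open>s\<close> and \<open>s / (s - 1)\<close>.\<close>

lemma powr_tangent:
 assumes "1 < s" "0 <= a" "0 <= (b::real)"
 shows "a powr s + s * a powr (s - 1) * (b - a) <= b powr s"
proof (cases "a = 0")
 case False
 define q where "q = s / (s - 1)"
 have q: "1 < q" "1 / s + 1 / q = 1" using assms by (auto simp: q_def field_simps)
 have aq: "(a powr (s - 1)) powr q = a powr s" using assms by (simp add: powr_powr q_def)
 have "b * a powr (s - 1) <= b powr s / s + (a powr (s - 1)) powr q / q"
 using assms q by (intro Youngs_inequality) auto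
 hence "s * (b * a powr (s - 1)) <= s * (b powr s / s + a powr s / q)"
 using assms unfolding aq by (intro mult_left_mono) auto
 also have "... = b powr s + (s - 1) * a powr s" using assms by (simp add: q_def field_simps)
 also have "a powr s = a powr (s - 1) * a" using assms False powr_add[of a "s - 1" 1] by (simp add: powr_one)
 finally show ?thesis using \<open>a powr s = a powr (s - 1) * a\<close> by (simp add: algebra_simps)
qed (use assms in simp)

text \<open>Terms are added in increasing order of the index. Each step raises the power by at most
  \<open>s\<close> times the new term times the power \<open>s - 1\<close> of the new partial sum,
  by the tangent at that sum. In the application only averages at scales no finer than
  \<open>v\<close> then multiply the term of index \<open>v\<close>.\<close>

lemma powr_sum_le_telescope:
 fixes f :: "int => real"
 assumes "1 < s" "finite J" "!!j. j : J ==> 0 <= f j"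
 shows "(SUM j:J. f j) powr s <= s * (SUM v:J. (SUM j:{j\<in>J. j <= v}. f j) powr (s - 1) * f v)"
 using assms(2,3)
proof (induction J rule: finite_linorder_max_induct)
 case empty thus ?case by simp
next
 case (insert b A)
 let ?S = "SUM j:A. f j"
 have S0: "0 <= ?S" "0 <= f b" using insert.prems by (auto intro: sum_nonneg)
 have bA: "b ~: A" using insert.hyps by auto
 have 1: "{j : insert b A. j <= b} = insert b A" using insert.hyps by auto
 have 2: "{j : insert b A. j <= v} = {j : A. j <= v}" if "v : A" for v using insert.hyps that by auto
 have "(f b + ?S) powr s + s * (f b + ?S) powr (s - 1) * (?S - (f b + ?S)) <= ?S powr s"
 using S0 assms(1) by (intro powr_tangent) auto
 hence "(f b + ?S) powr s <= ?S powr s + s * ((f b + ?S) powr (s - 1) * f b)" by (simp add: algebra_simps)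
 also have "?S powr s <= s * (SUM v:A. (SUM j:{j\<in>A. j <= v}. f j) powr (s - 1) * f v)"
 using insert by auto
 finally have "(f b + ?S) powr s <= s * ((f b + ?S) powr (s - 1) * f b + (SUM v:A. (SUM j:{j\<in>A. j <= v}. f j) powr (s - 1) * f v))"
 by (simp add: algebra_simps)
 moreover have "(SUM v:insert b A. (SUM j:{j\<in>insert b A. j <= v}. f j) powr (s - 1) * f v)
 = (f b + ?S) powr (s - 1) * f b + (SUM v:A. (SUM j:{j\<in>A. j <= v}. f j) powr (s - 1) * f v)"
 using bA insert.hyps(1) 1 2 by (simp cong: sum.cong)
 ultimately show ?case using bA insert.hyps(1) by simp
qed

text \<open>Integrate \<open>powr_tangent\<close>, taken at the true mean \<open>a\<close>, over the
  ball; the linear term drops out.\<close>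

lemma bavg_jensen:
 fixes h :: "'a::euclidean_space => real"
 assumes s: "1 < s" and h: "LB h"
 shows "bavg j h x powr s <= ubv TYPE('a) powr (s - 1) * bavg j (%z. h z powr s) x"
proof -
 let ?B = "ball x (tm j)" and ?c = "p2 (ri j * real DIM('a))"
 define V where "V = ubv TYPE('a)"
 have V: "0 < V" by (simp add: V_def)
 define a where "a = bavg j h x / V"
 have a0: "0 <= a" using bavg_nonneg[OF h] V by (simp add: a_def)
 have hs: "LB (%z. h z powr s)" using h s by (intro LB_powr) auto
 have cB: "?c * measure lborel ?B = V"
 proof -
 have "measure lborel ?B = V * tm j ^ DIM('a)"
 by (simp add: measure_def emeasure_ball_ubv V_def)
 also have "tm j ^ DIM('a) = p2 (- (ri j * real DIM('a)))"
 by (simp only: two_powr_power) (simp add: mult.commute)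
 finally show ?thesis by (simp add: powr_minus)
 qed
 have iB: "intl (ind ?B :: 'a => real)"
 using emeasure_bounded_finite[OF bounded_ball, of x "tm j"] by (intro integrable_real_indicator) (auto simp: less_top)
 define k where "k = s * a powr (s - 1)"
 have "(LI z. (a powr s - k * a) * ind ?B z + k * (ind ?B z * h z)) <= (LI z. ind ?B z * h z powr s)"
 proof (rule integral_mono)
 show "intl (%z. (a powr s - k * a) * ind ?B z + k * (ind ?B z * h z))"
 by (intro Bochner_Integration.integrable_add integrable_mult_right iB LB_integrable_ball[OF h])
 show "intl (%z. ind ?B z * h z powr s)" by (rule LB_integrable_ball[OF hs])
 fix z
 show "(a powr s - k * a) * ind ?B z + k * (ind ?B z * h z) <= ind ?B z * h z powr s"
 using powr_tangent[OF s a0 LB_nonneg[OF h, of z]] by (auto simp: indicator_def k_def algebra_simps)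
 qed
 hence "?c * (LI z. (a powr s - k * a) * ind ?B z + k * (ind ?B z * h z)) <= ?c * (LI z. ind ?B z * h z powr s)"
 by (rule mult_left_mono) simp
 also have "?c * (LI z. ind ?B z * h z powr s) = bavg j (%z. h z powr s) x" by (simp add: bavg_def)
 also have "(LI z. (a powr s - k * a) * ind ?B z + k * (ind ?B z * h z))
 = (a powr s - k * a) * measure lborel ?B + k * (LI z. ind ?B z * h z)"
 by (subst Bochner_Integration.integral_add) (auto intro!: iB LB_integrable_ball[OF h] integrable_mult_right)
 also have "?c * ... = (a powr s - k * a) * (?c * measure lborel ?B) + k * (?c * (LI z. ind ?B z * h z))"
 by (simp add: algebra_simps)
 also have "... = (a powr s - k * a) * V + k * (a * V)" unfolding cB using V by (simp add: a_def bavg_def)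
 also have "... = V * a powr s" by (simp add: algebra_simps)
 also have "V * a powr s = V powr (1 - s) * bavg j h x powr s"
 using V bavg_nonneg[OF h] by (simp add: a_def powr_divide powr_diff)
 finally have "V powr (s - 1) * (V powr (1 - s) * bavg j h x powr s) <= V powr (s - 1) * bavg j (%z. h z powr s) x"
 by (rule mult_left_mono) simp
 moreover have "V powr (s - 1) * V powr (1 - s) = 1" using V by (subst powr_add[symmetric]) simp
 ultimately show ?thesis by (simp add: V_def mult.assoc[symmetric])
qed

lemma nn_integral_bavg:
 fixes h :: "'a::euclidean_space => real"
 assumes h: "LB h"
 shows "(NI x. en (bavg j h x)) <= en (ubv TYPE('a)) * (NI x. en (h x))"
proof -
 have 1: "LB (%x::'a. 1::real)" by (auto simp: LB_def)
 have "(NI x. en (1 * bavg j h x)) = (NI x. en (bavg j (%_. 1) x * h x))"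
 by (rule bavg_swap[OF 1 h])
 also have "... <= (NI x. en (ubv TYPE('a)) * en (h x))"
 proof (rule nn_integral_mono)
 fix x :: 'a
 have "bavg j (%_. 1) x <= ubv TYPE('a) * 1" by (rule bavg_le_const[OF 1]) auto
 hence "bavg j (%_. 1) x * h x <= ubv TYPE('a) * h x" using LB_nonneg[OF h] by (intro mult_right_mono) auto
 thus "en (bavg j (%_. 1) x * h x) <= en (ubv TYPE('a)) * en (h x)"
 using less_imp_le[OF ubv_pos[where 'a='a]] by (simp add: ennreal_mult'[symmetric] ennreal_leI)
 qed
 also have "... = en (ubv TYPE('a)) * (NI x. en (h x))"
 using LB_measurable[OF h] by (intro nn_integral_cmult) simp
 finally show ?thesis by simp
qed

lemma nn_integral_bavg_powr:
 fixes h :: "'a::euclidean_space => real"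
 assumes s: "1 < s" and h: "LB h"
 shows "(NI x. en (bavg j h x powr s)) <= en (ubv TYPE('a) powr s) * (NI x. en (h x powr s))"
proof -
 let ?V = "ubv TYPE('a)"
 have hs: "LB (%z. h z powr s)" using h s by (intro LB_powr) auto
 have "(NI x. en (bavg j h x powr s)) <= (NI x. en (?V powr (s - 1)) * en (bavg j (%z. h z powr s) x))"
 by (intro nn_integral_mono) (simp add: ennreal_mult'[symmetric] ennreal_leI bavg_jensen[OF s h])
 also have "... = en (?V powr (s - 1)) * (NI x. en (bavg j (%z. h z powr s) x))"
 using LB_measurable[OF LB_bavg[OF hs]] by (intro nn_integral_cmult) simp
 also have "... <= en (?V powr (s - 1)) * (en ?V * (NI x. en (h x powr s)))"
 by (intro mult_left_mono nn_integral_bavg[OF hs]) simp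
 also have "... = en (?V powr (s - 1) * ?V) * (NI x. en (h x powr s))"
 by (simp add: ennreal_mult' mult.assoc)
 also have "?V powr (s - 1) * ?V = ?V powr s" using powr_add[of ?V "s - 1" 1] ubv_pos[where 'a='a] by (simp add: powr_one)
 finally show ?thesis .
qed

lemma nn_integral_cmult_sum:
 fixes f :: "'b => 'c => ennreal"
 assumes "!!j. j : J ==> f j : bm M"
 shows "(\<integral>\<^sup>+x. c * (SUM j:J. f j x) \<partial>M) = c * (SUM j:J. \<integral>\<^sup>+x. f j x \<partial>M)"
 using assms by (subst nn_integral_cmult) (auto intro!: borel_measurable_sum simp: nn_integral_sum)

lemma powr_sum_le:
 fixes f :: "'b => real"
 assumes "0 < s" "finite J" "!!j. j : J ==> 0 <= f j"
 shows "(SUM j:J. f j) powr s <= real (card J) powr s * (SUM j:J. f j powr s)"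
proof (cases "J = {}")
 case False
 define M where "M = Max (f ` J)"
 have M: "M : f ` J" "!!j. j : J ==> f j <= M" using False assms(2) by (auto simp: M_def)
 then obtain i where i: "i : J" "M = f i" by blast
 have "(SUM j:J. f j) <= real (card J) * M" using sum_bounded_above[of J f M] M(2) by simp
 hence "(SUM j:J. f j) powr s <= (real (card J) * M) powr s"
 using assms by (intro powr_mono2 sum_nonneg) auto
 also have "... = real (card J) powr s * f i powr s" using assms(3)[OF i(1)] i(2) by (simp add: powr_mult)
 also have "... <= real (card J) powr s * (SUM j:J. f j powr s)"
 using i assms by (intro mult_left_mono member_le_sum) auto
 finally show ?thesis .
qed simp

definition fs_good :: "'a::euclidean_space itself => real => nat => real => bool" where
 "fs_good _ s N C \<longleftrightarrow> (ALL J (H :: int => 'a => real). finite J & card J <= N & (ALL j:J. LB (H j)) -->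
 (NI x. en ((SUM j:J. bavg j (H j) x) powr s)) <= en C * (NI x. en ((SUM j:J. H j x) powr s)))"

lemma fs_goodD:
 "fs_good TYPE('a) s N C ==> finite J ==> card J <= N ==> (!!j. j : J ==> LB (H j :: 'a::euclidean_space => real)) ==>
 (NI x. en ((SUM j:J. bavg j (H j) x) powr s)) <= en C * (NI x. en ((SUM j:J. H j x) powr s))"
 by (auto simp: fs_good_def)

lemma fs_good_mono: "fs_good TYPE('a::euclidean_space) s N C ==> C <= C' ==> fs_good TYPE('a) s N C'"
 unfolding fs_good_def
 by (intro allI impI order.trans[OF _ mult_right_mono[OF ennreal_leI[of C C']]]) auto

lemma fs_good_apriori:
 assumes s: "1 < s"
 shows "fs_good TYPE('a::euclidean_space) s N (real N powr s * (real N * ubv TYPE('a) powr s))"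
 unfolding fs_good_def
proof (intro allI impI, elim conjE)
 fix J and H :: "int => 'a => real"
 assume J: "finite J" "card J <= N" "ALL j:J. LB (H j)"
 let ?V = "ubv TYPE('a)" let ?T = "(NI x. en ((SUM j:J. H j x) powr s))"
 have "(NI x. en ((SUM j:J. bavg j (H j) x) powr s))
 <= (NI x. en (real N powr s) * (SUM j:J. en (bavg j (H j) x powr s)))"
 proof (rule nn_integral_mono)
 fix x
 have "(SUM j:J. bavg j (H j) x) powr s <= real (card J) powr s * (SUM j:J. bavg j (H j) x powr s)"
 using s J by (intro powr_sum_le) (auto intro: bavg_nonneg)
 also have "... <= real N powr s * (SUM j:J. bavg j (H j) x powr s)"
 using s J by (intro mult_right_mono powr_mono2 sum_nonneg) auto
 finally show "en ((SUM j:J. bavg j (H j) x) powr s) <= en (real N powr s) * (SUM j:J. en (bavg j (H j) x powr s))"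
 by (simp add: ennreal_mult'[symmetric] ennreal_leI sum_nonneg)
 qed
 also have "... = en (real N powr s) * (SUM j:J. (NI x. en (bavg j (H j) x powr s)))"
 proof -
 have m: "(%x. en (bavg j (H j) x powr s)) : bm lborel" if "j : J" for j
 using LB_measurable[OF LB_powr[OF LB_bavg, of "H j" s j]] J(3) that s by simp
 thus ?thesis by (rule nn_integral_cmult_sum)
 qed
 also have "... <= en (real N powr s) * (SUM j:J. en (?V powr s) * ?T)"
 proof (intro mult_left_mono sum_mono)
 fix j assume j: "j : J"
 have "(NI x. en (bavg j (H j) x powr s)) <= en (?V powr s) * (NI x. en (H j x powr s))"
 using J(3) j s by (intro nn_integral_bavg_powr) auto
 also have "... <= en (?V powr s) * ?T"
 using J j s by (intro mult_left_mono nn_integral_mono ennreal_leI powr_mono2 member_le_sum) (auto intro: LB_nonneg)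
 finally show "(NI x. en (bavg j (H j) x powr s)) <= en (?V powr s) * ?T" .
 qed simp
 also have "... = en (real N powr s) * (of_nat (card J) * (en (?V powr s) * ?T))" by simp
 also have "... <= en (real N powr s) * (of_nat N * (en (?V powr s) * ?T))"
 using J(2) by (intro mult_left_mono mult_right_mono) auto
 also have "... = en (real N powr s * (real N * ?V powr s)) * ?T"
 by (simp add: ennreal_mult' ennreal_of_nat_eq_real_of_nat mult.assoc)
 finally show "(NI x. en ((SUM j:J. bavg j (H j) x) powr s)) <= en (real N powr s * (real N * ?V powr s)) * ?T" .
qed

lemma young_absorb:
 assumes "1 < s" "0 < e" "0 <= a" "0 <= (h::real)"
 shows "a powr (s - 1) * h <= e * a powr s + e powr (1 - s) * h powr s"
proof (cases "h <= e * a")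
 case True
 have "a powr (s - 1) * h <= a powr (s - 1) * (e * a)" using True by (intro mult_left_mono) auto
 also have "... = e * a powr s" using assms powr_add[of a "s - 1" 1] by (cases "a = 0") (auto simp: powr_one)
 finally show ?thesis using assms by (intro add_increasing2) auto
next
 case False
 hence h: "0 < h" using assms by (meson le_less_trans linorder_not_le mult_nonneg_nonneg less_imp_le)
 have "a <= h / e" using False assms by (simp add: field_simps)
 hence "a powr (s - 1) * h <= (h / e) powr (s - 1) * h" using assms by (intro mult_right_mono powr_mono2) auto
 also have "... = e powr (1 - s) * h powr s"
 using assms h powr_add[of h "s - 1" 1] by (simp add: powr_divide powr_diff powr_one)
 finally show ?thesis using assms by (intro add_increasing) auto
qed

text \<open>After telescoping, self-adjointness moves the average at scale \<open>v\<close> from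
  \<open>H v\<close> to the power of the partial sum \<open>S v\<close>. This sum involves only
  balls of radius at least \<open>tm v\<close>; hence on a ball of that radius it is controlled by
  the value at the centre of \<open>S2\<close>, where all radii are doubled. Young's inequality
  leaves half of the integral of the power of \<open>S2\<close>, to which the assumed bound applies
  after a translation of indices, and a multiple of the right side.\<close>

lemma fs_good_step:
 assumes s: "1 < s"
 obtains K where "0 < K" "!!N C. 0 <= C ==> fs_good TYPE('a::euclidean_space) s N C ==> fs_good TYPE('a) s N (C / 2 + K)"
proof -
 let ?V = "ubv TYPE('a)" let ?n = "real DIM('a)"
 let ?A = "%s S2 x. (2 powr ?n) powr (s - 1) * S2 x powr (s - 1)"
 let ?B = "%J s S2 x H. SUM v:J. en (?V * ?A s S2 x * H v x)"
 let ?C = "%S v x s H. S v x powr (s - 1) * bavg v (H v) x"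
 let ?D = "%T s. NI x. en (T x powr s)"
 let ?E = "%J H x. SUM j:J. bavg j (H j) x"
 define A where "A = s * (?V * (2 powr ?n) powr (s - 1))"
 have A: "0 < A" using s by (simp add: A_def)
 \<comment> \<open>Makes \<open>A * e = 1 / 2\<close>, the coefficient with which the assumed
   constant returns.\<close>
 define e where "e = 1 / (2 * A)"
 have e: "0 < e" using A by (simp add: e_def)
 define K where "K = A * e powr (1 - s)"
 have K: "0 < K" using A e by (simp add: K_def)
 have "fs_good TYPE('a) s N (C / 2 + K)" if C: "0 <= C" and good: "fs_good TYPE('a) s N C" for N C
 unfolding fs_good_def
 proof (intro allI impI, elim conjE)
 fix J and H :: "int => 'a => real"
 assume J: "finite J" "card J <= N" "ALL j:J. LB (H j)"
 let ?T = "(NI x. en ((SUM j:J. H j x) powr s))"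
 define S where "S v x = (SUM j:{j\<in>J. j <= v}. bavg j (H j) x)" for v x
 define S2 where "S2 x = (SUM j:J. bavg (j - 1) (H j) x)" for x
 define T where "T x = (SUM j:J. H j x)" for x
 have LH: "LB (H j)" if "j : J" for j using J(3) that by blast
 have LS: "LB (S v)" for v unfolding S_def[abs_def] using J(1) by (intro LB_sum LB_bavg LH) auto
 have LS': "LB (%x. S v x powr (s - 1))" for v using s by (intro LB_powr LS) simp
 have LS2: "LB S2" unfolding S2_def[abs_def] using J(1) by (intro LB_sum LB_bavg LH) auto
 have LT: "LB T" unfolding T_def[abs_def] using J(1) by (intro LB_sum LH) auto
 have S_S2: "S v z <= 2 powr ?n * S2 x" if d: "dist x z < tm v" for v x z
 proof -
 have "S v z <= (SUM j:{j\<in>J. j <= v}. 2 powr ?n * bavg (j - 1) (H j) x)"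
 unfolding S_def
 proof (rule sum_mono)
 fix j assume j: "j : {j\<in>J. j <= v}"
 have "ball z (tm j) \<subseteq> ball x (p2 (- ri (j - 1)))"
 proof
 fix y assume y: "y : ball z (tm j)"
 have "tm v <= tm j" using j by simp
 moreover have "p2 (- ri (j - 1)) = 2 * tm j"
 using powr_add[of 2 1 "- ri j"] by simp
 ultimately show "y : ball x (p2 (- ri (j - 1)))"
 using y d dist_triangle[of x y z] unfolding mem_ball by linarith
 qed
 thus "bavg j (H j) z <= 2 powr ?n * bavg (j - 1) (H j) x"
 using bavg_mono_ball[of "H j" z j x "j - 1"] LH j by simp
 qed
 also have "... <= (SUM j:J. 2 powr ?n * bavg (j - 1) (H j) x)"
 using J(1) LH by (intro sum_mono2) (auto intro!: bavg_nonneg mult_nonneg_nonneg)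
 finally show ?thesis by (simp add: S2_def sum_distrib_left)
 qed
 have Bv: "bavg v (%z. S v z powr (s - 1)) x <= ?V * ?A s S2 x" for v x
 proof (rule bavg_le_const[OF LS'])
 fix z assume "dist x z < tm v"
 from S_S2[OF this] have "S v z powr (s - 1) <= (2 powr ?n * S2 x) powr (s - 1)"
 using s LB_nonneg[OF LS] by (intro powr_mono2) auto
 thus "S v z powr (s - 1) <= (2 powr ?n) powr (s - 1) * S2 x powr (s - 1)"
 using LB_nonneg[OF LS2, of x] by (simp add: powr_mult)
 qed simp
 have "(NI x. en ((?E J H x) powr s))
 <= (NI x. en s * (SUM v:J. en (?C S v x s H)))"
 proof (rule nn_integral_mono)
 fix x
 have "(?E J H x) powr s <= s * (SUM v:J. S v x powr (s - 1) * bavg v (H v) x)"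
 unfolding S_def using s J(1) LH by (intro powr_sum_le_telescope) (auto intro: bavg_nonneg)
 thus "en ((?E J H x) powr s) <= en s * (SUM v:J. en (?C S v x s H))"
 using s LH by (subst sum_ennreal) (auto simp: ennreal_mult'[symmetric] bavg_nonneg intro!: ennreal_leI)
 qed
 also have "... = en s * (SUM v:J. (NI x. en (?C S v x s H)))"
 proof -
 have m: "(%x. en (?C S v x s H)) : bm lborel" if "v : J" for v
 using LB_measurable[OF LS'[of v]] LB_measurable[OF LB_bavg[OF LH[OF that], of v]] by simp
 thus ?thesis by (rule nn_integral_cmult_sum)
 qed
 also have "... = en s * (SUM v:J. (NI x. en (bavg v (%z. S v z powr (s - 1)) x * H v x)))"
 using LH by (simp add: bavg_swap[OF LS'])
 also have "... <= en s * (SUM v:J. (NI x. en (?V * ?A s S2 x * H v x)))"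
 using LH by (intro mult_left_mono sum_mono nn_integral_mono ennreal_leI mult_right_mono Bv) (auto simp: LB_nonneg[OF LH])
 also have "(SUM v:J. (NI x. en (?V * ?A s S2 x * H v x)))
 = (NI x. (?B J s S2 x H))"
 using LB_measurable[OF LS2] LB_measurable[OF LH] by (subst nn_integral_sum) auto
 also have "en s * ... = (NI x. en s * ?B J s S2 x H)"
 using LB_measurable[OF LS2] LB_measurable[OF LH] by (subst nn_integral_cmult) (auto intro!: borel_measurable_sum)
 also have "... <= (NI x. en (1/2) * en (S2 x powr s) + en K * en (T x powr s))"
 proof (rule nn_integral_mono)
 fix x
 have "s * (SUM v:J. ?V * ?A s S2 x * H v x) = A * (S2 x powr (s - 1) * T x)"
 unfolding sum_distrib_left[symmetric] A_def T_def by (simp only: mult_ac)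
 also have "... <= A * (e * S2 x powr s + e powr (1 - s) * T x powr s)"
 using A by (intro mult_left_mono young_absorb s e LB_nonneg[OF LS2] LB_nonneg[OF LT]) auto
 also have "... = 1/2 * S2 x powr s + K * T x powr s" using A by (simp add: e_def K_def algebra_simps)
 finally have "en (s * (SUM v:J. ?V * ?A s S2 x * H v x)) <= en (1/2 * S2 x powr s + K * T x powr s)"
 by (rule ennreal_leI)
 moreover have "(?B J s S2 x H)
 = en (SUM v:J. ?V * ?A s S2 x * H v x)"
 using LH less_imp_le[OF ubv_pos[where 'a='a]] by (intro sum_ennreal) (auto intro!: mult_nonneg_nonneg simp: LB_nonneg[OF LH])
 moreover have "en (1/2 * S2 x powr s + K * T x powr s) = en (1/2) * en (S2 x powr s) + en K * en (T x powr s)"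
 using K by (simp only: ennreal_mult'[symmetric] ennreal_plus[symmetric]) (simp add: ennreal_mult')
 ultimately show "en s * ?B J s S2 x H <= en (1/2) * en (S2 x powr s) + en K * en (T x powr s)"
 using s by (simp add: ennreal_mult')
 qed
 also have "... = en (1/2) * (NI x. en (S2 x powr s)) + en K * ?D T s"
 using LB_measurable[OF LS2] LB_measurable[OF LT] by (subst nn_integral_add) (auto simp: nn_integral_cmult)
 \<comment> \<open>\<open>S2\<close> is the sum on the left of the inequality for the index set
   moved by one, with the same functions on the right.\<close>
 also have "(NI x. en (S2 x powr s)) <= en C * ?D T s"
 proof -
 let ?J = "(%j. j - 1) ` J"
 have inj: "inj_on (%j::int. j - 1) J" by (auto simp: inj_on_def)
 have "(NI x. en ((SUM j:?J. bavg j (H (j + 1)) x) powr s)) <= en C * (NI x. en ((SUM j:?J. H (j + 1) x) powr s))"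
 using J LH by (intro fs_goodD[OF good]) (auto simp: card_image[OF inj])
 thus ?thesis by (simp add: sum.reindex[OF inj] S2_def T_def)
 qed
 also have "en (1/2) * (en C * ?D T s) + en K * (?D T s)
 = en (C / 2 + K) * ?T"
 proof -
 have "en (C / 2 + K) = en (1/2 * C) + en K" using C K by (subst ennreal_plus[symmetric]) auto
 also have "en (1/2 * C) = en (1/2) * en C" using C by (intro ennreal_mult) auto
 finally show ?thesis by (simp only: T_def distrib_right mult.assoc)
 qed
 finally show "(NI x. en ((?E J H x) powr s)) <= en (C / 2 + K) * ?T"
 by (simp add: add_mono mult_left_mono)
 qed
 thus ?thesis using that K by blast
qed

text \<open>The best constant \<open>N\<close> for a fixed number of scales is finite and satisfies \<open>N <= N / 2 + K\<close>.\<close>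
lemma fs_sum:
 assumes s: "1 < s"
 shows "EX C>0. ALL J (H :: int => 'a::euclidean_space => real). finite J & (ALL j:J. LB (H j)) -->
 (NI x. en ((SUM j:J. bavg j (H j) x) powr s)) <= en C * (NI x. en ((SUM j:J. H j x) powr s))"
proof -
 obtain K where K: "0 < K" and step: "!!N C. 0 <= C ==> fs_good TYPE('a) s N C ==> fs_good TYPE('a) s N (C / 2 + K)"
 using fs_good_step[OF s] by metis
 have "fs_good TYPE('a) s N (2 * K + 1)" for N
 proof -
 define C0 where "C0 = real N powr s * (real N * ubv TYPE('a) powr s)"
 have C0: "0 <= C0" by (simp add: C0_def)
 have it: "fs_good TYPE('a) s N (2 * K + C0 / 2 ^ i)" for i
 proof (induction i)
 case 0
 have "fs_good TYPE('a) s N C0" unfolding C0_def by (rule fs_good_apriori[OF s])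
 thus ?case by (rule fs_good_mono) (use K in simp)
 next
 case (Suc i)
 have "0 <= 2 * K + C0 / 2 ^ i" using K C0 by simp
 from step[OF this Suc] show ?case by (simp add: field_simps)
 qed
 obtain i where "C0 < 2 ^ i" using real_arch_pow[of 2 C0] by auto
 hence "C0 / 2 ^ i <= 1" by (simp add: field_simps)
 thus ?thesis by (intro fs_good_mono[OF it[of i]]) simp
 qed
 note good = this
 have "ALL J (H :: int => 'a => real). finite J & (ALL j:J. LB (H j)) -->
 (NI x. en ((SUM j:J. bavg j (H j) x) powr s)) <= en (2 * K + 1) * (NI x. en ((SUM j:J. H j x) powr s))"
 by (intro allI impI fs_goodD[OF good _ order_refl]) auto
 thus ?thesis using K by (intro exI[of _ "2 * K + 1"]) auto
qed

lemma holder_finite: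
 fixes f g :: "'b => real"
 assumes pq: "1 < p" "1 < q" "1 / p + 1 / q = 1" and J: "finite J"
 and f: "!!j. j : J ==> 0 <= f j" and g: "!!j. j : J ==> 0 <= g j"
 shows "(SUM j:J. f j * g j) <= (SUM j:J. f j powr p) powr (1 / p) * (SUM j:J. g j powr q) powr (1 / q)"
proof -
 define A where "A = (SUM j:J. f j powr p)"
 define B where "B = (SUM j:J. g j powr q)"
 have A0: "0 <= A" and B0: "0 <= B" by (auto simp: A_def B_def intro: sum_nonneg)
 show ?thesis
 proof (cases "A = 0 | B = 0")
 case True
 hence "f j * g j = 0" if "j : J" for j
 proof
 assume "A = 0"
 hence "f j powr p = 0" using J that unfolding A_def by (subst (asm) sum_nonneg_eq_0_iff) auto
 thus ?thesis by simp
 next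
 assume "B = 0"
 hence "g j powr q = 0" using J that unfolding B_def by (subst (asm) sum_nonneg_eq_0_iff) auto
 thus ?thesis by simp
 qed
 hence "(SUM j:J. f j * g j) = 0" by (rule sum.neutral[OF ballI])
 thus ?thesis by simp
 next
 case False
 hence AB: "0 < A" "0 < B" using A0 B0 by auto
 define a where "a = A powr (1 / p)"
 define b where "b = B powr (1 / q)"
 have ab: "0 < a" "0 < b" using AB by (auto simp: a_def b_def)
 have ap: "a powr p = A" "b powr q = B" using AB pq by (auto simp: a_def b_def powr_powr)
 have "(SUM j:J. (f j / a) * (g j / b)) <= (SUM j:J. (f j / a) powr p / p + (g j / b) powr q / q)"
 using pq f g ab by (intro sum_mono Youngs_inequality) auto
 also have "... = (SUM j:J. f j powr p / A / p + g j powr q / B / q)"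
 using f g ab ap by (intro sum.cong) (auto simp: powr_divide)
 also have "... = A / A / p + B / B / q" by (simp add: sum.distrib sum_divide_distrib[symmetric] A_def B_def)
 also have "... = 1" using AB pq by simp
 finally have "(SUM j:J. f j * g j / (a * b)) <= 1" by simp
 hence "(SUM j:J. f j * g j) / (a * b) <= 1" by (simp add: sum_divide_distrib)
 thus ?thesis using ab by (simp add: a_def b_def A_def B_def field_simps)
 qed
qed

definition fs_bound :: "'a::euclidean_space itself => real => real => real => bool" where
 "fs_bound _ p q C \<longleftrightarrow> (ALL J (h :: int => 'a => real). finite J & (ALL j:J. LB (h j)) -->
 (NI x. en ((SUM j:J. bavg j (h j) x powr q) powr (p / q)))
 <= en C * (NI x. en ((SUM j:J. h j x powr q) powr (p / q))))"

lemma fs_bound_diag: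
 assumes p: "1 < p" shows "fs_bound TYPE('a::euclidean_space) p p (ubv TYPE('a) powr p)"
 unfolding fs_bound_def
proof (intro allI impI, elim conjE)
 fix J and h :: "int => 'a => real" assume J: "finite J" "ALL j:J. LB (h j)"
 let ?V = "ubv TYPE('a)"
 have sm: "en (SUM j:J. f j x powr p) = (SUM j:J. en (f j x powr p))" for f :: "int => 'a => real" and x
 by (rule sum_ennreal[symmetric]) simp
 have int: "(NI x. en (SUM j:J. f j x powr p)) = (SUM j:J. (NI x. en (f j x powr p)))"
 if "!!j. j : J ==> LB (f j)" for f :: "int => 'a => real"
 unfolding sm using LB_measurable[OF that] by (intro nn_integral_sum) simp
 have "(NI x. en (SUM j:J. bavg j (h j) x powr p)) = (SUM j:J. (NI x. en (bavg j (h j) x powr p)))"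
 using J by (intro int LB_bavg) auto
 also have "... <= (SUM j:J. en (?V powr p) * (NI x. en (h j x powr p)))"
 using J by (intro sum_mono nn_integral_bavg_powr p) auto
 also have "... = en (?V powr p) * (NI x. en (SUM j:J. h j x powr p))"
 using J by (subst int) (auto simp: sum_distrib_left)
 finally show "(NI x. en ((SUM j:J. bavg j (h j) x powr p) powr (p / p)))
 <= en (?V powr p) * (NI x. en ((SUM j:J. h j x powr p) powr (p / p)))"
 using p by (simp add: powr_one' sum_nonneg powr_one)
qed

text \<open>By Jensen the power \<open>q\<close> goes inside the averages, and what remains is the
  inequality for sums with exponent \<open>p / q\<close>, larger than 1 except on the
  diagonal.\<close>

lemma fs_bound_ge:
 assumes q: "1 < q" and pq: "q <= p" shows "EX C>0. fs_bound TYPE('a::euclidean_space) p q C"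
proof (cases "p = q")
 case True thus ?thesis using fs_bound_diag[OF q, where 'a='a] ubv_pos[where 'a='a]
 by (intro exI[of _ "ubv TYPE('a) powr q"]) (auto simp: less_imp_neq[symmetric])
next
 case False
 let ?V = "ubv TYPE('a)"
 define s where "s = p / q"
 have s: "1 < s" using False pq q by (simp add: s_def field_simps)
 obtain C where C: "0 < C" "ALL J (H :: int => 'a => real). finite J & (ALL j:J. LB (H j)) -->
 (NI x. en ((SUM j:J. bavg j (H j) x) powr s)) <= en C * (NI x. en ((SUM j:J. H j x) powr s))"
 using fs_sum[OF s, where 'a='a] by blast
 define D where "D = (?V powr (q - 1)) powr s"
 have D0: "0 <= D" by (simp add: D_def)
 have "fs_bound TYPE('a) p q (D * C)"
 unfolding fs_bound_def s_def[symmetric]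
 proof (intro allI impI, elim conjE)
 fix J and h :: "int => 'a => real" assume J: "finite J" "ALL j:J. LB (h j)"
 have LH: "LB (%x. h j x powr q)" if "j : J" for j using J q that by (intro LB_powr) auto
 have "(NI x. en ((SUM j:J. bavg j (h j) x powr q) powr s))
 <= (NI x. en D * en ((SUM j:J. bavg j (%x. h j x powr q) x) powr s))"
 proof (rule nn_integral_mono)
 fix x
 have "(SUM j:J. bavg j (h j) x powr q) <= (SUM j:J. ?V powr (q - 1) * bavg j (%x. h j x powr q) x)"
 using J q by (intro sum_mono bavg_jensen) auto
 also have "... = ?V powr (q - 1) * (SUM j:J. bavg j (%x. h j x powr q) x)" by (simp add: sum_distrib_left)
 finally have "(SUM j:J. bavg j (h j) x powr q) powr s <= (?V powr (q - 1) * (SUM j:J. bavg j (%x. h j x powr q) x)) powr s"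
 using s by (intro powr_mono2 sum_nonneg) auto
 also have "... = D * (SUM j:J. bavg j (%x. h j x powr q) x) powr s"
 using LH by (subst powr_mult) (auto simp: D_def intro!: sum_nonneg bavg_nonneg)
 finally show "en ((SUM j:J. bavg j (h j) x powr q) powr s) <= en D * en ((SUM j:J. bavg j (%x. h j x powr q) x) powr s)"
 using D0 by (subst ennreal_mult[symmetric]) (auto intro!: ennreal_leI)
 qed
 also have "... = en D * (NI x. en ((SUM j:J. bavg j (%x. h j x powr q) x) powr s))"
 using LB_measurable[OF LB_sum[OF J(1) LB_bavg[OF LH]]] by (intro nn_integral_cmult) simp
 also have "... <= en D * (en C * (NI x. en ((SUM j:J. h j x powr q) powr s)))"
 using C(2)[rule_format, of J "%j x. h j x powr q"] J(1) LH by (intro mult_left_mono) auto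
 finally show "(NI x. en ((SUM j:J. bavg j (h j) x powr q) powr s)) <= en (D * C) * (NI x. en ((SUM j:J. h j x powr q) powr s))"
 using C(1) by (simp add: ennreal_mult' D_def mult.assoc)
 qed
 moreover have "0 < D * C" using C(1) by (simp add: D_def ubv_neq_0)
 ultimately show ?thesis by blast
qed

lemma young_absorb':
 assumes p: "1 < p" and p': "p' = p / (p - 1)" and e: "0 < e" and a: "0 <= a" and b: "0 <= (b::real)"
 shows "a * b <= e * b powr p' + e powr (1 - p) * a powr p"
proof -
 define c where "c = b powr (1 / (p - 1))"
 have cb: "c powr (p - 1) = b" using p b by (simp add: c_def powr_powr)
 have cp: "c powr p = b powr p'" using p by (simp add: c_def powr_powr p')
 have "c powr (p - 1) * a <= e * c powr p + e powr (1 - p) * a powr p"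
 using p e a by (intro young_absorb) (auto simp: c_def)
 thus ?thesis by (simp add: cb cp mult.commute)
qed

text \<open>Duality: for \<open>p < q\<close> the extremal \<open>g\<^sub>j\<close> below lies in the dual space, where the previous case applies.\<close>
lemma fs_bound_less:
 assumes p: "1 < p" and pq: "p < q" shows "EX C>0. fs_bound TYPE('a::euclidean_space) p q C"
proof -
 let ?V = "ubv TYPE('a)"
 let ?B = "%J g x q' p'. (SUM j:J. bavg j (g j) x powr q') powr (p' / q')"
 let ?C = "%J. real (card J) powr (p / q)"
 let ?D = "%J g x q'. SUM j:J. g j x powr q'"
 let ?E = "%J h x. (SUM j:J. h j x powr q) powr (p / q)"
 define p' where "p' = p / (p - 1)"
 define q' where "q' = q / (q - 1)"
 have q: "1 < q" using p pq by simp
 have q'1: "1 < q'" using q by (simp add: q'_def field_simps)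
 have conj: "1 / q + 1 / q' = 1" using q by (simp add: q'_def field_simps)
 have qp': "q' <= p'" using p pq by (simp add: q'_def p'_def field_simps)
 obtain C where C: "0 < C" "fs_bound TYPE('a) p' q' C" using fs_bound_ge[OF q'1 qp', where 'a='a] by blast
 \<comment> \<open>Makes \<open>e * C = 1 / 2\<close>, so that half of the left side can be absorbed
   at the end.\<close>
 define e where "e = 1 / (2 * C)"
 have e: "0 < e" using C by (simp add: e_def)
 define D where "D = e powr (1 - p)"
 have D: "0 < D" using e by (simp add: D_def)
 have "fs_bound TYPE('a) p q (2 * D)"
 unfolding fs_bound_def
 proof (intro allI impI, elim conjE)
 fix J and h :: "int => 'a => real" assume J: "finite J" "ALL j:J. LB (h j)"
 let ?X = "(NI x. en (?E J h x))"
 define b where "b j x = bavg j (h j) x" for j x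
 have Lh: "LB (h j)" if "j : J" for j using J that by blast
 have Lb: "LB (b j)" if "j : J" for j unfolding b_def[abs_def] using Lh[OF that] by (rule LB_bavg)
 define W where "W x = (SUM j:J. b j x powr q)" for x
 have LW: "LB W" unfolding W_def[abs_def] using J(1) q by (intro LB_sum LB_powr Lb) auto
 have W0: "0 <= W x" for x by (rule LB_nonneg[OF LW])
 \<comment> \<open>The exponents are those of equality in Hoelder's inequality: the pairing of
   \<open>g\<close> with \<open>b\<close> gives back the integrand \<open>W x powr (p / q)\<close>
   of the left side, and so does the dual norm of \<open>g\<close> raised to the power
   \<open>p'\<close>.\<close>
 define g where "g j x = W x powr ((p - q) / q) * b j x powr (q - 1)" for j x
 let ?A = "(NI x. en (W x powr (p / q)))"
 have bW: "b j x powr q <= W x" if "j : J" for j x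
 unfolding W_def using J(1) that by (intro member_le_sum) auto
 have g_le: "g j x <= W x powr ((p - 1) / q)" if j: "j : J" for j x
 proof (cases "W x = 0")
 case False
 have "b j x = (b j x powr q) powr (1 / q)" using q LB_nonneg[OF Lb[OF j]] by (simp add: powr_powr)
 also have "... <= W x powr (1 / q)" using bW[OF j] q by (intro powr_mono2) auto
 finally have "b j x powr (q - 1) <= (W x powr (1 / q)) powr (q - 1)" using q LB_nonneg[OF Lb[OF j]] by (intro powr_mono2) auto
 hence "g j x <= W x powr ((p - q) / q) * W x powr ((q - 1) / q)" unfolding g_def by (intro mult_left_mono) (auto simp: powr_powr)
 also have "... = W x powr ((p - 1) / q)" by (subst powr_add[symmetric]) (simp add: add_divide_distrib[symmetric])
 finally show ?thesis .
 qed (simp add: g_def)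
 have Lg: "LB (g j)" if j: "j : J" for j
 proof (rule LB_dominated[OF LB_powr[OF LW, of "(p - 1) / q"]])
 show "g j : BM" unfolding g_def[abs_def] using LB_measurable[OF LW] LB_measurable[OF Lb[OF j]] by measurable
 qed (use p q g_le[OF j] in \<open>auto simp: g_def\<close>)
 show "(NI x. en ((SUM j:J. bavg j (h j) x powr q) powr (p / q))) <= en (2 * D) * ?X"
 proof (cases "?X = \<infinity>")
 case True thus ?thesis using D by (simp add: ennreal_mult_top)
 next
 case False
 have hp: "(NI x. en (h j x powr p)) <= ?X" if j: "j : J" for j
 proof (intro nn_integral_mono ennreal_leI)
 fix x
 have "h j x powr p = (h j x powr q) powr (p / q)" using q by (simp add: powr_powr)
 also have "... <= (SUM j:J. h j x powr q) powr (p / q)" using J(1) j p q by (intro powr_mono2 member_le_sum) auto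
 finally show "h j x powr p <= (SUM j:J. h j x powr q) powr (p / q)" .
 qed
 \<comment> \<open>Absorption needs a finite left side. The estimate used here depends on the
   cardinality of \<open>J\<close>, but only finiteness is retained.\<close>
 have Afin: "?A < \<infinity>"
 proof -
 have "?A <= (NI x. en (?C J) * (SUM j:J. en (b j x powr p)))"
 proof (rule nn_integral_mono)
 fix x
 have "W x powr (p / q) <= real (card J) powr (p / q) * (SUM j:J. (b j x powr q) powr (p / q))"
 unfolding W_def using J(1) p q by (intro powr_sum_le) auto
 also have "(SUM j:J. (b j x powr q) powr (p / q)) = (SUM j:J. b j x powr p)" using q by (simp add: powr_powr)
 finally show "en (W x powr (p / q)) <= en (?C J) * (SUM j:J. en (b j x powr p))"
 by (subst sum_ennreal) (auto simp: ennreal_mult'[symmetric] intro!: ennreal_leI)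
 qed
 also have "... = en (?C J) * (SUM j:J. (NI x. en (b j x powr p)))"
 using LB_measurable[OF Lb] by (intro nn_integral_cmult_sum) simp
 also have "... <= en (?C J) * (SUM j:J. en (?V powr p) * ?X)"
 proof (intro mult_left_mono sum_mono)
 fix j assume j: "j : J"
 have "(NI x. en (b j x powr p)) <= en (?V powr p) * (NI x. en (h j x powr p))"
 unfolding b_def by (rule nn_integral_bavg_powr[OF p Lh[OF j]])
 also have "... <= en (?V powr p) * ?X" by (intro mult_left_mono hp j) simp
 finally show "(NI x. en (b j x powr p)) <= en (?V powr p) * ?X" .
 qed simp
 also have "... < \<infinity>" using False by (simp add: ennreal_mult_less_top less_top of_nat_less_top)
 finally show ?thesis .
 qed
 have "?A = (NI x. (SUM j:J. en (g j x * b j x)))"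
 proof (rule nn_integral_cong)
 fix x
 have "(SUM j:J. g j x * b j x) = (SUM j:J. W x powr ((p - q) / q) * b j x powr q)"
 proof (rule sum.cong[OF refl])
 fix j assume j: "j : J"
 have "b j x powr (q - 1) * b j x = b j x powr q"
 using LB_nonneg[OF Lb[OF j], of x] powr_add[of "b j x" "q - 1" 1] q by (cases "b j x = 0") (auto simp: powr_one)
 thus "g j x * b j x = W x powr ((p - q) / q) * b j x powr q" by (simp add: g_def mult.assoc)
 qed
 also have "... = W x powr ((p - q) / q) * W x" by (simp add: W_def sum_distrib_left)
 also have "... = W x powr (p / q)"
 using W0[of x] powr_add[of "W x" "(p - q) / q" 1] q by (cases "W x = 0") (auto simp: powr_one diff_divide_distrib)
 finally show "en (W x powr (p / q)) = (SUM j:J. en (g j x * b j x))"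
 using LB_nonneg[OF Lb] LB_nonneg[OF Lg] by (subst sum_ennreal) auto
 qed
 also have "... = (SUM j:J. (NI x. en (g j x * b j x)))"
 using LB_measurable[OF Lb] LB_measurable[OF Lg] by (intro nn_integral_sum) auto
 also have "... = (SUM j:J. (NI x. en (bavg j (g j) x * h j x)))"
 unfolding b_def using Lg Lh by (intro sum.cong refl bavg_swap) auto
 also have "... = (NI x. (SUM j:J. en (bavg j (g j) x * h j x)))"
 using LB_measurable[OF Lh] LB_measurable[OF LB_bavg[OF Lg]] by (intro nn_integral_sum[symmetric]) auto
 also have "... <= (NI x. en e * en (?B J g x q' p') + en D * en (?E J h x))"
 proof (rule nn_integral_mono)
 fix x
 let ?Y = "SUM j:J. bavg j (g j) x powr q'" and ?Z = "SUM j:J. h j x powr q"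
 have "(SUM j:J. h j x * bavg j (g j) x) <= ?Z powr (1 / q) * ?Y powr (1 / q')"
 using q q'1 conj J(1) by (intro holder_finite) (auto intro: LB_nonneg[OF Lh] bavg_nonneg[OF Lg])
 also have "... <= e * (?Y powr (1 / q')) powr p' + e powr (1 - p) * (?Z powr (1 / q)) powr p"
 by (rule young_absorb'[OF p p'_def e]) auto
 also have "... = e * ?Y powr (p' / q') + D * ?Z powr (p / q)" by (simp add: powr_powr D_def)
 finally have "(SUM j:J. bavg j (g j) x * h j x) <= e * ?Y powr (p' / q') + D * ?Z powr (p / q)" by (simp add: mult.commute)
 hence "en (SUM j:J. bavg j (g j) x * h j x) <= en (e * ?Y powr (p' / q') + D * ?Z powr (p / q))" by (rule ennreal_leI)
 also have "... = en e * en (?Y powr (p' / q')) + en D * en (?Z powr (p / q))"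
 using e D by (subst ennreal_plus) (auto simp: ennreal_mult')
 finally show "(SUM j:J. en (bavg j (g j) x * h j x)) <= en e * en (?Y powr (p' / q')) + en D * en (?Z powr (p / q))"
 using LB_nonneg[OF Lh] bavg_nonneg[OF Lg] by (subst sum_ennreal) auto
 qed
 also have "... = en e * (NI x. en (?B J g x q' p')) + en D * ?X"
 proof -
 have "(%x. en (?B J g x q' p')) : bm lborel"
 using LB_measurable[OF LB_bavg[OF Lg]] by (auto intro!: borel_measurable_sum)
 moreover have "(%x. en (?E J h x)) : bm lborel"
 using LB_measurable[OF Lh] by (auto intro!: borel_measurable_sum)
 ultimately show ?thesis by (subst nn_integral_add) (auto simp: nn_integral_cmult)
 qed
 also have "(NI x. en (?B J g x q' p')) <= en C * (NI x. en ((?D J g x q') powr (p' / q')))"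
 using C(2) J(1) Lg unfolding fs_bound_def by blast
 also have "(NI x. en ((?D J g x q') powr (p' / q'))) = ?A"
 proof (rule nn_integral_cong)
 fix x
 have "?D J g x q' = (SUM j:J. W x powr ((p - q) / q * q') * b j x powr q)"
 proof (rule sum.cong[OF refl])
 fix j assume j: "j : J"
 have "(q - 1) * q' = q" using q by (simp add: q'_def)
 thus "g j x powr q' = W x powr ((p - q) / q * q') * b j x powr q"
 by (simp add: g_def powr_mult powr_powr)
 qed
 also have "... = W x powr ((p - q) / q * q') * W x" by (simp add: W_def sum_distrib_left)
 finally have 1: "?D J g x q' = W x powr ((p - q) / q * q') * W x" .
 show "en ((?D J g x q') powr (p' / q')) = en (W x powr (p / q))"
 proof (cases "W x = 0")
 case False
 have "?D J g x q' = W x powr ((p - q) / q * q' + 1)"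
 unfolding 1 using W0[of x] False by (simp add: powr_add powr_one)
 hence "(?D J g x q') powr (p' / q') = W x powr (((p - q) / q * q' + 1) * (p' / q'))" by (simp add: powr_powr)
 also have "((p - q) / q * q' + 1) * (p' / q') = p / q"
 using p q by (simp add: p'_def q'_def divide_simps)
 finally show ?thesis by simp
 qed (simp add: 1)
 qed
 finally have "?A <= en e * (en C * ?A) + en D * ?X" by (simp add: add_mono mult_left_mono)
 also have "en e * (en C * ?A) = en (1/2) * ?A"
 proof -
 have "en e * en C = en (1/2)" using C(1) e by (subst ennreal_mult[symmetric]) (auto simp: e_def)
 thus ?thesis by (simp only: mult.assoc[symmetric])
 qed
 finally have le: "?A <= en (1/2) * ?A + en D * ?X" .
 obtain a where a: "?A = en a" "0 <= a" using Afin by (cases ?A) auto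
 obtain y where y: "?X = en y" "0 <= y" using False by (cases ?X) auto
 have "a <= 1/2 * a + D * y"
 proof -
 have "en (1/2 * a + D * y) = en (1/2) * en a + en D * en y"
 using a(2) y(2) D by (simp only: ennreal_plus ennreal_mult mult_nonneg_nonneg less_imp_le zero_le_divide_1_iff zero_le_numeral)
 hence "en a <= en (1/2 * a + D * y)" using le unfolding a(1) y(1) by (simp only:)
 thus ?thesis using a(2) y(2) D by (subst (asm) ennreal_le_iff) auto
 qed
 hence "a <= 2 * D * y" by simp
 hence "?A <= en (2 * D) * ?X" unfolding a(1) y(1) using D y(2) by (simp add: ennreal_mult'[symmetric] ennreal_leI)
 thus ?thesis by (simp add: W_def b_def)
 qed
 qed
 thus ?thesis using D by (intro exI[of _ "2 * D"]) simp
qed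

text \<open>The displacement \<open>c\<close> between scale and radius is removed by translating the
  index set, so the constant does not depend on it. Thanks to this uniformity the later sums over
  displacements converge by their geometric weights alone.\<close>

theorem fefferman_stein:
 assumes p: "1 < p" and q: "1 < q"
 shows "EX C>0. ALL J c (h :: int => 'a::euclidean_space => real). finite J & (ALL j:J. LB (h j)) -->
 (NI x. en ((SUM j:J. bavg (j + c) (h j) x powr q) powr (p / q)))
 <= en C * (NI x. en ((SUM j:J. h j x powr q) powr (p / q)))"
proof -
 obtain C where C: "0 < C" "fs_bound TYPE('a) p q C"
 using fs_bound_ge[OF q, of p, where 'a='a] fs_bound_less[OF p, of q, where 'a='a] by (cases "q <= p") auto
 have "(NI x. en ((SUM j:J. bavg (j + c) (h j) x powr q) powr (p / q)))
 <= en C * (NI x. en ((SUM j:J. h j x powr q) powr (p / q)))"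
 if J: "finite J" "ALL j:J. LB (h j)" for J c and h :: "int => 'a => real"
 proof -
 let ?J = "(%j. j + c) ` J"
 have inj: "inj_on (%j::int. j + c) J" by (auto simp: inj_on_def)
 have "(NI x. en ((SUM j:?J. bavg j (h (j - c)) x powr q) powr (p / q)))
 <= en C * (NI x. en ((SUM j:?J. h (j - c) x powr q) powr (p / q)))"
 using J by (intro C(2)[unfolded fs_bound_def, rule_format]) auto
 thus ?thesis by (simp add: sum.reindex[OF inj])
 qed
 thus ?thesis using C(1) by blast
qed

section \<open>Derivatives, seminorms and Lipschitz bounds of Schwartz functions\<close>

lemma pdiff_has_derivative: "(f has_derivative D) (at x) ==> pdiff i f x = D (axis i 1)"
 unfolding pdiff_def using frechet_derivative_at by metis

lemma pdiff_affine:
 fixes g :: "'n::finite fn"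
 assumes "g differentiable (at (t + c *R x))"
 shows "pdiff i (%x. a * g (t + c *R x)) x = a * (cr c * pdiff i g (t + c *R x))"
 and "(%x. a * g (t + c *R x)) differentiable (at x)"
proof -
 let ?D = "frechet_derivative g (at (t + c *R x))"
 have gd: "(g has_derivative ?D) (at (t + c *R x))" using assms by (simp add: frechet_derivative_works)
 have "((%x. t + c *R x) has_derivative (%v. c *R v)) (at x)" by (auto intro!: derivative_eq_intros)
 from diff_chain_at[OF this gd] have "((%x. g (t + c *R x)) has_derivative (%v. ?D (c *R v))) (at x)"
 by (simp add: o_def)
 hence d: "((%x. a * g (t + c *R x)) has_derivative (%v. a * ?D (c *R v))) (at x)"
 by (rule has_derivative_mult_right)
 have "linear ?D" using gd by (rule has_derivative_linear)
 hence "?D (c *R axis i 1) = c *R ?D (axis i 1)" by (rule linear_scale)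
 thus "pdiff i (%x. a * g (t + c *R x)) x = a * (cr c * pdiff i g (t + c *R x))"
 using pdiff_has_derivative[OF d, of i] by (simp add: pdiff_def scaleR_conv_of_real)
 show "(%x. a * g (t + c *R x)) differentiable (at x)" using d by (auto simp: differentiable_def)
qed

lemma pdiff_lin:
 fixes f g :: "'n::finite fn"
 assumes "f differentiable (at x)" "g differentiable (at x)"
 shows "pdiff i (%x. a * f x + b * g x) x = a * pdiff i f x + b * pdiff i g x"
 and "(%x. a * f x + b * g x) differentiable (at x)"
proof -
 have d: "((%x. a * f x + b * g x) has_derivative (%v. a * frechet_derivative f (at x) v + b * frechet_derivative g (at x) v)) (at x)"
 using assms by (intro has_derivative_add has_derivative_mult_right) (simp_all add: frechet_derivative_works)
 show "pdiff i (%x. a * f x + b * g x) x = a * pdiff i f x + b * pdiff i g x"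
 using pdiff_has_derivative[OF d, of i] by (simp add: pdiff_def)
 show "(%x. a * f x + b * g x) differentiable (at x)" using d by (auto simp: differentiable_def)
qed

lemma smooth_differentiable: "smooth_fn f ==> pdiffs is f differentiable (at x)"
 by (simp add: smooth_fn_def)

lemma pdiffs_affine:
 assumes f: "smooth_fn f"
 shows "pdiffs is (%x. a * f (t + c *R x)) = (%x. a * cr c ^ length is * pdiffs is f (t + c *R x))"
proof (induction "is")
 case (Cons i "is")
 show ?case
 unfolding pdiffs.simps Cons pdiff_affine(1)[OF smooth_differentiable[OF f]] by (rule ext) simp
qed simp

lemma smooth_affine:
 assumes f: "smooth_fn f" shows "smooth_fn (%x. a * f (t + c *R x))"
 unfolding smooth_fn_def pdiffs_affine[OF f] using pdiff_affine(2)[OF smooth_differentiable[OF f]] by blast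

lemma pdiffs_lin:
 assumes f: "smooth_fn f" and g: "smooth_fn g"
 shows "pdiffs is (%x. a * f x + b * g x) = (%x. a * pdiffs is f x + b * pdiffs is g x)"
proof (induction "is")
 case (Cons i "is")
 show ?case
 by (rule ext) (simp add: Cons pdiff_lin(1)[OF smooth_differentiable[OF f] smooth_differentiable[OF g]])
qed simp

lemma smooth_lin:
 assumes f: "smooth_fn f" and g: "smooth_fn g" shows "smooth_fn (%x. a * f x + b * g x)"
 unfolding smooth_fn_def pdiffs_lin[OF assms] using pdiff_lin(2)[OF smooth_differentiable[OF f] smooth_differentiable[OF g]] by blast

lemma pdiffs_append: "pdiffs (is @ js) f = pdiffs is (pdiffs js f)"
 by (induction "is") auto

lemma smooth_pdiffs: "smooth_fn f ==> smooth_fn (pdiffs is f)"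
 unfolding smooth_fn_def pdiffs_append[symmetric] by blast

lemma power_wt: "(1 + norm x) ^ m * wt (real m) x = 1"
proof -
 have "1 + norm x > 0" using norm_ge_zero[of x] by linarith
 thus ?thesis by (simp add: wt_def powr_realpow[symmetric] powr_add[symmetric])
qed

lemma wt_bound_iff: "(1 + norm x) ^ m * a <= B \<longleftrightarrow> a <= B * wt (real m) x" for a :: real
proof -
 have "(1 + norm x) ^ m * a <= B \<longleftrightarrow> ((1 + norm x) ^ m * a) * wt (real m) x <= B * wt (real m) x" by simp
 also have "((1 + norm x) ^ m * a) * wt (real m) x = a" using power_wt[of x m] by (simp add: mult_ac)
 finally show ?thesis .
qed

text \<open>Trades the test by powers of \<open>norm x\<close> for the weights \<open>wt\<close>, in
  which all later estimates are phrased.\<close>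

lemma schwartz_iff: "f : schwartz \<longleftrightarrow> smooth_fn f & (ALL is. rd (pdiffs is f))" for f :: "'n::finite fn"
proof
 assume f: "f : schwartz"
 hence sm: "smooth_fn f" and bd: "!!is m. bounded (range (%x. (norm x) ^ m * norm (pdiffs is f x)))"
 by (auto simp: schwartz_def)
 have "rd (pdiffs is f)" for "is"
 proof (rule rdI)
 fix M :: real assume "0 <= M"
 obtain m :: nat where m: "M <= real m" using real_arch_simple by blast
 obtain A where A: "!!x. norm ((norm x) ^ 0 * norm (pdiffs is f x)) <= A" using bd[of 0 "is"] unfolding bounded_iff by blast
 obtain B where B: "!!x. norm ((norm x) ^ m * norm (pdiffs is f x)) <= B" using bd[of m "is"] unfolding bounded_iff by blast
 have "dec (real m) (pdiffs is f)"
 proof (rule decI)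
 show "continuous_on UNIV (pdiffs is f)"
 using smooth_differentiable[OF sm] by (intro continuous_at_imp_continuous_on ballI differentiable_imp_continuous_within)
 fix x :: "real^'n"
 have "(1 + norm x) ^ m <= (2 * max 1 (norm x)) ^ m" by (intro power_mono) auto
 also have "... = 2 ^ m * max 1 (norm x) ^ m" by (simp add: power_mult_distrib)
 also have "... <= 2 ^ m * (1 + norm x ^ m)" by (intro mult_left_mono) (auto simp: max_def)
 finally have "(1 + norm x) ^ m * norm (pdiffs is f x) <= 2 ^ m * (1 + norm x ^ m) * norm (pdiffs is f x)"
 by (rule mult_right_mono) simp
 also have "... = 2 ^ m * (norm (pdiffs is f x) + norm x ^ m * norm (pdiffs is f x))" by (simp add: algebra_simps)
 also have "... <= 2 ^ m * (A + B)" using A[of x] B[of x] by (intro mult_left_mono add_mono) auto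
 finally show "norm (pdiffs is f x) <= (2 ^ m * (A + B)) * wt (real m) x" by (simp only: wt_bound_iff)
 qed
 thus "dec M (pdiffs is f)" using m by (rule dec_mono)
 qed
 thus "smooth_fn f & (ALL is. rd (pdiffs is f))" using sm by blast
next
 assume f: "smooth_fn f & (ALL is. rd (pdiffs is f))"
 have "bounded (range (%x. (norm x) ^ m * norm (pdiffs is f x)))" for m "is"
 proof -
 have "rd (pdiffs is f)" using f by blast
 then obtain C where C: "0 <= C" "!!x. norm (pdiffs is f x) <= C * wt (real m) x" using decE[OF rd_dec] by blast
 have "norm ((norm x) ^ m * norm (pdiffs is f x)) <= C" for x
 proof -
 have "(norm x) ^ m * norm (pdiffs is f x) <= (1 + norm x) ^ m * norm (pdiffs is f x)"
 by (intro mult_right_mono power_mono) auto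
 also have "... <= C" using C(2)[of x] by (simp only: wt_bound_iff)
 finally show ?thesis by simp
 qed
 thus ?thesis unfolding bounded_iff by blast
 qed
 thus "f : schwartz" using f by (simp add: schwartz_def)
qed

lemma schwartz_rd: "f : schwartz ==> rd f"
 using schwartz_iff[of f] pdiffs.simps(1) by metis

lemma schwartz_smooth: "f : schwartz ==> smooth_fn f"
 by (simp add: schwartz_def)

lemma schwartz_rd_pdiffs: "f : schwartz ==> rd (pdiffs is f)"
 by (simp add: schwartz_iff)

lemma schwartz_pdiffs: "f : schwartz ==> pdiffs is f : schwartz"
 by (auto simp: schwartz_iff smooth_pdiffs pdiffs_append[symmetric])

lemma schwartz_affine: "f : schwartz ==> c ~= 0 ==> (%x. a * f (t + c *R x)) : schwartz"
 unfolding schwartz_iff by (auto simp: smooth_affine pdiffs_affine intro!: rd_mult rd_affine)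

lemma schwartz_lin: "f : schwartz ==> g : schwartz ==> (%x. a * f x + b * g x) : schwartz"
 unfolding schwartz_iff by (auto simp: smooth_lin pdiffs_lin intro!: rd_mult rd_add)

lemma seminorm_S_bdd:
 assumes "f : schwartz" shows "bdd_above (range (%x. (1 + norm x) ^ m * norm (pdiffs is f x)))"
proof -
 obtain C where C: "0 <= C" "!!x. norm (pdiffs is f x) <= C * wt (real m) x"
 using decE[OF rd_dec[OF schwartz_rd_pdiffs[OF assms]]] by blast
 have "(1 + norm x) ^ m * norm (pdiffs is f x) <= C" for x using C(2)[of x] by (simp only: wt_bound_iff)
 thus ?thesis by (intro bdd_aboveI2)
qed

lemma seminorm_S_ge: "f : schwartz ==> norm (pdiffs is f x) <= seminorm_S m is f * wt (real m) x"
 unfolding wt_bound_iff[symmetric] seminorm_S_def by (intro cSUP_upper seminorm_S_bdd) auto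

lemma seminorm_S_nonneg: "f : schwartz ==> 0 <= seminorm_S m is f"
proof -
 assume f: "f : schwartz"
 have "0 <= seminorm_S m is f * wt (real m) (0 :: real^'a)" by (rule order.trans[OF norm_ge_zero seminorm_S_ge[OF f]])
 thus ?thesis by simp
qed

lemma seminorm_S_le: "(!!x. norm (pdiffs is f x) <= B * wt (real m) x) ==> seminorm_S m is f <= B"
 unfolding seminorm_S_def by (intro cSUP_least) (auto simp: wt_bound_iff)

text \<open>Derivatives of order at most one: the estimates that use cancellation subtract only the
  value at a point.\<close>

definition sobs :: "nat => 'n::finite fn => real" where
 "sobs m f = seminorm_S m [] f + (SUM i:UNIV. seminorm_S m [i] f)"

lemma sobs_nonneg: "f : schwartz ==> 0 <= sobs m f"
 unfolding sobs_def by (intro add_nonneg_nonneg sum_nonneg seminorm_S_nonneg)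

lemma norm_le_sobs: "f : schwartz ==> norm (f x) <= sobs m f * wt (real m) x"
proof -
 assume f: "f : schwartz"
 have "norm (f x) <= seminorm_S m [] f * wt (real m) x" using seminorm_S_ge[OF f, of "[]" x m] by simp
 also have "... <= sobs m f * wt (real m) x"
 unfolding sobs_def by (intro mult_right_mono add_increasing2 sum_nonneg seminorm_S_nonneg f) auto
 finally show ?thesis .
qed

lemma sobs_le_sum:
 fixes f :: "'n::finite fn"
 assumes f: "f : schwartz"
 shows "sobs m f <= (\<Sum>k\<le>Suc m. SUM is:{is::'n list. length is <= Suc m}. seminorm_S k is f)"
proof -
 have fin: "finite {is::'n list. length is <= Suc m}" using finite_lists_length_le[of "UNIV::'n set" "Suc m"] by simp
 have sub: "insert [] ((%i. [i]) ` UNIV) \<subseteq> {is::'n list. length is <= Suc m}" by auto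
 have "sobs m f = (SUM is:insert [] ((%i. [i]) ` UNIV). seminorm_S m is f)"
 by (subst sum.insert) (auto simp: sobs_def sum.reindex inj_on_def)
 also have "... <= (SUM is:{is::'n list. length is <= Suc m}. seminorm_S m is f)"
 by (rule sum_mono2[OF fin sub]) (rule seminorm_S_nonneg[OF f])
 also have "... <= (\<Sum>k\<le>Suc m. SUM is:{is::'n list. length is <= Suc m}. seminorm_S k is f)"
 by (rule member_le_sum[of m "{..Suc m}" "%k. SUM is:{is::'n list. length is <= Suc m}. seminorm_S k is f"])
 (auto intro!: sum_nonneg seminorm_S_nonneg f)
 finally show ?thesis .
qed

text \<open>The minimum with 1 makes the condition reduce to the size bound for distant points; the
  sum of both weights spares a case distinction on which point is nearer to the origin.\<close>

definition LD :: "real => real => 'n::finite fn => bool" where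
 "LD m B f \<longleftrightarrow> (ALL x. norm (f x) <= B * wt m x) &
 (ALL x y. norm (f x - f y) <= B * min 1 (norm (x - y)) * (wt m x + wt m y))"

lemma LD_norm: "LD m B f ==> norm (f x) <= B * wt m x" by (simp add: LD_def)
lemma LD_diff: "LD m B f ==> norm (f x - f y) <= B * min 1 (norm (x - y)) * (wt m x + wt m y)" by (simp add: LD_def)

lemma LD_nonneg: "LD m B f ==> 0 <= B" for f :: "'n::finite fn"
proof -
 assume f: "LD m B f"
 have "0 <= B * wt m (0::real^'n)" by (rule order.trans[OF norm_ge_zero LD_norm[OF f]])
 thus ?thesis by simp
qed

lemma wt_near: assumes "norm (x - y) <= 1" "0 <= m" shows "wt m y <= 2 powr m * wt m x"
proof -
 have "wt m (y - x + x) <= (1 + norm (y - x)) powr m * wt m x" by (rule wt_shift_le[OF assms(2)])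
 also have "... <= 2 powr m * wt m x" using assms by (intro mult_right_mono powr_mono2) (auto simp: norm_minus_commute)
 finally show ?thesis by simp
qed

lemma schwartz_LD:
 fixes f :: "'n::finite fn"
 assumes f: "f : schwartz"
 shows "LD (real m) (2 ^ m * sobs m f) f"
 unfolding LD_def
proof (intro conjI allI)
 have s0: "0 <= sobs m f" by (rule sobs_nonneg[OF f])
 have ge: "sobs m f <= 2 ^ m * sobs m f" using mult_right_mono[OF one_le_power[of 2 m] s0] by simp
 show 1: "norm (f x) <= 2 ^ m * sobs m f * wt (real m) x" for x
 by (rule order.trans[OF norm_le_sobs[OF f, of x m]]) (intro mult_right_mono ge, simp)
 fix x y :: "real^'n"
 show "norm (f x - f y) <= 2 ^ m * sobs m f * min 1 (norm (x - y)) * (wt (real m) x + wt (real m) y)"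
 proof (cases "norm (x - y) <= 1")
 case False
 have "norm (f x - f y) <= norm (f x) + norm (f y)" by (rule norm_triangle_ineq4)
 also have "... <= 2 ^ m * sobs m f * (wt (real m) x + wt (real m) y)" using 1[of x] 1[of y] by (simp add: algebra_simps)
 finally show ?thesis using False by simp
 next
 case True
 let ?S = "closed_segment x y"
 let ?B = "2 ^ m * sobs m f * wt (real m) x"
 have "norm (f x - f y) <= ?B * norm (x - y)"
 proof (rule differentiable_bound[OF convex_closed_segment])
 fix z assume z: "z : ?S"
 have d: "(f has_derivative frechet_derivative f (at z)) (at z)"
 using smooth_differentiable[OF schwartz_smooth[OF f], of "[]" z] by (simp add: frechet_derivative_works)
 thus "(f has_derivative frechet_derivative f (at z)) (at z within ?S)" by (rule has_derivative_at_withinI)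
 have "norm (x - z) <= norm (x - y)" using segment_bound(1)[OF z] by (simp add: norm_minus_commute)
 hence wz: "wt (real m) z <= 2 ^ m * wt (real m) x" using True wt_near[of x z "real m"] by (simp add: powr_realpow)
 show "onorm (frechet_derivative f (at z)) <= ?B"
 proof (rule onorm_le)
 fix v :: "real^'n"
 have lin: "linear (frechet_derivative f (at z))" using d by (rule has_derivative_linear)
 have "v = (SUM i:UNIV. (v $ i) *R axis i 1)" using basis_expansion[of v] by (simp add: scalar_mult_eq_scaleR)
 hence "frechet_derivative f (at z) v = frechet_derivative f (at z) (SUM i:UNIV. (v $ i) *R axis i 1)"
 by (rule arg_cong)
 also have "... = (SUM i:UNIV. (v $ i) *R pdiff i f z)"
 unfolding linear_sum[OF lin] linear_scale[OF lin] pdiff_def ..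
 finally have "norm (frechet_derivative f (at z) v) <= (SUM i:UNIV. \<bar>v $ i\<bar> * norm (pdiff i f z))"
 by (simp add: order.trans[OF norm_sum])
 also have "... <= (SUM i:UNIV. norm v * (seminorm_S m [i] f * wt (real m) z))"
 proof (intro sum_mono mult_mono component_le_norm_cart)
 fix i show "norm (pdiff i f z) <= seminorm_S m [i] f * wt (real m) z" using seminorm_S_ge[OF f, of "[i]" z m] by simp
 qed auto
 also have "... = norm v * ((SUM i:UNIV. seminorm_S m [i] f) * wt (real m) z)"
 by (simp add: sum_distrib_left sum_distrib_right)
 also have "... <= norm v * (sobs m f * (2 ^ m * wt (real m) x))"
 using wz s0 seminorm_S_nonneg[OF f] by (intro mult_left_mono mult_mono) (auto simp: sobs_def)
 finally show "norm (frechet_derivative f (at z) v) <= ?B * norm v" by (simp add: mult_ac)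
 qed
 qed auto
 also have "... <= 2 ^ m * sobs m f * (wt (real m) x + wt (real m) y) * norm (x - y)"
 using s0 by (intro mult_right_mono mult_left_mono) auto
 finally show ?thesis using True by (simp add: mult_ac)
 qed
qed

lemma pdiffs_zero_open:
 assumes S: "open S" and g: "!!x. x : S ==> g x = 0"
 shows "x : S ==> pdiffs is g x = 0"
proof (induction "is" arbitrary: x)
 case (Cons i "is")
 have "(pdiffs is g has_derivative (%_. 0)) (at x)"
 by (rule has_derivative_transform_within_open[OF has_derivative_const[of 0] S Cons.prems]) (simp add: Cons.IH)
 thus ?case using pdiff_has_derivative[of "pdiffs is g" "%_. 0" x i] by simp
qed (use g in simp)

text \<open>For a spectrum away from the origin membership in \<open>schwartz0\<close> is checked
  without any smoothness of the Fourier transform, since near the origin it is the zero function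
  that is differentiated.\<close>

lemma schwartz0_if_vanish_near_0:
 assumes f: "f : schwartz" and r: "0 < r" and v: "!!xi. norm xi < r ==> ft f xi = 0"
 shows "f : schwartz0"
proof -
 have "pdiffs is (fourier f) 0 = 0" for "is"
 by (rule pdiffs_zero_open[of "ball 0 r"]) (use r v in \<open>auto simp: fourier_ft\<close>)
 thus ?thesis using f by (simp add: schwartz0_def)
qed

lemma schwartz0_schwartz: "f : schwartz0 ==> f : schwartz"
 by (simp add: schwartz0_def)

lemma schwartz0_integral: "f : schwartz0 ==> (LI x. f x) = 0"
proof -
 assume f: "f : schwartz0"
 hence "pdiffs [] (fourier f) 0 = 0" by (auto simp: schwartz0_def simp del: pdiffs.simps)
 hence "ft f 0 = 0" by (simp add: fourier_eq_0_iff)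
 thus ?thesis by (simp add: ft_def)
qed

lemma has_vector_derivative_quotient:
 assumes "(F has_vector_derivative D) (at (0::real))"
 shows "((%t. (1 / t) *R (F t - F 0)) \<longlongrightarrow> D) (at 0)"
proof -
 have "((%h. norm (F (0 + h) - F 0 - h *R D) / norm h) \<longlongrightarrow> 0) (at 0)"
 using assms unfolding has_vector_derivative_def has_derivative_at by blast
 hence "((%t. norm ((1 / t) *R (F t - F 0) - D)) \<longlongrightarrow> 0) (at 0)"
 proof (rule Lim_transform_eventually)
 have "norm (F (0 + t) - F 0 - t *R D) / norm t = norm ((1 / t) *R (F t - F 0) - D)" if "t ~= 0" for t
 proof -
 have "(1 / t) *R (F t - F 0) - D = (1 / t) *R (F t - F 0 - t *R D)" using that by (simp add: algebra_simps)
 thus ?thesis by simp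
 qed
 thus "\<forall>\<^sub>F t in at 0. norm (F (0 + t) - F 0 - t *R D) / norm t = norm ((1 / t) *R (F t - F 0) - D)"
 by (auto simp: eventually_at_filter)
 qed
 hence "((%t. (1 / t) *R (F t - F 0) - D) \<longlongrightarrow> 0) (at 0)" by (rule tendsto_norm_zero_cancel)
 thus ?thesis by (rule LIM_zero_cancel)
qed

text \<open>Passage to the limit in difference quotients replaces integration by parts: the
  transform of a translate is known exactly, and \<open>LD\<close> provides an integrable majorant
  independent of the step.\<close>

lemma ft_pdiff:
 fixes f :: "'n::finite fn"
 assumes f: "f : schwartz"
 shows "ft (pdiff i f) xi = \<i> * cr (xi $ i) * ft f xi"
proof -
 define h where "h k = inverse (real (Suc k))" for k
 have h0: "0 < h k" "h k <= 1" for k by (auto simp: h_def inverse_le_1_iff)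
 have hlim: "h \<longlonglongrightarrow> 0" unfolding h_def by (rule LIMSEQ_inverse_real_of_nat)
 have hat: "filterlim h (at 0) sequentially" using hlim h0 by (auto simp: filterlim_at less_imp_neq[symmetric])
 define e :: "real^'n" where "e = axis i 1"
 have e1: "norm e = 1" by (simp add: e_def)
 define M where "M = CARD('n) + 1"
 let ?m = "real M"
 define B where "B = 2 ^ M * sobs M f"
 have LDf: "LD ?m B f" unfolding B_def by (rule schwartz_LD[OF f])
 have B0: "0 <= B" by (rule LD_nonneg[OF LDf])
 define q where "q k x = (1 / h k) *R (f (h k *R e + x) - f x)" for k x
 have rdf: "rd f" by (rule schwartz_rd[OF f])
 have lhs: "(%k. ft (q k) xi) \<longlonglongrightarrow> ft (pdiff i f) xi"
 unfolding ft_def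
 proof (rule integral_dominated_convergence[where w="%x. B * (2 powr ?m + 1) * wt ?m x"])
 have "continuous_on UNIV (q k)" for k unfolding q_def[abs_def]
 by (intro continuous_intros continuous_on_compose2[OF rd_continuous[OF rdf]]) auto
 hence [measurable]: "q k : BM" for k by (rule borel_measurable_continuous_onI)
 show "(%x. q k x * ech xi x) : bm lborel" for k by measurable
 have [measurable]: "pdiff i f : BM" using rd_measurable[OF schwartz_rd_pdiffs[OF f, of "[i]"]] by simp
 show "(%x. pdiff i f x * ech xi x) : bm lborel" by measurable
 show "intl (%x::real^'n. B * (2 powr ?m + 1) * wt ?m x)"
 by (intro integrable_mult_right integrable_wt) (simp add: M_def)
 show "AE x in lborel. (%k. q k x * ech xi x) \<longlonglongrightarrow> pdiff i f x * ech xi x"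
 proof (rule AE_I2, rule tendsto_mult[OF _ tendsto_const])
 fix x
 have d: "(f has_derivative frechet_derivative f (at x)) (at x)"
 using smooth_differentiable[OF schwartz_smooth[OF f], of "[]" x] by (simp add: frechet_derivative_works)
 have g: "((%t::real. x + t *R e) has_derivative (%t. t *R e)) (at 0)" by (auto intro!: derivative_eq_intros)
 have d': "(f has_derivative frechet_derivative f (at x)) (at (x + 0 *R e))" using d by simp
 have "((%t. f (x + t *R e)) has_derivative (%t. frechet_derivative f (at x) (t *R e))) (at 0)"
 using diff_chain_at[OF g d'] by (simp add: o_def)
 hence "((%t. f (x + t *R e)) has_vector_derivative pdiff i f x) (at 0)"
 unfolding has_vector_derivative_def pdiff_def e_def
 using linear_scale[OF has_derivative_linear[OF d]] by simp
 from filterlim_compose[OF has_vector_derivative_quotient[OF this] hat] show "(%k. q k x) \<longlonglongrightarrow> pdiff i f x" by (simp add: q_def add.commute)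
 qed
 show "AE x in lborel. norm (q k x * ech xi x) <= B * (2 powr ?m + 1) * wt ?m x" for k
 proof (rule AE_I2)
 fix x :: "real^'n"
 have nh: "norm (h k *R e) = h k" using h0[of k] by (simp add: e1)
 have "norm (f (h k *R e + x) - f x) <= B * min 1 (norm (h k *R e + x - x)) * (wt ?m (h k *R e + x) + wt ?m x)"
 by (rule LD_diff[OF LDf])
 also have "... <= B * h k * (2 powr ?m * wt ?m x + wt ?m x)"
 using h0[of k] B0 nh wt_near[of x "h k *R e + x" ?m] by (intro mult_mono add_mono) auto
 finally have "norm (f (h k *R e + x) - f x) <= h k * (B * (2 powr ?m + 1) * wt ?m x)" by (simp add: algebra_simps)
 moreover have "norm (q k x * ech xi x) = norm (f (h k *R e + x) - f x) / h k"
 using h0[of k] by (simp add: q_def norm_mult)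
 ultimately show "norm (q k x * ech xi x) <= B * (2 powr ?m + 1) * wt ?m x"
 using h0[of k] by (simp add: pos_divide_le_eq mult.commute)
 qed
 qed
 have eq: "ft (q k) xi = (1 / h k) *R (ech xi (- h k *R e) - 1) * ft f xi" for k
 proof -
 have "ft (q k) xi = (LI x. (1 / h k) *R (f (h k *R e + x) * ech xi x - f x * ech xi x))"
 by (simp add: ft_def q_def algebra_simps)
 also have "... = (1 / h k) *R ((LI x. f (h k *R e + x) * ech xi x) - (LI x. f x * ech xi x))"
 using rd_integrable[OF rd_mult_ech[OF rd_shift[OF rdf]]] rd_integrable[OF rd_mult_ech[OF rdf]] by simp
 also have "... = (1 / h k) *R (ech xi (- h k *R e) * ft f xi - ft f xi)"
 using ft_shift[of f "h k *R e" xi] by (simp add: ft_def)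
 finally show ?thesis by (simp add: algebra_simps)
 qed
 have "((%t. ech xi (- t *R e)) has_vector_derivative \<i> * cr (xi $ i)) (at 0)"
 proof -
 have "ech xi (- t *R e) = exp (t *R (\<i> * cr (xi $ i)))" for t
 proof -
 have "(- t *R e) \<bullet> xi = - (t * xi $ i)" by (simp add: e_def inner_axis')
 thus ?thesis by (simp only: ech_def) (simp add: scaleR_conv_of_real mult_ac)
 qed
 moreover have "((%t. exp (t *R (\<i> * cr (xi $ i)))) has_vector_derivative \<i> * cr (xi $ i)) (at 0)"
 by (rule has_vector_derivative_eq_rhs[OF exp_scaleR_has_vector_derivative_right]) simp
 ultimately show ?thesis by simp
 qed
 from filterlim_compose[OF has_vector_derivative_quotient[OF this] hat] have "(%k. (1 / h k) *R (ech xi (- h k *R e) - 1)) \<longlonglongrightarrow> \<i> * cr (xi $ i)" by simp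
 hence "(%k. ft (q k) xi) \<longlonglongrightarrow> \<i> * cr (xi $ i) * ft f xi" unfolding eq by (intro tendsto_mult tendsto_const)
 thus ?thesis using lhs LIMSEQ_unique by blast
qed

text \<open>What matters later is that the factor is the same for all \<open>f\<close>:
  differentiation does not enlarge the support of a transform, and both sides of the reproducing
  formula acquire the same factor.\<close>

lemma ft_pdiffs_factor:
 "EX c. ALL f : schwartz. ft (pdiffs is f) xi = c * ft f xi" for xi :: "real^'n::finite"
proof (induction "is")
 case Nil show ?case by (intro exI[of _ 1]) simp
next
 case (Cons i "is")
 then obtain c where "ALL f : schwartz. ft (pdiffs is f) xi = c * ft f xi" by blast
 thus ?case by (intro exI[of _ "\<i> * cr (xi $ i) * c"]) (simp add: ft_pdiff[OF schwartz_pdiffs] mult.assoc)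
qed

section \<open>Cancellation against a smooth function\<close>

lemma integral_wt_affine:
 fixes a :: "real^'n::finite"
 assumes l: "0 < l" and m: "real CARD('n) < m"
 shows "intl (%y. wt m ((1 / l) *R (y - a)))"
 and "(LI y. wt m ((1 / l) *R (y - a))) = l ^ CARD('n) * (LI y. wt m (y::real^'n))"
proof -
 have eq: "(%y. wt m ((1 / l) *R (y - a))) = (%y. wt m (- (1 / l) *R a + (1 / l) *R y))"
 by (rule ext) (simp add: algebra_simps)
 have i: "intl (wt m :: real^'n => real)" using m by (intro integrable_wt) simp
 show "intl (%y. wt m ((1 / l) *R (y - a)))"
 unfolding eq using l by (intro integrable_affine[OF i]) simp
 show "(LI y. wt m ((1 / l) *R (y - a))) = l ^ CARD('n) * (LI y. wt m (y::real^'n))"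
 unfolding eq using l by (subst integral_affine) (auto simp: power_one_over divide_simps)
qed

lemma wt_integral_nonneg: "0 <= (LI y. wt m y)"
 by (intro integral_nonneg_AE) simp

lemma min_powr_le: "0 < (ga::real) ==> ga <= 1 ==> 0 <= t ==> min 1 t <= min 1 t powr ga"
 using powr_mono'[of ga 1 "min 1 t"] by (cases "t = 0") (auto simp: powr_one)

text \<open>Here \<open>l\<close> is the width of the concentrated function and \<open>ga\<close>
  the order of cancellation. Near \<open>a\<close> the weights at \<open>y\<close> and
  \<open>a\<close> are comparable, and \<open>min 1 t \<le> t powr ga\<close> gives the power of
  \<open>l\<close>. At distance more than 1 the concentrated weight pays for moving the weight from
  \<open>y\<close> to \<open>a\<close> and still leaves a power of \<open>l\<close>, while the
  surplus decay of order \<open>m'\<close> provides integrability.\<close>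

lemma cancellation_pointwise:
 fixes a y :: "real^'n::finite"
 assumes g: "0 < ga" "ga <= 1" and m: "real CARD('n) + ga < m" and m': "m + (real CARD('n) + 1) <= m'" and l: "0 < l" "l <= 1"
 shows "min 1 (norm (y - a)) * (wt m' y + wt m' a) * wt m ((1 / l) *R (y - a))
 <= wt m a * ((1 + p2 m) * (l powr ga * wt (m - ga) ((1 / l) *R (y - a))) + 2 powr m * l powr (real CARD('n) + ga) * wt (real CARD('n) + 1) y)"
proof -
 let ?n = "real CARD('n)"
 let ?A = "%v. 2 powr m * v + 2 powr m * l powr (?n + ga) * wt (?n + 1) y"
 let ?B = "(1 / l) *R (y - a)"
 let ?C = "2 powr m * l powr (?n + ga)"
 have m0: "0 < m" using m g by (meson add_nonneg_pos le_less_trans less_imp_le of_nat_0_le_iff order.strict_trans)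
 define ta where "ta = norm (y - a)"
 have t0: "0 <= ta" by (simp add: ta_def)
 define w where "w = wt m ?B"
 define v where "v = l powr ga * wt (m - ga) ?B"
 have w0: "0 <= w" and v0: "0 <= v" by (simp_all add: w_def v_def)
 have tw: "min 1 ta * w <= v"
 proof -
 have "min 1 ta <= min 1 ta powr ga" by (rule min_powr_le[OF g t0])
 also have "... <= ta powr ga" using g t0 by (intro powr_mono2) auto
 also have "ta = l * norm ?B" using l by (simp add: ta_def)
 also have "(l * norm ?B) powr ga = l powr ga * norm ?B powr ga" using l by (subst powr_mult) auto
 finally have "min 1 (l * norm ?B) * w <= l powr ga * norm ?B powr ga * w"
 using w0 by (rule mult_right_mono)
 also have "... = l powr ga * (norm ?B powr ga * w)" by simp
 also have "... <= v" unfolding v_def w_def using g by (intro mult_left_mono norm_pow_wt) auto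
 also have "l * norm ?B = ta" using l by (simp add: ta_def)
 finally show ?thesis .
 qed
 have t2: "min 1 ta * wt m' a * w <= wt m a * v"
 proof -
 have "wt m' a <= wt m a" using m' by (intro wt_mono) (simp add: add_increasing2)
 hence "wt m' a * (min 1 ta * w) <= wt m a * v" using tw w0 t0 by (intro mult_mono) auto
 thus ?thesis by (simp add: mult_ac)
 qed
 have t1: "min 1 ta * wt m' y * w <= wt m a * ?A v"
 proof -
 have y1: "wt m' y <= wt m y * wt (?n + 1) y" unfolding wt_mult using m' by (rule wt_mono)
 have y2: "wt m y <= (1 + ta) powr m * wt m a" using wt_shift_le[of m "y - a" a] m0 by (simp add: ta_def)
 show ?thesis
 proof (cases "ta <= 1")
 case True
 have "(1 + ta) powr m <= p2 m" using True t0 m0 by (intro powr_mono2) auto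
 hence "wt m y <= 2 powr m * wt m a" by (intro order.trans[OF y2] mult_right_mono) auto
 moreover have "wt m' y <= wt m y * 1" by (intro order.trans[OF y1] mult_left_mono wt_le_1) auto
 ultimately have "wt m' y <= 2 powr m * wt m a" by simp
 hence "wt m' y * (min 1 ta * w) <= (2 powr m * wt m a) * v" using tw w0 t0 by (intro mult_mono) auto
 hence "min 1 ta * wt m' y * w <= wt m a * (2 powr m * v)" by (simp add: mult_ac)
 also have "... <= wt m a * ?A v"
 by (intro mult_left_mono) auto
 finally show ?thesis .
 next
 case False
 have wl: "w = (1 + ta / l) powr (- m)" using l by (simp add: w_def wt_def ta_def)
 have "(1 + ta) powr m * w <= (2 * l) powr m"
 proof -
 have "1 + ta <= 2 * ta" using False by simp
 also have "... <= 2 * l * (1 + ta / l)" using l by (simp add: field_simps)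
 finally have "(1 + ta) powr m <= (2 * l * (1 + ta / l)) powr m" using t0 m0 by (intro powr_mono2) auto
 also have "... = (2 * l) powr m * (1 + ta / l) powr m" using l t0 by (subst powr_mult) auto
 finally have "(1 + ta) powr m * w <= (2 * l) powr m * (1 + ta / l) powr m * w" using w0 by (rule mult_right_mono)
 also have "... = (2 * l) powr m * ((1 + ta / l) powr m * (1 + ta / l) powr (- m))" by (simp add: wl)
 also have "(1 + ta / l) powr m * (1 + ta / l) powr (- m) = 1"
 proof -
 have "0 < 1 + ta / l" using l t0 by (intro add_pos_nonneg) auto
 thus ?thesis by (subst powr_add[symmetric]) simp
 qed
 finally show ?thesis by simp
 qed
 also have "... = 2 powr m * l powr m" using l by (simp add: powr_mult)
 also have "... <= ?C" using l m by (intro mult_left_mono powr_mono') auto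
 finally have k: "(1 + ta) powr m * w <= ?C" .
 have "min 1 ta * wt m' y * w = wt m' y * w" using False by simp
 also have "... <= ((1 + ta) powr m * wt m a * wt (?n + 1) y) * w"
 by (intro mult_right_mono order.trans[OF y1] y2 w0) auto
 also have "... = wt m a * wt (?n + 1) y * ((1 + ta) powr m * w)" by (simp add: mult_ac)
 also have "... <= wt m a * wt (?n + 1) y * (2 powr m * l powr (?n + ga))" by (intro mult_left_mono k) auto
 also have "... = wt m a * (2 powr m * l powr (?n + ga) * wt (?n + 1) y)" by (simp add: mult_ac)
 also have "... <= wt m a * ?A v"
 using v0 by (intro mult_left_mono) auto
 finally show ?thesis .
 qed
 qed
 have "min 1 ta * (wt m' y + wt m' a) * w = min 1 ta * wt m' y * w + min 1 ta * wt m' a * w" by (simp add: algebra_simps)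
 also have "... <= wt m a * ?A v + wt m a * v"
 by (rule add_mono[OF t1 t2])
 also have "... = wt m a * ((1 + p2 m) * v + 2 powr m * l powr (?n + ga) * wt (?n + 1) y)" by (simp add: algebra_simps)
 finally show ?thesis by (simp only: w_def v_def ta_def)
qed

text \<open>Subtract the constant \<open>f a\<close>, which costs nothing as \<open>g\<close> has
  mean zero. Integration gives the power n of \<open>l\<close> from the width of \<open>g\<close>
  and the power \<open>ga\<close> from the Lipschitz bound; the condition that \<open>m\<close>
  exceeds n + \<open>ga\<close> says that the majorant of \<open>g\<close> has a finite moment of
  order \<open>ga\<close>.\<close>

lemma cancellation:
 assumes g: "0 < ga" "ga <= 1" and m: "real CARD('n::finite) + ga < m" and m': "m + (real CARD('n) + 1) <= m'"
 shows "EX C>=0. ALL (g::'n fn) f A B l a. g : BM & f : BM & 0 <= A &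
 (ALL y. norm (g y) <= A * wt m ((1 / l) *R (y - a))) & (LI y. g y) = 0 & LD m' B f & 0 < l & l <= 1 -->
 norm (LI y. f y * g y) <= C * A * B * l powr (real CARD('n) + ga) * wt m a"
proof -
 let ?n = "real CARD('n)"
 define I1 where "I1 = (LI y. wt (m - ga) (y::real^'n))"
 define I2 where "I2 = (LI y. wt (?n + 1) (y::real^'n))"
 define C where "C = (1 + p2 m) * I1 + 2 powr m * I2"
 have I: "0 <= I1" "0 <= I2" by (simp_all add: I1_def I2_def wt_integral_nonneg)
 have C0: "0 <= C" unfolding C_def using I by (intro add_nonneg_nonneg mult_nonneg_nonneg) auto
 have m1: "?n < m - ga" "?n < m" using m g by simp_all
 have "norm (LI y. f y * g y) <= C * A * B * l powr (?n + ga) * wt m a"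
 if [measurable]: "g : BM" "f : BM" and A: "0 <= A" and
 gA: "ALL y. norm (g y) <= A * wt m ((1 / l) *R (y - a))" and g0: "(LI y. g y) = 0" and LDf: "LD m' B f" and l: "0 < l" "l <= 1"
 for g f :: "'n fn" and A B l a
 proof -
 have B: "0 <= B" by (rule LD_nonneg[OF LDf])
 have m'0: "0 <= m'" using m1 m' by (smt (verit) of_nat_0_le_iff)
 have gi: "intl g"
 by (rule integrable_dominated[OF integrable_mult_right[OF integral_wt_affine(1)[OF l(1) m1(2)], of A]]) (use gA in auto)
 have fb: "norm (f y) <= B" for y
 using LD_norm[OF LDf, of y] mult_left_mono[OF wt_le_1[OF m'0, of y] B] by simp
 have fgi: "intl (%y. f y * g y)"
 by (rule integrable_dominated[OF integrable_mult_right[OF integrable_norm[OF gi], of B]])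
 (use fb in \<open>auto simp: norm_mult intro!: mult_right_mono\<close>)
 define D where "D y = A * B * (wt m a * ((1 + p2 m) * (l powr ga * wt (m - ga) ((1 / l) *R (y - a))) + 2 powr m * l powr (?n + ga) * wt (?n + 1) y))" for y
 have i1: "intl (%y. wt (m - ga) ((1 / l) *R (y - a)))" by (rule integral_wt_affine(1)[OF l(1) m1(1)])
 have i2: "intl (%y::real^'n. wt (?n + 1) y)" by (rule integrable_wt) simp
 have Di: "intl D" unfolding D_def[abs_def]
 by (intro integrable_mult_right Bochner_Integration.integrable_add i1 i2)
 have le: "norm ((f y - f a) * g y) <= D y" for y
 proof -
 have "norm ((f y - f a) * g y) <= (B * min 1 (norm (y - a)) * (wt m' y + wt m' a)) * (A * wt m ((1 / l) *R (y - a)))"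
 unfolding norm_mult using LD_diff[OF LDf, of y a] gA B by (intro mult_mono mult_nonneg_nonneg) (auto intro: add_nonneg_nonneg)
 also have "... = A * B * (min 1 (norm (y - a)) * (wt m' y + wt m' a) * wt m ((1 / l) *R (y - a)))" by (simp only: mult_ac)
 also have "... <= D y" unfolding D_def using A B by (intro mult_left_mono cancellation_pointwise g m m' l) auto
 finally show ?thesis .
 qed
 have "(LI y. f y * g y) = (LI y. f y * g y) - f a * (LI y. g y)" using g0 by simp
 also have "... = (LI y. f y * g y - f a * g y)" using fgi gi by simp
 also have "... = (LI y. (f y - f a) * g y)" by (simp add: algebra_simps)
 finally have "norm (LI y. f y * g y) = norm (LI y. (f y - f a) * g y)" by simp
 also have "... <= (LI y. D y)" by (rule norm_integral_le[OF Di _ le]) measurable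
 also have "... = A * B * (wt m a * ((1 + p2 m) * (l powr ga * (l ^ CARD('n) * I1)) + 2 powr m * l powr (?n + ga) * I2))"
 unfolding D_def using i1 i2 by (simp add: integral_wt_affine(2)[OF l(1) m1(1)] I1_def I2_def)
 also have "l powr ga * (l ^ CARD('n) * I1) = l powr (?n + ga) * I1" using l by (simp add: powr_add powr_realpow)
 finally show ?thesis by (simp add: C_def algebra_simps)
 qed
 thus ?thesis using C0 by (intro exI[of _ C]) blast
qed

section \<open>Kernels with second order differences\<close>

text \<open>One half of \<open>SKm1\<close>: differences in the first variable alone. Both
  \<open>K\<close> and its transpose satisfy it, so every kernel estimate is proved once.\<close>

definition KB :: "real => real => (real^'n::finite => real^'n => complex) => bool" where
 "KB de C K = (continuous_on {(x, y). x ~= y} (%(x, y). K x y) & 0 <= C &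
 (ALL x y. x ~= y --> norm (K x y) <= C * norm (x - y) powr (1 - real CARD('n))) &
 (ALL x y h. x ~= y & 0 < norm h & norm h <= norm (x - y) / 2 -->
 norm (K (x + h) y + K (x - h) y - 2 * K x y)
 <= C * norm h powr (1 + de) * norm (x - y) powr (- real CARD('n) - de)))"

lemma KB_size: "KB de C K ==> x ~= y ==> norm (K x y) <= C * norm (x - y) powr (1 - real CARD('n))"
 for K :: "real^'n::finite => real^'n => complex"
 by (simp add: KB_def)

lemma KB_diff: "KB de C K ==> x ~= y ==> 0 < norm h ==> norm h <= norm (x - y) / 2 ==>
 norm (K (x + h) y + K (x - h) y - 2 * K x y) <= C * norm h powr (1 + de) * norm (x - y) powr (- real CARD('n) - de)"
 for K :: "real^'n::finite => real^'n => complex"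
 by (simp add: KB_def)

lemma KB_nonneg: "KB de C K ==> 0 <= C" by (simp add: KB_def)

lemma continuous_on_swap_kernel:
 fixes K :: "real^'n::finite => real^'n => complex"
 assumes "continuous_on {(x, y). x ~= y} (%(x, y). K x y)"
 shows "continuous_on {(x, y). x ~= y} (%(x, y). K y x)"
proof -
 have "continuous_on {(x, y). x ~= y} ((%(x, y). K x y) \<circ> prod.swap)"
 proof (rule continuous_on_compose)
 show "continuous_on {(x, y). x ~= y} (prod.swap :: (real^'n) \<times> (real^'n) => _)" by (rule continuous_on_swap)
 show "continuous_on (prod.swap ` {(x, y). x ~= y}) (%(x, y). K x y)"
 by (rule continuous_on_subset[OF assms]) auto
 qed
 thus ?thesis by (simp add: o_def case_prod_beta')
qed

lemma SKm1_KB: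
 assumes "SKm1 de T K"
 shows "EX C. KB de C K & KB de C (%x y. K y x)"
proof -
 let ?A = "- real CARD('a) - de"
 let ?B = "%C h x y. C * norm h powr (1 + de) * norm (x - y) powr ?A"
 let ?C = "%C x y. C * norm (x - y) powr (1 - real CARD('a))"
 obtain C0 where cont: "continuous_on {(x, y). x ~= y} (%(x, y). K x y)" and
 C0: "ALL x y h. x ~= y & 0 < norm h & norm h <= norm (x - y) / 2 -->
 norm (K x y) <= C0 * norm (x - y) powr (1 - real CARD('a)) &
 norm (K (x + h) y + K (x - h) y - 2 * K x y)
 <= C0 * norm h powr (1 + de) * norm (x - y) powr ?A &
 norm (K x (y + h) + K x (y - h) - 2 * K x y)
 <= C0 * norm h powr (1 + de) * norm (x - y) powr ?A"
 using assms unfolding SKm1_def by blast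
 define C where "C = max 0 C0"
 have CC: "C0 * a <= C * a" if "0 <= a" for a :: real using that by (intro mult_right_mono) (simp_all add: C_def)
 have CC2: "C0 * a * b <= C * a * b" if "0 <= a" "0 <= b" for a b :: real using that by (intro mult_right_mono CC) simp_all
 have size: "norm (K x y) <= ?C C x y" if "x ~= y" for x y
 proof -
 \<comment> \<open>In \<open>SKm1\<close> the size bound shares its hypotheses with the difference
   bounds and needs some admissible \<open>h\<close>; half of \<open>x - y\<close> is one.\<close>
 have "norm (K x y) <= C0 * norm (x - y) powr (1 - real CARD('a))"
 using C0[rule_format, of x y "(1/2) *R (x - y)"] that by simp
 also have "... <= ?C C x y" by (rule CC) simp
 finally show ?thesis .
 qed
 have d1: "norm (K (x + h) y + K (x - h) y - 2 * K x y) <= ?B C h x y"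
 if "x ~= y & 0 < norm h & norm h <= norm (x - y) / 2" for x y h
 using C0[rule_format, OF that] CC2[of "norm h powr (1 + de)" "norm (x - y) powr ?A"] by simp
 have d2: "norm (K x (y + h) + K x (y - h) - 2 * K x y) <= ?B C h x y"
 if "x ~= y & 0 < norm h & norm h <= norm (x - y) / 2" for x y h
 using C0[rule_format, OF that] CC2[of "norm h powr (1 + de)" "norm (x - y) powr ?A"] by simp
 have "KB de C K" unfolding KB_def using cont size d1 by (auto simp: C_def)
 moreover have "KB de C (%x y. K y x)" unfolding KB_def
 proof (intro conjI allI impI)
 show "continuous_on {(x, y). x ~= y} (%(x, y). K y x)" by (rule continuous_on_swap_kernel[OF cont])
 show "0 <= C" by (simp add: C_def)
 show "norm (K y x) <= ?C C x y" if "x ~= y" for x y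
 using size[of y x] that by (simp add: norm_minus_commute)
 show "norm (K y (x + h) + K y (x - h) - 2 * K y x) <= ?B C h x y"
 if "x ~= y & 0 < norm h & norm h <= norm (x - y) / 2" for x y h
 proof -
 have n: "norm (y - x) = norm (x - y)" by (rule norm_minus_commute)
 have "y ~= x & 0 < norm h & norm h <= norm (y - x) / 2" unfolding n using that by auto
 from d2[OF this] show ?thesis unfolding n .
 qed
 qed
 ultimately show ?thesis by blast
qed

text \<open>The size and the difference bound are homogeneous of the same degree, so one factor, the
  power n - 1 of \<open>s\<close>, restores both with the same constant. Estimates for functions
  attached to a cube thereby reduce to the unit cube.\<close>

lemma KB_scale:
 fixes K :: "real^'n::finite => real^'n => complex"
 assumes K: "KB de C K" and s: "0 < s"
 shows "KB de C (%x y. cr (s powr (real CARD('n) - 1)) * K (b + s *R x) (b + s *R y))"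
 unfolding KB_def
proof (intro conjI allI impI)
 let ?n = "real CARD('n)"
 have cont: "continuous_on {(x, y). x ~= y} (%(x, y). K x y)" using K by (simp add: KB_def)
 have "continuous_on {(x, y). x ~= y} (%p. (%(x, y). K x y) (b + s *R fst p, b + s *R snd p))"
 by (rule continuous_on_compose2[OF cont]) (use s in \<open>auto intro!: continuous_intros\<close>)
 hence "continuous_on {(x, y). x ~= y} (%p. cr (s powr (?n - 1)) * K (b + s *R fst p) (b + s *R snd p))"
 by (intro continuous_on_mult continuous_on_const) simp
 thus "continuous_on {(x, y). x ~= y} (%(x, y). cr (s powr (?n - 1)) * K (b + s *R x) (b + s *R y))"
 by (simp add: case_prod_beta')
 show "0 <= C" using K by (rule KB_nonneg)
 have nd: "norm ((b + s *R x) - (b + s *R y)) = s * norm (x - y)" for x y :: "real^'n"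
 using s by (simp add: scaleR_diff_right[symmetric])
 fix x y :: "real^'n"
 show "norm (cr (s powr (?n - 1)) * K (b + s *R x) (b + s *R y)) <= C * norm (x - y) powr (1 - ?n)" if "x ~= y"
 proof -
 have "norm (K (b + s *R x) (b + s *R y)) <= C * (s * norm (x - y)) powr (1 - ?n)"
 using KB_size[OF K, of "b + s *R x" "b + s *R y"] that s unfolding nd by simp
 hence "s powr (?n - 1) * norm (K (b + s *R x) (b + s *R y)) <= s powr (?n - 1) * (C * (s * norm (x - y)) powr (1 - ?n))"
 by (rule mult_left_mono) simp
 also have "... = C * norm (x - y) powr (1 - ?n) * (s powr (?n - 1) * s powr (1 - ?n))" using s by (simp add: powr_mult mult_ac)
 also have "s powr (?n - 1) * s powr (1 - ?n) = 1" using s by (subst powr_add[symmetric]) simp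
 finally show ?thesis by (simp add: norm_mult)
 qed
 show "norm (cr (s powr (?n - 1)) * K (b + s *R (x + h)) (b + s *R y) + cr (s powr (?n - 1)) * K (b + s *R (x - h)) (b + s *R y)
 - 2 * (cr (s powr (?n - 1)) * K (b + s *R x) (b + s *R y))) <= C * norm h powr (1 + de) * norm (x - y) powr (- ?n - de)"
 if h: "x ~= y & 0 < norm h & norm h <= norm (x - y) / 2" for h
 proof -
 let ?X = "b + s *R x" and ?Y = "b + s *R y"
 have "norm (K (?X + s *R h) ?Y + K (?X - s *R h) ?Y - 2 * K ?X ?Y) <= C * norm (s *R h) powr (1 + de) * norm (?X - ?Y) powr (- ?n - de)"
 proof (rule KB_diff[OF K])
 show "norm (s *R h) <= norm (?X - ?Y) / 2"
 unfolding nd using mult_left_mono[of "norm h" "norm (x - y) / 2" s] h s by simp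
 qed (use h s in auto)
 also have "... = C * (s * norm h) powr (1 + de) * (s * norm (x - y)) powr (- ?n - de)" using s unfolding nd by simp
 finally have "s powr (?n - 1) * norm (K (?X + s *R h) ?Y + K (?X - s *R h) ?Y - 2 * K ?X ?Y) <= s powr (?n - 1) * (C * (s * norm h) powr (1 + de) * (s * norm (x - y)) powr (- ?n - de))"
 by (rule mult_left_mono) simp
 also have "... = C * norm h powr (1 + de) * norm (x - y) powr (- ?n - de) * (s powr (?n - 1) * s powr (1 + de) * s powr (- ?n - de))"
 using s by (simp add: powr_mult mult_ac)
 also have "s powr (?n - 1) * s powr (1 + de) * s powr (- ?n - de) = 1" using s by (simp only: powr_add[symmetric]) simp
 finally have "s powr (?n - 1) * norm (K (?X + s *R h) ?Y + K (?X - s *R h) ?Y - 2 * K ?X ?Y) <= C * norm h powr (1 + de) * norm (x - y) powr (- ?n - de)" by simp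
 moreover have "cr (s powr (?n - 1)) * K (b + s *R (x + h)) ?Y + cr (s powr (?n - 1)) * K (b + s *R (x - h)) ?Y
 - 2 * (cr (s powr (?n - 1)) * K ?X ?Y) = cr (s powr (?n - 1)) * (K (?X + s *R h) ?Y + K (?X - s *R h) ?Y - 2 * K ?X ?Y)"
 by (simp add: algebra_simps)
 ultimately show ?thesis by (simp add: norm_mult)
 qed
qed

text \<open>Continuity is known only off the diagonal, hence the kernel is set to zero there before
  joint measurability is claimed. The diagonal meets each slice in a single point, so integrals in
  one variable do not notice the change.\<close>

lemma KB_measurable:
 fixes K :: "real^'n::finite => real^'n => complex"
 assumes "KB de C K"
 shows "(%p. if fst p = snd p then 0 else K (fst p) (snd p)) : BM"
proof -
 let ?A = "{(x, y). x ~= (y::real^'n)}"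
 have cont: "continuous_on ?A (%(x, y). K x y)" using assms by (simp add: KB_def)
 have "open ?A" using open_Collect_neq[of "fst :: (real^'n) \<times> (real^'n) => _" snd] by (simp add: case_prod_beta' continuous_on_fst continuous_on_snd continuous_on_id)
 hence "(%p. ind ?A p *R (%(x, y). K x y) p) : BM"
 by (intro borel_measurable_continuous_on_indicator cont) auto
 moreover have "(%p. ind ?A p *R (%(x, y). K x y) p) = (%p. if fst p = snd p then 0 else K (fst p) (snd p))"
 by (rule ext) (auto simp: indicator_def)
 ultimately show ?thesis by simp
qed

lemma KB_measurable_1:
 fixes K :: "real^'n::finite => real^'n => complex"
 assumes "KB de C K"
 shows "(%x. K x y) : BM"
proof -
 have "(%x. (%p. if fst p = snd p then 0 else K (fst p) (snd p)) (x, y)) : BM"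
 by (rule measurable_compose[OF _ KB_measurable[OF assms]]) (simp add: borel_prod[symmetric])
 hence m [measurable]: "(%x. if x = y then 0 else K x y) : BM" unfolding fst_conv snd_conv .
 have "(%x. if x = y then K y y else (if x = y then 0 else K x y)) : BM" by measurable
 moreover have "(%x. if x = y then K y y else (if x = y then 0 else K x y)) = (%x. K x y)" by (rule ext) simp
 ultimately show ?thesis by simp
qed

lemma riesz_wt_integrable:
 assumes m: "real CARD('n::finite) < m"
 shows "EX C>=0. ALL y::real^'n. intl (%x. norm (x - y) powr (1 - real CARD('n)) * wt m x) &
 (LI x. norm (x - y) powr (1 - real CARD('n)) * wt m x) <= C"
proof -
 have m': "real DIM(real^'n) < m" using m by simp
 show ?thesis
 proof (rule nn_integral_riesz_wt_bound[OF m'])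
 fix C assume C: "0 <= C" "!!y::real^'n. (NI x. en (norm (x - y) powr (1 - real DIM(real^'n)) * wt m x)) <= en C"
 have "intl (%x. norm (x - y) powr (1 - real CARD('n)) * wt m x) &
 (LI x. norm (x - y) powr (1 - real CARD('n)) * wt m x) <= C" for y :: "real^'n"
 proof -
 have le: "(NI x. en (norm (x - y) powr (1 - real CARD('n)) * wt m x)) <= en C" using C(2)[of y] by simp
 have i: "intl (%x. norm (x - y) powr (1 - real CARD('n)) * wt m x)"
 by (rule integrableI_nonneg) (use le in \<open>auto intro: le_less_trans\<close>)
 hence "en (LI x. norm (x - y) powr (1 - real CARD('n)) * wt m x) <= en C"
 using le by (subst (asm) nn_integral_eq_integral) auto
 thus ?thesis using i C(1) by (simp add: ennreal_le_iff)
 qed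
 thus ?thesis using C(1) by blast
 qed
qed

lemma AE_neq_lborel: "AE x in lborel. x ~= (y::real^'n::finite)"
 by (rule AE_lborel_singleton)

lemma norm_integral_le_AE:
 fixes f :: "'a => 'b::{banach, second_countable_topology}"
 assumes g: "integrable M g" and f: "f : bm M" and le: "AE x in M. norm (f x) <= g x"
 shows "integrable M f" "norm (LINT x|M. f x) <= (LINT x|M. g x)"
proof -
 have "AE x in M. norm (f x) <= norm (g x)" using le by eventually_elim simp
 thus i: "integrable M f" by (rule Bochner_Integration.integrable_bound[OF g f])
 hence "norm (LINT x|M. f x) <= (LINT x|M. norm (f x))" by (intro integral_norm_bound)
 also have "... <= (LINT x|M. g x)" by (rule integral_mono_AE[OF integrable_norm[OF i] g le])
 finally show "norm (LINT x|M. f x) <= (LINT x|M. g x)" .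
qed

lemma kernel_integral_bound:
 assumes f: "rd (f::'n::finite fn)"
 shows "EX D>=0. ALL K C y. KB de C K --> intl (%x. K x y * f x) & norm (LI x. K x y * f x) <= D * C"
proof -
 let ?n = "real CARD('n)"
 obtain R where R: "0 <= R" "ALL y::real^'n. intl (%x. norm (x - y) powr (1 - ?n) * wt (?n + 1) x) &
 (LI x. norm (x - y) powr (1 - ?n) * wt (?n + 1) x) <= R" using riesz_wt_integrable[where 'n='n, of "?n + 1"] by auto
 obtain B where B: "0 <= B" "!!x. norm (f x) <= B * wt (?n + 1) x" using decE[OF rd_dec[OF f]] by blast
 have "intl (%x. K x y * f x) & norm (LI x. K x y * f x) <= B * R * C" if K: "KB de C K" for K C y
 proof -
 have [measurable]: "(%x. K x y) : BM" "f : BM" using KB_measurable_1[OF K] rd_measurable[OF f] by auto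
 have C0: "0 <= C" by (rule KB_nonneg[OF K])
 have le: "AE x in lborel. norm (K x y * f x) <= C * B * (norm (x - y) powr (1 - ?n) * wt (?n + 1) x)"
 using AE_neq_lborel[of y]
 proof eventually_elim
 case (elim x)
 have "norm (K x y * f x) <= (C * norm (x - y) powr (1 - ?n)) * (B * wt (?n + 1) x)"
 unfolding norm_mult using KB_size[OF K elim] B C0 by (intro mult_mono) auto
 thus ?case by (simp add: mult_ac)
 qed
 have i: "intl (%x. C * B * (norm (x - y) powr (1 - ?n) * wt (?n + 1) x))" using R(2) by (intro integrable_mult_right) blast
 have "norm (LI x. K x y * f x) <= (LI x. C * B * (norm (x - y) powr (1 - ?n) * wt (?n + 1) x))"
 by (rule norm_integral_le_AE(2)[OF i _ le]) measurable
 also have "... = C * B * (LI x. norm (x - y) powr (1 - ?n) * wt (?n + 1) x)" by simp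
 also have "... <= C * B * R" using R(2) C0 B(1) by (intro mult_left_mono) auto
 finally have "norm (LI x. K x y * f x) <= B * R * C" by (simp add: mult_ac)
 moreover have "intl (%x. K x y * f x)" by (rule norm_integral_le_AE(1)[OF i _ le]) measurable
 ultimately show ?thesis by blast
 qed
 thus ?thesis using B(1) R(1) by (intro exI[of _ "B * R"]) auto
qed

text \<open>As \<open>f\<close> is even with mean zero, twice the integral equals the integral of
  the symmetric difference \<open>K x y + K (- x) y - 2 * K 0 y\<close> against \<open>f\<close>.
  For \<open>norm x \<le> norm y / 2\<close> the difference bound applies at the base point 0 with
  step \<open>x\<close>; for larger \<open>x\<close> the decay of \<open>f\<close> already contains
  the required decay in \<open>y\<close>.\<close>

lemma kernel_decay:
 assumes f: "rd (f::'n::finite fn)" and ev: "!!x. f (- x) = f x" and f0: "(LI x. f x) = 0" and d: "0 < de"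
 shows "EX D>=0. ALL K C y. KB de C K --> norm (LI x. K x y * f x) <= D * C * wt (real CARD('n) + de) y"
proof -
 let ?n = "real CARD('n)"
 let ?W = "%x::real^'n. wt (?n + 1) x"
 let ?A = "%x y. norm (x - y) powr (1 - ?n) + norm (x - (- y)) powr (1 - ?n) + 2"
 let ?B = "%y. (LI x. norm (x - y) powr (1 - ?n) * ?W x) + (LI x. norm (x - (- y)) powr (1 - ?n) * ?W x)"
 let ?C = "%x y. wt (?n + de) x * wt (?n + de) y"
 let ?D = "%P y. P * wt (?n + de) y"
 let ?E = "%x y. norm (x - y) powr (1 - ?n) * ?W x + norm (x - (- y)) powr (1 - ?n) * ?W x"
 let ?F = "%D C y. D * C * wt (?n + de) y"
 let ?G = "%C y. C * wt (?n + de) y"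
 obtain R where R: "0 <= R" "ALL y::real^'n. intl (%x. norm (x - y) powr (1 - ?n) * ?W x) &
 (LI x. norm (x - y) powr (1 - ?n) * ?W x) <= R" using riesz_wt_integrable[where 'n='n, of "?n + 1"] by auto
 have n1: "1 <= ?n" by (simp add: Suc_le_eq)
 \<comment> \<open>One summand for each demand on the decay of \<open>f\<close>: decay in
   \<open>y\<close>, integrability, and the growth of \<open>norm x powr (1 + de)\<close> from the
   difference bound.\<close>
 define N where "N = (?n + de) + (?n + 1) + (1 + de)"
 obtain B where B: "0 <= B" "!!x. norm (f x) <= B * wt N x" using decE[OF rd_dec[OF f]] by blast
 obtain D0 where D0: "0 <= D0" "ALL K C y. KB de C K --> intl (%x. K x y * f x) & norm (LI x. K x y * f x) <= D0 * C"
 using kernel_integral_bound[OF f] by blast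
 define I where "I = (LI x. ?W x)"
 have I0: "0 <= I" by (simp add: I_def wt_integral_nonneg)
 define P where "P = p2 (?n + de)"
 have P0: "0 < P" by (simp add: P_def)
 define D where "D = P * (D0 + B * (3 * I + 2 * R))"
 have "norm (LI x. K x y * f x) <= ?F D C y" if K: "KB de C K" for K C y
 proof -
 have C0: "0 <= C" by (rule KB_nonneg[OF K])
 have [measurable]: "(%x. K x y) : BM" "f : BM" using KB_measurable_1[OF K] rd_measurable[OF f] by auto
 define r where "r = norm y"
 have Pw: "1 <= P * wt (?n + de) y * (max 1 r) powr (?n + de)"
 proof -
 have "(1 + r) powr (?n + de) <= (2 * max 1 r) powr (?n + de)" using d by (intro powr_mono2) (auto simp: r_def)
 also have "... = P * (max 1 r) powr (?n + de)" by (simp add: P_def powr_mult)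
 finally have "(1 + r) powr (?n + de) * wt (?n + de) y <= P * (max 1 r) powr (?n + de) * wt (?n + de) y" by (rule mult_right_mono) simp
 moreover have "(1 + r) powr (?n + de) * wt (?n + de) y = 1"
 proof -
 have "1 + norm y ~= 0" using norm_ge_zero[of y] by linarith
 thus ?thesis by (simp add: wt_def r_def powr_add[symmetric])
 qed
 ultimately have "1 <= P * (max 1 r) powr (?n + de) * wt (?n + de) y" by (simp only:)
 thus ?thesis by (simp only: mult_ac)
 qed
 show ?thesis
 \<comment> \<open>For bounded \<open>y\<close> no decay is asked for and the plain bound
   \<open>D0\<close> suffices; the other case also ensures \<open>y \<noteq> 0\<close>, so that
   \<open>K 0 y\<close> is off the diagonal.\<close>
 proof (cases "r <= 1")
 case True
 hence "1 <= P * wt (?n + de) y" using Pw by (simp add: max_def split: if_splits)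
 hence "D0 * C * 1 <= D0 * C * ?D P y" using D0 C0 by (intro mult_left_mono) auto
 also have "... <= ?F D C y"
 proof -
 have "D0 * P <= D" unfolding D_def using P0 B R I0 by (simp add: algebra_simps)
 hence "D0 * P * ?G C y <= D * ?G C y" using C0 by (intro mult_right_mono) auto
 thus ?thesis by (simp add: mult_ac)
 qed
 finally show ?thesis using D0(2)[rule_format, OF K, of y] by simp
 next
 case False
 hence r1: "1 < r" by simp
 have y0: "y ~= 0" using r1 by (auto simp: r_def)
 have rP: "r powr (- ?n - de) <= P * wt (?n + de) y"
 proof -
 have "r powr (- ?n - de) * 1 <= r powr (- ?n - de) * (P * wt (?n + de) y * r powr (?n + de))"
 using Pw r1 by (intro mult_left_mono) auto
 also have "... = P * wt (?n + de) y * (r powr (- ?n - de) * r powr (?n + de))" by (simp only: mult_ac)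
 also have "r powr (- ?n - de) * r powr (?n + de) = 1" using r1 by (subst powr_add[symmetric]) simp
 finally show ?thesis by simp
 qed
 define q where "q x = (K x y + K (- x) y - 2 * K 0 y) * f x" for x
 have i1: "intl (%x. K x y * f x)" using D0(2) K by blast
 have i2: "intl (%x. K (- x) y * f x)" using integrable_affine[OF i1, of "-1" 0] by (simp add: ev)
 have i3: "intl (%x. 2 * K 0 y * f x)" using rd_integrable[OF f] by simp
 have e2: "(LI x. K (- x) y * f x) = (LI x. K x y * f x)"
 using integral_reflect[of "%x. K x y * f x" 0] by (simp add: ev)
 have "(LI x. q x) = (LI x. K x y * f x + K (- x) y * f x - 2 * K 0 y * f x)"
 by (simp add: q_def algebra_simps)
 also have "... = 2 * (LI x. K x y * f x)" using i1 i2 i3 f0 e2 by simp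
 finally have half: "(LI x. q x) = 2 * (LI x. K x y * f x)" .
 have [measurable]: "(%x. K (- x) y) : BM"
 by (rule measurable_compose[OF _ KB_measurable_1[OF K]]) simp
 have [measurable]: "q : BM" unfolding q_def[abs_def] by measurable
 define F where "F x = C * B * ?D P y * (3 * ?W x + ?E x y)" for x
 have iF: "intl F" unfolding F_def[abs_def]
 using R(2)[rule_format, of y] R(2)[rule_format, of "- y"]
 by (intro integrable_mult_right Bochner_Integration.integrable_add integrable_wt) auto
 have "AE x in lborel. x ~= y & x ~= - y & x ~= 0"
 using AE_neq_lborel[of y] AE_neq_lborel[of "- y"] AE_neq_lborel[of 0] by eventually_elim auto
 hence qF: "AE x in lborel. norm (q x) <= F x"
 proof eventually_elim
 case (elim x)
 have W0: "0 <= ?W x" by simp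
 show "norm (q x) <= F x"
 proof (cases "norm x <= r / 2")
 case True
 have "norm (K (0 + x) y + K (0 - x) y - 2 * K 0 y) <= C * norm x powr (1 + de) * norm (0 - y) powr (- ?n - de)"
 using True elim y0 by (intro KB_diff[OF K]) (auto simp: r_def)
 hence "norm (q x) <= (C * norm x powr (1 + de) * r powr (- ?n - de)) * (B * wt N x)"
 unfolding q_def norm_mult using B C0 by (intro mult_mono) (auto simp: r_def)
 also have "... = C * B * r powr (- ?n - de) * (norm x powr (1 + de) * wt N x)" by (simp add: mult_ac)
 also have "... <= C * B * ?D P y * (3 * ?W x)"
 proof (rule mult_mono)
 show "C * B * r powr (- ?n - de) <= C * B * ?D P y" using C0 B rP by (intro mult_left_mono) auto
 have "norm x powr (1 + de) * wt N x <= wt (N - (1 + de)) x" using d by (intro norm_pow_wt) simp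
 also have "... <= ?W x" using d by (intro wt_mono) (simp add: N_def)
 finally show "norm x powr (1 + de) * wt N x <= 3 * ?W x" using W0 by linarith
 qed (use C0 B P0 in auto)
 also have "... <= F x" unfolding F_def using C0 B P0 by (intro mult_left_mono mult_nonneg_nonneg) auto
 finally show ?thesis .
 next
 case False
 have wN: "wt N x <= P * wt (?n + de) y * ?W x"
 proof -
 have "1 + r <= 2 * (1 + norm x)" using False by simp
 hence "(1 + r) powr (?n + de) <= (2 * (1 + norm x)) powr (?n + de)" using d by (intro powr_mono2) (auto simp: r_def)
 also have "... = P * (1 + norm x) powr (?n + de)" unfolding P_def by (rule powr_mult)
 finally have le1: "(1 + r) powr (?n + de) * ?C x y <= P * (1 + norm x) powr (?n + de) * ?C x y"
 by (rule mult_right_mono) simp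
 have inv1: "(1 + norm z) powr (?n + de) * wt (?n + de) z = 1" for z :: "real^'n"
 proof -
 have "1 + norm z ~= 0" using norm_ge_zero[of z] by linarith
 thus ?thesis by (simp add: wt_def powr_add[symmetric])
 qed
 have "(1 + r) powr (?n + de) * ?C x y = wt (?n + de) x * ((1 + norm y) powr (?n + de) * wt (?n + de) y)"
 unfolding r_def by (simp only: mult_ac)
 moreover have "P * (1 + norm x) powr (?n + de) * ?C x y = P * wt (?n + de) y * ((1 + norm x) powr (?n + de) * wt (?n + de) x)"
 by (simp only: mult_ac)
 ultimately have "wt (?n + de) x <= P * wt (?n + de) y" using le1 by (simp only: inv1 mult_1_right)
 moreover have "wt N x <= wt (?n + de) x * ?W x" unfolding wt_mult N_def using d by (intro wt_mono) simp
 ultimately show ?thesis using mult_right_mono[OF \<open>wt (?n + de) x <= P * wt (?n + de) y\<close> W0] by linarith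
 qed
 have kx: "norm (K x y) <= C * norm (x - y) powr (1 - ?n)" using elim by (intro KB_size[OF K]) auto
 have kmx: "norm (K (- x) y) <= C * norm (x - (- y)) powr (1 - ?n)"
 proof -
 have "- x ~= y" using elim by auto
 thus ?thesis using KB_size[OF K, of "- x" y] norm_minus_cancel[of "x + y"] by simp
 qed
 have k0: "norm (K 0 y) <= C"
 proof -
 have "norm (K 0 y) <= C * r powr (1 - ?n)" using KB_size[OF K, of 0 y] y0 by (simp add: r_def)
 also have "... <= C * 1" using C0 r1 n1 powr_mono2'[of "1 - ?n" 1 r] by (intro mult_left_mono) auto
 finally show ?thesis by simp
 qed
 have "norm (K x y + K (- x) y - 2 * K 0 y) <= norm (K x y) + norm (K (- x) y) + 2 * norm (K 0 y)"
 using norm_triangle_ineq4[of "K x y + K (- x) y" "2 * K 0 y"] norm_triangle_ineq[of "K x y" "K (- x) y"] by (simp add: norm_mult)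
 also have "... <= C * ?A x y"
 using kx kmx k0 by (simp add: algebra_simps)
 finally have "norm (q x) <= (C * ?A x y) * (B * (P * wt (?n + de) y * ?W x))"
 unfolding q_def norm_mult using B(2)[of x] mult_left_mono[OF wN B(1)] C0 by (intro mult_mono mult_nonneg_nonneg add_nonneg_nonneg) auto
 also have "... <= F x"
 proof -
 have "?A x y * ?W x <= 3 * ?W x + ?E x y"
 by (simp add: algebra_simps)
 hence "C * B * ?D P y * ((?A x y) * ?W x) <= F x"
 unfolding F_def using C0 B P0 by (intro mult_left_mono mult_nonneg_nonneg) auto
 thus ?thesis by (simp only: mult_ac)
 qed
 finally show ?thesis .
 qed
 qed
 have "2 * norm (LI x. K x y * f x) = norm (LI x. q x)" unfolding half by (simp add: norm_mult)
 also have "... <= (LI x. F x)" by (rule norm_integral_le_AE(2)[OF iF _ qF]) measurable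
 also have "... = C * B * ?D P y * (3 * I + ?B y)"
 unfolding F_def I_def using R(2)[rule_format, of y] R(2)[rule_format, of "- y"] integrable_wt[where 'a="real^'n" and m="?n + 1"] by simp
 also have "... <= C * B * ?D P y * (3 * I + 2 * R)"
 proof (rule mult_left_mono)
 show "3 * I + ?B y <= 3 * I + 2 * R"
 using R(2)[rule_format, of y] R(2)[rule_format, of "- y"] by linarith
 qed (use C0 B P0 in auto)
 also have "... <= ?F D C y"
 proof -
 have "B * P * (3 * I + 2 * R) <= D" unfolding D_def using P0 D0 by (simp add: algebra_simps)
 hence "B * P * (3 * I + 2 * R) * ?G C y <= D * ?G C y" using C0 by (intro mult_right_mono) auto
 thus ?thesis by (simp only: mult_ac)
 qed
 finally have "2 * norm (LI x. K x y * f x) <= ?F D C y" .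
 thus ?thesis using norm_ge_zero[of "LI x. K x y * f x"] by linarith
 qed
 qed
 moreover have "0 <= D" unfolding D_def using P0 D0 B I0 R by auto
 ultimately show ?thesis by blast
qed

text \<open>Absolute integrability comes from the uniform Riesz bound in the inner variable and from
  integrability of \<open>g\<close> in the outer one.\<close>

lemma kernel_fubini:
 fixes f g :: "'n::finite fn"
 assumes K: "KB de C K" and f: "rd f" and g: "rd g"
 shows "(LI x. (LI y. K x y * f y) * g x) = (LI y. f y * (LI x. K x y * g x))"
proof -
 let ?n = "real CARD('n)"
 let ?A = "%y x. norm (y - x) powr (1 - ?n) * wt (?n + 1) y"
 let ?B = "lborel \<Otimes>\<^sub>M lborel"
 let ?C = "%K0 x. NI y. norm (K0 x y * f y * g x)"
 let ?D = "%B x. C * B * norm (g x)"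
 define K0 where "K0 x y = (if x = y then 0 else K x y)" for x y
 have m [measurable]: "(%p. K0 (fst p) (snd p)) : bm ?B"
 proof -
 have "(%p. K0 (fst p) (snd p)) : bm (borel :: ((real^'n) \<times> (real^'n)) measure)"
 using KB_measurable[OF K] by (simp add: K0_def)
 thus ?thesis by (simp add: lborel_prod)
 qed
 have [measurable]: "f : BM" "g : BM" using rd_measurable f g by auto
 have C0: "0 <= C" by (rule KB_nonneg[OF K])
 obtain R where R: "0 <= R" "ALL y::real^'n. intl (%x. norm (x - y) powr (1 - ?n) * wt (?n + 1) x) &
 (LI x. norm (x - y) powr (1 - ?n) * wt (?n + 1) x) <= R" using riesz_wt_integrable[where 'n='n, of "?n + 1"] by auto
 obtain B where B: "0 <= B" "!!x. norm (f x) <= B * wt (?n + 1) x" using decE[OF rd_dec[OF f]] by blast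
 have K0b: "norm (K0 x y) <= C * norm (x - y) powr (1 - ?n)" for x y using KB_size[OF K, of x y] C0 by (simp add: K0_def)
 have int: "integrable ?B (%(x, y). K0 x y * f y * g x)"
 proof -
 have inner: "?C K0 x <= en (C * B * R) * en (norm (g x))" for x
 proof -
 have "?C K0 x <= (NI y. en (?D B x) * en (?A y x))"
 proof (rule nn_integral_mono)
 fix y
 have "norm (K0 x y * f y * g x) <= (C * norm (x - y) powr (1 - ?n)) * (B * wt (?n + 1) y) * norm (g x)"
 unfolding norm_mult using K0b B C0 by (intro mult_right_mono mult_mono) auto
 also have "... = C * B * norm (g x) * ?A y x" by (simp add: norm_minus_commute mult_ac)
 finally show "en (norm (K0 x y * f y * g x)) <= en (?D B x) * en (?A y x)"
 using C0 B(1) by (subst ennreal_mult[symmetric]) (auto intro!: ennreal_leI)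
 qed
 also have "... = en (?D B x) * (NI y. en (?A y x))"
 by (rule nn_integral_cmult) measurable
 also have "(NI y. en (?A y x)) <= en R"
 using R by (subst nn_integral_eq_integral) (auto intro!: ennreal_leI)
 finally have "?C K0 x <= en (?D B x) * en R" by (simp add: mult_left_mono)
 also have "... = en (C * B * R) * en (norm (g x))" using C0 B(1) R(1) by (simp add: ennreal_mult'[symmetric] mult_ac)
 finally show ?thesis .
 qed
 have "(\<integral>\<^sup>+p. norm ((%(x, y). K0 x y * f y * g x) p) \<partial>?B) = (NI x. (?C K0 x))"
 by (subst lborel.nn_integral_fst[symmetric]) (auto simp: case_prod_beta')
 also have "... <= (NI x. en (C * B * R) * en (norm (g x)))" by (intro nn_integral_mono inner)
 also have "... = en (C * B * R) * (NI x. en (norm (g x)))" by (rule nn_integral_cmult) measurable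
 also have "... < \<infinity>" using rd_integrable[OF g] by (simp add: integrable_iff_bounded ennreal_mult_less_top)
 finally show ?thesis by (intro integrableI_bounded) (auto simp: case_prod_beta')
 qed
 have c1: "(LI y. K x y * f y) = (LI y. K0 x y * f y)" for x
 proof (rule integral_cong_AE)
 have [measurable]: "(%y. K0 x y) : BM"
 using measurable_compose[OF _ m, of "%y. (x, y)" borel] by simp
 have "(%y. if y = x then K x x else K0 x y) : BM" by measurable
 moreover have "(%y. if y = x then K x x else K0 x y) = K x" by (rule ext) (simp add: K0_def)
 ultimately have [measurable]: "K x : BM" by simp
 show "(%y. K x y * f y) : bm lborel" "(%y. K0 x y * f y) : bm lborel" by measurable
 show "AE y in lborel. K x y * f y = K0 x y * f y" using AE_neq_lborel[of x] by eventually_elim (simp add: K0_def)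
 qed
 have c2: "(LI x. K x y * g x) = (LI x. K0 x y * g x)" for y
 proof (rule integral_cong_AE)
 have [measurable]: "(%x. K0 x y) : BM"
 using measurable_compose[OF _ m, of "%x. (x, y)" borel] by simp
 have [measurable]: "(%x. K x y) : BM" by (rule KB_measurable_1[OF K])
 show "(%x. K x y * g x) : bm lborel" "(%x. K0 x y * g x) : bm lborel" by measurable
 show "AE x in lborel. K x y * g x = K0 x y * g x" using AE_neq_lborel[of y] by eventually_elim (simp add: K0_def)
 qed
 have "(LI x. (LI y. K x y * f y) * g x) = (LI x. (LI y. K0 x y * f y * g x))"
 unfolding c1 by (simp only: integral_mult_left_zero)
 also have "... = (LI y. (LI x. K0 x y * f y * g x))"
 by (rule lborel_pair.Fubini_integral[OF int, symmetric])
 also have "... = (LI y. f y * (LI x. K0 x y * g x))"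
 by (simp only: integral_mult_right_zero[symmetric] mult_ac)
 finally show ?thesis unfolding c2 .
qed

lemma side_pos [simp]: "0 < side Q" by (simp add: side_def)

lemma abs_side [simp]: "\<bar>side Q\<bar> = side Q" using side_pos[of Q] by linarith

lemma cubefn_scale:
 fixes f :: "'n::finite fn"
 shows "cubefn f Q x = cr (side Q powr (- real CARD('n) / 2)) * f ((1 / side Q) *R (x - corner Q))"
proof -
 have "side Q powr (- real CARD('n) / 2) = p2 (ri (fst Q) * real CARD('n) / 2)"
 by (simp add: side_def powr_powr)
 moreover have s: "1 / side Q = tp (fst Q)" by (simp add: side_def powr_minus divide_inverse)
 moreover have "(1 / side Q) *R (x - corner Q) = tp (fst Q) *R x - cvec (snd Q)"
 unfolding s by (simp add: corner_def scaleR_diff_right powr_minus)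
 ultimately show ?thesis by (simp add: cubefn_def)
qed

lemma cubefn_integral:
 fixes F :: "'n::finite fn"
 shows "(LI x. F x * cubefn f Q x) = cr (side Q powr (real CARD('n) / 2)) * (LI z. F (corner Q + side Q *R z) * f z)"
proof -
 let ?n = "real CARD('n)" and ?l = "side Q"
 let ?A = "%z. corner Q + ?l *R z"
 let ?B = "LI x. F x * cubefn f Q x"
 let ?C = "?l powr (- ?n / 2)"
 let ?D = "LI z. F (?A z) * f z"
 let ?E = "LI z. (%x. F x * cubefn f Q x) (?A z)"
 let ?F = "1 / \<bar>?l\<bar> ^ CARD('n)"
 have "cubefn f Q (?A z) = cr ?C * f z" for z
 using side_pos[of Q] by (simp add: cubefn_scale less_imp_neq[symmetric])
 hence "F (?A z) * cubefn f Q (?A z) = cr ?C * (F (?A z) * f z)" for z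
 by simp
 hence "?E = cr ?C * ?D"
 by (simp only: integral_mult_right_zero)
 moreover have "?E = (1 / \<bar>?l\<bar> ^ DIM(real^'n)) *R ?B"
 using side_pos[of Q] by (intro integral_affine) (auto simp: less_imp_neq[symmetric])
 ultimately have e: "?F *R ?B = cr ?C * ?D" by simp
 have "?B = ?l ^ CARD('n) *R (?F *R ?B)"
 using side_pos[of Q] by (simp add: less_imp_neq[symmetric])
 also have "... = cr (?l ^ CARD('n) * ?l powr (- ?n / 2)) * ?D"
 unfolding e by (simp add: scaleR_conv_of_real)
 also have "?l ^ CARD('n) * ?l powr (- ?n / 2) = ?l powr (?n / 2)"
 proof -
 have "?l ^ CARD('n) = ?l powr ?n" using side_pos[of Q] by (simp add: powr_realpow)
 thus ?thesis by (simp only: powr_add[symmetric]) simp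
 qed
 finally show ?thesis .
qed

lemma cubefn_integral_nofactor:
 "(LI x. cubefn f Q x) = cr (side Q powr (real CARD('n) / 2)) * (LI z. f z)"
 for f :: "'n::finite fn"
 using cubefn_integral[of "%_. 1" f Q] by simp

lemma kernel_cube_decay:
 fixes et :: "'n::finite fn"
 assumes D: "ALL K C y. KB de C K --> norm (LI x. K x y * et x) <= D * C * wt (real CARD('n) + de) y" and K: "KB de C K"
 shows "norm (LI x. K x y * cubefn et Q x) <= D * C * side Q powr (1 - real CARD('n) / 2) * wt (real CARD('n) + de) ((1 / side Q) *R (y - corner Q))"
proof -
 let ?n = "real CARD('n)" and ?l = "side Q" and ?b = "corner Q"
 define y' where "y' = (1 / ?l) *R (y - ?b)"
 have l: "0 < ?l" by simp
 have y: "y = ?b + ?l *R y'" using l by (simp add: y'_def less_imp_neq[symmetric])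
 let ?K = "%x y. cr (?l powr (?n - 1)) * K (?b + ?l *R x) (?b + ?l *R y)"
 have "norm (LI x. ?K x y' * et x) <= D * C * wt (?n + de) y'" using D KB_scale[OF K l, of ?b] by blast
 moreover have "(LI x. ?K x y' * et x) = cr (?l powr (?n - 1)) * (LI x. K (?b + ?l *R x) y * et x)"
 by (simp add: y mult.assoc)
 ultimately have "?l powr (?n - 1) * norm (LI x. K (?b + ?l *R x) y * et x) <= D * C * wt (?n + de) y'" by (simp add: norm_mult)
 hence "?l powr (1 - ?n / 2) * (?l powr (?n - 1) * norm (LI x. K (?b + ?l *R x) y * et x)) <= ?l powr (1 - ?n / 2) * (D * C * wt (?n + de) y')"
 by (rule mult_left_mono) simp
 moreover have "?l powr (1 - ?n / 2) * ?l powr (?n - 1) = ?l powr (?n / 2)" by (subst powr_add[symmetric]) simp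
 ultimately have "?l powr (?n / 2) * norm (LI x. K (?b + ?l *R x) y * et x) <= D * C * ?l powr (1 - ?n / 2) * wt (?n + de) y'"
 by (simp add: mult.assoc[symmetric]) (simp add: mult_ac)
 thus ?thesis unfolding cubefn_integral y'_def by (simp add: norm_mult)
qed

lemma omega_commute: "omega e P Q = omega e Q P"
 by (simp add: omega_def Let_def min.commute max.commute norm_minus_commute)

lemma omega_nonneg: "0 <= omega e P Q"
 by (simp add: omega_def Let_def)

lemma omega_le_side:
 fixes P Q :: "'n::finite cube"
 assumes "side Q <= side P"
 shows "omega e P Q = side Q powr (1 + (real CARD('n) + e) / 2) / side P powr ((real CARD('n) + e) / 2) * wt (real CARD('n) + e) ((1 / side P) *R (corner Q - corner P))"
 using assms abs_of_pos[OF side_pos[of P]] abs_of_pos[OF side_pos[of Q]]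
 by (simp add: omega_def Let_def min_def max_def wt_def norm_minus_commute split: if_splits)

text \<open>Rescaling by the larger cube \<open>P\<close> turns the pairing into one of
  \<open>th\<close> with a mean zero function of width \<open>l / L\<close>. The decay of order n +
  \<open>de\<close> comes from \<open>kernel_decay\<close>, the power of \<open>l / L\<close> from
  \<open>cancellation\<close>.\<close>

lemma almost_diagonal_one_sided:
 fixes et th :: "'n::finite fn"
 assumes d: "0 < de" "de <= 1" and K: "KB de C K"
 and et: "rd et" "!!x. et (- x) = et x" "(LI x. et x) = 0" and th: "th : schwartz"
 and G: "!!Q. intl (%y. LI x. K x y * cubefn et Q x) & (LI y. (LI x. K x y * cubefn et Q x)) = 0"
 shows "EX E>=0. ALL P Q. side Q <= side P --> norm (LI y. (LI x. K x y * cubefn et Q x) * cubefn th P y) <= E * omega de P Q"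
proof -
 let ?n = "real CARD('n)"
 obtain D where D: "0 <= D" "ALL K C y. KB de C K --> norm (LI x. K x y * et x) <= D * C * wt (?n + de) y"
 using kernel_decay[OF et d(1)] by blast
 define M where "M = CARD('n) + CARD('n) + 2"
 have M: "(?n + de) + (?n + 1) <= real M" using d by (simp add: M_def)
 obtain B where LDt: "LD (real M) B th" using schwartz_LD[OF th] by blast
 have B0: "0 <= B" by (rule LD_nonneg[OF LDt])
 have C0: "0 <= C" by (rule KB_nonneg[OF K])
 \<comment> \<open>Cancellation of order \<open>de\<close> would need a moment that decay of order n
   + \<open>de\<close> does not provide; half of it is available and matches the exponent in
   \<open>omega\<close>.\<close>
 have g: "0 < de / 2" "de / 2 <= 1" "?n + de / 2 < ?n + de" using d by auto
 obtain E where E: "0 <= E" "ALL (g::'n fn) f A B l a. g : BM & f : BM & 0 <= A &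
 (ALL y. norm (g y) <= A * wt (?n + de) ((1 / l) *R (y - a))) & (LI y. g y) = 0 & LD (real M) B f & 0 < l & l <= 1 -->
 norm (LI y. f y * g y) <= E * A * B * l powr (?n + de / 2) * wt (?n + de) a"
 using cancellation[OF g M] by blast
 have "norm (LI y. (LI x. K x y * cubefn et Q x) * cubefn th P y) <= (E * (D * C) * B) * omega de P Q"
 if le: "side Q <= side P" for P Q :: "'n cube"
 proof -
 define l where "l = side Q" define L where "L = side P" define b where "b = corner Q" define b' where "b' = corner P"
 have l: "0 < l" "0 < L" "l <= L" using le by (simp_all add: l_def L_def)
 define GG where "GG y = (LI x. K x y * cubefn et Q x)" for y
 have GG: "intl GG" "(LI y. GG y) = 0" using G[of Q] by (simp_all add: GG_def[abs_def])
 define A where "A = D * C * l powr (1 - ?n / 2)"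
 define a where "a = (1 / L) *R (b - b')"
 define g where "g z = GG (b' + L *R z)" for z
 have gi: "intl g" unfolding g_def[abs_def] using l by (intro integrable_affine[OF GG(1)]) auto
 have g0: "(LI z. g z) = 0" unfolding g_def using l by (subst integral_affine) (auto simp: GG)
 have gb: "norm (g z) <= A * wt (?n + de) ((1 / (l / L)) *R (z - a))" for z
 proof -
 have "norm (g z) <= A * wt (?n + de) ((1 / l) *R ((b' + L *R z) - b))"
 unfolding g_def GG_def A_def l_def b_def by (rule kernel_cube_decay[OF D(2) K])
 also have "(1 / l) *R ((b' + L *R z) - b) = (1 / (l / L)) *R (z - a)"
 using l by (simp add: a_def algebra_simps)
 finally show ?thesis .
 qed
 have "norm (LI z. th z * g z) <= E * A * B * (l / L) powr (?n + de / 2) * wt (?n + de) a"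
 by (rule E(2)[rule_format]) (use gi g0 gb LDt l D(1) C0 rd_measurable[OF schwartz_rd[OF th]] in \<open>auto simp: A_def\<close>)
 hence "L powr (?n / 2) * norm (LI z. th z * g z) <= L powr (?n / 2) * (E * A * B * (l / L) powr (?n + de / 2) * wt (?n + de) a)"
 by (rule mult_left_mono) simp
 also have "... = E * (D * C) * B * (L powr (?n / 2) * l powr (1 - ?n / 2) * (l / L) powr (?n + de / 2) * wt (?n + de) a)"
 by (simp add: A_def mult_ac)
 also have "L powr (?n / 2) * l powr (1 - ?n / 2) * (l / L) powr (?n + de / 2) = l powr (1 + (?n + de) / 2) / L powr ((?n + de) / 2)"
 proof -
 have "(l / L) powr (?n + de / 2) = l powr (?n + de / 2) * L powr (- (?n + de / 2))"
 unfolding powr_minus_divide powr_divide by simp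
 hence "L powr (?n / 2) * l powr (1 - ?n / 2) * (l / L) powr (?n + de / 2)
 = (l powr (1 - ?n / 2) * l powr (?n + de / 2)) * (L powr (?n / 2) * L powr (- (?n + de / 2)))" by (simp only: mult_ac)
 also have "... = l powr (1 + (?n + de) / 2) * L powr (- ((?n + de) / 2))"
 proof -
 have "(1 - ?n / 2) + (?n + de / 2) = 1 + (?n + de) / 2" by (simp add: add_divide_distrib)
 moreover have "?n / 2 + - (?n + de / 2) = - ((?n + de) / 2)" by (simp add: add_divide_distrib)
 ultimately show ?thesis by (simp only: powr_add[symmetric])
 qed
 finally show ?thesis unfolding powr_minus_divide by simp
 qed
 finally have "L powr (?n / 2) * norm (LI z. th z * g z) <= E * (D * C) * B * omega de P Q"
 unfolding omega_le_side[OF le] by (simp add: l_def L_def a_def b_def b'_def)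
 moreover have "(LI y. GG y * cubefn th P y) = cr (L powr (?n / 2)) * (LI z. th z * g z)"
 unfolding cubefn_integral g_def L_def b'_def by (simp add: mult.commute)
 ultimately show ?thesis by (simp add: GG_def norm_mult)
 qed
 thus ?thesis using E(1) D(1) C0 B0 by (intro exI[of _ "E * (D * C) * B"]) auto
qed

text \<open>The mean zero function is always the one produced from the smaller cube: the transpose
  of \<open>T\<close> on the function of \<open>Q\<close> if \<open>Q\<close> is not larger,
  \<open>T\<close> on the function of \<open>P\<close> otherwise.\<close>

theorem almost_diagonal:
 fixes ph ps :: "'n::finite fn"
 assumes d: "0 < de" "de <= 1" and SK: "SKm1 de T K"
 and ph: "ph : schwartz" "!!x. ph (- x) = ph x" "(LI x. ph x) = 0"
 and ps: "ps : schwartz" "!!x. ps (- x) = ps x" "(LI x. ps x) = 0"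
 and S0: "!!Q. cubefn ph Q : schwartz0" "!!Q. cubefn ps Q : schwartz0"
 and int_T: "!!Q. intl (%x. LI y. K x y * cubefn ps Q y) &
 (LI x. (LI y. K x y * cubefn ps Q y)) = 0"
 and int_Tt: "!!Q. intl (%x. LI y. K y x * cubefn ph Q y) &
 (LI x. (LI y. K y x * cubefn ph Q y)) = 0"
 shows "EX C>=0. ALL P Q. norm (T (cubefn ps P) (cubefn ph Q)) <= C * omega de P Q"
proof -
 obtain C where K: "KB de C K" and Kt: "KB de C (%x y. K y x)" using SKm1_KB[OF SK] by blast
 have T: "T f g = (LI x. (LI y. K x y * f y) * g x)" if "f : schwartz0" "g : schwartz0" for f g
 using SK that by (simp add: SKm1_def)
 obtain E1 where E1: "0 <= E1" "ALL P Q. side Q <= side P --> norm (LI y. (LI x. K x y * cubefn ph Q x) * cubefn ps P y) <= E1 * omega de P Q"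
 using almost_diagonal_one_sided[OF d K schwartz_rd[OF ph(1)] ph(2,3) ps(1) int_Tt] by blast
 obtain E2 where E2: "0 <= E2" "ALL P Q. side Q <= side P --> norm (LI y. (LI x. K y x * cubefn ps Q x) * cubefn ph P y) <= E2 * omega de P Q"
 using almost_diagonal_one_sided[OF d Kt schwartz_rd[OF ps(1)] ps(2,3) ph(1) int_T] by blast
 have "norm (T (cubefn ps P) (cubefn ph Q)) <= (E1 + E2) * omega de P Q" for P Q
 proof (cases "side Q <= side P")
 case True
 have "T (cubefn ps P) (cubefn ph Q) = (LI y. cubefn ps P y * (LI x. K x y * cubefn ph Q x))"
 unfolding T[OF S0(2) S0(1)]
 by (rule kernel_fubini[OF K schwartz_rd[OF schwartz0_schwartz[OF S0(2)]] schwartz_rd[OF schwartz0_schwartz[OF S0(1)]]])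
 hence "norm (T (cubefn ps P) (cubefn ph Q)) <= E1 * omega de P Q"
 using E1(2)[rule_format, OF True] by (simp add: mult.commute)
 also have "... <= (E1 + E2) * omega de P Q" using E2(1) by (intro mult_right_mono omega_nonneg) simp
 finally show ?thesis .
 next
 case False
 hence "norm (T (cubefn ps P) (cubefn ph Q)) <= E2 * omega de Q P"
 unfolding T[OF S0(2) S0(1)] using E2(2)[rule_format, of P Q] by simp
 also have "... <= (E1 + E2) * omega de P Q" unfolding omega_commute[of de Q P] using E1(1) by (intro mult_right_mono omega_nonneg) simp
 finally show ?thesis .
 qed
 thus ?thesis using E1(1) E2(1) by (intro exI[of _ "E1 + E2"]) auto
qed

section \<open>Wavelet coefficients and the Calderon formula\<close>

text \<open>Cancellation is exploited on the more concentrated factor: on the wavelet if the cube is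
  small, on \<open>f\<close>, rescaled to the cube, if the cube is large. Decay of any order is
  available here, so cancellation of full first order can be used in both cases.\<close>

lemma coefficient_bound:
 fixes et :: "'n::finite fn"
 assumes et: "et : schwartz" "(LI x. et x) = 0" and m: "CARD('n) + 1 < m"
 defines "M \<equiv> m + CARD('n) + 1"
 shows "EX C>=0. ALL f Q. f : schwartz & (LI x. f x) = 0 -->
 (side Q <= 1 --> norm (LI x. f x * cubefn et Q x) <= C * sobs M f * side Q powr (real CARD('n) / 2 + 1) * wt (real m) (corner Q)) &
 (1 <= side Q --> norm (LI x. f x * cubefn et Q x) <= C * sobs M f * side Q powr (- real CARD('n) / 2 - 1) * wt (real m) ((1 / side Q) *R corner Q))"
proof -
 let ?n = "real CARD('n)"
 have m1: "?n + 1 < real m" using m by linarith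
 have mM: "real m + (?n + 1) <= real M" by (simp add: M_def)
 obtain E where E: "0 <= E" "ALL (g::'n fn) f A B l a. g : BM & f : BM & 0 <= A &
 (ALL y. norm (g y) <= A * wt (real m) ((1 / l) *R (y - a))) & (LI y. g y) = 0 & LD (real M) B f & 0 < l & l <= 1 -->
 norm (LI y. f y * g y) <= E * A * B * l powr (?n + 1) * wt (real m) a"
 using cancellation[OF zero_less_one order_refl m1 mM] by blast
 define B where "B = 2 ^ M * sobs M et"
 have LDc: "LD (real M) B et" unfolding B_def by (rule schwartz_LD[OF et(1)])
 have B0: "0 <= B" by (rule LD_nonneg[OF LDc])
 have mM': "real m <= real M" by (simp add: M_def)
 have cet: "norm (et x) <= B * wt (real m) x" for x
 using LD_norm[OF LDc, of x] mult_left_mono[OF wt_mono[OF mM', of x] B0] by linarith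
 have etm [measurable]: "et : BM" using rd_measurable[OF schwartz_rd[OF et(1)]] .
 define C where "C = E * B * 2 ^ M"
 have "(side Q <= 1 --> norm (LI x. f x * cubefn et Q x) <= C * sobs M f * side Q powr (?n / 2 + 1) * wt (real m) (corner Q)) &
 (1 <= side Q --> norm (LI x. f x * cubefn et Q x) <= C * sobs M f * side Q powr (- ?n / 2 - 1) * wt (real m) ((1 / side Q) *R corner Q))"
 if f: "f : schwartz" "(LI x. f x) = 0" for f :: "'n fn" and Q
 proof (intro conjI impI)
 define l where "l = side Q" define b where "b = corner Q"
 have l: "0 < l" by (simp add: l_def)
 define A where "A = 2 ^ M * sobs M f"
 have LDf: "LD (real M) A f" unfolding A_def by (rule schwartz_LD[OF f(1)])
 have A0: "0 <= A" by (rule LD_nonneg[OF LDf])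
 have [measurable]: "f : BM" using rd_measurable[OF schwartz_rd[OF f(1)]] .
 {
 assume "side Q <= 1"
 hence l1: "l <= 1" by (simp add: l_def)
 have "norm (LI y. f y * cubefn et Q y) <= E * (l powr (- ?n / 2) * B) * A * l powr (?n + 1) * wt (real m) b"
 proof (rule E(2)[rule_format], intro conjI allI)
 show "cubefn et Q : BM" unfolding cubefn_scale[abs_def] by measurable
 show "norm (cubefn et Q y) <= l powr (- ?n / 2) * B * wt (real m) ((1 / l) *R (y - b))" for y
 unfolding cubefn_scale l_def b_def using mult_left_mono[OF cet, of "side Q powr (- ?n / 2)" "(1 / side Q) *R (y - corner Q)"]
 by (simp add: norm_mult mult.assoc)
 show "(LI y. cubefn et Q y) = 0" by (simp add: cubefn_integral_nofactor et(2))
 qed (use LDf l l1 B0 in auto)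
 also have "... = C * sobs M f * (l powr (- ?n / 2) * l powr (?n + 1)) * wt (real m) b" by (simp add: C_def A_def mult_ac)
 also have "l powr (- ?n / 2) * l powr (?n + 1) = l powr (?n / 2 + 1)" by (subst powr_add[symmetric]) simp
 finally show "norm (LI x. f x * cubefn et Q x) <= C * sobs M f * side Q powr (?n / 2 + 1) * wt (real m) (corner Q)"
 by (simp add: l_def b_def)
 }
 {
 assume "1 <= side Q"
 hence l1: "1 <= l" by (simp add: l_def)
 define a where "a = - (1 / l) *R b"
 have fm: "norm (f x) <= A * wt (real m) x" for x
 using LD_norm[OF LDf, of x] mult_left_mono[OF wt_mono[OF mM', of x] A0] by linarith
 have "norm (LI z. et z * f (b + l *R z)) <= E * A * B * (1 / l) powr (?n + 1) * wt (real m) a"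
 proof (rule E(2)[rule_format], intro conjI allI)
 show "(%z. f (b + l *R z)) : BM" by measurable
 show "norm (f (b + l *R z)) <= A * wt (real m) ((1 / (1 / l)) *R (z - a))" for z
 proof -
 have "(1 / (1 / l)) *R (z - a) = b + l *R z" using l by (simp add: a_def algebra_simps)
 thus ?thesis using fm[of "b + l *R z"] by simp
 qed
 show "(LI z. f (b + l *R z)) = 0" using l f(2) by (subst integral_affine) auto
 qed (use LDc l l1 A0 in auto)
 hence "l powr (?n / 2) * norm (LI z. et z * f (b + l *R z)) <= l powr (?n / 2) * (E * A * B * (1 / l) powr (?n + 1) * wt (real m) a)"
 by (rule mult_left_mono) simp
 also have "... = C * sobs M f * (l powr (?n / 2) * (1 / l) powr (?n + 1)) * wt (real m) a" by (simp add: C_def A_def mult_ac)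
 also have "l powr (?n / 2) * (1 / l) powr (?n + 1) = l powr (- ?n / 2 - 1)"
 proof -
 have "(1 / l) powr (?n + 1) = l powr (- (?n + 1))" using l by (simp only: powr_minus_divide powr_divide powr_one_eq_one)
 moreover have "?n / 2 + - (?n + 1) = - ?n / 2 - 1" by simp
 ultimately show ?thesis by (simp only: powr_add[symmetric])
 qed
 also have "wt (real m) a = wt (real m) ((1 / l) *R b)" unfolding a_def scaleR_minus_left by (rule wt_minus)
 finally show "norm (LI x. f x * cubefn et Q x) <= C * sobs M f * side Q powr (- ?n / 2 - 1) * wt (real m) ((1 / side Q) *R corner Q)"
 unfolding cubefn_integral l_def b_def by (simp add: norm_mult mult.commute[of "et _"])
 }
 qed
 moreover have "0 <= C" using E(1) B0 by (simp add: C_def)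
 ultimately show ?thesis by blast
qed

lemma nn_integral_int_geometric:
 assumes c: "0 < c"
 shows "(NS nu. en (p2 (- (c * \<bar>ri nu\<bar>)))) < \<infinity>"
proof -
 let ?g = "%k::nat. en (p2 (- (real k * c)))"
 have "en (p2 (- (c * \<bar>ri nu\<bar>))) <= (NS k. ?g k * ind {int k, - int k} nu)" for nu
 proof -
 have "en (p2 (- (c * \<bar>ri nu\<bar>))) = (NS k. ?g k * ind {int k, - int k} nu * ind {nat \<bar>nu\<bar>} k)"
 by (subst nn_integral_indicator_singleton) (auto simp: indicator_def mult.commute)
 also have "... <= (NS k. ?g k * ind {int k, - int k} nu)"
 by (intro nn_integral_mono) (auto simp: indicator_def)
 finally show ?thesis .
 qed
 hence "(NS nu. en (p2 (- (c * \<bar>ri nu\<bar>))))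
 <= (NS nu. (NS k. ?g k * ind {int k, - int k} nu))"
 by (intro nn_integral_mono)
 also have "... = (NS k. (NS nu. ?g k * ind {int k, - int k} nu))"
 by (rule nn_integral_count_space_nn_integral[symmetric]) auto
 also have "... <= (NS k. ?g k * 2)"
 proof (rule nn_integral_mono)
 fix k :: nat
 have "(NS nu. ?g k * ind {int k, - int k} nu) = ?g k * emeasure (count_space UNIV) {int k, - int k}"
 by (rule nn_integral_cmult_indicator) simp
 also have "emeasure (count_space UNIV) {int k, - int k} <= 2" by (auto simp: emeasure_count_space card_insert_if)
 finally show "(NS nu. ?g k * ind {int k, - int k} nu) <= ?g k * 2" by (simp add: mult_left_mono)
 qed
 also have "... = (\<Sum>k. ?g k) * 2" by (simp add: nn_integral_multc nn_integral_count_space_nat)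
 also have "... < \<infinity>"
 proof -
 have "(\<Sum>k. ?g k) < \<infinity>" using suminf_geometric_finite[OF c, of 1] by (simp only: mult_1_left zero_le_one)
 thus ?thesis unfolding mult_2_right infinity_ennreal_def by (simp only: ennreal_add_less_top)
 qed
 finally show ?thesis .
qed

lemma two_powr_le_1: "x <= 0 ==> 2 powr x <= (1::real)"
 using powr_mono[of x 0 "2::real"] by simp

lemma int_geometric_integrable:
 "0 < c ==> intc (%nu::int. p2 (- (c * \<bar>ri nu\<bar>)))"
 using nn_integral_int_geometric[of c] by (intro integrableI_nonneg) auto

lemma integral_cube:
 fixes F :: "int \<times> 'b::countable => complex"
 assumes F: "intc F"
 shows "(LC P. F P) = (LC nu. (LC k. F (nu, k)))"
proof -
 interpret A: sigma_finite_measure "count_space (UNIV::int set)" by (rule sigma_finite_count_space)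
 interpret B: sigma_finite_measure "count_space (UNIV::'b set)" by (rule sigma_finite_count_space)
 interpret pair_sigma_finite "count_space (UNIV::int set)" "count_space (UNIV::'b set)" by standard
 have eq: "count_space (UNIV::(int \<times> 'b) set) = count_space UNIV \<Otimes>\<^sub>M count_space UNIV"
 by (subst pair_measure_countable) auto
 show ?thesis using integral_fst'[of F] F unfolding eq by simp
qed

text \<open>The properties shared by \<phi> and \<psi>, which are all that is kept of them besides
  \<open>PU\<close>. The two functions can then be interchanged, as the transposed operator
  requires.\<close>

definition band :: "'n::finite fn => bool" where
 "band f = (f : schwartz & (ALL x. f (- x) = f x) & (ALL xi. ft f xi ~= 0 --> 1/2 < norm xi & norm xi < 2))"

lemma band_schwartz: "band f ==> f : schwartz" by (simp add: band_def)
lemma band_even: "band f ==> f (- x) = f x" by (simp add: band_def)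
lemma band_supp: "band f ==> ft f xi ~= 0 ==> 1/2 < norm xi & norm xi < 2" by (simp add: band_def)
lemma band_rd: "band f ==> rd f" using schwartz_rd band_schwartz by blast

lemma ft_0: "ft f 0 = (LI x. f x)" by (simp add: ft_def)

lemma band_integral: "band f ==> (LI x. f x) = 0"
 using band_supp[of f 0] by (auto simp: ft_0[symmetric])

lemma ft_cubefn:
 fixes f :: "'n::finite fn"
 shows "ft (cubefn f Q) xi = cr (side Q powr (real CARD('n) / 2)) * ech xi (corner Q) * ft f (side Q *R xi)"
proof -
 have "ft (cubefn f Q) xi = (LI x. ech xi x * cubefn f Q x)" by (simp add: ft_def mult.commute)
 also have "... = cr (side Q powr (real CARD('n) / 2)) * (LI z. ech xi (corner Q + side Q *R z) * f z)"
 by (rule cubefn_integral)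
 also have "(%z. ech xi (corner Q + side Q *R z) * f z) = (%z. ech xi (corner Q) * (f z * ech (side Q *R xi) z))"
 by (rule ext) (simp add: ech_add ech_scaleR)
 finally show ?thesis by (simp add: ft_def)
qed

lemma cubefn_affine: "cubefn f Q = (%x. cr (p2 (ri (fst Q) * real CARD('n) / 2)) * f (- cvec (snd Q) + tp (fst Q) *R x))"
 for f :: "'n::finite fn"
 by (rule ext) (simp add: cubefn_def)

lemma schwartz_cubefn: "f : schwartz ==> cubefn f Q : schwartz"
 unfolding cubefn_affine by (rule schwartz_affine) auto

lemma band_cubefn: "band f ==> cubefn f Q : schwartz0"
proof -
 assume f: "band f"
 show ?thesis
 proof (rule schwartz0_if_vanish_near_0[of _ "1 / (2 * side Q)"])
 show "cubefn f Q : schwartz" by (rule schwartz_cubefn[OF band_schwartz[OF f]])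
 fix xi :: "real^'a" assume "norm xi < 1 / (2 * side Q)"
 hence "norm (side Q *R xi) < 1/2" using side_pos[of Q] by (simp add: field_simps)
 hence "ft f (side Q *R xi) = 0" using band_supp[OF f, of "side Q *R xi"] by (meson less_asym)
 thus "ft (cubefn f Q) xi = 0" by (simp add: ft_cubefn)
 qed simp
qed

text \<open>The constant is (2 pi)^n because each of the two transforms \<open>ft\<close> lacks a
  factor (2 pi)^(-n/2). The origin is excluded, where for functions in \<open>band\<close> all terms
  vanish.\<close>

definition PU :: "'n::finite fn => 'n fn => bool" where
 "PU f g \<longleftrightarrow> (ALL xi. xi ~= 0 --> (LC nu::int. ft f (tm nu *R xi) * ft g (tm nu *R xi)) = cr ((2 * pi) ^ CARD('n)))"

lemma PU_commute: "PU f g ==> PU g f" by (simp add: PU_def mult.commute)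

lemma poisson_samples:
 fixes f :: "'n::finite fn"
 assumes f: "rd f" and sf: "!!xi. ft f xi ~= 0 ==> norm xi < 2" and xi: "norm xi < 2"
 shows "(LC k. f (cvec k) * ech xi (cvec k)) = ft f xi"
proof -
 have shift: "ft (%x. f x * ech xi x) et = ft f (xi + et)" for et
 by (simp add: ft_def ech_add_freq mult.assoc)
 have "(LC k. (%x. f x * ech xi x) (0 + cvec k)) = ft (%x. f x * ech xi x) 0"
 proof (rule poisson_summation[OF rd_dec[OF rd_mult_ech[OF f]], of "real CARD('n) + 1"])
 fix l :: "int^'n" assume "l ~= 0"
 hence "1 <= norm (cvec l)" by (rule norm_cvec_ge_1)
 hence "2 * pi <= norm ((2 * pi) *R cvec l)" by simp
 moreover have "norm ((2 * pi) *R cvec l) <= norm (xi + (2 * pi) *R cvec l) + norm xi"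
 using norm_triangle_ineq4[of "xi + (2 * pi) *R cvec l" xi] by simp
 ultimately have "~ norm (xi + (2 * pi) *R cvec l) < 2" using xi pi_ge_two by linarith
 thus "ft (%x. f x * ech xi x) ((2 * pi) *R cvec l) = 0" unfolding shift using sf by blast
 qed simp
 thus ?thesis unfolding shift by simp
qed

lemma lattice_sum_wt_ex:
 assumes m: "real CARD('n::finite) < m"
 shows "EX C>=0. ALL h (x::real^'n). 0 < h & h <= 1 -->
 (NS k. en (h ^ CARD('n) * wt m (h *R cvec k + x))) <= en C"
proof (rule lattice_sum_wt_bound[OF m])
 fix C assume C: "0 <= C" "!!h (x::real^'n). 0 < h ==> h <= 1 ==>
 (NS k. en (h ^ CARD('n) * wt m (h *R cvec k + x))) <= en C"
 show ?thesis by (intro exI[of _ C] conjI allI impI C) auto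
qed

lemma lattice_sum_wt_unit:
 assumes m: "real CARD('n::finite) < m"
 shows "EX C>=0. ALL x::real^'n. (NS k. en (wt m (x - cvec k))) <= en C"
proof -
 obtain C where C: "0 <= C" "ALL h (x::real^'n). 0 < h & h <= 1 -->
 (NS k. en (h ^ CARD('n) * wt m (h *R cvec k + x))) <= en C" using lattice_sum_wt_ex[OF m] by blast
 have "(NS k. en (wt m (x - cvec k))) <= en C" for x :: "real^'n"
 proof -
 have "wt m (x - cvec k) = wt m (cvec k + - x)" for k by (subst wt_diff_commute) simp
 thus ?thesis using C(2)[rule_format, of 1 "- x"] by simp
 qed
 thus ?thesis using C(1) by blast
qed

text \<open>The majorant of \<open>coefficient_bound\<close> as a function of the scale
  \<open>nu\<close> and the position \<open>k\<close>; nonnegative \<open>nu\<close> are the small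
  cubes.\<close>

definition cbd :: "nat => int => int^'n::finite => real" where
 "cbd m nu k = (if 0 <= nu then (tm nu) powr (real CARD('n) / 2 + 1) * wt (real m) (tm nu *R cvec k)
 else (tm nu) powr (- real CARD('n) / 2 - 1) * wt (real m) (cvec k))"

lemma cbd_nonneg: "0 <= cbd m nu k" by (simp add: cbd_def)

lemma coefficient_cbd:
 fixes et :: "'n::finite fn"
 assumes et: "band et" and m: "CARD('n) + 1 < m"
 shows "EX C>=0. ALL f nu k. f : schwartz & (LI x. f x) = 0 -->
 norm (LI x. f x * cubefn et (nu, k) x) <= C * sobs (m + CARD('n) + 1) f * cbd m nu k"
proof -
 obtain C where C: "0 <= C" "ALL f Q. f : schwartz & (LI x. f x) = 0 -->
 (side Q <= 1 --> norm (LI x. f x * cubefn et Q x) <= C * sobs (m + CARD('n) + 1) f * side Q powr (real CARD('n) / 2 + 1) * wt (real m) (corner Q)) &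
 (1 <= side Q --> norm (LI x. f x * cubefn et Q x) <= C * sobs (m + CARD('n) + 1) f * side Q powr (- real CARD('n) / 2 - 1) * wt (real m) ((1 / side Q) *R corner Q))"
 using coefficient_bound[OF band_schwartz[OF et] band_integral[OF et] m] by blast
 have "norm (LI x. f x * cubefn et (nu, k) x) <= C * sobs (m + CARD('n) + 1) f * cbd m nu k"
 if f: "f : schwartz" "(LI x. f x) = 0" for f :: "'n fn" and nu k
 proof -
 have s: "side (nu, k) = tm nu" "corner (nu, k) = tm nu *R cvec k" by (simp_all add: side_def corner_def)
 show ?thesis
 proof (cases "0 <= nu")
 case True
 hence "side (nu, k) <= 1" by (simp add: side_def two_powr_le_1)
 hence "norm (LI x. f x * cubefn et (nu, k) x) <= C * sobs (m + CARD('n) + 1) f * side (nu, k) powr (real CARD('n) / 2 + 1) * wt (real m) (corner (nu, k))"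
 using C(2)[rule_format, of f "(nu, k)"] f by blast
 thus ?thesis using True unfolding s cbd_def by (simp add: mult.assoc)
 next
 case False
 hence "1 <= side (nu, k)" by (simp add: side_def ge_one_powr_ge_zero)
 hence "norm (LI x. f x * cubefn et (nu, k) x) <= C * sobs (m + CARD('n) + 1) f * side (nu, k) powr (- real CARD('n) / 2 - 1) * wt (real m) ((1 / side (nu, k)) *R corner (nu, k))"
 using C(2)[rule_format, of f "(nu, k)"] f by blast
 thus ?thesis using False unfolding s cbd_def by (simp add: mult.assoc)
 qed
 qed
 thus ?thesis using C(1) by blast
qed

lemma nn_integral_count_cmult:
 "0 <= c ==> (\<integral>\<^sup>+k. en (c * f k) \<partial>count_space A) = en c * (\<integral>\<^sup>+k. en (f k) \<partial>count_space A)"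
 by (simp add: ennreal_mult' nn_integral_cmult)

lemma cbd_sum:
 assumes m: "CARD('n::finite) < m"
 shows "EX C>=0. ALL nu. (NS k. en (cbd m nu (k::int^'n) * tm nu powr (real CARD('n) / 2))) <= en (C * p2 (- \<bar>ri nu\<bar>))"
proof -
 let ?n = "real CARD('n)"
 obtain C where C: "0 <= C" "ALL h (x::real^'n). 0 < h & h <= 1 -->
 (NS k. en (h ^ CARD('n) * wt (real m) (h *R cvec k + x))) <= en C" using lattice_sum_wt_ex[of "real m"] m by auto
 have "(NS k. en (cbd m nu (k::int^'n) * tm nu powr (?n / 2))) <= en (C * p2 (- \<bar>ri nu\<bar>))" for nu
 proof -
 define l where "l = tm nu"
 have l: "0 < l" by (simp add: l_def)
 show ?thesis
 proof (cases "0 <= nu")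
 case True
 hence l1: "l <= 1" by (simp add: l_def two_powr_le_1)
 have e: "cbd m nu k * l powr (?n / 2) = l * (l ^ CARD('n) * wt (real m) (l *R cvec k + 0))" for k :: "int^'n"
 proof -
 have "l powr (?n / 2 + 1) * l powr (?n / 2) = l * l ^ CARD('n)" using l by (simp only: powr_add[symmetric] powr_realpow[symmetric]) (simp add: powr_add powr_one)
 thus ?thesis using True by (simp add: cbd_def l_def[symmetric] mult_ac)
 qed
 have "(NS k. en (cbd m nu (k::int^'n) * l powr (?n / 2))) = en l * (NS k. en (l ^ CARD('n) * wt (real m) (l *R cvec (k::int^'n) + 0)))"
 unfolding e using l by (intro nn_integral_count_cmult) simp
 also have "... <= en l * en C" using C(2)[rule_format, of l 0] l l1 by (intro mult_left_mono) auto
 also have "... = en (C * p2 (- \<bar>ri nu\<bar>))" using True l C(1) by (simp add: l_def ennreal_mult'[symmetric] mult.commute)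
 finally show ?thesis by (simp add: l_def)
 next
 case False
 have e: "cbd m nu k * l powr (?n / 2) = l powr (- 1) * (1 ^ CARD('n) * wt (real m) (1 *R cvec k + 0))" for k :: "int^'n"
 proof -
 have "l powr (- ?n / 2 - 1) * l powr (?n / 2) = l powr (- 1)" using l by (simp only: powr_add[symmetric]) simp
 thus ?thesis using False by (simp add: cbd_def l_def[symmetric] mult_ac)
 qed
 have "(NS k. en (cbd m nu (k::int^'n) * l powr (?n / 2))) = en (l powr (- 1)) * (NS k. en (1 ^ CARD('n) * wt (real m) (1 *R cvec (k::int^'n) + 0)))"
 unfolding e by (intro nn_integral_count_cmult) simp
 also have "... <= en (l powr (- 1)) * en C" using C(2)[rule_format, of 1 0] by (intro mult_left_mono) auto
 also have "... = en (C * p2 (- \<bar>ri nu\<bar>))"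
 proof -
 have "l powr (- 1) = p2 (- \<bar>ri nu\<bar>)" using False by (simp only: l_def powr_powr) simp
 thus ?thesis using C(1) by (simp only: ennreal_mult'[symmetric] powr_ge_zero mult.commute[of C])
 qed
 finally show ?thesis by (simp add: l_def)
 qed
 qed
 thus ?thesis using C(1) by blast
qed

text \<open>The weight of order n + 1/2 is a compromise: it has to be integrable in
  \<open>x\<close>, and at coarse scales of side \<open>l\<close> stretching it costs the power n +
  1/2 of \<open>l\<close> against the available power -n - 1, so that decay in the scale
  survives.\<close>

lemma scale_sum_bound:
 fixes ze :: "'n::finite fn"
 assumes ze: "rd ze" and m: "2 * CARD('n) + 2 < m"
 shows "EX C>=0. ALL nu x. (NS k. en (cbd m nu k * norm (cubefn ze (nu, k) x)))
 <= en (C * p2 (- (1/2 * \<bar>ri nu\<bar>)) * wt (real CARD('n) + 1/2) x)"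
proof -
 let ?n = "real CARD('n)" and ?mu = "real CARD('n) + 1/2"
 let ?A = "%l x k. (1 / l) *R x - cvec k"
 let ?B = "%nu. - (1/2 * \<bar>ri nu\<bar>)"
 let ?C = "%nu k x. cubefn ze (nu, k) x"
 let ?D = "%x l k. wt ?mu (x - l *R cvec k) * wt (?n + 1) (?A l x k)"
 let ?E = "%l k x. wt ?mu (l *R cvec k) * wt ?mu (x - l *R cvec k)"
 define N where "N = ?mu + (?n + 1)"
 obtain B where B: "0 <= B" "!!x. norm (ze x) <= B * wt N x" using decE[OF rd_dec[OF ze]] by blast
 obtain C where C: "0 <= C" "ALL x::real^'n. (NS k. en (wt (?n + 1) (x - cvec k))) <= en C"
 using lattice_sum_wt_unit[of "?n + 1", where 'n='n] by auto
 have mu: "?mu <= real m" using m by simp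
 have "(NS k. en (cbd m nu k * norm (?C nu k x)))
 <= en (B * C * p2 (?B nu) * wt ?mu x)" for nu x
 proof -
 define l where "l = tm nu"
 have l: "0 < l" by (simp add: l_def)
 have s: "side (nu, k) = l" "corner (nu, k) = l *R cvec k" for k :: "int^'n" by (simp_all add: side_def corner_def l_def)
 have "(1 / l) *R (x - l *R cvec k) = (1 / l) *R x - cvec k" for k using l by (simp add: scaleR_diff_right)
 hence cz: "norm (?C nu k x) <= l powr (- ?n / 2) * (B * (wt ?mu (?A l x k) * wt (?n + 1) (?A l x k)))" for k
 unfolding cubefn_scale s wt_mult N_def[symmetric] using mult_left_mono[OF B(2)[of "(1 / l) *R x - cvec k"], of "l powr (- ?n / 2)"] by (simp add: norm_mult)
 have key: "cbd m nu k * norm (?C nu k x) <= B * p2 (?B nu) * wt ?mu x * wt (?n + 1) (?A l x k)" for k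
 proof (cases "0 <= nu")
 case True
 hence l1: "l <= 1" by (simp add: l_def two_powr_le_1)
 have "cbd m nu k * norm (?C nu k x)
 <= (l powr (?n / 2 + 1) * wt ?mu (l *R cvec k)) * (l powr (- ?n / 2) * (B * ?D x l k))"
 proof (rule mult_mono)
 show "cbd m nu k <= l powr (?n / 2 + 1) * wt ?mu (l *R cvec k)"
 using True wt_mono[OF mu, of "l *R cvec k"] by (simp add: cbd_def l_def[symmetric] mult_left_mono)
 have "norm (x - l *R cvec k) <= norm (?A l x k)"
 proof -
 have "x - l *R cvec k = l *R (?A l x k)" using l by (simp add: scaleR_diff_right)
 hence "norm (x - l *R cvec k) = l * norm (?A l x k)" using l by simp
 also have "... <= 1 * norm (?A l x k)" by (rule mult_right_mono[OF l1]) simp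
 finally show ?thesis by simp
 qed
 hence "wt ?mu (?A l x k) <= wt ?mu (x - l *R cvec k)" by (intro wt_antimono_norm) auto
 thus "norm (?C nu k x) <= l powr (- ?n / 2) * (B * ?D x l k)"
 using B(1) by (intro order.trans[OF cz] mult_left_mono mult_right_mono) auto
 qed (use B(1) in auto)
 also have "... = (l powr (?n / 2 + 1) * l powr (- ?n / 2)) * B * ?E l k x * wt (?n + 1) (?A l x k)"
 by (simp only: mult_ac)
 also have "l powr (?n / 2 + 1) * l powr (- ?n / 2) = l" using l by (simp only: powr_add[symmetric]) (simp add: powr_one)
 also have "l * B * ?E l k x * wt (?n + 1) (?A l x k)
 <= p2 (?B nu) * B * wt ?mu x * wt (?n + 1) (?A l x k)"
 proof (intro mult_right_mono mult_mono)
 show "l <= p2 (?B nu)" unfolding l_def using True by (intro powr_mono) auto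
 show "wt ?mu (l *R cvec k) * wt ?mu (x - l *R cvec k) <= wt ?mu x" using wt_add_ge[of ?mu "l *R cvec k" "x - l *R cvec k"] by simp
 qed (use B(1) in auto)
 finally show ?thesis by (simp only: mult_ac)
 next
 case False
 hence l1: "1 <= l" by (simp add: l_def ge_one_powr_ge_zero)
 have "cbd m nu k * norm (?C nu k x)
 <= (l powr (- ?n / 2 - 1) * wt ?mu (cvec k)) * (l powr (- ?n / 2) * (B * (wt ?mu (?A l x k) * wt (?n + 1) (?A l x k))))"
 proof (rule mult_mono[OF _ cz])
 show "cbd m nu k <= l powr (- ?n / 2 - 1) * wt ?mu (cvec k)"
 using False wt_mono[OF mu, of "cvec k"] by (simp add: cbd_def l_def[symmetric] mult_left_mono)
 qed (use B(1) in auto)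
 also have "... = (l powr (- ?n / 2 - 1) * l powr (- ?n / 2)) * B * (wt ?mu (cvec k) * wt ?mu (?A l x k)) * wt (?n + 1) (?A l x k)"
 by (simp only: mult_ac)
 also have "l powr (- ?n / 2 - 1) * l powr (- ?n / 2) = l powr (- ?n - 1)" by (simp only: powr_add[symmetric]) simp
 also have "l powr (- ?n - 1) * B * (wt ?mu (cvec k) * wt ?mu (?A l x k)) * wt (?n + 1) (?A l x k)
 <= l powr (- ?n - 1) * B * (l powr ?mu * wt ?mu x) * wt (?n + 1) (?A l x k)"
 proof (intro mult_right_mono mult_left_mono)
 have "wt ?mu (cvec k) * wt ?mu (?A l x k) <= wt ?mu ((1 / l) *R x)" using wt_add_ge[of ?mu "cvec k" "(1 / l) *R x - cvec k"] by simp
 also have "... <= l powr ?mu * wt ?mu x"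
 proof -
 have "(1 + norm x) / l <= 1 + norm ((1 / l) *R x)" using l l1 by (simp add: field_simps)
 hence "(1 + norm ((1 / l) *R x)) powr (- ?mu) <= ((1 + norm x) / l) powr (- ?mu)"
 using l by (intro powr_mono2') (auto simp: add_pos_nonneg)
 also have "... = l powr ?mu * wt ?mu x" unfolding powr_divide powr_minus_divide[of l] wt_def by simp
 finally show ?thesis by (simp add: wt_def)
 qed
 finally show "wt ?mu (cvec k) * wt ?mu (?A l x k) <= l powr ?mu * wt ?mu x" .
 qed (use B(1) in auto)
 also have "... = (l powr (- ?n - 1) * l powr ?mu) * B * wt ?mu x * wt (?n + 1) (?A l x k)" by (simp only: mult_ac)
 also have "l powr (- ?n - 1) * l powr ?mu = l powr (- (1/2))"
 proof -
 have "(- ?n - 1) + ?mu = - (1/2)" by simp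
 thus ?thesis by (simp only: powr_add[symmetric])
 qed
 also have "l powr (- (1/2)) = p2 (?B nu)" using False by (simp add: l_def powr_powr)
 finally show ?thesis by (simp only: mult_ac)
 qed
 have "(NS k. en (cbd m nu k * norm (?C nu k x)))
 <= (NS k. en (B * p2 (?B nu) * wt ?mu x) * en (wt (?n + 1) (?A l x k)))"
 using key B(1) by (intro nn_integral_mono) (simp add: ennreal_mult'[symmetric] ennreal_leI)
 also have "... = en (B * p2 (?B nu) * wt ?mu x) * (NS k. en (wt (?n + 1) (?A l x k)))"
 by (rule nn_integral_cmult) simp
 also have "... <= en (B * p2 (?B nu) * wt ?mu x) * en C"
 using C(2) by (intro mult_left_mono) auto
 also have "... = en (B * C * p2 (?B nu) * wt ?mu x)"
 using B(1) C(1) by (subst ennreal_mult[symmetric]) (auto simp: mult_ac)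
 finally show ?thesis .
 qed
 thus ?thesis using B(1) C(1) by (intro exI[of _ "B * C"]) auto
qed

lemma count_integrableI:
 fixes f :: "'a => 'b::{banach, second_countable_topology}"
 assumes "(NS k. en (norm (f k))) <= en C"
 shows "intc f" "norm (LC k. f k) <= max 0 C"
proof -
 show i: "intc f" by (rule integrableI_bounded) (use assms in \<open>auto intro: le_less_trans\<close>)
 have "en (norm (LC k. f k)) <= en C" by (rule order.trans[OF integral_norm_bound_ennreal[OF i] assms])
 thus "norm (LC k. f k) <= max 0 C"
 by (cases "0 <= C") (auto simp: ennreal_le_iff ennreal_neg le_max_iff_disj)
qed

lemma ft_series:
 fixes G :: "int => 'n::finite fn"
 assumes G: "!!nu. G nu : BM" and w: "intc w" and W: "intl W"
 and le: "!!nu x. norm (G nu x) <= w nu * W x"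
 shows "ft (%x. LC nu. G nu x) xi = (LC nu. ft (G nu) xi)"
proof -
 interpret A: sigma_finite_measure "count_space (UNIV::int set)" by (rule sigma_finite_count_space)
 interpret pair_sigma_finite "count_space (UNIV::int set)" "lborel :: (real^'n) measure" by standard
 let ?h = "%(nu, x). G nu x * ech xi x"
 have m: "?h : bm (count_space UNIV \<Otimes>\<^sub>M lborel)"
 by (rule measurable_pair_measure_countable1) (use G in auto)
 have "(\<integral>\<^sup>+p. norm (?h p) \<partial>(count_space UNIV \<Otimes>\<^sub>M lborel)) = (NS nu. (NI x. norm (G nu x * ech xi x)))"
 using m by (subst lborel.nn_integral_fst[symmetric]) auto
 also have "... <= (NS nu. (NI x. en (norm (w nu)) * en (norm (W x))))"
 proof (intro nn_integral_mono)
 fix nu x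
 have "norm (G nu x * ech xi x) <= norm (w nu) * norm (W x)" using le[of nu x] by (simp add: norm_mult abs_mult[symmetric] order.trans[OF _ abs_ge_self])
 thus "en (norm (G nu x * ech xi x)) <= en (norm (w nu)) * en (norm (W x))" by (simp add: ennreal_mult'[symmetric] ennreal_leI)
 qed
 also have "... = (NS nu. en (norm (w nu))) * (NI x. en (norm (W x)))"
 using W by (simp add: nn_integral_cmult nn_integral_multc)
 also have "... < \<infinity>" using w W by (simp add: integrable_iff_bounded ennreal_mult_less_top)
 finally have i: "integrable (count_space UNIV \<Otimes>\<^sub>M lborel) ?h" using m by (intro integrableI_bounded)
 have "ft (%x. LC nu. G nu x) xi = (LI x. (LC nu. G nu x * ech xi x))"
 unfolding ft_def by (simp only: integral_mult_left_zero)
 also have "... = (LC nu. (LI x. G nu x * ech xi x))"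
 by (rule Fubini_integral) (use i in simp)
 finally show ?thesis by (simp add: ft_def)
qed

definition coef :: "'n::finite fn => 'n fn => 'n cube => complex" where
 "coef f et Q = (LI x. f x * cubefn et Q x)"

text \<open>The sum over one scale is a lattice convolution with the samples of a band limited
  function; by Poisson summation its transform is \<open>ft f\<close> times one term of
  \<open>PU\<close>. Summing the scales gives both sides the same transform, and
  \<open>ft_inject\<close> concludes. The first claim, summability with a weight in the side length,
  is what later allows the series to be integrated term by term.\<close>

theorem calderon:
 fixes et ze f :: "'n::finite fn"
 assumes et: "band et" and ze: "band ze" and PU: "PU et ze" and f: "f : schwartz" "(LI x. f x) = 0"
 shows "intc (%P. norm (coef f et P) * side P powr (real CARD('n) / 2))"
 and "intc (%P. coef f et P * cubefn ze P x)"
 and "(LC P. coef f et P * cubefn ze P x) = cr ((2 * pi) ^ CARD('n)) * f x"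
proof -
 let ?n = "real CARD('n)" and ?mu = "real CARD('n) + 1/2"
 let ?A = "%f nu k. norm (coef f et (nu, k)) * side (nu, k) powr (?n / 2)"
 let ?B = "(2 * pi) ^ CARD('n)"
 let ?C = "%m nu k x. cbd m nu k * norm (cubefn ze (nu, k) x)"
 let ?D = "%f nu k x. coef f et (nu, k) * cubefn ze (nu, k) x"
 let ?E = "%m nu k. cbd m nu (k::int^'n) * tm nu powr (?n / 2)"
 let ?F = "%f. NS P. en (norm (coef f et P) * side P powr (?n / 2))"
 let ?G = "%nu. - (1/2 * \<bar>ri nu\<bar>)"
 let ?H = "%nu. - (1 * \<bar>ri nu\<bar>)"
 let ?J = "%f x. NS P. en (norm (coef f et P * cubefn ze P x))"
 let ?K = "%f xi nu. ft f xi * (ft et (tm nu *R xi) * ft ze (tm nu *R xi))"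
 define m where "m = 2 * CARD('n) + 3"
 have m: "CARD('n) + 1 < m" "2 * CARD('n) + 2 < m" "CARD('n) < m" by (simp_all add: m_def)
 obtain A where A: "0 <= A" "ALL f nu k. f : schwartz & (LI x. f x) = 0 -->
 norm (LI x. f x * cubefn et (nu, k) x) <= A * sobs (m + CARD('n) + 1) f * cbd m nu k" using coefficient_cbd[OF et m(1)] by blast
 define A' where "A' = A * sobs (m + CARD('n) + 1) f"
 have A'0: "0 <= A'" using A(1) sobs_nonneg[OF f(1)] by (simp add: A'_def)
 have a: "norm (coef f et (nu, k)) <= A' * cbd m nu k" for nu k using A(2) f unfolding coef_def A'_def by blast
 obtain C1 where C1: "0 <= C1" "ALL nu. (NS k. en (?E m nu k)) <= en (C1 * p2 (- \<bar>ri nu\<bar>))"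
 using cbd_sum[OF m(3)] by blast
 obtain C2 where C2: "0 <= C2" "ALL nu x. (NS k. en (?C m nu k x))
 <= en (C2 * p2 (?G nu) * wt ?mu x)" using scale_sum_bound[OF band_rd[OF ze] m(2)] by blast
 show "intc (%P. norm (coef f et P) * side P powr (?n / 2))"
 proof (rule integrableI_nonneg)
 have "(?F f)
 = (NS nu. (NS k. en (?A f nu k)))"
 by (rule nn_integral_fst_count_space[symmetric])
 also have "... <= (NS nu. en A' * en (C1 * p2 (?H nu)))"
 proof (rule nn_integral_mono)
 fix nu
 have "(NS k. en (?A f nu k))
 <= (NS k. en A' * en (?E m nu k))"
 proof (rule nn_integral_mono)
 fix k
 have "norm (coef f et (nu, k)) * side (nu, k) powr (?n / 2) <= A' * (cbd m nu k * tm nu powr (?n / 2))"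
 using mult_right_mono[OF a[of nu k], of "tm nu powr (?n / 2)"] by (simp add: side_def mult.assoc)
 thus "en (?A f nu k) <= en A' * en (cbd m nu k * tm nu powr (?n / 2))"
 using A'0 by (simp add: ennreal_mult'[symmetric] ennreal_leI)
 qed
 also have "... = en A' * (NS k. en (?E m nu k))"
 by (rule nn_integral_cmult) simp
 also have "... <= en A' * en (C1 * p2 (- \<bar>ri nu\<bar>))" using C1(2) by (intro mult_left_mono) auto
 finally show "(NS k. en (?A f nu k)) <= en A' * en (C1 * p2 (?H nu))" by simp
 qed
 also have "... = en A' * (en C1 * (NS nu. en (p2 (?H nu))))"
 using C1(1) by (simp add: nn_integral_cmult ennreal_mult')
 also have "... < \<infinity>" using nn_integral_int_geometric[of 1] by (simp add: ennreal_mult_less_top)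
 finally show "(?F f) < \<infinity>" .
 qed auto
 define w where "w nu = A' * C2 * p2 (?G nu)" for nu :: int
 have w0: "0 <= w nu" for nu using A'0 C2(1) by (simp add: w_def)
 have wi: "intc w" unfolding w_def[abs_def] by (intro integrable_mult_right int_geometric_integrable) simp
 have abs: "(NS k. en (norm (?D f nu k x))) <= en (w nu * wt ?mu x)" for nu x
 proof -
 have "(NS k. en (norm (?D f nu k x)))
 <= (NS k. en A' * en (?C m nu k x))"
 proof (rule nn_integral_mono)
 fix k
 have "norm (?D f nu k x) <= A' * ?C m nu k x"
 using mult_right_mono[OF a[of nu k] norm_ge_zero[of "cubefn ze (nu, k) x"]] by (simp add: norm_mult mult.assoc)
 thus "en (norm (?D f nu k x)) <= en A' * en (?C m nu k x)"
 using A'0 by (simp add: ennreal_mult'[symmetric] ennreal_leI)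
 qed
 also have "... = en A' * (NS k. en (?C m nu k x))" by (rule nn_integral_cmult) simp
 also have "... <= en A' * en (C2 * p2 (?G nu) * wt ?mu x)" using C2(2) by (intro mult_left_mono) auto
 also have "... = en (w nu * wt ?mu x)" using A'0 C2(1) by (simp add: w_def ennreal_mult'[symmetric] mult.assoc)
 finally show ?thesis .
 qed
 show ix: "intc (%P. coef f et P * cubefn ze P x)" for x
 proof (rule integrableI_bounded)
 have "(?J f x)
 = (NS nu. (NS k. en (norm (?D f nu k x))))"
 by (rule nn_integral_fst_count_space[symmetric])
 also have "... <= (NS nu. en (w nu * wt ?mu x))" by (intro nn_integral_mono abs)
 also have "... < \<infinity>"
 proof -
 have "intc (%nu. w nu * wt ?mu x)" by (intro integrable_mult_left wi)
 hence "(NS nu. en (w nu * wt ?mu x)) = en (LC nu. w nu * wt ?mu x)"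
 by (rule nn_integral_eq_integral) (simp add: w0)
 thus ?thesis by simp
 qed
 finally show "(?J f x) < \<infinity>" .
 qed simp
 define G where "G nu x = (LC k. coef f et (nu, k) * cubefn ze (nu, k) x)" for nu x
 have Gle: "norm (G nu x) <= w nu * wt ?mu x" for nu x
 using count_integrableI(2)[OF abs[of nu x]] w0[of nu] unfolding G_def by (simp add: max_def split: if_splits)
 \<comment> \<open>The convolution with the dilate of \<open>et\<close>, rescaled so that its
   samples sit on the integer lattice. Evenness of \<open>et\<close> identifies these samples with
   the coefficients in \<open>aF\<close>.\<close>
 define F where "F nu y = conv f (dil et nu) (tm nu *R y)" for nu y
 have dile: "dil et nu = (%x. cr (p2 (ri nu * ?n)) * et (0 + tp nu *R x))" for nu by (rule ext) (simp add: dil_def)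
 have rdd: "rd (dil et nu)" for nu unfolding dile by (intro rd_mult rd_affine band_rd[OF et]) simp
 have ftd: "ft (dil et nu) xi = ft et (tm nu *R xi)" for nu xi
 proof -
 have "(p2 (ri nu * ?n)) * (1 / (tp nu) ^ CARD('n)) = (1::real)" by (simp add: two_powr_power mult.commute)
 hence "cr (p2 (ri nu * ?n)) * cr (1 / (tp nu) ^ CARD('n)) = 1" unfolding of_real_mult[symmetric] by simp
 thus ?thesis unfolding dile ft_mult by (subst ft_affine) (auto simp: powr_minus_divide mult.assoc[symmetric])
 qed
 have rdF: "rd (F nu)" for nu
 using rd_affine[OF rd_conv[OF schwartz_rd[OF f(1)] rdd[of nu]], of "tm nu" 0] by (simp add: F_def[abs_def])
 have ftF: "ft (F nu) xi = cr (tp nu ^ CARD('n)) * (ft f (tp nu *R xi) * ft et xi)" for nu xi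
 proof -
 have "ft (%y. conv f (dil et nu) (0 + tm nu *R y)) xi = cr (1 / \<bar>tm nu\<bar> ^ CARD('n)) * ech xi (- (1 / (tm nu)) *R 0) * ft (conv f (dil et nu)) ((1 / (tm nu)) *R xi)"
 by (rule ft_affine) simp
 also have "1 / (tm nu) = tp nu" by (simp add: powr_minus_divide)
 also have "1 / \<bar>tm nu\<bar> ^ CARD('n) = tp nu ^ CARD('n)" by (simp add: powr_minus_divide power_one_over)
 finally show ?thesis
 by (simp add: F_def[abs_def] ft_conv[OF schwartz_rd[OF f(1)] rdd] ftd powr_add[symmetric])
 qed
 have aF: "coef f et (nu, k) = cr (tm nu powr (?n / 2)) * F nu (cvec k)" for nu k
 proof -
 have e: "f x * cubefn et (nu, k) x = cr (tm nu powr (?n / 2)) * (f x * dil et nu (tm nu *R cvec k - x))" for x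
 proof -
 have "tp nu *R (tm nu *R cvec k - x) = - (tp nu *R x - cvec k)"
 by (simp add: scaleR_diff_right powr_minus)
 hence "et (tp nu *R (tm nu *R cvec k - x)) = et (tp nu *R x - cvec k)" by (simp only: band_even[OF et])
 moreover have "tm nu powr (?n / 2) * p2 (ri nu * ?n) = p2 (ri nu * ?n / 2)"
 proof -
 have "tm nu powr (?n / 2) * p2 (ri nu * ?n) = p2 (- ri nu * (?n / 2) + ri nu * ?n)" by (simp only: powr_powr powr_add)
 also have "- ri nu * (?n / 2) + ri nu * ?n = ri nu * ?n / 2" by (simp add: field_simps)
 finally show ?thesis .
 qed
 ultimately show ?thesis by (simp add: cubefn_def dil_def of_real_mult[symmetric] mult_ac del: of_real_mult)
 qed
 show ?thesis unfolding coef_def e F_def conv_def by simp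
 qed
 have Gm: "G nu : BM" and ftG: "ft (G nu) xi = ?K f xi nu"
 and Gc: "continuous_on UNIV (G nu)" for nu xi
 proof -
 define l where "l = tm nu"
 have l: "0 < l" by (simp add: l_def)
 define S where "S x = (LC k. F nu (cvec k) * ze (x - cvec k))" for x
 have rdS: "rd S" unfolding S_def[abs_def] by (rule rd_lattice_conv[OF rdF band_rd[OF ze]])
 have GS: "G nu x = S (0 + (1 / l) *R x)" for x
 proof -
 have "coef f et (nu, k) * cubefn ze (nu, k) x = F nu (cvec k) * ze ((1 / l) *R x - cvec k)" for k
 proof -
 have s: "side (nu, k) = l" "corner (nu, k) = l *R cvec k" by (simp_all add: side_def corner_def l_def)
 have "(1 / l) *R (x - l *R cvec k) = (1 / l) *R x - cvec k" using l by (simp add: scaleR_diff_right)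
 moreover have "cr (l powr (?n / 2)) * cr (l powr (- ?n / 2)) = 1"
 unfolding of_real_mult[symmetric] powr_add[symmetric] using l by simp
 ultimately show ?thesis unfolding aF cubefn_scale s l_def[symmetric] by (simp add: mult_ac)
 qed
 thus ?thesis by (simp add: G_def S_def)
 qed
 hence GS': "G nu = (%x. S (0 + (1 / l) *R x))" by (rule ext)
 have "rd (G nu)" unfolding GS' using l by (intro rd_affine rdS) simp
 thus "G nu : BM" "continuous_on UNIV (G nu)" by (rule rd_measurable, intro rd_continuous)
 have "ft (G nu) xi = cr (1 / \<bar>1 / l\<bar> ^ CARD('n)) * ech xi (- (1 / (1 / l)) *R 0) * ft S ((1 / (1 / l)) *R xi)"
 unfolding GS' using l by (intro ft_affine) simp
 also have "... = cr (l ^ CARD('n)) * ft S (l *R xi)" using l by (simp add: power_one_over)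
 also have "ft S (l *R xi) = (LC k. F nu (cvec k) * ech (l *R xi) (cvec k)) * ft ze (l *R xi)"
 unfolding S_def[abs_def] using dec_lattice_integrable[OF rd_dec[OF rdF[of nu], of "?n + 1"], of 0] by (intro latt.gconv_ft band_rd[OF ze]) simp
 also have "... = ft (F nu) (l *R xi) * ft ze (l *R xi)"
 proof (cases "ft ze (l *R xi) = 0")
 case False
 hence "norm (l *R xi) < 2" using band_supp[OF ze] by blast
 hence "(LC k. F nu (cvec k) * ech (l *R xi) (cvec k)) = ft (F nu) (l *R xi)"
 by (intro poisson_samples rdF) (use band_supp[OF et] in \<open>auto simp: ftF\<close>)
 thus ?thesis by simp
 qed simp
 also have "cr (l ^ CARD('n)) * (ft (F nu) (l *R xi) * ft ze (l *R xi)) = (cr (l ^ CARD('n)) * cr (tp nu ^ CARD('n))) * (ft f (tp nu *R (l *R xi)) * (ft et (l *R xi) * ft ze (l *R xi)))"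
 unfolding ftF by (simp add: mult_ac)
 also have "cr (l ^ CARD('n)) * cr (tp nu ^ CARD('n)) = 1"
 unfolding of_real_mult[symmetric] power_mult_distrib[symmetric] l_def by (simp add: powr_minus)
 also have "tp nu *R (l *R xi) = xi" by (simp add: l_def powr_minus)
 finally show "ft (G nu) xi = ?K f xi nu" by (simp add: l_def)
 qed
 define SS where "SS x = (LC nu. G nu x)" for x
 have SSc: "dec ?mu SS"
 proof (rule decI)
 show "continuous_on UNIV SS" unfolding SS_def[abs_def]
 proof (rule continuous_on_integral_dominated[OF _ _ wi])
 show "continuous_on UNIV (%x. G nu x)" for nu by (rule Gc)
 show "norm (G nu x) <= w nu" for x nu
 using Gle[of nu x] mult_left_mono[OF wt_le_1[of ?mu x] w0[of nu]] by simp
 qed simp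
 show "norm (SS x) <= (LC nu. w nu) * wt ?mu x" for x
 using norm_integral_le[OF integrable_mult_left[OF wi, of "wt ?mu x"], of "%nu. G nu x"] Gle unfolding SS_def by simp
 qed
 have ftSS: "ft SS xi = cr ?B * ft f xi" for xi
 proof -
 have "ft SS xi = (LC nu. ft (G nu) xi)"
 unfolding SS_def[abs_def] by (rule ft_series[OF Gm wi _ Gle]) (rule integrable_wt, simp)
 also have "... = ft f xi * (LC nu. ft et (tm nu *R xi) * ft ze (tm nu *R xi))"
 unfolding ftG by (simp only: integral_mult_right_zero)
 also have "... = ft f xi * cr ?B"
 proof (cases "xi = 0")
 \<comment> \<open>At the origin \<open>PU\<close> says nothing; here both sides vanish because
   \<open>f\<close> has mean zero.\<close>
 case True thus ?thesis using f(2) by (simp add: ft_0)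
 next
 case False thus ?thesis using PU by (simp add: PU_def)
 qed
 finally show ?thesis by (simp add: mult.commute)
 qed
 have "SS x = cr ?B * f x"
 proof (rule ft_inject[OF SSc])
 show "dec ?mu (%x. cr ?B * f x)" by (intro rd_dec rd_mult schwartz_rd f)
 show "ft SS xi = ft (%x. cr ?B * f x) xi" for xi unfolding ftSS ft_mult ..
 qed simp
 thus "(LC P. coef f et P * cubefn ze P x) = cr ?B * f x"
 unfolding integral_cube[OF ix] SS_def G_def .
qed

section \<open>Consequences of the dual pair hypothesis\<close>

lemma finite_dyadic_annulus:
 fixes xi :: "'a::real_normed_vector"
 assumes "xi ~= 0"
 shows "finite {nu::int. 1/2 < norm (tm nu *R xi) & norm (tm nu *R xi) < 2}"
proof -
 define L where "L = log 2 (norm xi)"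
 have n: "norm xi = p2 L" using assms by (simp add: L_def)
 have "{nu::int. 1/2 < norm (tm nu *R xi) & norm (tm nu *R xi) < 2} \<subseteq> {\<lfloor>L\<rfloor> - 2..\<lceil>L\<rceil> + 2}"
 proof
 fix nu :: int assume nu: "nu : {nu::int. 1/2 < norm (tm nu *R xi) & norm (tm nu *R xi) < 2}"
 have e: "norm (tm nu *R xi) = p2 (L - ri nu)" by (simp add: n powr_add[symmetric])
 have "p2 (-1) < p2 (L - ri nu)" "p2 (L - ri nu) < p2 1" using nu unfolding mem_Collect_eq e by (simp_all add: powr_minus)
 hence "-1 < L - ri nu" "L - ri nu < 1" by (simp_all only: powr_less_cancel_iff)
 thus "nu : {\<lfloor>L\<rfloor> - 2..\<lceil>L\<rceil> + 2}" unfolding atLeastAtMost_iff by linarith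
 qed
 thus ?thesis by (rule finite_subset) simp
qed

text \<open>The ratio of 5/3 to 3/5 exceeds 2, so the dyadic dilates of this annulus cover
  everything but the origin; the argument lands in the part between 5/6 and 5/3.\<close>

lemma dyadic_hits_core:
 fixes xi :: "'a::real_normed_vector"
 assumes "xi ~= 0"
 shows "EX nu::int. 3/5 <= norm (tm nu *R xi) & norm (tm nu *R xi) <= 5/3"
proof -
 define L where "L = log 2 (norm xi)"
 have n: "norm xi = p2 L" using assms by (simp add: L_def)
 define b where "b = log 2 (5/3)"
 have b: "2 powr b = 5/3" by (simp add: b_def)
 define nu where "nu = \<lceil>L - b\<rceil>"
 have e: "norm (tm nu *R xi) = p2 (L - ri nu)" by (simp add: n powr_add[symmetric])
 have 1: "L - ri nu <= b" "b - 1 <= L - ri nu" unfolding nu_def by linarith+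
 have "p2 (L - ri nu) <= p2 b" using 1(1) by simp
 moreover have "p2 (b - 1) <= p2 (L - ri nu)" using 1(2) by simp
 moreover have "p2 (b - 1) = 5/6" by (simp add: powr_diff b)
 ultimately have "3/5 <= p2 (L - ri nu) & p2 (L - ri nu) <= 5/3" unfolding b by simp
 thus ?thesis unfolding e[symmetric] by blast
qed

lemma count_integral_eq_infsum:
 fixes g :: "int => complex"
 assumes "finite {nu. g nu ~= 0}"
 shows "(LC nu. g nu) = (\<Sum>\<^sub>\<infinity>nu. g nu)"
proof -
 have "(LC nu. g nu) = (\<Sum>nu | nu : UNIV & g nu ~= 0. g nu)"
 using assms by (intro lebesgue_integral_count_space_finite_support) simp
 also have "... = (\<Sum>\<^sub>\<infinity>nu\<in>{nu. g nu ~= 0}. g nu)" using assms by simp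
 also have "... = (\<Sum>\<^sub>\<infinity>nu. g nu)" by (rule infsum_cong_neutral) auto
 finally show ?thesis .
qed

lemma even_if_ft_even:
 fixes f :: "'n::finite fn"
 assumes f: "rd f" and e: "!!xi. ft f (- xi) = ft f xi"
 shows "f (- x) = f x"
proof -
 have "(%x. f (0 + (-1) *R x)) x = f x"
 proof (rule ft_inject[of "real CARD('n) + 1"])
 show "dec (real CARD('n) + 1) (%x. f (0 + (-1) *R x))" by (intro rd_dec rd_affine f) simp
 show "dec (real CARD('n) + 1) f" by (rule rd_dec[OF f])
 show "ft (%x. f (0 + (-1) *R x)) xi = ft f xi" for xi by (subst ft_affine) (simp_all add: e)
 qed simp
 thus ?thesis by simp
qed

lemma rho_cong: "(!!nu. fourier f (tp nu *R xi) = fourier f (tp nu *R et)) ==> rho f xi = rho f et"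
 unfolding rho_def by (intro infsum_cong) simp

lemma rho_dilate: "rho f (tp j *R xi) = rho f xi"
proof -
 have "rho f (tp j *R xi) = (\<Sum>\<^sub>\<infinity>nu. (%nu. (fourier f (tp nu *R xi)) ^ 2) (nu + j))"
 unfolding rho_def by (intro infsum_cong) (simp add: powr_add)
 also have "... = (\<Sum>\<^sub>\<infinity>nu. (fourier f (tp nu *R xi)) ^ 2)"
 by (rule infsum_reindex_bij_betw) (rule bij_betwI[of _ _ _ "%nu. nu - j"], auto)
 finally show ?thesis by (simp add: rho_def)
qed

text \<open>\<open>PU\<close> comes down to \<open>rho\<close> being invariant under dyadic
  dilations and nonzero. It is nonzero because its terms are squares of real numbers and one of them
  is taken in the annulus where the transform is bounded below. Evenness of both functions follows
  from their radial transforms by uniqueness.\<close>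

theorem dual_pair_props:
 fixes ph ps :: "'n::finite fn"
 assumes dp: "dual_pair ph ps"
 shows "band ph" "band ps" "PU ph ps"
proof -
 let ?F = "fourier ph"
 let ?A = "(2 * pi) ^ CARD('n)"
 let ?B = "- real CARD('n) / 2"
 have LP: "LP_fun ph" and psS: "ps : schwartz" and fps: "!!xi. fourier ps xi = ?F xi / rho ph xi"
 using dp by (simp_all add: dual_pair_def)
 have ph0: "ph : schwartz0" and Im0: "!!xi. Im (?F xi) = 0" and rad: "!!xi et. norm xi = norm et ==> ?F xi = ?F et"
 and cl: "closure {xi. ?F xi ~= 0} \<subseteq> {xi. 1/2 < norm xi & norm xi < 2}"
 using LP unfolding LP_fun_def by blast+
 have "EX c>0. ALL xi. 3/5 <= norm xi & norm xi <= 5/3 --> c <= norm (?F xi)" using LP unfolding LP_fun_def by (elim conjE)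
 then obtain c where c: "c > 0" "ALL xi. 3/5 <= norm xi & norm xi <= 5/3 --> c <= norm (?F xi)" by blast
 have supp: "1/2 < norm xi & norm xi < 2" if "?F xi ~= 0" for xi
 proof -
 have "xi : closure {xi. ?F xi ~= 0}" by (rule subsetD[OF closure_subset]) (simp add: that)
 hence "xi : {xi. 1/2 < norm xi & norm xi < 2}" by (rule subsetD[OF cl])
 thus ?thesis by simp
 qed
 have phS: "ph : schwartz" by (rule schwartz0_schwartz[OF ph0])
 define ka where "ka = cr ((2 * pi) powr ?B)"
 have ka: "ka ~= 0" by (simp add: ka_def)
 have fk: "fourier f xi = ka * ft f xi" for f :: "'n fn" and xi by (simp add: fourier_ft ka_def)
 have ftrad: "ft ph xi = ft ph et" if "norm xi = norm et" for xi et using rad[OF that] ka by (simp add: fk)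
 show "band ph" unfolding band_def
 proof (intro conjI allI impI)
 show "ph (- x) = ph x" for x by (rule even_if_ft_even[OF schwartz_rd[OF phS]]) (rule ftrad, simp)
 fix xi assume "ft ph xi ~= 0"
 hence "?F xi ~= 0" using ka by (simp add: fk)
 thus "1/2 < norm xi" "norm xi < 2" using supp by blast+
 qed (rule phS)
 have rrad: "rho ph xi = rho ph et" if "norm xi = norm et" for xi et by (rule rho_cong) (rule rad, simp add: that)
 have "fourier ps (- xi) = fourier ps xi" for xi unfolding fps using rad[of "- xi" xi] rrad[of "- xi" xi] by simp
 hence fte: "ft ps (- xi) = ft ps xi" for xi using ka by (simp add: fk)
 show "band ps" unfolding band_def
 proof (intro conjI allI impI)
 show "ps (- x) = ps x" for x by (rule even_if_ft_even[OF schwartz_rd[OF psS] fte])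
 fix xi assume "ft ps xi ~= 0"
 hence "fourier ps xi ~= 0" using ka by (simp add: fk)
 hence "?F xi ~= 0" unfolding fps by auto
 thus "1/2 < norm xi" "norm xi < 2" using supp by blast+
 qed (rule psS)
 show "PU ph ps" unfolding PU_def
 proof (intro allI impI)
 fix xi :: "real^'n" assume xi: "xi ~= 0"
 define q where "q nu = (?F (tm nu *R xi)) ^ 2" for nu :: int
 have fin: "finite {nu. q nu ~= 0}"
 proof (rule finite_subset[OF _ finite_dyadic_annulus[OF xi]])
 show "{nu. q nu ~= 0} \<subseteq> {nu::int. 1/2 < norm (tm nu *R xi) & norm (tm nu *R xi) < 2}"
 using supp unfolding q_def by (auto simp del: norm_scaleR)
 qed
 have rq: "rho ph xi = (\<Sum>\<^sub>\<infinity>nu. q nu)"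
 proof -
 have "(\<Sum>\<^sub>\<infinity>nu. q nu) = (\<Sum>\<^sub>\<infinity>nu. (%nu. (?F (tp nu *R xi)) ^ 2) (- nu))" unfolding q_def by simp
 also have "... = rho ph xi" unfolding rho_def by (rule infsum_reindex_bij_betw) (rule bij_betwI[of _ _ _ uminus], auto)
 finally show ?thesis by simp
 qed
 have lq: "(LC nu. q nu) = rho ph xi" unfolding rq by (rule count_integral_eq_infsum[OF fin])
 have "rho ph xi ~= 0"
 proof
 assume r0: "rho ph xi = 0"
 obtain nu0 :: int where nu0: "3/5 <= norm ((tm nu0) *R xi) & norm ((tm nu0) *R xi) <= 5/3"
 using dyadic_hits_core[OF xi] by blast
 have Fn: "c <= norm (?F ((tm nu0) *R xi))" by (rule c(2)[rule_format, OF nu0])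
 have Rq: "Re (q nu) = (Re (?F (tm nu *R xi))) ^ 2" for nu unfolding q_def by (simp add: power2_eq_square Im0)
 have Re0: "0 <= Re (q nu)" for nu unfolding Rq by simp
 have F0: "Re (?F ((tm nu0) *R xi)) ~= 0" using Fn c(1) Im0 by (metis complex_eq_iff less_le_not_le norm_zero zero_complex.sel)
 hence "0 < Re (q nu0)" unfolding Rq by simp
 moreover have "nu0 : {nu. q nu ~= 0}" using \<open>0 < Re (q nu0)\<close> by auto
 ultimately have "0 < (SUM nu:{nu. q nu ~= 0}. Re (q nu))" using fin Re0 by (intro sum_pos2) auto
 moreover have "rho ph xi = (SUM nu:{nu. q nu ~= 0}. q nu)"
 unfolding lq[symmetric] using lebesgue_integral_count_space_finite_support[of UNIV q] fin by simp
 ultimately show False using r0 by (metis Re_sum less_irrefl zero_complex.sel(1))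
 qed
 have ka2: "ka * ka * cr ?A = 1"
 proof -
 have "(2 * pi) powr ?B * (2 * pi) powr ?B * (2 * pi) ^ CARD('n) = 1"
 proof -
 have gen: "x powr ?B * x powr ?B * x ^ CARD('n) = 1" if "0 < x" for x :: real
 using that by (simp add: powr_add[symmetric] powr_realpow[symmetric])
 show ?thesis by (rule gen) simp
 qed
 thus ?thesis unfolding ka_def of_real_mult[symmetric] by simp
 qed
 have trm: "ft ph (tm nu *R xi) * ft ps (tm nu *R xi) = cr ?A / rho ph xi * q nu" for nu
 proof -
 let ?x = "tm nu *R xi"
 have r: "rho ph ?x = rho ph xi" using rho_dilate[of ph "- nu" xi] by simp
 have "ka * ft ph ?x = ?F ?x" "ka * ft ps ?x = ?F ?x / rho ph xi" using fps[of ?x] r by (simp_all add: fk)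
 hence "(ka * ft ph ?x) * (ka * ft ps ?x) = q nu / rho ph xi" unfolding q_def by (simp only: power2_eq_square times_divide_eq_right)
 moreover have "(ka * ka) * (ft ph ?x * ft ps ?x) = (ka * ft ph ?x) * (ka * ft ps ?x)" by (simp only: mult_ac)
 ultimately have "(ka * ka) * (ft ph ?x * ft ps ?x) = q nu / rho ph xi" by (simp only:)
 hence "cr ?A * ((ka * ka) * (ft ph ?x * ft ps ?x)) = cr ?A * (q nu / rho ph xi)" by (rule arg_cong)
 moreover have "cr ?A * ((ka * ka) * (ft ph ?x * ft ps ?x)) = (ka * ka * cr ?A) * (ft ph ?x * ft ps ?x)" by (simp only: mult_ac)
 ultimately show ?thesis unfolding ka2 by simp
 qed
 show "(LC nu. ft ph (tm nu *R xi) * ft ps (tm nu *R xi)) = cr ?A"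
 unfolding trm integral_mult_right_zero lq using \<open>rho ph xi ~= 0\<close> by simp
 qed
qed

section \<open>Series in the dual of the test space and sample expansions\<close>

text \<open>A common radius \<open>r\<close> of vanishing passes to linear combinations at once and
  keeps all partial sums of a series inside \<open>schwartz0\<close>.\<close>

definition S00 :: "real => 'n::finite fn => bool" where
 "S00 r f = (f : schwartz & (ALL xi. norm xi < r --> ft f xi = 0))"

lemma S00_schwartz0: "0 < r ==> S00 r f ==> f : schwartz0"
 unfolding S00_def by (intro schwartz0_if_vanish_near_0[of f r]) auto

lemma S00_lin: "S00 r f ==> S00 r g ==> S00 r (%x. a * f x + b * g x)"
 unfolding S00_def by (auto simp: schwartz_lin ft_add rd_mult schwartz_rd ft_mult)

lemma S00_sum:
 assumes "finite A" "!!k. k : A ==> S00 r (g k)" "S00 r f"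
 shows "S00 r (%x. f x - (SUM k:A. c k * g k x))"
 using assms(1,2)
proof (induction A rule: finite_induct)
 case (insert k A)
 have "S00 r (%x. 1 * (f x - (SUM k:A. c k * g k x)) + (- c k) * g k x)" using insert by (intro S00_lin) auto
 thus ?case using insert.hyps by (simp add: algebra_simps)
qed (use assms(3) in simp)

lemma SP_sum:
 assumes u: "u : SP" and r: "0 < r" and fin: "finite A" "!!k. k : A ==> S00 r (g k)" "S00 r f"
 shows "u (%x. f x - (SUM k:A. c k * g k x)) = u f - (SUM k:A. c k * u (g k))"
 using fin(1,2)
proof (induction A rule: finite_induct)
 case (insert k A)
 have "(%x. f x - (SUM k:insert k A. c k * g k x)) = (%x. 1 * (f x - (SUM k:A. c k * g k x)) + (- c k) * g k x)"
 using insert.hyps by (simp add: algebra_simps)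
 moreover have "u (%x. 1 * (f x - (SUM k:A. c k * g k x)) + (- c k) * g k x) = 1 * u (%x. f x - (SUM k:A. c k * g k x)) + (- c k) * u (g k)"
 proof -
 have L: "ALL f:schwartz0. ALL g:schwartz0. ALL a b. u (%x. a * f x + b * g x) = a * u f + b * u g"
 using u unfolding SP_def lin_on_S0_def by blast
 have 1: "(%x. f x - (SUM k:A. c k * g k x)) : schwartz0" using insert fin(3) by (intro S00_schwartz0[OF r S00_sum]) auto
 have 2: "g k : schwartz0" using insert by (intro S00_schwartz0[OF r]) auto
 show ?thesis by (rule L[rule_format, OF 1 2])
 qed
 ultimately show ?case using insert by (simp add: algebra_simps)
qed simp

lemma pdiffs_sum:
 assumes "finite A" "!!k. k : A ==> g k : schwartz" "f : schwartz"
 shows "pdiffs is (%x. f x - (SUM k:A. c k * g k x)) = (%x. pdiffs is f x - (SUM k:A. c k * pdiffs is (g k) x)) & (%x. f x - (SUM k:A. c k * g k x)) : schwartz"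
 using assms(1,2)
proof (induction A rule: finite_induct)
 case (insert k A)
 let ?h = "%x. f x - (SUM k:A. c k * g k x)"
 have e: "(%x. f x - (SUM k:insert k A. c k * g k x)) = (%x. 1 * ?h x + (- c k) * g k x)"
 using insert.hyps by (simp add: algebra_simps)
 have hS: "?h : schwartz" "g k : schwartz" using insert by auto
 have "pdiffs is (%x. 1 * ?h x + (- c k) * g k x) = (%x. 1 * pdiffs is ?h x + (- c k) * pdiffs is (g k) x)"
 by (rule pdiffs_lin[OF schwartz_smooth[OF hS(1)] schwartz_smooth[OF hS(2)]])
 moreover have "pdiffs is ?h = (%x. pdiffs is f x - (SUM k:A. c k * pdiffs is (g k) x))" using insert by blast
 ultimately show ?case unfolding e using insert.hyps schwartz_lin[OF hS, of 1 "- c k"] by (simp add: algebra_simps)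
qed (use assms(3) in simp)

text \<open>Finite partial sums differ from \<open>g\<close> by tails that \<open>w\<close> makes
  small in each of the finitely many seminorms controlling \<open>u\<close>. The hypotheses ask for
  pointwise identities and bounds for all derivatives, so that no topology on the test space has to
  be formulated.\<close>

lemma SP_series:
 fixes g :: "'n::finite fn" and gk :: "'k::countable => 'n fn"
 assumes u: "u : SP" and r: "0 < r" and g: "S00 r g" and gk: "!!k. S00 r (gk k)"
 and eq: "!!is z. pdiffs is g z = (LC k. c k * pdiffs is (gk k) z)"
 and w: "!!(m::nat) is. intc (w m is)"
 and le: "!!(m::nat) is k z. norm (c k * pdiffs is (gk k) z) <= w m is k * wt (real m) z"
 shows "intc (%k. c k * u (gk k))" "u g = (LC k. c k * u (gk k))"
proof -
 let ?A = "%N f. \<Sum>m\<le>N. SUM is:{is::'n list. length is <= N}. seminorm_S m is f"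
 let ?B = "%k is z. c k * pdiffs is (gk k) z"
 let ?C = "%N A. \<Sum>m\<le>N. SUM is:{is::'n list. length is <= N}. (LC k. ind (- A) k * w m is k)"
 let ?D = "LC k. c k * u (gk k)"
 let ?E = "%A is z. SUM k:A. c k * pdiffs is (gk k) z"
 let ?F = "%is z A. LC k. c k * pdiffs is (gk k) z - ind A k *R (?B k is z)"
 let ?G = "%A j. SUM k:A j. c k * u (gk k)"
 obtain C0 N where CN0: "ALL f:schwartz0. norm (u f) <= C0 * ?A N f"
 using u unfolding SP_def cont_on_S0_def by blast
 define C where "C = max 0 C0"
 have CN: "norm (u f) <= C * ?A N f" if f: "f : schwartz0" for f
 proof -
 have "0 <= ?A N f"
 by (intro sum_nonneg seminorm_S_nonneg schwartz0_schwartz[OF f])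
 hence "C0 * ?A N f <= C * ?A N f"
 by (intro mult_right_mono) (simp_all add: C_def)
 thus ?thesis using CN0 f by (meson order.trans)
 qed
 define W where "W k = (\<Sum>m\<le>N. SUM is:{is::'n list. length is <= N}. w m is k)" for k
 have Wi: "intc W" unfolding W_def[abs_def] by (intro Bochner_Integration.integrable_sum w)
 have C0: "0 <= C" by (simp add: C_def)
 have tail: "norm (u g - (SUM k:A. c k * u (gk k))) <= C * (LC k. ind (- A) k * W k)" if A: "finite A" for A
 proof -
 let ?h = "%x. g x - (SUM k:A. c k * gk k x)"
 have S: "!!k. gk k : schwartz" "g : schwartz" using g gk by (auto simp: S00_def)
 have h0: "?h : schwartz0" by (rule S00_schwartz0[OF r S00_sum[OF A gk g]])
 have wi: "intc (%k. ind (- A) k * w m is k)" for m "is"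
 by (rule Bochner_Integration.integrable_bound[OF w[of m "is"]]) (auto simp: indicator_def)
 have sem: "seminorm_S m is ?h <= (LC k. ind (- A) k * w m is k)" for m "is"
 proof (rule seminorm_S_le)
 fix z
 have ci: "intc (%k. c k * pdiffs is (gk k) z)"
 by (rule integrable_dominated[OF integrable_mult_left[OF w[of m "is"], of "wt (real m) z"] _ le]) simp
 have "pdiffs is ?h z = pdiffs is g z - (?E A is z)" using pdiffs_sum[of A gk g "is" c] A S by simp
 also have "?E A is z = (LC k. ind A k *R (?B k is z))"
 proof -
 have "(LC k. ind A k *R (?B k is z)) = (\<Sum>k | k : UNIV & ind A k *R (?B k is z) ~= 0. ind A k *R (?B k is z))"
 by (rule lebesgue_integral_count_space_finite_support) (rule finite_subset[OF _ A], auto simp: indicator_def split: if_splits)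
 also have "... = ?E A is z"
 using A by (intro sum.mono_neutral_cong_left) (auto simp: indicator_def split: if_splits)
 finally show ?thesis by simp
 qed
 also have "pdiffs is g z = (LC k. c k * pdiffs is (gk k) z)" by (rule eq)
 also have "(LC k. c k * pdiffs is (gk k) z) - (LC k. ind A k *R (?B k is z))
 = ?F is z A"
 by (rule Bochner_Integration.integral_diff[symmetric, OF ci]) (rule Bochner_Integration.integrable_bound[OF ci], auto simp: indicator_def)
 finally have "norm (pdiffs is ?h z) = norm (?F is z A)" by simp
 also have "... <= (LC k. (ind (- A) k * w m is k) * wt (real m) z)"
 proof (rule norm_integral_le[OF integrable_mult_left[OF wi]])
 fix k
 show "norm (c k * pdiffs is (gk k) z - ind A k *R (?B k is z)) <= ind (- A) k * w m is k * wt (real m) z"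
 using le[of k "is" z m] by (cases "k : A") auto
 qed simp
 finally show "norm (pdiffs is ?h z) <= (LC k. ind (- A) k * w m is k) * wt (real m) z" by simp
 qed
 have "norm (u ?h) <= C * (\<Sum>m\<le>N. SUM is:{is::'n list. length is <= N}. seminorm_S m is ?h)" by (rule CN[OF h0])
 also have "... <= C * ?C N A"
 using C0 by (intro mult_left_mono sum_mono sem) auto
 also have "?C N A = (LC k. ind (- A) k * W k)"
 unfolding W_def sum_distrib_left using wi by (simp add: Bochner_Integration.integral_sum)
 finally show ?thesis using SP_sum[OF u r A gk g, of c] by simp
 qed
 have trm: "norm (c k * u (gk k)) <= C * W k" for k
 proof -
 have "S00 r (%x. c k * gk k x + 0 * gk k x)" by (intro S00_lin gk)
 hence S: "S00 r (%x. c k * gk k x)" by simp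
 have "u (%x. c k * gk k x + 0 * gk k x) = c k * u (gk k) + 0 * u (gk k)"
 using u S00_schwartz0[OF r gk] unfolding SP_def lin_on_S0_def by blast
 hence "norm (c k * u (gk k)) = norm (u (%x. c k * gk k x))" by simp
 also have "... <= C * (\<Sum>m\<le>N. SUM is:{is::'n list. length is <= N}. seminorm_S m is (%x. c k * gk k x))" by (rule CN[OF S00_schwartz0[OF r S]])
 also have "... <= C * W k" unfolding W_def
 proof (intro mult_left_mono sum_mono C0 seminorm_S_le)
 fix m "is" z
 have "pdiffs is (%x. c k * gk k (0 + 1 *R x)) z = c k * pdiffs is (gk k) z"
 using gk[of k] by (subst pdiffs_affine) (auto simp: S00_def schwartz_smooth)
 thus "norm (pdiffs is (%x. c k * gk k x) z) <= w m is k * wt (real m) z" using le[of k "is" z m] by simp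
 qed
 finally show ?thesis .
 qed
 show ci: "intc (%k. c k * u (gk k))"
 by (rule integrable_dominated[OF integrable_mult_right[OF Wi, of C] _ trm]) simp
 have W0: "0 <= C * W k" for k using trm[of k] norm_ge_zero order.trans by blast
 define A where "A j = {k::'k. to_nat k < j}" for j :: nat
 have finA: "finite (A j)" for j
 proof -
 have "A j \<subseteq> from_nat ` {..<j}" unfolding A_def by (auto simp: image_iff) (metis from_nat_to_nat lessThan_iff)
 thus ?thesis by (rule finite_subset) simp
 qed
 have "(%j. SUM k:A j. c k * u (gk k)) \<longlonglongrightarrow> u g"
 proof (rule Lim_transform2[of "%_. u g"])
 have "(%j. LC k. ind (- A j) k * W k) \<longlonglongrightarrow> (LC k::'k. 0)"
 proof (rule integral_dominated_convergence[where w="%k. \<bar>W k\<bar>"])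
 show "AE k in count_space UNIV. (%j. ind (- A j) k * W k) \<longlonglongrightarrow> 0"
 proof (rule AE_I2)
 fix k :: 'k
 have "\<forall>\<^sub>F j in sequentially. ind (- A j) k * W k = 0"
 unfolding eventually_sequentially by (rule exI[of _ "Suc (to_nat k)"]) (auto simp: A_def indicator_def)
 thus "(%j. ind (- A j) k * W k) \<longlonglongrightarrow> 0" by (rule tendsto_eventually)
 qed
 qed (use Wi in \<open>auto simp: indicator_def\<close>)
 hence "(%j. C * (LC k. ind (- A j) k * W k)) \<longlonglongrightarrow> C * 0" by (intro tendsto_mult tendsto_const) simp
 thus "(%j. u g - (?G A j)) \<longlonglongrightarrow> 0"
 by (intro Lim_null_comparison[OF always_eventually[OF allI[OF tail[OF finA]]]]) simp
 qed simp
 moreover have "(%j. SUM k:A j. c k * u (gk k)) \<longlonglongrightarrow> ?D"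
 proof -
 have "(%j. LC k. ind (A j) k *R (c k * u (gk k))) \<longlonglongrightarrow> ?D"
 proof (rule integral_dominated_convergence[where w="%k. norm (c k * u (gk k))"])
 show "AE k in count_space UNIV. (%j. ind (A j) k *R (c k * u (gk k))) \<longlonglongrightarrow> c k * u (gk k)"
 proof (rule AE_I2)
 fix k :: 'k
 have "\<forall>\<^sub>F j in sequentially. ind (A j) k *R (c k * u (gk k)) = c k * u (gk k)"
 unfolding eventually_sequentially by (rule exI[of _ "Suc (to_nat k)"]) (auto simp: A_def indicator_def)
 thus "(%j. ind (A j) k *R (c k * u (gk k))) \<longlonglongrightarrow> c k * u (gk k)" by (rule tendsto_eventually)
 qed
 qed (use ci in \<open>auto simp: indicator_def\<close>)
 moreover have "(LC k. ind (A j) k *R (c k * u (gk k))) = ?G A j" for j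
 proof -
 have "(LC k. ind (A j) k *R (c k * u (gk k))) = (\<Sum>k | k : UNIV & ind (A j) k *R (c k * u (gk k)) ~= 0. ind (A j) k *R (c k * u (gk k)))"
 by (rule lebesgue_integral_count_space_finite_support) (rule finite_subset[OF _ finA[of j]], auto simp: indicator_def split: if_splits)
 also have "... = ?G A j"
 using finA[of j] by (intro sum.mono_neutral_cong_left) (auto simp: indicator_def split: if_splits)
 finally show ?thesis .
 qed
 ultimately show ?thesis by simp
 qed
 ultimately show "u g = ?D" by (rule LIMSEQ_unique)
qed

lemma count_integral_finite:
 fixes f :: "'a => complex"
 assumes A: "finite A" and f: "!!k. k ~: A ==> f k = 0"
 shows "(LC k. f k) = (SUM k:A. f k)"
proof -
 have sub: "{k. f k ~= 0} \<subseteq> A" using f by blast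
 have "(LC k. f k) = (\<Sum>k | k : UNIV & f k ~= 0. f k)"
 using finite_subset[OF sub A] by (intro lebesgue_integral_count_space_finite_support) simp
 also have "... = (SUM k:A. f k)" using A sub by (intro sum.mono_neutral_left) auto
 finally show ?thesis .
qed

lemma integrable_pairs_finite:
 fixes v :: "int => 'b::countable => real"
 assumes I: "finite I" and v: "!!i. i : I ==> intc (v i)"
 shows "intc (%P. if fst P : I then v (fst P) (snd P) else 0)"
proof (rule integrableI_bounded)
 have "(\<integral>\<^sup>+P. en (norm (if fst P : I then v (fst P) (snd P) else 0)) \<partial>count_space (UNIV::(int \<times> 'b) set))
 = (NS i. (NS k. en (norm (if fst (i, k) : I then v (fst (i, k)) (snd (i, k)) else 0))))"
 by (rule nn_integral_fst_count_space[symmetric])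
 also have "... = (NS i. (NS k. en (norm (v i k))) * ind I i)"
 by (intro nn_integral_cong) (auto simp: indicator_def)
 also have "... = (SUM i:I. (NS k. en (norm (v i k))))"
 using I by (subst nn_integral_count_space'[of I]) (auto simp: indicator_def)
 also have "... < \<infinity>"
 proof -
 have "(NS k. en (norm (v i k))) < top" if "i : I" for i using v[OF that] by (simp add: integrable_iff_bounded)
 thus ?thesis using I by (simp add: ennreal_sum_less_top)
 qed
 finally show "(\<integral>\<^sup>+P. en (norm (if fst P : I then v (fst P) (snd P) else 0)) \<partial>count_space (UNIV::(int \<times> 'b) set)) < \<infinity>" .
qed simp

lemma dil_affine: "dil f nu = (%x. cr (p2 (ri nu * real CARD('n))) * f (0 + tp nu *R x))"
 for f :: "'n::finite fn"
 by (rule ext) (simp add: dil_def)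

lemma rd_dil: "rd f ==> rd (dil f nu)" unfolding dil_affine by (intro rd_mult rd_affine) simp_all

lemma schwartz_dil: "f : schwartz ==> dil f nu : schwartz" unfolding dil_affine by (intro schwartz_affine) simp_all

lemma ft_dil: "ft (dil f nu) xi = ft f (tm nu *R xi)" for f :: "'n::finite fn"
proof -
 have "(p2 (ri nu * real CARD('n))) * (1 / (tp nu) ^ CARD('n)) = (1::real)" by (simp add: two_powr_power mult.commute)
 hence "cr (p2 (ri nu * real CARD('n))) * cr (1 / (tp nu) ^ CARD('n)) = 1" unfolding of_real_mult[symmetric] by simp
 thus ?thesis unfolding dil_affine ft_mult by (subst ft_affine) (auto simp: powr_minus_divide mult.assoc[symmetric])
qed

lemma conv_dil:
 fixes f g :: "'n::finite fn"
 shows "conv (dil f (mu + i)) (dil g mu) x = cr (p2 (ri mu * real CARD('n))) * conv (dil f i) g (tp mu *R x)"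
proof -
 let ?c = "tp mu" and ?d = "cr (p2 (ri mu * real CARD('n)))"
 have 0: "cr (p2 (ri (mu + i) * real CARD('n))) = ?d * cr (p2 (ri i * real CARD('n)))"
 by (simp only: of_int_add distrib_right powr_add of_real_mult)
 have 1: "dil f (mu + i) y = ?d * dil f i (?c *R y)" for y
 unfolding dil_def 0 by (simp add: powr_add mult_ac)
 have 2: "dil f (mu + i) y * dil g mu (x - y) = ?d * ?d * (%t. dil f i t * g (?c *R x - t)) (0 + ?c *R y)" for y
 unfolding 1 by (simp add: dil_def[of g] scaleR_diff_right mult_ac)
 have "conv (dil f (mu + i)) (dil g mu) x = ?d * ?d * (LI y. (%t. dil f i t * g (?c *R x - t)) (0 + ?c *R y))"
 unfolding conv_def 2 by (simp only: integral_mult_right_zero)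
 also have "(LI y. (%t. dil f i t * g (?c *R x - t)) (0 + ?c *R y)) = (1 / \<bar>?c\<bar> ^ DIM(real^'n)) *R (LI t. dil f i t * g (?c *R x - t))"
 by (rule integral_affine) simp
 also have "... = cr (1 / p2 (ri mu * real CARD('n))) * conv (dil f i) g (?c *R x)"
 by (simp add: conv_def scaleR_conv_of_real two_powr_power mult.commute)
 also have "?d * ?d * (cr (1 / p2 (ri mu * real CARD('n))) * conv (dil f i) g (?c *R x)) = ?d * conv (dil f i) g (?c *R x)"
 by simp
 finally show ?thesis .
qed

lemma scaled_sampling:
 fixes f g :: "'n::finite fn"
 assumes f: "rd f" and g: "rd g" and h: "0 < h"
 and sf: "!!xi. ft f xi ~= 0 ==> norm (h *R xi) < 2" and sg: "!!xi. ft g xi ~= 0 ==> norm (h *R xi) < 2"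
 shows "cr (h ^ CARD('n)) * (LC k. f (h *R (y + cvec k) - z) * g (x - h *R (y + cvec k))) = conv f g (x - z)"
proof -
 let ?F = "%t. f (- z + h *R t)" and ?G = "%t. g (0 + h *R t)"
 have s: "norm xi < 2" if "ft q ((1 / h) *R xi) ~= 0" "!!xi. ft q xi ~= 0 ==> norm (h *R xi) < 2" for q :: "'n fn" and xi
 using that(2)[OF that(1)] h by simp
 have "(LC k. ?F (y + cvec k) * ?G ((1 / h) *R x - (y + cvec k))) = conv ?F ?G ((1 / h) *R x)"
 proof (rule sampling)
 show "rd ?F" by (rule rd_affine[OF f]) (use h in simp)
 show "rd ?G" by (rule rd_affine[OF g]) (use h in simp)
 show "norm xi < 2" if "ft ?F xi ~= 0" for xi using that h by (subst (asm) ft_affine) (auto intro!: s[of f] sf)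
 show "norm xi < 2" if "ft ?G xi ~= 0" for xi using that h by (subst (asm) ft_affine) (auto intro!: s[of g] sg)
 qed
 moreover have "?F (y + cvec k) * ?G ((1 / h) *R x - (y + cvec k)) = f (h *R (y + cvec k) - z) * g (x - h *R (y + cvec k))" for k
 using h by (simp add: scaleR_diff_right)
 ultimately have 1: "(LC k. f (h *R (y + cvec k) - z) * g (x - h *R (y + cvec k))) = conv ?F ?G ((1 / h) *R x)" by (simp only:)
 have "conv ?F ?G ((1 / h) *R x) = (LI t. (%s. f s * g ((x - z) - s)) (- z + h *R t))"
 unfolding conv_def using h by (intro Bochner_Integration.integral_cong) (auto simp: scaleR_diff_right algebra_simps)
 also have "... = (1 / \<bar>h\<bar> ^ DIM(real^'n)) *R (LI s. f s * g ((x - z) - s))" using h by (intro integral_affine) simp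
 finally have "conv ?F ?G ((1 / h) *R x) = (1 / h ^ CARD('n)) *R conv f g (x - z)" using h by (simp add: conv_def)
 thus ?thesis unfolding 1 using h by (simp add: scaleR_conv_of_real)
qed

text \<open>On the spectrum of \<open>dil et mu\<close> only three neighbouring terms of the
  partition of unity can be nonzero, so three scales reproduce it. The derivative is placed on
  \<open>ph\<close>, the factor that the distribution will see.\<close>

lemma reproducing_sum:
 fixes ph ps et :: "'n::finite fn"
 assumes ph: "band ph" and ps: "band ps" and PU: "PU ph ps" and et: "band et"
 shows "(SUM i:{-1,0,1::int}. conv (pdiffs is (dil ph (mu + i))) (conv (dil ps (mu + i)) (dil et mu)) s) = cr ((2 * pi) ^ CARD('n)) * pdiffs is (dil et mu) s"
proof -
 let ?g = "%i. conv (pdiffs is (dil ph (mu + i))) (conv (dil ps (mu + i)) (dil et mu))"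
 let ?A = "%et. %s. cr ((2 * pi) ^ CARD('n)) * pdiffs is (dil et mu) s"
 let ?B = "%s. ?g (-1) s + (?g 0 s + ?g 1 s)"
 have phS: "dil ph nu : schwartz" for nu by (rule schwartz_dil[OF band_schwartz[OF ph]])
 have etS: "dil et nu : schwartz" for nu by (rule schwartz_dil[OF band_schwartz[OF et]])
 have r1: "rd (conv (dil ps (mu + i)) (dil et mu))" for i by (intro rd_conv rd_dil band_rd ps et)
 have rp: "rd (pdiffs is (dil ph (mu + i)))" for i by (rule schwartz_rd_pdiffs[OF phS])
 have rg: "rd (?g i)" for i by (rule rd_conv[OF rp r1])
 have "?B s = (?A et) s"
 proof (rule ft_inject[of "real CARD('n) + 1" "%s. ?g (-1) s + (?g 0 s + ?g 1 s)"])
 show "dec (real CARD('n) + 1) ?B" by (intro rd_dec rd_add rg)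
 show "dec (real CARD('n) + 1) (?A et)" by (intro rd_dec rd_mult schwartz_rd_pdiffs etS)
 fix xi
 obtain c where c: "ALL f : schwartz. ft (pdiffs is f) xi = c * ft f xi" using ft_pdiffs_factor[of "is" xi] by blast
 define A where "A nu = ft ph (tm nu *R xi) * ft ps (tm nu *R xi)" for nu
 define e where "e = ft et (tm mu *R xi)"
 have g: "ft (?g i) xi = c * A (mu + i) * e" for i
 unfolding ft_conv[OF rp r1] ft_conv[OF rd_dil[OF band_rd[OF ps]] rd_dil[OF band_rd[OF et]]] c[rule_format, OF phS] ft_dil A_def e_def by simp
 have "ft ?B xi = c * e * (A (mu + -1) + (A (mu + 0) + A (mu + 1)))"
 unfolding ft_add[OF rg rd_add[OF rg rg]] ft_add[OF rg rg] g by (simp add: algebra_simps)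
 also have "... = c * e * cr ((2 * pi) ^ CARD('n))"
 proof (cases "e = 0")
 case False
 hence b: "1/2 < tm mu * norm xi" "tm mu * norm xi < 2"
 using band_supp[OF et, of "tm mu *R xi"] by (auto simp: e_def)
 hence xi0: "xi ~= 0" by auto
 define L where "L = log 2 (norm xi)"
 have n: "norm xi = p2 L" using xi0 by (simp add: L_def)
 have near: "\<bar>L - ri nu\<bar> < 1" if "1/2 < tm nu * norm xi" "tm nu * norm xi < 2" for nu
 proof -
 have "p2 (-1) < p2 (L - ri nu)" "p2 (L - ri nu) < p2 1"
 using that unfolding n powr_add[symmetric] by (simp_all add: powr_minus)
 hence "-1 < L - ri nu" "L - ri nu < 1" by (simp_all only: powr_less_cancel_iff)
 thus ?thesis by linarith
 qed
 have Az: "A nu = 0" if "nu ~: {mu - 1, mu, mu + 1}" for nu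
 proof (rule ccontr)
 assume "A nu ~= 0"
 hence "\<bar>L - ri nu\<bar> < 1" using band_supp[OF ph, of "tm nu *R xi"] by (intro near) (auto simp: A_def)
 moreover have "\<bar>L - ri mu\<bar> < 1" by (rule near[OF b])
 ultimately have "\<bar>ri (nu - mu)\<bar> < 2" by simp
 hence "\<bar>nu - mu\<bar> < 2" by linarith
 thus False using that by auto
 qed
 have "cr ((2 * pi) ^ CARD('n)) = (LC nu. A nu)" using PU xi0 unfolding PU_def A_def by simp
 also have "... = (SUM nu:{mu - 1, mu, mu + 1}. A nu)" by (rule count_integral_finite) (use Az in auto)
 also have "... = A (mu + -1) + (A (mu + 0) + A (mu + 1))" by simp
 finally show ?thesis by simp
 qed simp
 also have "... = ft (?A et) xi"
 unfolding ft_mult c[rule_format, OF etS] ft_dil e_def by simp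
 finally show "ft ?B xi = ft (?A et) xi" .
 qed simp
 thus ?thesis by simp
qed

lemma SP_series_ex:
 fixes g :: "'n::finite fn" and gk :: "'k::countable => 'n fn"
 assumes u: "u : SP" and r: "0 < r" and g: "S00 r g" and gk: "!!k. S00 r (gk k)"
 and eq: "!!is z. pdiffs is g z = (LC k. c k * pdiffs is (gk k) z)"
 and w: "!!(m::nat) is. EX w. intc w & (ALL k z. norm (c k * pdiffs is (gk k) z) <= w k * wt (real m) z)"
 shows "intc (%k. c k * u (gk k))" "u g = (LC k. c k * u (gk k))"
proof -
 have "EX w. ALL (m::nat) is. intc (w m is) & (ALL k z. norm (c k * pdiffs is (gk k) z) <= w m is k * wt (real m) z)"
 using w by (intro choice allI)
 then obtain w where w': "ALL (m::nat) is. intc (w m is) & (ALL k z. norm (c k * pdiffs is (gk k) z) <= w m is k * wt (real m) z)" by blast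
 note * = SP_series[OF u r g gk eq, of w]
 show "intc (%k. c k * u (gk k))" by (rule *(1)) (use w' in auto)
 show "u g = (LC k. c k * u (gk k))" by (rule *(2)) (use w' in auto)
qed

lemma pdiffs_reflect:
 assumes "f : schwartz" shows "pdiffs is (%z. f (t - z)) = (%z. (-1) ^ length is * pdiffs is f (t - z))"
 using pdiffs_affine[OF schwartz_smooth[OF assms], of "is" 1 t "-1"] by simp

lemma schwartz_reflect: "f : schwartz ==> (%z. f (t - z)) : schwartz"
 using schwartz_affine[of f "-1" 1 t] by simp

lemma ft_reflect: "ft (%z. f (t - z)) xi = ech xi t * ft f (- xi)"
 using ft_affine[of "-1" f t xi] by simp

lemma S00_dil_reflect:
 assumes f: "band f" and r: "r <= p2 (ri nu - 1)"
 shows "S00 r (%z. dil f nu (t - z))"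
 unfolding S00_def
proof (intro conjI allI impI)
 show "(%z. dil f nu (t - z)) : schwartz" by (intro schwartz_reflect schwartz_dil band_schwartz f)
 fix xi :: "real^'a" assume "norm xi < r"
 hence "norm xi < p2 (ri nu - 1)" using r by simp
 hence "tm nu * norm xi < tm nu * p2 (ri nu - 1)" by simp
 also have "... = p2 (-1)" by (simp only: powr_add[symmetric]) simp
 also have "... = 1/2" by (simp add: powr_minus)
 finally have "ft f (tm nu *R (- xi)) = 0" using band_supp[OF f, of "tm nu *R (- xi)"] by fastforce
 thus "ft (%z. dil f nu (t - z)) xi = 0" unfolding ft_reflect ft_dil by simp
qed

lemma lattice_wt_scaled_integrable:
 fixes a :: "real^'n::finite"
 assumes h: "0 < h" and m: "real CARD('n) < m"
 shows "intc (%k. wt m (a - h *R (y + cvec k)))"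
proof -
 have "dec m (%t::real^'n. cr (wt m t))" by (rule decI[of _ 1]) (auto intro!: continuous_on_of_real continuous_on_wt)
 moreover have m0: "0 <= m" using m by (meson of_nat_0_le_iff le_less_trans less_imp_le)
 ultimately have "dec m (%t. cr (wt m ((a - h *R y) + (- h) *R t)))" using h by (intro dec_affine[of m "%t. cr (wt m t)"]) auto
 from dec_lattice_integrable[OF this m, of 0] have "intc (%k. cr (wt m (a - h *R (y + cvec k))))"
 by (simp add: algebra_simps)
 hence "intc (%k. norm (cr (wt m (a - h *R (y + cvec k)))))" by (rule integrable_norm)
 thus ?thesis by (simp only: norm_of_real abs_of_nonneg wt_nonneg)
qed

text \<open>\<open>reproducing_sum\<close> and \<open>scaled_sampling\<close> write the reflected
  function as a lattice series of reflected dilates of \<open>ph\<close>, and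
  \<open>SP_series\<close> lets \<open>u\<close> act term by term, which produces samples of
  \<open>LPconv\<close>. The offset \<open>y\<close> remains arbitrary.\<close>

theorem sample_expansion:
 fixes ph ps et :: "'n::finite fn" and mu :: int
 assumes ph: "band ph" and ps: "band ps" and PU: "PU ph ps" and et: "band et" and u: "u : SP"
 defines "h \<equiv> %i::int. p2 (- ri (mu + i))"
 defines "cc \<equiv> %x y i k. cr (h i ^ CARD('n) / (2 * pi) ^ CARD('n)) * conv (dil ps (mu + i)) (dil et mu) (x - h i *R (y + cvec k))"
 shows "i : {-1,0,1} ==> intc (%k. cc x y i k * LPconv ph (mu + i) u (h i *R (y + cvec k)))"
 and "u (%z. dil et mu (x - z)) = (SUM i:{-1,0,1}. LC k. cc x y i k * LPconv ph (mu + i) u (h i *R (y + cvec k)))"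
proof -
 let ?n = "real CARD('n)"
 define I where "I = {-1,0,1::int}"
 have finI: "finite I" by (simp add: I_def)
 \<comment> \<open>Clamps the scale offset to the three admissible values: for other indices the
   coefficient is zero, but \<open>gk\<close> must still vanish near the origin with the common
   radius.\<close>
 define cl where "cl i = max (-1) (min 1 (i::int))" for i
 have clI: "cl i = i" if "i : I" for i using that by (auto simp: cl_def I_def)
 have cl1: "-1 <= cl i" for i by (simp add: cl_def)
 have h0: "0 < h i" for i by (simp add: h_def)
 define c where "c P = (if fst P : I then cc x y (fst P) (snd P) else 0)" for P
 define gk where "gk P = (%z. dil ph (mu + cl (fst P)) (h (cl (fst P)) *R (y + cvec (snd P)) - z))" for P
 define g where "g = (%z. dil et mu (x - z))"
 \<comment> \<open>The lowest frequencies occur at scale \<open>mu - 1\<close>, where the spectrum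
   lies beyond half of \<open>p2 (ri mu - 1)\<close>.\<close>
 define r where "r = p2 (ri mu - 2)"
 have r: "0 < r" by (simp add: r_def)
 have gS: "S00 r g" unfolding g_def by (rule S00_dil_reflect[OF et]) (simp add: r_def)
 have gkS: "S00 r (gk P)" for P unfolding gk_def
 proof (rule S00_dil_reflect[OF ph])
 have "ri mu - 2 <= ri (mu + cl (fst P)) - 1" using cl1[of "fst P"] by simp
 thus "r <= p2 (ri (mu + cl (fst P)) - 1)" unfolding r_def by (rule powr_mono) simp
 qed
 have dS: "dil ph nu : schwartz" for nu by (rule schwartz_dil[OF band_schwartz[OF ph]])
 have eS: "dil et nu : schwartz" for nu by (rule schwartz_dil[OF band_schwartz[OF et]])
 have rG: "rd (conv (dil ps (mu + i)) (dil et mu))" for i by (intro rd_conv rd_dil band_rd ps et)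
 have w: "EX w. intc w & (ALL P z. norm (c P * pdiffs is (gk P) z) <= w P * wt (real m) z)" for m :: nat and "is"
 proof -
 have "EX v. ALL i. intc (v i) & (ALL k z. norm (cc x y i k * pdiffs is (dil ph (mu + i)) (h i *R (y + cvec k) - z)) <= v i k * wt (real m) z)"
 proof (rule choice, rule allI)
 fix i
 obtain B where B: "0 <= B" "!!s. norm (conv (dil ps (mu + i)) (dil et mu) s) <= B * wt (real m + (?n + 1)) s" using decE[OF rd_dec[OF rG]] by blast
 obtain D where D: "0 <= D" "!!s. norm (pdiffs is (dil ph (mu + i)) s) <= D * wt (real m) s" using decE[OF rd_dec[OF schwartz_rd_pdiffs[OF dS]]] by blast
 define E where "E = h i ^ CARD('n) / (2 * pi) ^ CARD('n)"
 have E: "0 <= E" using h0[of i] by (simp add: E_def)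
 define v where "v k = E * B * D * (1 + norm x) powr real m * wt (?n + 1) (x - h i *R (y + cvec k))" for k
 have "intc v" unfolding v_def[abs_def] by (intro integrable_mult_right lattice_wt_scaled_integrable h0) simp
 moreover have "norm (cc x y i k * pdiffs is (dil ph (mu + i)) (h i *R (y + cvec k) - z)) <= v k * wt (real m) z" for k z
 proof -
 define a where "a = h i *R (y + cvec k)"
 have "norm (cc x y i k * pdiffs is (dil ph (mu + i)) (a - z)) <= (E * (B * (wt (real m) (x - a) * wt (?n + 1) (x - a)))) * (D * wt (real m) (a - z))"
 unfolding cc_def norm_mult wt_mult a_def[symmetric] E_def[symmetric] norm_of_real using B D E by (intro mult_mono) auto
 also have "... = E * B * D * wt (?n + 1) (x - a) * (wt (real m) (x - a) * wt (real m) (a - z))" by (simp only: mult_ac)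
 also have "... <= E * B * D * wt (?n + 1) (x - a) * ((1 + norm x) powr real m * wt (real m) z)"
 proof (rule mult_left_mono)
 have "wt (real m) (x - a) * wt (real m) (a - z) <= wt (real m) (x + - z)" using wt_add_ge[of "real m" "x - a" "a - z"] by simp
 also have "... <= (1 + norm x) powr real m * wt (real m) (- z)" by (rule wt_shift_le) simp
 finally show "wt (real m) (x - a) * wt (real m) (a - z) <= (1 + norm x) powr real m * wt (real m) z" by simp
 qed (use B D E in auto)
 finally show ?thesis unfolding v_def a_def by (simp only: mult_ac)
 qed
 ultimately show "EX v. intc v & (ALL k z. norm (cc x y i k * pdiffs is (dil ph (mu + i)) (h i *R (y + cvec k) - z)) <= v k * wt (real m) z)" by blast
 qed
 then obtain v where v: "ALL i. intc (v i) & (ALL k z. norm (cc x y i k * pdiffs is (dil ph (mu + i)) (h i *R (y + cvec k) - z)) <= v i k * wt (real m) z)" by blast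
 have "intc (%P. if fst P : I then v (fst P) (snd P) else 0)" by (rule integrable_pairs_finite[OF finI]) (use v in blast)
 moreover have "norm (c P * pdiffs is (gk P) z) <= (if fst P : I then v (fst P) (snd P) else 0) * wt (real m) z" for P z
 proof (cases "fst P : I")
 case True
 have "norm (c P * pdiffs is (gk P) z) = norm (cc x y (fst P) (snd P) * pdiffs is (dil ph (mu + fst P)) (h (fst P) *R (y + cvec (snd P)) - z))"
 using True unfolding c_def gk_def clI[OF True] pdiffs_reflect[OF dS] by (simp add: norm_mult norm_power)
 thus ?thesis using v True by simp
 qed (simp add: c_def)
 ultimately show ?thesis by blast
 qed
 have eq: "pdiffs is g z = (LC P. c P * pdiffs is (gk P) z)" for "is" z
 proof -
 obtain v where v: "intc v" "ALL P z. norm (c P * pdiffs is (gk P) z) <= v P * wt (real 0) z" using w by blast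
 have vi: "intc (%P. v P * wt (real 0) z)" by (rule integrable_mult_left) (rule v(1))
 have int: "intc (%P. c P * pdiffs is (gk P) z)"
 by (rule integrable_dominated[OF vi]) (use v(2) in auto)
 have "(LC P. c P * pdiffs is (gk P) z) = (LC i. (LC k. c (i, k) * pdiffs is (gk (i, k)) z))"
 by (rule integral_cube[OF int])
 also have "... = (SUM i:I. (LC k. c (i, k) * pdiffs is (gk (i, k)) z))"
 by (rule count_integral_finite[OF finI]) (simp add: c_def)
 also have "... = (SUM i:I. (-1) ^ length is * cr (1 / (2 * pi) ^ CARD('n)) * conv (pdiffs is (dil ph (mu + i))) (conv (dil ps (mu + i)) (dil et mu)) (x - z))"
 proof (rule sum.cong[OF refl])
 fix i assume i: "i : I"
 let ?f = "pdiffs is (dil ph (mu + i))" and ?G = "conv (dil ps (mu + i)) (dil et mu)"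
 have e: "c (i, k) * pdiffs is (gk (i, k)) z = (-1) ^ length is * cr (1 / (2 * pi) ^ CARD('n)) * cr (h i ^ CARD('n)) * (?f (h i *R (y + cvec k) - z) * ?G (x - h i *R (y + cvec k)))" for k
 using i unfolding c_def gk_def fst_conv snd_conv clI[OF i] pdiffs_reflect[OF dS] cc_def by simp
 have "cr (h i ^ CARD('n)) * (LC k. ?f (h i *R (y + cvec k) - z) * ?G (x - h i *R (y + cvec k))) = conv ?f ?G (x - z)"
 proof (rule scaled_sampling[OF schwartz_rd_pdiffs[OF dS] rG h0])
 fix xi
 show "norm (h i *R xi) < 2" if "ft ?f xi ~= 0"
 proof -
 obtain d where "ALL f : schwartz. ft (pdiffs is f) xi = d * ft f xi" using ft_pdiffs_factor[of "is" xi] by blast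
 hence "ft (dil ph (mu + i)) xi ~= 0" using that dS[of "mu + i"] by auto
 hence "ft ph (h i *R xi) ~= 0" by (simp add: ft_dil h_def)
 thus ?thesis using band_supp[OF ph] by blast
 qed
 show "norm (h i *R xi) < 2" if "ft ?G xi ~= 0"
 proof -
 have "ft (dil ps (mu + i)) xi ~= 0" using that ft_conv[OF rd_dil[OF band_rd[OF ps]] rd_dil[OF band_rd[OF et]]] by auto
 hence "ft ps (h i *R xi) ~= 0" by (simp add: ft_dil h_def)
 thus ?thesis using band_supp[OF ps] by blast
 qed
 qed
 thus "(LC k. c (i, k) * pdiffs is (gk (i, k)) z) = (-1) ^ length is * cr (1 / (2 * pi) ^ CARD('n)) * conv ?f ?G (x - z)"
 unfolding e integral_mult_right_zero mult.assoc by simp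
 qed
 also have "... = (-1) ^ length is * cr (1 / (2 * pi) ^ CARD('n)) * (SUM i:I. conv (pdiffs is (dil ph (mu + i))) (conv (dil ps (mu + i)) (dil et mu)) (x - z))"
 by (simp only: sum_distrib_left)
 also have "... = (-1) ^ length is * pdiffs is (dil et mu) (x - z)"
 unfolding I_def reproducing_sum[OF ph ps PU et] by simp
 also have "... = pdiffs is g z" unfolding g_def pdiffs_reflect[OF eS] ..
 finally show ?thesis by simp
 qed
 have S: "intc (%P. c P * u (gk P))" "u g = (LC P. c P * u (gk P))"
 using SP_series_ex[OF u r gS gkS eq w] by blast+
 have ugk: "c (i, k) * u (gk (i, k)) = cc x y i k * LPconv ph (mu + i) u (h i *R (y + cvec k))" if i: "i : I" for i k
 using i unfolding c_def gk_def LPconv_def fst_conv snd_conv clI[OF i] by simp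
 show "intc (%k. cc x y i k * LPconv ph (mu + i) u (h i *R (y + cvec k)))" if "i : {-1,0,1}"
 proof -
 have i: "i : I" using that by (simp add: I_def)
 have "(NS k. en (norm (c (i, k) * u (gk (i, k))))) <= (NS j. (NS k. en (norm (c (j, k) * u (gk (j, k))))))"
 by (rule nn_integral_ge_point) simp
 also have "... = (NS P. en (norm (c P * u (gk P))))" by (rule nn_integral_fst_count_space)
 also have "... < \<infinity>" using S(1) by (simp add: integrable_iff_bounded)
 finally have "intc (%k. c (i, k) * u (gk (i, k)))" by (intro integrableI_bounded) auto
 thus ?thesis unfolding ugk[OF i] .
 qed
 have "u g = (LC i. (LC k. c (i, k) * u (gk (i, k))))" unfolding S(2) by (rule integral_cube[OF S(1)])
 also have "... = (SUM i:I. (LC k. c (i, k) * u (gk (i, k))))"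
 by (rule count_integral_finite[OF finI]) (simp add: c_def)
 also have "... = (SUM i:I. LC k. cc x y i k * LPconv ph (mu + i) u (h i *R (y + cvec k)))"
 by (intro sum.cong refl) (simp only: ugk)
 finally show "u (%z. dil et mu (x - z)) = (SUM i:{-1,0,1}. LC k. cc x y i k * LPconv ph (mu + i) u (h i *R (y + cvec k)))"
 unfolding g_def I_def .
qed

section \<open>Powers of extended nonnegative numbers; measurability of the Littlewood-Paley
  pieces\<close>

text \<open>Mirrors the case distinction in \<open>TL_normp\<close>, so that infinite values can be
  carried through the estimates.\<close>

definition epow :: "ennreal => real => ennreal" where
 "epow x t = (if x = \<infinity> then \<infinity> else en (enn2real x powr t))"

lemma epow_0 [simp]: "epow 0 t = 0" by (simp add: epow_def)

lemma epow_top [simp]: "epow top t = top" by (simp add: epow_def)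

lemma epow_ennreal: "0 <= a ==> epow (en a) t = en (a powr t)" by (simp add: epow_def)

lemma epow_mono: assumes "x <= y" "0 <= t" shows "epow x t <= epow y t"
proof (cases y)
 case (real b)
 then obtain a where a: "0 <= a" "x = en a" using assms(1) by (cases x) (auto simp: top_unique)
 hence "a <= b" using assms(1) real by simp
 thus ?thesis using a real assms(2) by (simp add: epow_ennreal powr_mono2 ennreal_leI)
qed simp

lemma epow_mult: assumes t: "0 < t" shows "epow (x * y) t = epow x t * epow y t"
proof -
 have top: "epow (top * z) t = epow top t * epow z t" for z
 proof (cases "z = 0")
 case False
 hence "epow z t ~= 0" by (cases z) (auto simp: epow_ennreal)
 thus ?thesis using False by (simp add: ennreal_top_mult)
 qed simp
 show ?thesis
 proof (cases x)
 case (real a)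
 show ?thesis
 proof (cases y)
 case (real b)
 thus ?thesis using \<open>0 <= a\<close> \<open>x = en a\<close> by (simp add: epow_ennreal ennreal_mult[symmetric] powr_mult)
 next
 case top
 thus ?thesis using \<open>epow (top * x) t = epow top t * epow x t\<close>[unfolded mult.commute[of top]]
 by (simp add: mult.commute)
 qed
 next
 case top
 thus ?thesis using \<open>!!z. epow (top * z) t = epow top t * epow z t\<close> by simp
 qed
qed

lemma epow_epow: assumes "0 < s" "0 < t" shows "epow (epow x s) t = epow x (s * t)"
 by (cases x) (simp_all add: epow_ennreal powr_powr)

lemma epow_1: "epow x 1 = x"
 by (cases x) (simp_all add: epow_ennreal)

lemma epow_add: assumes "0 < s" "0 < t" shows "epow x s * epow x t = epow x (s + t)"
 by (cases x) (simp_all add: epow_ennreal powr_add ennreal_mult[symmetric])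

lemma epow_measurable [measurable]:
 assumes [measurable]: "f : bm M" shows "(%x. epow (f x) t) : bm M"
 unfolding epow_def by measurable

lemma epow_le_iff: assumes t: "0 < t" shows "epow x t <= y \<longleftrightarrow> x <= epow y (1 / t)"
proof
 assume "epow x t <= y"
 hence "epow (epow x t) (1 / t) <= epow y (1 / t)" using t by (intro epow_mono) auto
 thus "x <= epow y (1 / t)" using t by (simp add: epow_epow epow_1)
next
 assume "x <= epow y (1 / t)"
 hence "epow x t <= epow (epow y (1 / t)) t" using t by (intro epow_mono) auto
 thus "epow x t <= y" using t by (simp add: epow_epow epow_1)
qed

lemma epow_SUP: assumes t: "0 < t" shows "epow (SUP i\<in>A. f i) t = (SUP i\<in>A. epow (f i) t)"
proof (rule antisym)
 show "epow (SUP i\<in>A. f i) t <= (SUP i\<in>A. epow (f i) t)"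
 unfolding epow_le_iff[OF t] by (rule SUP_least, unfold epow_le_iff[OF t, symmetric], rule SUP_upper)
 show "(SUP i\<in>A. epow (f i) t) <= epow (SUP i\<in>A. f i) t"
 using t by (intro SUP_least epow_mono SUP_upper) auto
qed

text \<open>Every term is at most the power \<open>1 / r\<close> of the right side. Split it into
  its powers \<open>r\<close> and \<open>1 - r\<close>, bound the latter, and sum.\<close>

lemma epow_sum_le:
 fixes f :: "'a => ennreal"
 assumes r: "0 < r" "r <= 1"
 shows "epow (NS k. f k) r <= (NS k. epow (f k) r)"
proof (cases "r = 1")
 case False
 hence r1: "0 < 1 - r" using r by simp
 define S where "S = (NS k. epow (f k) r)"
 have "epow (f k) r <= S" for k unfolding S_def by (rule nn_integral_ge_point) simp
 hence fk: "f k <= epow S (1 / r)" for k by (simp add: epow_le_iff[OF r(1)])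
 have "f k <= epow (f k) r * epow S ((1 - r) / r)" for k
 proof -
 have "f k = epow (f k) r * epow (f k) (1 - r)" using r r1 by (simp add: epow_add epow_1)
 also have "... <= epow (f k) r * epow (epow S (1 / r)) (1 - r)" using r1 by (intro mult_left_mono epow_mono fk) auto
 also have "epow (epow S (1 / r)) (1 - r) = epow S ((1 - r) / r)" using r r1 by (simp add: epow_epow)
 finally show ?thesis .
 qed
 hence "(NS k. f k) <= (NS k. epow (f k) r * epow S ((1 - r) / r))" by (intro nn_integral_mono)
 also have "... = epow S 1 * epow S ((1 - r) / r)" unfolding S_def epow_1 by (simp add: nn_integral_multc)
 also have "... = epow S (1 / r)" using r r1 by (subst epow_add) (auto simp: field_simps)
 finally show ?thesis unfolding epow_le_iff[OF r(1)] S_def .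
qed (simp add: epow_1)

text \<open>A substitute for Hoelder's inequality that works for exponents on both sides of 1: split
  the weight into two square roots, bound one of them times the term by the supremum, and the
  supremum by the sum. For geometric weights the price is half of the decay.\<close>

lemma epow_weighted_sum_le:
 fixes y :: "'a => ennreal"
 assumes t: "0 < t" and w: "!!k. 0 <= w k"
 shows "epow (NS k. en (w k) * y k) t
 <= epow (NS k. en (sqrt (w k))) t * (NS k. en (w k powr (t / 2)) * epow (y k) t)"
proof -
 define S where "S = (NS k. en (w k powr (t / 2)) * epow (y k) t)"
 have e: "en (w k powr (t / 2)) * epow (y k) t = epow (en (sqrt (w k)) * y k) t" for k
 proof -
 have "sqrt (w k) powr t = w k powr (t / 2)" using w[of k] by (simp add: powr_half_sqrt[symmetric] powr_powr)
 thus ?thesis using t w by (simp add: epow_mult epow_ennreal)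
 qed
 have "epow (en (sqrt (w k)) * y k) t <= S" for k unfolding S_def e[symmetric] by (rule nn_integral_ge_point) simp
 hence b: "en (sqrt (w k)) * y k <= epow S (1 / t)" for k by (simp add: epow_le_iff[OF t])
 have "en (w k) * y k <= en (sqrt (w k)) * epow S (1 / t)" for k
 proof -
 have "en (w k) * y k = en (sqrt (w k)) * (en (sqrt (w k)) * y k)"
 using w[of k] by (simp add: mult.assoc[symmetric] ennreal_mult[symmetric])
 thus ?thesis using b[of k] by (simp add: mult_left_mono)
 qed
 hence "(NS k. en (w k) * y k) <= (NS k. en (sqrt (w k)) * epow S (1 / t))" by (intro nn_integral_mono)
 also have "... = (NS k. en (sqrt (w k))) * epow S (1 / t)" by (rule nn_integral_multc) simp
 finally have "epow (NS k. en (w k) * y k) t <= epow ((NS k. en (sqrt (w k))) * epow S (1 / t)) t"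
 using t by (intro epow_mono) auto
 also have "... = epow (NS k. en (sqrt (w k))) t * S" using t by (simp add: epow_mult epow_epow epow_1)
 finally show ?thesis unfolding S_def .
qed

lemma epow_finite_sum_le:
 fixes y :: "'a => ennreal"
 assumes t: "0 < t" and I: "finite I"
 shows "epow (SUM i:I. y i) t <= en (real (card I) powr t) * (SUM i:I. epow (y i) t)"
proof -
 define S where "S = (SUM i:I. epow (y i) t)"
 have "y i <= epow S (1 / t)" if "i : I" for i
 unfolding epow_le_iff[OF t, symmetric] S_def by (rule member_le_sum[OF that _ I]) simp
 hence "(SUM i:I. y i) <= of_nat (card I) * epow S (1 / t)" using sum_bounded_above[of I y "epow S (1 / t)"] by simp
 hence "epow (SUM i:I. y i) t <= epow (en (real (card I)) * epow S (1 / t)) t" using t by (intro epow_mono) (auto simp: ennreal_of_nat_eq_real_of_nat)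
 also have "... = en (real (card I) powr t) * S" using t by (simp add: epow_mult epow_epow epow_1 epow_ennreal del: ennreal_of_nat_eq_real_of_nat)
 finally show ?thesis unfolding S_def .
qed

lemma nn_integral_int_SUP:
 fixes f :: "int => ennreal"
 shows "(NS j. f j) = (SUP N::nat. SUM j:{-int N..int N}. f j)"
proof -
 have "f j = (SUP N::nat. f j * ind {-int N..int N} j)" for j
 proof (rule antisym)
 have "j : {-int (nat \<bar>j\<bar>)..int (nat \<bar>j\<bar>)}" by auto
 hence "f j = f j * ind {-int (nat \<bar>j\<bar>)..int (nat \<bar>j\<bar>)} j" by simp
 also have "... <= (SUP N::nat. f j * ind {-int N..int N} j)" by (rule SUP_upper) simp
 finally show "f j <= (SUP N::nat. f j * ind {-int N..int N} j)" .
 show "(SUP N::nat. f j * ind {-int N..int N} j) <= f j" by (intro SUP_least) (simp add: indicator_def)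
 qed
 hence "(NS j. f j) = (NS j. (SUP N::nat. f j * ind {-int N..int N} j))" by simp
 also have "... = (SUP N::nat. (NS j. f j * ind {-int N..int N} j))"
 by (intro nn_integral_monotone_convergence_SUP) (auto simp: incseq_def le_fun_def indicator_def)
 also have "... = (SUP N::nat. SUM j:{-int N..int N}. f j)"
 proof (intro SUP_cong refl)
 fix N :: nat
 show "(NS j. f j * ind {-int N..int N} j) = (SUM j:{-int N..int N}. f j)"
 by (subst nn_integral_count_space'[of "{-int N..int N}"]) (auto simp: indicator_def)
 qed
 finally show ?thesis .
qed

lemma fefferman_stein_int:
 assumes p: "1 < p" and q: "1 < q"
 shows "EX C>=0. ALL c (h :: int => 'a::euclidean_space => real). (ALL j. LB (h j)) -->
 (NI x. epow (NS j. en (bavg (j + c) (h j) x powr q)) (p / q))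
 <= en C * (NI x. epow (NS j. en (h j x powr q)) (p / q))"
proof -
 obtain C where C: "C > 0" "ALL J c (h :: int => 'a => real). finite J & (ALL j:J. LB (h j)) -->
 (NI x. en ((SUM j:J. bavg (j + c) (h j) x powr q) powr (p / q))) <= en C * (NI x. en ((SUM j:J. h j x powr q) powr (p / q)))"
 using fefferman_stein[OF p q, where 'a='a] by blast
 have pq: "0 < p / q" using p q by simp
 have e: "en ((SUM j:J. f j powr q) powr (p / q)) = epow (SUM j:J. en (f j powr q)) (p / q)" for J and f :: "int => real"
 by (simp add: sum_ennreal epow_ennreal sum_nonneg)
 have "(NI x. epow (NS j. en (bavg (j + c) (h j) x powr q)) (p / q))
 <= en C * (NI x. epow (NS j. en (h j x powr q)) (p / q))"
 if h: "ALL j. LB (h j)" for c and h :: "int => 'a => real"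
 proof -
 let ?J = "%N::nat. {-int N..int N}"
 let ?B = "%N x. epow (SUM j:?J N. en (bavg (j + c) (h j) x powr q)) (p / q)"
 have "(NI x. epow (NS j. en (bavg (j + c) (h j) x powr q)) (p / q)) = (NI x. (SUP N. ?B N x))"
 unfolding nn_integral_int_SUP epow_SUP[OF pq] ..
 also have "... = (SUP N. (NI x. ?B N x))"
 proof (rule nn_integral_monotone_convergence_SUP)
 have "?B m x <= ?B n x" if "m <= n" for m n x using pq that by (intro epow_mono sum_mono2) auto
 thus "incseq ?B" unfolding incseq_def le_fun_def by blast
 fix N
 have m: "(%x. bavg (j + c) (h j) x) : BM" for j using LB_measurable[OF LB_bavg[OF h[rule_format]]] .
 show "?B N : bm lborel" using m by measurable
 qed
 also have "... <= en C * (NI x. epow (NS j. en (h j x powr q)) (p / q))"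
 proof (rule SUP_least)
 fix N
 have "(NI x. ?B N x) <= en C * (NI x. epow (SUM j:?J N. en (h j x powr q)) (p / q))"
 using C(2)[rule_format, of "?J N" h c] h unfolding e by simp
 also have "... <= en C * (NI x. epow (NS j. en (h j x powr q)) (p / q))"
 unfolding nn_integral_int_SUP using pq by (intro mult_left_mono nn_integral_mono epow_mono SUP_upper) auto
 finally show "(NI x. ?B N x) <= en C * (NI x. epow (NS j. en (h j x powr q)) (p / q))" .
 qed
 finally show ?thesis .
 qed
 thus ?thesis using C(1) by (intro exI[of _ C]) auto
qed

lemma TL_normp_epow:
 "TL_normp ph al q p u = (NI x. epow (NS nu. en ((p2 (ri nu * al) * norm (LPconv ph nu u x)) powr q)) (p / q))"
 unfolding TL_normp_def epow_def Let_def ..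

lemma dil_reflect_schwartz0: "band f ==> (%z. dil f nu (x - z)) : schwartz0"
 by (rule S00_schwartz0[of "p2 (ri nu - 1)"], simp, rule S00_dil_reflect) simp_all

lemma LPconv_bounded:
 fixes ph :: "'n::finite fn"
 assumes ph: "band ph" and u: "u : SP"
 shows "EX C. ALL x. norm x <= R --> norm (LPconv ph nu u x) <= C"
proof -
 have S: "dil ph nu : schwartz" by (intro schwartz_dil band_schwartz ph)
 have "EX B. ALL x z. norm x <= R --> norm (pdiffs is (%z. dil ph nu (x - z)) z) <= B * wt (real m) z" for m :: nat and "is"
 proof -
 obtain D where D: "0 <= D" "!!s. norm (pdiffs is (dil ph nu) s) <= D * wt (real m) s" using decE[OF rd_dec[OF schwartz_rd_pdiffs[OF S]]] by blast
 have "norm (pdiffs is (%z. dil ph nu (x - z)) z) <= (D * (1 + R) powr real m) * wt (real m) z" if x: "norm x <= R" for x z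
 proof -
 have "norm (pdiffs is (%z. dil ph nu (x - z)) z) = norm (pdiffs is (dil ph nu) (x - z))"
 unfolding pdiffs_reflect[OF S] by (simp add: norm_mult norm_power)
 also have "... <= D * wt (real m) (x + - z)" using D(2)[of "x - z"] by simp
 also have "... <= D * ((1 + norm x) powr real m * wt (real m) (- z))" using D(1) by (intro mult_left_mono wt_shift_le) auto
 also have "... <= D * ((1 + R) powr real m * wt (real m) (- z))" using D(1) x by (intro mult_left_mono mult_right_mono powr_mono2) auto
 finally show ?thesis by (simp add: mult.assoc)
 qed
 thus ?thesis by blast
 qed
 hence "ALL m. EX B. ALL is x z. norm x <= R --> norm (pdiffs is (%z. dil ph nu (x - z)) z) <= B is * wt (real m) z" by (intro allI choice)
 then obtain B where B: "ALL (m::nat) is x z. norm x <= R --> norm (pdiffs is (%z. dil ph nu (x - z)) z) <= B m is * wt (real m) z" using choice by metis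
 obtain C N where C: "ALL f:schwartz0. norm (u f) <= C * (\<Sum>m\<le>N. SUM is:{is::'n list. length is <= N}. seminorm_S m is f)"
 using u unfolding SP_def cont_on_S0_def by blast
 have "norm (LPconv ph nu u x) <= \<bar>C\<bar> * (\<Sum>m\<le>N. SUM is:{is::'n list. length is <= N}. B m is)" if x: "norm x <= R" for x
 proof -
 let ?f = "%z. dil ph nu (x - z)"
 have f: "?f : schwartz0" by (rule dil_reflect_schwartz0[OF ph])
 have "norm (LPconv ph nu u x) <= C * (\<Sum>m\<le>N. SUM is:{is::'n list. length is <= N}. seminorm_S m is ?f)"
 unfolding LPconv_def using C f by blast
 also have "... <= \<bar>C\<bar> * (\<Sum>m\<le>N. SUM is:{is::'n list. length is <= N}. seminorm_S m is ?f)"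
 by (intro mult_right_mono sum_nonneg seminorm_S_nonneg schwartz0_schwartz f) auto
 also have "... <= \<bar>C\<bar> * (\<Sum>m\<le>N. SUM is:{is::'n list. length is <= N}. B m is)"
 using B x by (intro mult_left_mono sum_mono seminorm_S_le) auto
 finally show ?thesis .
 qed
 thus ?thesis by blast
qed

text \<open>\<open>u\<close> is an abstract functional, so its effect on the dependence on
  \<open>x\<close> is not visible. The sample expansion of the convolution with \<open>ph\<close>
  itself, at offset 0, puts \<open>x\<close> into explicit measurable coefficients of a countable
  sum.\<close>

lemma LPconv_measurable:
 fixes ph :: "'n::finite fn"
 assumes ph: "band ph" and ps: "band ps" and PU: "PU ph ps" and u: "u : SP"
 shows "LPconv ph nu u : BM"
proof -
 let ?h = "%i::int. p2 (- ri (nu + i))"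
 let ?G = "%i. conv (dil ps (nu + i)) (dil ph nu)"
 let ?c = "%i. cr (?h i ^ CARD('n) / (2 * pi) ^ CARD('n))"
 have m: "?G i : BM" for i by (intro rd_measurable rd_conv rd_dil band_rd ph ps)
 have eq: "LPconv ph nu u = (%x. SUM i:{-1,0,1}. LC k. ?c i * ?G i (x - ?h i *R (0 + cvec k)) * LPconv ph (nu + i) u (?h i *R (0 + cvec k)))"
 unfolding LPconv_def[of ph nu] by (rule ext, rule sample_expansion(2)[OF ph ps PU ph u])

 have "(%x. LC k. ?c i * ?G i (x - ?h i *R (0 + cvec k)) * LPconv ph (nu + i) u (?h i *R (0 + cvec k))) : BM" for i
 proof (rule sigma_finite_measure.borel_measurable_lebesgue_integral[OF sigma_finite_count_space])
 show "(%(x, k). ?c i * ?G i (x - ?h i *R (0 + cvec k)) * LPconv ph (nu + i) u (?h i *R (0 + cvec k))) : bm (borel \<Otimes>\<^sub>M count_space UNIV)"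
 unfolding measurable_pair_swap_iff[of _ borel] case_prod_conv
 proof (rule measurable_pair_measure_countable1)
 show "countable (UNIV::(int^'n) set)" by simp
 fix k :: "int^'n"
 show "(%x. case (k, x) of (k, x) => ?c i * ?G i (x - ?h i *R (0 + cvec k)) * LPconv ph (nu + i) u (?h i *R (0 + cvec k))) : BM"
 unfolding case_prod_conv using m by measurable
 qed
 qed
 thus ?thesis by (subst eq) (rule borel_measurable_sum)
qed

lemma LPconv_LB:
 assumes "band ph" "band ps" "PU ph ps" "u : SP"
 shows "LB (%x. norm (LPconv ph nu u x))"
 unfolding LB_def using LPconv_measurable[OF assms] LPconv_bounded[OF assms(1,4)] by (auto intro!: borel_measurable_norm)

section \<open>Bounds for r-th powers by sampling\<close>

lemma nn_integral_scale:
 fixes G :: "real^'n::finite => ennreal"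
 assumes G: "G : BM" and c: "0 < c"
 shows "(NI x. G (c *R x)) = en (1 / c ^ CARD('n)) * (NI x. G x)"
proof -
 have "(NI x. G x) = en (c ^ CARD('n)) * (NI x. G (c *R x))"
 using nn_integral_affine[OF G, of c 0] c by simp
 hence "en (1 / c ^ CARD('n)) * (NI x. G x) = (en (1 / c ^ CARD('n)) * en (c ^ CARD('n))) * (NI x. G (c *R x))"
 by (simp only: mult.assoc)
 also have "en (1 / c ^ CARD('n)) * en (c ^ CARD('n)) = 1" using c by (simp add: ennreal_mult[symmetric])
 finally show ?thesis by simp
qed

lemma LB_cmult: assumes "LB h" "0 <= c" shows "LB (%x. c * h x)"
proof -
 have "EX C. ALL x. norm x <= R --> c * h x <= C" for R
 proof -
 obtain C where "ALL x. norm x <= R --> h x <= C" using LB_bound[OF assms(1)] by blast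
 hence "ALL x. norm x <= R --> c * h x <= c * C" using assms(2) by (auto intro: mult_left_mono)
 thus ?thesis by blast
 qed
 thus ?thesis unfolding LB_def using assms LB_measurable[OF assms(1)] LB_nonneg[OF assms(1)] by auto
qed

text \<open>The r-th powers of the three neighbouring pieces that enter a sample expansion, with the
  smoothness weight of the source space.\<close>

definition lpow :: "'n::finite fn => real => real => ('n fn => complex) => int => real^'n => real" where
 "lpow ph al r u mu s = (SUM i:{-1,0,1::int}. (p2 (ri (mu + i) * al) * norm (LPconv ph (mu + i) u s)) powr r)"

lemma lpow_nonneg: "0 <= lpow ph al r u mu s" unfolding lpow_def by (intro sum_nonneg) simp

lemma LB_lpow:
 assumes "band ph" "band ps" "PU ph ps" "u : SP" "0 <= r"
 shows "LB (lpow ph al r u mu)"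
 unfolding lpow_def[abs_def] using assms by (intro LB_sum LB_powr LB_cmult LPconv_LB) auto

lemma lpow_ge:
 assumes al: "-1 <= al" "al <= 0" and r: "0 < r"
 shows "(SUM i:{-1,0,1::int}. norm (LPconv ph (mu + i) u s) powr r) <= 2 powr r * p2 (- (ri mu * al * r)) * lpow ph al r u mu s"
 unfolding lpow_def sum_distrib_left
proof (rule sum_mono)
 fix i :: int assume i: "i : {-1,0,1}"
 let ?X = "norm (LPconv ph (mu + i) u s)"
 have "0 <= r * (1 + ri i * al)" using i al r by auto
 hence "1 <= p2 (r * (1 + ri i * al))" by (simp add: ge_one_powr_ge_zero)
 hence "?X powr r <= p2 (r * (1 + ri i * al)) * ?X powr r" by (intro mult_le_cancel_right1[THEN iffD2]) auto
 also have "r * (1 + ri i * al) = r + - (ri mu * al * r) + ri (mu + i) * al * r" by (simp add: algebra_simps)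
 also have "2 powr ... * ?X powr r = 2 powr r * p2 (- (ri mu * al * r)) * (p2 (ri (mu + i) * al) * ?X) powr r"
 by (simp only: powr_add powr_mult powr_powr mult.assoc)
 finally show "?X powr r <= ..." .
qed

text \<open>For \<open>r \<le> 1\<close> the r-th power may be taken inside the lattice sum. As the
  left side does not depend on the offset of the lattice, averaging over the unit cube replaces the
  sum by an integral.\<close>

lemma sample_power_bound:
 fixes ph ps et :: "'n::finite fn"
 assumes ph: "band ph" and ps: "band ps" and PU: "PU ph ps" and et: "band et"
 and r: "0 < r" "r <= 1" and N: "0 <= N" and al: "-1 <= al" "al <= 0"
 shows "EX C>=0. ALL u mu x. u : SP --> en (norm (u (%z. dil et mu (x - z))) powr r)
 <= en (C * p2 (- (ri mu * al * r))) * (NI s. en (lpow ph al r u mu s * (p2 (ri mu * real CARD('n)) * wt N (tp mu *R (x - s)))))"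
proof -
 let ?n = "real CARD('n)" and ?I = "{-1,0,1::int}"
 let ?A = "%h i y k. h i *R (y + cvec k)"
 let ?B = "%u mu s V. lpow ph al r u mu s * (p2 (ri mu * ?n) * V s)"
 let ?C = "%mu. 2 powr ?n * p2 (ri mu * ?n)"
 let ?D = "%mu. - (ri mu * al * r)"
 let ?E = "%mu x. %z. dil et mu (x - z)"
 let ?G = "%mu G s. SUM i:?I. en (3 powr r) * (en (?C mu) * G i s)"
 let ?H = "%cc y i k U h. norm (cc y i k) * U i (?A h i y k)"
 let ?J = "%h i mu. h i ^ CARD('n) / (2 * pi) ^ CARD('n) * p2 (ri mu * ?n)"
 let ?M = "%G h y. NS k. (SUM i:?I. en (3 powr r) * G i (?A h i y k))"
 \<comment> \<open>Decay of order \<open>N / r\<close> becomes \<open>N\<close> after the r-th power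
   is taken.\<close>
 have "EX B. 0 <= B & (ALL s. norm (conv (dil ps i) et s) <= B * wt (N / r) s)" for i
 using decE[OF rd_dec[OF rd_conv[OF rd_dil[OF band_rd[OF ps]] band_rd[OF et]]]] by metis
 then obtain B where B: "!!i. 0 <= B i" "!!i s. norm (conv (dil ps i) et s) <= B i * wt (N / r) s" by metis
 define E where "E = 2 powr ?n * (B (-1) + B 0 + B 1)"
 have E: "0 <= E" using B(1)[of "-1"] B(1)[of 0] B(1)[of 1] by (simp add: E_def)
 have BE: "2 powr ?n * B i <= E" if "i : ?I" for i using that B(1)[of "-1"] B(1)[of 0] B(1)[of 1] by (auto simp: E_def)
 define C where "C = 3 powr r * (E powr r * 2 powr ?n) * p2 r"
 have C: "0 <= C" by (simp add: C_def)
 have main: "en (norm (u (?E mu x)) powr r) <= en (C * p2 (?D mu)) * (NI s. en (lpow ph al r u mu s * (p2 (ri mu * ?n) * wt N (tp mu *R (x - s)))))"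
 if u: "u : SP" for u mu x
 proof -
 define h where "h i = p2 (- ri (mu + i))" for i
 have h: "0 < h i" for i by (simp add: h_def)
 define cc where "cc y i k = cr (h i ^ CARD('n) / (2 * pi) ^ CARD('n)) * conv (dil ps (mu + i)) (dil et mu) (x - h i *R (y + cvec k))" for y i k
 define U where "U i s = norm (LPconv ph (mu + i) u s)" for i s
 have Um [measurable]: "U i : BM" for i unfolding U_def[abs_def] using LPconv_measurable[OF ph ps PU u, of "mu + i"] by measurable
 define V where "V s = wt N (tp mu *R (x - s))" for s
 have Vm [measurable]: "V : BM" unfolding V_def[abs_def] by measurable
 have V0: "0 <= V s" for s by (simp add: V_def)
 define G where "G i s = en (E powr r * V s * U i s powr r)" for i s
 have Gm [measurable]: "G i : BM" for i unfolding G_def[abs_def] by measurable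
 have ccb: "(?H cc y i k U h) powr r <= E powr r * V (?A h i y k) * U i (?A h i y k) powr r" if i: "i : ?I" for y i k
 proof -
 let ?s = "h i *R (y + cvec k)"
 have p: "?J h i mu <= 2 powr ?n"
 proof -
 have "1 <= (2 * pi) ^ CARD('n)" using pi_gt3 by (intro one_le_power) simp
 hence "h i ^ CARD('n) / (2 * pi) ^ CARD('n) <= h i ^ CARD('n) / 1" using h[of i] by (intro divide_left_mono) auto
 hence "h i ^ CARD('n) / (2 * pi) ^ CARD('n) <= h i ^ CARD('n)" by (simp only: div_by_1)
 hence "?J h i mu <= h i ^ CARD('n) * p2 (ri mu * ?n)" by (rule mult_right_mono) simp
 also have "... = p2 (?n * - ri (mu + i) + ri mu * ?n)" unfolding h_def two_powr_power powr_add ..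
 also have "... <= 2 powr ?n" using i by (intro powr_mono) (auto simp: algebra_simps)
 finally show ?thesis .
 qed
 have "norm (cc y i k) = h i ^ CARD('n) / (2 * pi) ^ CARD('n) * (p2 (ri mu * ?n) * norm (conv (dil ps i) et (tp mu *R (x - ?s))))"
 unfolding cc_def conv_dil norm_mult norm_of_real using h[of i] by simp
 also have "... <= h i ^ CARD('n) / (2 * pi) ^ CARD('n) * (p2 (ri mu * ?n) * (B i * wt (N / r) (tp mu *R (x - ?s))))"
 using h[of i] by (intro mult_left_mono B) auto
 also have "... = (h i ^ CARD('n) / (2 * pi) ^ CARD('n) * p2 (ri mu * ?n)) * (B i * wt (N / r) (tp mu *R (x - ?s)))" by (simp only: mult.assoc)
 also have "... <= 2 powr ?n * (B i * wt (N / r) (tp mu *R (x - ?s)))" using B(1) by (intro mult_right_mono p) auto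
 also have "... <= E * wt (N / r) (tp mu *R (x - ?s))" using BE[OF i] by (simp add: mult.assoc[symmetric] mult_right_mono)
 finally have "(norm (cc y i k) * U i ?s) powr r <= (E * wt (N / r) (tp mu *R (x - ?s)) * U i ?s) powr r"
 using r by (intro powr_mono2 mult_right_mono) (auto simp: U_def)
 also have "... = E powr r * V ?s * U i ?s powr r" unfolding powr_mult wt_powr V_def using r by simp
 finally show ?thesis .
 qed
 have pt: "en (norm (u (?E mu x)) powr r) <= ?M G h y" for y
 proof -
 have eq: "u (?E mu x) = (SUM i:?I. LC k. cc y i k * LPconv ph (mu + i) u (?A h i y k))"
 unfolding cc_def h_def by (rule sample_expansion(2)[OF ph ps PU et u])
 have int: "intc (%k. cc y i k * LPconv ph (mu + i) u (?A h i y k))" if "i : ?I" for i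
 unfolding cc_def h_def by (rule sample_expansion(1)[OF ph ps PU et u that])
 let ?X = "%i. (NS k. en (?H cc y i k U h))"
 have "en (norm (u (?E mu x))) <= (SUM i:?I. en (norm (LC k. cc y i k * LPconv ph (mu + i) u (?A h i y k))))"
 unfolding eq by (subst sum_ennreal, simp, rule ennreal_leI, rule norm_sum)
 also have "... <= (SUM i:?I. ?X i)"
 proof (rule sum_mono)
 fix i assume "i : ?I"
 from integral_norm_bound_ennreal[OF int[OF this]]
 show "en (norm (LC k. cc y i k * LPconv ph (mu + i) u (?A h i y k))) <= ?X i" by (simp add: norm_mult U_def)
 qed
 finally have "epow (en (norm (u (?E mu x)))) r <= epow (SUM i:?I. ?X i) r" using r by (intro epow_mono) auto
 also have "... <= en (3 powr r) * (SUM i:?I. epow (?X i) r)" using epow_finite_sum_le[OF r(1), of ?I ?X] by simp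
 also have "... <= en (3 powr r) * (SUM i:?I. (NS k. G i (?A h i y k)))"
 proof (intro mult_left_mono sum_mono)
 fix i assume i: "i : ?I"
 have "epow (?X i) r <= (NS k. epow (en (?H cc y i k U h)) r)" by (rule epow_sum_le[OF r])
 also have "... <= (NS k. G i (?A h i y k))"
 proof (rule nn_integral_mono)
 fix k
 show "epow (en (?H cc y i k U h)) r <= G i (?A h i y k)"
 unfolding G_def by (subst epow_ennreal) (auto simp: U_def[of i "h i *R (y + cvec k)"] intro!: ennreal_leI ccb[OF i, unfolded U_def])
 qed
 finally show "epow (?X i) r <= (NS k. G i (?A h i y k))" .
 qed simp
 also have "... = ?M G h y"
 by (subst nn_integral_sum) (simp_all add: nn_integral_cmult distrib_left)
 finally show ?thesis by (simp only: epow_ennreal norm_ge_zero)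
 qed
 let ?L = "en (norm (u (?E mu x)) powr r)"
 let ?F = "%t. SUM i:?I. en (3 powr r) * G i (h i *R t)"
 \<comment> \<open>A quantity without \<open>y\<close> equals its integral over the unit cube, whose
   volume is 1; only here the freedom of the offset is used.\<close>
 have "?L = (NI y. ?L * ind ucube (y::real^'n))" by (simp add: nn_integral_cmult_indicator emeasure_ucube)
 also have "... <= (NI y. (NS k. ?F (y + cvec k)) * ind ucube y)"
 by (intro nn_integral_mono mult_right_mono pt) simp
 also have "... = (NI t. ?F t)" by (rule nn_integral_lattice[symmetric]) measurable
 also have "... = (SUM i:?I. en (3 powr r) * (NI t. G i (h i *R t)))"
 by (subst nn_integral_sum) (simp_all add: nn_integral_cmult)
 also have "... <= (SUM i:?I. en (3 powr r) * (en (?C mu) * (NI s. G i s)))"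
 proof (intro sum_mono mult_left_mono)
 fix i assume i: "i : ?I"
 have "1 / h i ^ CARD('n) = p2 (?n * ri (mu + i))" unfolding h_def two_powr_power mult_minus_right by (simp only: powr_minus_divide) simp
 also have "... <= p2 (?n + ri mu * ?n)" using i by (intro powr_mono) (auto simp: algebra_simps)
 finally have "1 / h i ^ CARD('n) <= 2 powr ?n * p2 (ri mu * ?n)" by (simp only: powr_add)
 thus "(NI t. G i (h i *R t)) <= en (?C mu) * (NI s. G i s)"
 unfolding nn_integral_scale[OF Gm h] by (intro mult_right_mono ennreal_leI) auto
 qed simp
 also have "... = (NI s. (?G mu G s))"
 by (subst nn_integral_sum) (simp_all add: nn_integral_cmult)
 also have "... <= (NI s. en (C * p2 (?D mu)) * en (?B u mu s V))"
 proof (rule nn_integral_mono)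
 fix s
 let ?K = "3 powr r * ?C mu * (E powr r * V s)"
 have K: "0 <= ?K" using V0 by simp
 have "?G mu G s = (SUM i:?I. en (?K * U i s powr r))"
 unfolding G_def using V0[of s] by (intro sum.cong refl) (simp add: ennreal_mult[symmetric] mult.assoc)
 also have "... = en (?K * (SUM i:?I. U i s powr r))" unfolding sum_distrib_left using K by (intro sum_ennreal) simp
 also have "... <= en (?K * (2 powr r * p2 (?D mu) * lpow ph al r u mu s))"
 unfolding U_def by (intro ennreal_leI mult_left_mono lpow_ge al r K)
 also have "?K * (2 powr r * p2 (?D mu) * lpow ph al r u mu s) = (C * p2 (?D mu)) * ?B u mu s V"
 unfolding C_def by (simp only: mult_ac)
 also have "en ... = en (C * p2 (?D mu)) * en (?B u mu s V)"
 using C by (intro ennreal_mult) (auto intro!: mult_nonneg_nonneg lpow_nonneg V0)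
 finally show "?G mu G s <= ..." .
 qed
 also have "... = en (C * p2 (?D mu)) * (NI s. en (?B u mu s V))"
 proof (rule nn_integral_cmult)
 have [measurable]: "lpow ph al r u mu : BM" using r by (intro LB_measurable LB_lpow[OF ph ps PU u]) simp
 show "(%s. en (?B u mu s V)) : bm lborel" by measurable
 qed
 finally show ?thesis unfolding V_def .
 qed
 show ?thesis using C main by blast
qed

section \<open>Almost diagonal matrices acting between two scales\<close>

lemma cubefn_eq_dil:
 fixes et :: "'n::finite fn"
 assumes et: "band et"
 shows "cubefn et (mu, k) = (%z. cr (p2 (- (ri mu * real CARD('n) / 2))) * dil et mu (corner (mu, k) - z))"
proof (rule ext)
 fix z
 have 1: "tp mu *R (corner (mu, k) - z) = - (tp mu *R z - cvec k)"
 by (simp add: corner_def scaleR_diff_right powr_minus)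
 have 2: "p2 (- (ri mu * real CARD('n) / 2)) * p2 (ri mu * real CARD('n)) = p2 (ri mu * real CARD('n) / 2)"
 by (simp only: powr_add[symmetric]) simp
 show "cubefn et (mu, k) z = cr (p2 (- (ri mu * real CARD('n) / 2))) * dil et mu (corner (mu, k) - z)"
 unfolding cubefn_def dil_def 1 band_even[OF et] fst_conv snd_conv mult.assoc[symmetric] of_real_mult[symmetric] 2 ..
qed

lemma SP_scale: "u : SP ==> f : schwartz0 ==> u (%x. a * f x) = a * u f"
 unfolding SP_def lin_on_S0_def by (drule CollectD, drule conjunct1, drule (1) bspec, drule (1) bspec, drule spec[of _ a], drule spec[of _ 0]) simp

lemma norm_SP_cubefn:
 fixes et :: "'n::finite fn"
 assumes "band et" "u : SP"
 shows "norm (u (cubefn et (mu, k))) = p2 (- (ri mu * real CARD('n) / 2)) * norm (u (%z. dil et mu (corner (mu, k) - z)))"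
 unfolding cubefn_eq_dil[OF assms(1)] SP_scale[OF assms(2) dil_reflect_schwartz0[OF assms(1)]] by (simp add: norm_mult)

lemma omega_dyadic:
 fixes k k' :: "int^'n::finite"
 shows "omega de (mu, k) (j, k') = p2 (- ri (max j mu) - \<bar>ri (j - mu)\<bar> * ((real CARD('n) + de) / 2)) * wt (real CARD('n) + de) (tp (min j mu) *R (corner (mu, k) - corner (j, k')))"
proof -
 let ?a = "(real CARD('n) + de) / 2"
 have mx: "max (tm mu) (tm j) = p2 (- ri (min j mu))"
 by (auto simp: max_def min_def)
 have mn: "min (tm mu) (tm j) = p2 (- ri (max j mu))"
 by (auto simp: max_def min_def)
 have "\<bar>ri (j - mu)\<bar> = ri (max j mu) - ri (min j mu)" by (auto simp: max_def min_def)
 moreover have "(p2 (- M)) powr (1 + a) / (p2 (- m)) powr a = p2 (- M - (M - m) * a)" for M m a :: real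
 unfolding powr_powr powr_diff[symmetric] by (simp add: algebra_simps)
 ultimately have "(p2 (- ri (max j mu))) powr (1 + ?a) / (p2 (- ri (min j mu))) powr ?a = p2 (- ri (max j mu) - \<bar>ri (j - mu)\<bar> * ?a)"
 by (simp only:)
 moreover have "norm z / p2 (- ri (min j mu)) = norm (tp (min j mu) *R z)" for z :: "real^'n" by (simp add: powr_minus divide_inverse mult.commute)
 ultimately show ?thesis unfolding omega_def side_def fst_conv mx mn Let_def wt_def by simp
qed

text \<open>The balls of \<open>wt_le_dyadic_sum\<close>, rescaled. Normalising the average over the
  \<open>i\<close>-th ball uses up n of the decay \<open>be\<close>, hence the rate
  \<open>be\<close> - n.\<close>

lemma bavg_dyadic:
 fixes H :: "real^'n::finite => real"
 assumes H: "LB H" and l: "0 <= be"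
 shows "(NI s. en (H s * (p2 (ri m * real CARD('n)) * wt be (tp m *R (x - s)))))
 <= (\<integral>\<^sup>+i. en (2 powr be * p2 (- (real i * (be - real CARD('n))))) * en (bavg (m - int i) H x) \<partial>count_space (UNIV::nat set))"
proof -
 let ?n = "real CARD('n)"
 have [measurable]: "H : BM" by (rule LB_measurable[OF H])
 let ?b = "%i. ball x (p2 (- ri (m - int i)))"
 have ind: "ind (ball 0 (2 ^ i)) (tp m *R (x - s)) = (ind (?b i) s :: ennreal)" for i s
 proof -
 have e: "tp m * p2 (- ri (m - int i)) = 2 ^ i" unfolding powr_add[symmetric] by (simp add: powr_realpow)
 have "norm (tp m *R (x - s)) < 2 ^ i \<longleftrightarrow> tp m * norm (x - s) < tp m * p2 (- ri (m - int i))"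
 unfolding e by simp
 also have "... \<longleftrightarrow> norm (x - s) < p2 (- ri (m - int i))" by (rule mult_less_cancel_left_pos) simp
 finally show ?thesis by (simp add: indicator_def dist_norm)
 qed
 let ?c = "%i. en (2 powr be * p2 (- (real i * be)))"
 have "(NI s. en (H s * (p2 (ri m * ?n) * wt be (tp m *R (x - s)))))
 <= (NI s. (\<Sum>i. ?c i * en (p2 (ri m * ?n)) * (ind (?b i) s * en (H s))))"
 proof (rule nn_integral_mono)
 fix s
 have "en (H s * (p2 (ri m * ?n) * wt be (tp m *R (x - s)))) = en (H s) * en (p2 (ri m * ?n)) * en (wt be (tp m *R (x - s)))"
 using LB_nonneg[OF H, of s] by (simp add: ennreal_mult[symmetric] mult.assoc)
 also have "... <= en (H s) * en (p2 (ri m * ?n)) * (\<Sum>i. ?c i * ind (?b i) s)"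
 using wt_le_dyadic_sum[OF l, of "tp m *R (x - s)"] unfolding ind by (intro mult_left_mono) auto
 also have "... = (\<Sum>i. ?c i * en (p2 (ri m * ?n)) * (ind (?b i) s * en (H s)))"
 unfolding ennreal_suminf_cmult[symmetric] by (intro suminf_cong) (simp only: mult_ac)
 finally show "en (H s * (p2 (ri m * ?n) * wt be (tp m *R (x - s)))) <= ..." .
 qed
 also have "... = (\<Sum>i. (NI s. ?c i * en (p2 (ri m * ?n)) * (ind (?b i) s * en (H s))))"
 by (rule nn_integral_suminf) measurable
 also have "... = (\<Sum>i. en (2 powr be * p2 (- (real i * (be - ?n)))) * en (bavg (m - int i) H x))"
 proof (rule suminf_cong)
 fix i
 have e: "2 powr be * p2 (- (real i * be)) * p2 (ri m * ?n) = 2 powr be * p2 (- (real i * (be - ?n))) * p2 (ri (m - int i) * ?n)"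
 unfolding powr_add[symmetric] by (simp add: algebra_simps)
 have A: "(NI s. ?c i * en (p2 (ri m * ?n)) * (ind (?b i) s * en (H s))) = ?c i * en (p2 (ri m * ?n)) * (NI s. ind (?b i) s * en (H s))"
 by (rule nn_integral_cmult) measurable
 have B: "?c i * en (p2 (ri m * ?n)) = en (2 powr be * p2 (- (real i * (be - ?n)))) * en (p2 (ri (m - int i) * ?n))"
 by (subst (1 2) ennreal_mult[symmetric]) (simp_all only: e mult_nonneg_nonneg powr_ge_zero)
 show "(NI s. ?c i * en (p2 (ri m * ?n)) * (ind (?b i) s * en (H s))) = en (2 powr be * p2 (- (real i * (be - ?n)))) * en (bavg (m - int i) H x)"
 unfolding A unfolding bavg_nn[OF H] B by (simp add: mult.assoc)
 qed
 finally show ?thesis unfolding nn_integral_count_space_nat .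
qed

text \<open>\<open>J\<close> is the scale of the output and \<open>M\<close> that of the input; n +
  \<open>de / 4\<close> is n divided by the exponent r of the sampling bound. Beyond the stated gain
  the left side contributes \<open>- ((M - J) * (1 + al))\<close> if the input is finer and
  \<open>- ((J - M) * (de / 4 - al))\<close> if the output is finer. The range of \<open>al\<close>
  gives both the right sign.\<close>

lemma almost_diagonal_exponent:
 fixes J M n de al :: real
 assumes "0 <= de" "-1 <= al" "al <= 0"
 shows "J * (1 + al) + J * n / 2 + (- max J M - \<bar>J - M\<bar> * ((n + de) / 2)) - M * n / 2 - M * al + (M - min J M) * (n + de / 4) <= - (de / 4 * \<bar>M - J\<bar>)"
proof (cases "J <= M")
 case True
 hence "J * (1 + al) + J * n / 2 + (- max J M - \<bar>J - M\<bar> * ((n + de) / 2)) - M * n / 2 - M * al + (M - min J M) * (n + de / 4) = - ((M - J) * (1 + al)) - de / 4 * (M - J)"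
 by (simp add: max_def min_def field_simps)
 moreover have "0 <= (M - J) * (1 + al)" using True assms by simp
 ultimately show ?thesis using True by simp
next
 case False
 hence "J * (1 + al) + J * n / 2 + (- max J M - \<bar>J - M\<bar> * ((n + de) / 2)) - M * n / 2 - M * al + (M - min J M) * (n + de / 4) = - ((J - M) * (de / 4 - al)) - de / 4 * (J - M)"
 by (simp add: max_def min_def field_simps)
 moreover have "0 <= (J - M) * (de / 4 - al)" using False assms by simp
 ultimately show ?thesis using False by simp
qed

text \<open>In use, \<open>y\<close> is the corner of an input cube, \<open>z\<close> that of the
  output cube and \<open>s\<close> an integration variable. Decay between \<open>y\<close> and
  \<open>z\<close> is transferred to an arbitrary point \<open>x\<close>, at a price depending on
  the distance of \<open>x\<close> from \<open>z\<close>, and decay of order \<open>m\<close> is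
  kept for the sum over \<open>y\<close>.\<close>

lemma wt_chain:
 fixes x y z s :: "'a::real_normed_vector"
 assumes l: "0 <= l" and ab: "0 < a" "a <= b" "a <= c"
 shows "wt l (a *R (y - z)) * wt (l + m) (b *R (y - s)) <= (1 + c * norm (x - z)) powr l * wt l (a *R (x - s)) * wt m (b *R (y - s))"
proof -
 have "wt l (a *R (y - z)) * wt (l + m) (b *R (y - s)) = wt l (a *R (y - z)) * wt l (b *R (y - s)) * wt m (b *R (y - s))"
 by (simp add: wt_mult[symmetric])
 also have "... <= ((1 + c * norm (x - z)) powr l * wt l (a *R (x - s))) * wt m (b *R (y - s))"
 proof (rule mult_right_mono)
 have "wt l (b *R (y - s)) <= wt l (a *R (y - s))" using ab by (intro wt_antimono_norm l) (simp add: mult_right_mono)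
 hence "wt l (a *R (y - z)) * wt l (b *R (y - s)) <= wt l (a *R (z - y)) * wt l (a *R (y - s))"
 using wt_diff_commute[of l "a *R y" "a *R z"] by (simp only: scaleR_diff_right) (simp add: mult_left_mono)
 also have "... <= wt l (a *R (z - y) + a *R (y - s))" by (rule wt_add_ge[OF l])
 also have "a *R (z - y) + a *R (y - s) = a *R (z - x) + a *R (x - s)" by (simp add: algebra_simps)
 also have "wt l ... <= (1 + norm (a *R (z - x))) powr l * wt l (a *R (x - s))" by (rule wt_shift_le[OF l])
 also have "... <= (1 + c * norm (x - z)) powr l * wt l (a *R (x - s))"
 using ab l by (intro mult_right_mono powr_mono2) (auto simp: norm_minus_commute mult_right_mono)
 finally show "wt l (a *R (y - z)) * wt l (b *R (y - s)) <= (1 + c * norm (x - z)) powr l * wt l (a *R (x - s))" .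
 qed simp
 finally show ?thesis .
qed

text \<open>The first index is a difference of scales, the second numbers the dyadic balls of
  \<open>bavg_dyadic\<close>.\<close>

definition geo :: "real => real => int \<times> nat => real" where
 "geo a b lp = p2 (- (a * \<bar>ri (fst lp)\<bar>)) * p2 (- (b * real (snd lp)))"

lemma geo_nonneg: "0 <= geo a b lp" by (simp add: geo_def)

lemma geo_powr: "geo a b lp powr t = geo (a * t) (b * t) lp"
 unfolding geo_def powr_mult powr_powr by (simp add: mult_ac)

lemma geo_sqrt: "sqrt (geo a b lp) = geo (a * (1/2)) (b * (1/2)) lp"
 unfolding powr_half_sqrt[OF geo_nonneg, symmetric] geo_powr ..

lemma geo_finite: assumes "0 < a" "0 < b" shows "(NS lp. en (geo a b lp)) < \<infinity>"
proof -
 have e: "en (geo a b (l, i)) = en (p2 (- (a * \<bar>ri l\<bar>))) * en (1 * p2 (- (real i * b)))" for l i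
 by (simp add: geo_def ennreal_mult[symmetric] mult.commute)
 have "(NS lp. en (geo a b lp)) = (NS l. (NS i. en (geo a b (l, i))))"
 by (rule nn_integral_fst_count_space[symmetric])
 also have "... = (NS l. en (p2 (- (a * \<bar>ri l\<bar>)))) * (\<Sum>i. en (1 * p2 (- (real i * b))))"
 unfolding e nn_integral_count_space_nat[symmetric] by (simp add: nn_integral_cmult nn_integral_multc)
 finally show ?thesis unfolding infinity_ennreal_def
 using nn_integral_int_geometric[OF assms(1), unfolded infinity_ennreal_def] suminf_geometric_finite[OF assms(2) zero_le_one, unfolded infinity_ennreal_def]
 by (simp only: ennreal_mult_less_top simp_thms)
qed

lemma epow_finite: "x < \<infinity> ==> epow x t < \<infinity>"
 by (simp add: epow_def)

lemma ennreal_bound: assumes "x < (\<infinity>::ennreal)" shows "EX C>=0. x <= en C"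
 using assms by (intro exI[of _ "enn2real x"]) auto

locale lp_setting =
 fixes ph ps et :: "'n::finite fn" and de al :: real
 assumes ph: "band ph" and ps: "band ps" and PU: "PU ph ps" and et: "band et"
 and de: "0 < de" and al: "-1 <= al" "al <= 0"
begin

text \<open>Less than 1, so that \<open>p / r\<close> and \<open>q / r\<close> exceed 1 even at the
  endpoints. Dividing n by it gives n + \<open>de / 4\<close>, which leaves both \<open>ex\<close>
  above n and a gain of \<open>de / 4\<close> per scale.\<close>

definition r :: real where "r = real CARD('n) / (real CARD('n) + de / 4)"

definition ex :: real where "ex = (real CARD('n) + de) * r"

text \<open>The decay (\<open>ex\<close> - n) / \<open>r\<close> in the index of the balls, halved
  by \<open>epow_weighted_sum_le\<close>.\<close>

definition si :: real where "si = (ex - real CARD('n)) / (2 * r)"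

definition H :: "('n fn => complex) => int => real^'n => real" where "H u = lpow ph al r u"

text \<open>A majorant for the modulus of the output coefficient at \<open>Q\<close>, normalised for
  the target space: the power of two combines its smoothness 1 + \<open>al\<close> with the inverse
  square root of the volume of \<open>Q\<close>.\<close>

definition dd :: "('n fn => complex) => 'n cube => ennreal" where
 "dd u Q = en (p2 (ri (fst Q) * (1 + al) + ri (fst Q) * real CARD('n) / 2))
 * (NS P. en (omega de P Q * norm (u (cubefn et P))))"

text \<open>A majorant of \<open>dd\<close> at scale \<open>j\<close> that depends on a point and no
  longer on a cube. The input scale is \<open>j + fst lp\<close>, and the balls start at the coarser
  of the two scales, hence \<open>min 0 (fst lp)\<close>.\<close>

definition DD :: "('n fn => complex) => int => real^'n => ennreal" where
 "DD u j x = (NS lp. en (geo (de / 4) si lp)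
 * en (bavg (j + (min 0 (fst lp) - int (snd lp))) (H u (j + fst lp)) x powr (1 / r)))"

lemma r: "0 < r" "r < 1"
 using de by (auto simp: r_def)

lemma n_over_r: "real CARD('n) / r = real CARD('n) + de / 4" using de by (simp add: r_def)

lemma ex_gt: "real CARD('n) < ex"
proof -
 have "real CARD('n) = (real CARD('n) + de / 4) * r" unfolding n_over_r[symmetric] using r by simp
 also have "... < ex" unfolding ex_def using r de by (intro mult_strict_right_mono) auto
 finally show ?thesis .
qed

lemma ex_nonneg: "0 <= ex" using ex_gt by (meson of_nat_0_le_iff less_imp_le order_trans)

lemma si: "0 < si" unfolding si_def using ex_gt r by simp

lemma LB_H: "u : SP ==> LB (H u mu)" unfolding H_def using r by (intro LB_lpow[OF ph ps PU]) auto

lemma H_nonneg: "0 <= H u mu s" unfolding H_def by (rule lpow_nonneg)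

text \<open>The contribution of one input scale \<open>mu\<close>. The r-th power goes inside the
  sum over \<open>k\<close>, each coefficient is bounded by \<open>sample_power_bound\<close>, and
  \<open>wt_chain\<close> moves the decay to \<open>x\<close>, so that the sum over \<open>k\<close>
  acts on a single weight. The point \<open>x\<close> is unrestricted and pays by its distance from
  the corner of the output cube.\<close>

lemma scale_bound:
 "EX C>=0. ALL u j k' x mu. u : SP --> en (p2 (ri j * (1 + al) + ri j * real CARD('n) / 2))
 * (NS k. en (omega de (mu, k) (j, k') * norm (u (cubefn et (mu, k)))))
 <= en (C * (1 + tp j * norm (x - corner (j, k'))) powr (real CARD('n) + de) * p2 (- (de / 4 * \<bar>ri (mu - j)\<bar>)))
 * epow (NI s. en (H u mu s * (p2 (ri (min j mu) * real CARD('n)) * wt ex (tp (min j mu) *R (x - s))))) (1 / r)"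
proof -
 let ?n = "real CARD('n)"
 let ?A = "%u mu s R xp k. H u mu s * (p2 (ri mu * ?n) * wt (ex + (?n + 1)) (tp mu *R (xp k - s)))"
 let ?B = "%C1 mu. C1 * p2 (- (ri mu * al * r))"
 let ?C = "%mu R s k. wt (?n + 1) (tp mu *R s - cvec k)"
 let ?D = "%mu k j k' u. omega de (mu, k) (j, k') * norm (u (cubefn et (mu, k)))"
 let ?E = "%mu j. de / 4 * \<bar>ri (mu - j)\<bar>"
 let ?F = "%ep mu m. (ep - ri mu * ?n / 2) * r + - (ri mu * al * r) + ri (mu - m) * ?n"
 let ?G = "%ep mu m. ep - ri mu * ?n / 2 - ri mu * al + ri (mu - m) * (?n + de / 4)"
 let ?H = "%A1 R C2. A1 * R powr ex * C2"
 let ?J = "%A1 R Hs s. A1 * R powr ex * Hs s"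
 let ?L = "%A1 R Hs mu k. NI s. en (?J A1 R Hs s) * en (?C mu R s k)"
 let ?M = "%A1 R Hs s mu. NS k. en (?J A1 R Hs s) * en (?C mu R s k)"
 let ?N = "%m R xp k z. (tp m) *R (xp k - z)"
 have r': "r <= 1" using r by simp
 \<comment> \<open>Of this decay \<open>ex\<close> ends up at \<open>x\<close>, and the remaining n
   + 1 bounds the sum over \<open>k\<close>.\<close>
 have N: "0 <= ex + (?n + 1)" using ex_nonneg by simp
 obtain C1 where C1: "C1 >= 0" "ALL u mu x. u : SP --> en (norm (u (%z. dil et mu (x - z))) powr r)
 <= en (?B C1 mu) * (NI s. en (lpow ph al r u mu s * (p2 (ri mu * ?n) * wt (ex + (?n + 1)) (tp mu *R (x - s)))))"
 using sample_power_bound[OF ph ps PU et r(1) r' N al] by blast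
 have n1: "?n < ?n + 1" by simp
 obtain C2 where C2: "C2 >= 0" "ALL x::real^'n. (NS k. en (wt (?n + 1) (x - cvec k))) <= en C2"
 using lattice_sum_wt_unit[OF n1] by blast
 define C where "C = (C1 * C2) powr (1 / r)"
 have C: "0 <= C" by (simp add: C_def)
 have main: "en (p2 (ri j * (1 + al) + ri j * ?n / 2))
 * (NS k. en (?D mu k j k' u))
 <= en (C * (1 + tp j * norm (x - corner (j, k'))) powr (?n + de) * p2 (- (?E mu j)))
 * epow (NI s. en (H u mu s * (p2 (ri (min j mu) * ?n) * wt ex (tp (min j mu) *R (x - s))))) (1 / r)"
 if u: "u : SP" for u j k' x mu
 proof -
 define m where "m = min j mu"
 define e where "e = ri j * (1 + al) + ri j * ?n / 2"
 define ep where "ep = - ri (max j mu) - \<bar>ri (j - mu)\<bar> * ((?n + de) / 2)"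
 define z where "z = corner (j, k')"
 define R where "R = 1 + tp j * norm (x - z)"
 have R: "0 < R" by (simp add: R_def add_pos_nonneg)
 define xp where "xp k = corner (mu, k)" for k :: "int^'n"
 define t where "t k = norm (u (%z. dil et mu (xp k - z)))" for k
 define A0 where "A0 = p2 ((ep - ri mu * ?n / 2) * r)"
 define Hs where "Hs s = H u mu s * (p2 (ri m * ?n) * wt ex (tp m *R (x - s)))" for s
 have Hs0: "0 <= Hs s" for s unfolding Hs_def by (intro mult_nonneg_nonneg H_nonneg) auto
 have [measurable]: "H u mu : BM" by (rule LB_measurable[OF LB_H[OF u]])
 have [measurable]: "Hs : BM" unfolding Hs_def[abs_def] by measurable
 define X where "X = (NS k. en (?D mu k j k' u))"
 define A1 where "A1 = A0 * ?B C1 mu * p2 (ri (mu - m) * ?n)"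
 have A0: "0 <= A0" by (simp add: A0_def)
 have A1: "0 <= A1" using A0 C1(1) by (simp add: A1_def)
 have pw: "(?D mu k j k' u) powr r = A0 * wt ex (?N m R xp k z) * t k powr r" for k
 proof -
 have "omega de (mu, k) (j, k') * norm (u (cubefn et (mu, k))) = p2 (ep + - (ri mu * ?n / 2)) * wt (?n + de) (?N m R xp k z) * t k"
 unfolding omega_dyadic norm_SP_cubefn[OF et u] ep_def[symmetric] m_def[symmetric] xp_def z_def t_def powr_add by (simp only: mult_ac)
 hence "(?D mu k j k' u) powr r = (p2 (ep + - (ri mu * ?n / 2)) * wt (?n + de) (?N m R xp k z) * t k) powr r" by (rule arg_cong)
 thus ?thesis by (simp only: powr_mult[of "2 powr _ * _"] powr_mult[of "p2 _"] wt_powr powr_powr ex_def[symmetric] A0_def diff_conv_add_uminus)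
 qed
 have tk: "en (t k powr r) <= en (?B C1 mu) * (NI s. en (?A u mu s R xp k))" for k
 unfolding t_def H_def using C1(2) u by blast
 have pt: "A0 * wt ex (?N m R xp k z) * ?B C1 mu * (?A u mu s R xp k)
 <= A1 * R powr ex * Hs s * wt (?n + 1) (tp mu *R s - cvec k)" for k s
 proof -
 have xk: "tp mu *R (xp k - s) = - (tp mu *R s - cvec k)" by (simp add: xp_def corner_def scaleR_diff_right powr_minus)
 let ?K = "A0 * ?B C1 mu * H u mu s * p2 (ri mu * ?n)"
 have K: "0 <= ?K" using A0 C1(1) H_nonneg by simp
 have "wt ex (?N m R xp k z) * wt (ex + (?n + 1)) (tp mu *R (xp k - s))
 <= R powr ex * wt ex (tp m *R (x - s)) * wt (?n + 1) (tp mu *R (xp k - s))"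
 unfolding R_def by (rule wt_chain[OF ex_nonneg]) (auto simp: m_def)
 from mult_left_mono[OF this K]
 have "A0 * wt ex (?N m R xp k z) * ?B C1 mu * (?A u mu s R xp k)
 <= ?K * (R powr ex * wt ex (tp m *R (x - s)) * wt (?n + 1) (tp mu *R (xp k - s)))"
 by (simp only: mult_ac)
 also have "... = A1 * R powr ex * Hs s * wt (?n + 1) (tp mu *R s - cvec k)"
 proof -
 have pe: "p2 (ri mu * ?n) = p2 (ri (mu - m) * ?n) * p2 (ri m * ?n)"
 unfolding powr_add[symmetric] by (simp add: algebra_simps)
 show ?thesis unfolding A1_def Hs_def xk wt_minus pe by (simp only: mult_ac)
 qed
 finally show ?thesis .
 qed
 have "epow X r <= (NS k. epow (en (?D mu k j k' u)) r)"
 unfolding X_def by (rule epow_sum_le[OF r(1) r'])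
 also have "... = (NS k. en (A0 * wt ex (?N m R xp k z) * t k powr r))"
 by (rule nn_integral_cong, subst epow_ennreal) (simp_all only: pw mult_nonneg_nonneg omega_nonneg norm_ge_zero)
 also have "... <= (NS k. (?L A1 R Hs mu k))"
 proof (rule nn_integral_mono)
 fix k
 let ?w = "A0 * wt ex (?N m R xp k z)"
 have w: "0 <= ?w" using A0 by simp
 have "en (?w * t k powr r) = en ?w * en (t k powr r)" by (rule ennreal_mult[OF w]) simp
 also have "... <= en ?w * (en (?B C1 mu) * (NI s. en (?A u mu s R xp k)))"
 by (intro mult_left_mono tk) simp
 also have "... = en (?w * ?B C1 mu) * (NI s. en (?A u mu s R xp k))"
 by (subst ennreal_mult[OF w]) (simp_all add: C1(1) mult.assoc)
 also have "... = (NI s. en (?w * ?B C1 mu) * en (?A u mu s R xp k))"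
 by (rule nn_integral_cmult[symmetric]) measurable
 also have "... <= ?L A1 R Hs mu k"
 proof (rule nn_integral_mono)
 fix s
 have "en (?w * ?B C1 mu) * en (?A u mu s R xp k)
 = en (?w * ?B C1 mu * ?A u mu s R xp k)"
 using A0 C1(1) H_nonneg by (intro ennreal_mult[symmetric] mult_nonneg_nonneg) auto
 also have "... <= en (A1 * R powr ex * Hs s * wt (?n + 1) (tp mu *R s - cvec k))" by (intro ennreal_leI pt)
 also have "... = en (?J A1 R Hs s) * en (?C mu R s k)"
 using A1 Hs0[of s] by (intro ennreal_mult mult_nonneg_nonneg) auto
 finally show "en (?w * ?B C1 mu) * en (?A u mu s R xp k) <= ..." .
 qed
 finally show "en (?w * t k powr r) <= ?L A1 R Hs mu k" .
 qed
 also have "... = (NI s. (?M A1 R Hs s mu))"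
 by (rule nn_integral_count_space_nn_integral[symmetric]) (simp, measurable)
 also have "... <= (NI s. en (?H A1 R C2) * en (Hs s))"
 proof (rule nn_integral_mono)
 fix s
 have "?M A1 R Hs s mu = en (?J A1 R Hs s) * (NS k. en (?C mu R s k))"
 by (rule nn_integral_cmult) simp
 also have "... <= en (?J A1 R Hs s) * en C2" using C2(2) by (intro mult_left_mono) auto
 also have "... = en (?H A1 R C2) * en (Hs s)" using A1 Hs0[of s] C2(1) by (simp add: ennreal_mult[symmetric] mult_ac)
 finally show "?M A1 R Hs s mu <= en (?H A1 R C2) * en (Hs s)" .
 qed
 also have "... = en (?H A1 R C2) * (NI s. en (Hs s))" by (rule nn_integral_cmult) measurable
 finally have "X <= epow (en (?H A1 R C2) * (NI s. en (Hs s))) (1 / r)" unfolding epow_le_iff[OF r(1)] .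
 also have "... = en ((?H A1 R C2) powr (1 / r)) * epow (NI s. en (Hs s)) (1 / r)"
 using r A1 C2(1) by (subst epow_mult) (auto simp: epow_ennreal)
 finally have XX: "en (p2 e) * X <= en (p2 e) * (en ((?H A1 R C2) powr (1 / r)) * epow (NI s. en (Hs s)) (1 / r))"
 by (rule mult_left_mono) simp
 have fin: "2 powr e * (?H A1 R C2) powr (1 / r) <= C * R powr (?n + de) * p2 (- (?E mu j))"
 proof -
 have "A1 * R powr ex * C2 = C1 * C2 * (p2 (?F ep mu m)) * R powr ex"
 unfolding A1_def A0_def powr_add by (simp only: mult_ac)
 hence "(?H A1 R C2) powr (1 / r) = C * p2 ((?F ep mu m) * (1 / r)) * R powr (ex * (1 / r))"
 unfolding C_def by (simp only: powr_mult powr_powr)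
 also have "?F ep mu m * (1 / r) = ep - ri mu * ?n / 2 - ri mu * al + ri (mu - m) * (?n / r)"
 using r by (simp add: field_simps)
 also have "ex * (1 / r) = ?n + de" unfolding ex_def using r by simp
 finally have "2 powr e * (?H A1 R C2) powr (1 / r) = C * R powr (?n + de) * (2 powr e * p2 (?G ep mu m))"
 unfolding n_over_r by (simp only: mult_ac)
 also have "... <= C * R powr (?n + de) * p2 (- (?E mu j))"
 proof (rule mult_left_mono)
 have "e + ?G ep mu m <= - (?E mu j)"
 using almost_diagonal_exponent[of de al "ri j" ?n "ri mu"] de al unfolding e_def ep_def m_def by (simp add: of_int_max of_int_min)
 thus "2 powr e * p2 (?G ep mu m) <= p2 (- (?E mu j))"
 unfolding powr_add[symmetric] by (rule powr_mono) simp
 qed (use C R in auto)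
 finally show ?thesis .
 qed
 have "en (p2 e) * X <= en (2 powr e * (?H A1 R C2) powr (1 / r)) * epow (NI s. en (Hs s)) (1 / r)"
 using XX by (simp add: ennreal_mult mult.assoc)
 also have "... <= en (C * R powr (?n + de) * p2 (- (?E mu j))) * epow (NI s. en (Hs s)) (1 / r)"
 by (intro mult_right_mono ennreal_leI fin) simp
 finally show ?thesis unfolding X_def e_def Hs_def R_def z_def m_def .
 qed
 show ?thesis using C main by blast
qed

lemma dd_le:
 "EX C>=0. ALL u Q x. u : SP --> dd u Q <= en (C * (1 + tp (fst Q) * norm (x - corner Q)) powr (real CARD('n) + de)) * DD u (fst Q) x"
proof -
 let ?n = "real CARD('n)"
 let ?A = "%mu j. - (de / 4 * \<bar>ri (mu - j)\<bar>)"
 let ?C = "%mu j k' u. NS k. en (omega de (mu, k) (j, k') * norm (u (cubefn et (mu, k))))"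
 let ?D = "%K. K * p2 (ex / (2 * r))"
 let ?E = "%m u mu x. NS i. en (p2 (- (si * real i))) * en (bavg (m - int i) (H u mu) x powr (1 / r))"
 let ?F = "%u mu j R x. NI s. en (H u mu s * (p2 (ri (min j mu) * ?n) * wt ex (tp (min j mu) *R (x - s))))"
 let ?G = "%w m u mu x. NS i. en (w i powr ((1 / r) / 2)) * epow (en (bavg (m - int i) (H u mu) x)) (1 / r)"
 let ?H = "%j x k'. 1 + tp j * norm (x - corner (j, k'))"
 let ?J = "%u mu m R x. NI s. en (H u mu s * (p2 (ri m * ?n) * wt ex (tp m *R (x - s))))"
 let ?K = "%w. NS i. en (sqrt (w i))"
 let ?L = "%j. p2 (ri j * (1 + al) + ri j * ?n / 2)"
 obtain C1 where C1: "C1 >= 0" "ALL u j k' x mu. u : SP --> en (?L j)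
 * (?C mu j k' u)
 <= en (C1 * (?H j x k') powr (?n + de) * p2 (?A mu j))
 * epow (?F u mu j R x) (1 / r)"
 using scale_bound by blast
 define w where "w i = 2 powr ex * p2 (- (real i * (ex - ?n)))" for i :: nat
 have w0: "0 <= w i" for i by (simp add: w_def)
 have sq: "sqrt (w i) = p2 (ex / 2) * p2 (- (real i * ((ex - ?n) / 2)))" for i
 proof -
 have e: "ex * (1 / 2) = ex / 2" "- (real i * (ex - ?n)) * (1 / 2) = - (real i * ((ex - ?n) / 2))" by simp_all
 show ?thesis unfolding powr_half_sqrt[OF w0, symmetric] unfolding w_def powr_mult powr_powr e ..
 qed
 have "(?K w) < \<infinity>"
 unfolding nn_integral_count_space_nat sq by (rule suminf_geometric_finite) (use ex_gt in simp_all)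
 from ennreal_bound[OF epow_finite[OF this]]
 obtain K where K: "K >= 0" "epow (?K w) (1 / r) <= en K" by blast
 have wp: "w i powr ((1 / r) / 2) = p2 (ex / (2 * r)) * p2 (- (si * real i))" for i
 proof -
 have e: "ex * ((1 / r) / 2) = ex / (2 * r)" "real i * (ex - ?n) * ((1 / r) / 2) = (ex - ?n) / (2 * r) * real i" by (simp_all add: mult.commute)
 show ?thesis unfolding w_def powr_mult powr_powr si_def mult_minus_left e ..
 qed
 have S: "epow (?J u mu m R x) (1 / r)
 <= en (?D K) * ?E m u mu x"
 if u: "u : SP" for u mu m x
 proof -
 have "epow (?J u mu m R x) (1 / r)
 <= epow (NS i. en (w i) * en (bavg (m - int i) (H u mu) x)) (1 / r)"
 unfolding w_def using r by (intro epow_mono bavg_dyadic LB_H u ex_nonneg) auto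
 also have "... <= epow (?K w) (1 / r) * ?G w m u mu x"
 using r w0 by (intro epow_weighted_sum_le) auto
 also have "... <= en K * ?G w m u mu x"
 by (intro mult_right_mono K) simp
 also have "... = en K * (en (p2 (ex / (2 * r))) * ?E m u mu x)"
 unfolding wp by (subst nn_integral_cmult[symmetric]) (simp_all add: ennreal_mult mult.assoc epow_ennreal[OF bavg_nonneg[OF LB_H[OF u]]])
 finally show ?thesis using K(1) by (simp add: ennreal_mult mult.assoc)
 qed
 define C where "C = C1 * ?D K"
 have C: "0 <= C" using C1(1) K(1) by (simp add: C_def)
 have main: "dd u (j, k') <= en (C * (?H j x k') powr (?n + de)) * DD u j x"
 if u: "u : SP" for u j k' x
 proof -
 let ?e = "en (?L j)"
 define R where "R = (?H j x k') powr (?n + de)"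
 have R: "0 <= R" by (simp add: R_def)
 let ?B = "%mu i. en (p2 (- (si * real i))) * en (bavg (min j mu - int i) (H u mu) x powr (1 / r))"
 have "dd u (j, k') = (NS mu. ?e * ?C mu j k' u)"
 unfolding dd_def fst_conv nn_integral_fst_count_space[symmetric] by (simp add: nn_integral_cmult)
 also have "... <= (NS mu. en (C1 * R * p2 (?A mu j)) * (en (?D K) * (NS i. ?B mu i)))"
 proof (rule nn_integral_mono)
 fix mu
 have "?e * (?C mu j k' u)
 <= en (C1 * R * p2 (?A mu j)) * epow (?F u mu j R x) (1 / r)"
 unfolding R_def using C1(2) u by blast
 also have "... <= en (C1 * R * p2 (?A mu j)) * (en (?D K) * (NS i. ?B mu i))"
 by (rule mult_left_mono[OF S[OF u]]) simp
 finally show "?e * ?C mu j k' u <= ..." .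
 qed
 also have "... = (NS mu. en (C * R) * (en (p2 (?A mu j)) * (NS i. ?B mu i)))"
 proof (rule nn_integral_cong)
 fix mu
 have "en (C1 * R * p2 (?A mu j)) * en (?D K) = en (C * R) * en (p2 (?A mu j))"
 using C1(1) K(1) R C by (subst (1 2) ennreal_mult[symmetric]) (simp_all add: C_def mult_ac)
 thus "en (C1 * R * p2 (?A mu j)) * (en (?D K) * (NS i. ?B mu i)) = en (C * R) * (en (p2 (?A mu j)) * (NS i. ?B mu i))"
 by (simp only: mult.assoc[symmetric])
 qed
 also have "... = en (C * R) * (NS mu. en (p2 (?A mu j)) * (NS i. ?B mu i))"
 by (rule nn_integral_cmult) simp
 also have "(NS mu. en (p2 (?A mu j)) * (NS i. ?B mu i))
 = (NS l. en (p2 (- (de / 4 * \<bar>ri ((j + l) - j)\<bar>))) * (NS i. ?B (j + l) i))"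
 by (rule nn_integral_bij_count_space[symmetric]) (auto simp: bij_betw_def inj_on_def image_iff intro: exI[of _ "_ - j"])
 also have "... = DD u j x"
 proof -
 have m: "min j (j + l) - int i = j + (min 0 l - int i)" for l i by (simp add: min_def)
 show ?thesis unfolding DD_def nn_integral_fst_count_space[symmetric] m fst_conv snd_conv geo_def
 by (intro nn_integral_cong) (simp add: nn_integral_cmult[symmetric] ennreal_mult mult.assoc)
 qed
 finally show ?thesis unfolding R_def .
 qed
 show ?thesis using C main by (intro exI[of _ C]) (auto simp: split_paired_all)
qed

end

section \<open>Bounds in the mixed norm\<close>

lemma nn_integral_count_shift: "(NS j. f (j + l)) = (\<integral>\<^sup>+j. f j \<partial>count_space (UNIV::int set))" for f :: "int => ennreal"
proof (rule nn_integral_bij_count_space)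
 show "bij_betw (%j. j + l) UNIV UNIV" by (rule bij_betw_byWitness[where f' = "%j. j - l"]) auto
qed

lemma nn_integral_count_swap:
 fixes f :: "'a => 'b => ennreal"
 shows "(NS x. (NS y. f x y)) = (NS y. (NS x. f x y))"
 using nn_integral_fst_count_space[of "%(x, y). f x y"] nn_integral_snd_count_space[of "%(x, y). f x y"] by simp

lemma nn_integral_int_measurable:
 fixes f :: "int => 'a => ennreal"
 assumes [measurable]: "!!j. f j : bm M"
 shows "(%x. (NS j. f j x)) : bm M"
 unfolding nn_integral_int_SUP by measurable

context lp_setting
begin

lemma lpow_TL:
 assumes q: "0 < q" and p: "0 < p"
 shows "EX C>=0. ALL u. u : SP --> (NI x. epow (NS j. en (H u j x powr (q / r))) (p / q)) <= en C * TL_normp ph al q p u"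
proof -
 let ?I = "{-1,0,1::int}"
 define C0 where "C0 = 3 powr (q / r) * 3"
 have C0: "0 <= C0" by (simp add: C0_def)
 have pt: "(NS j. en (H u j x powr (q / r))) <= en C0 * (NS j. en ((p2 (ri j * al) * norm (LPconv ph j u x)) powr q))" for u x
 proof -
 define a where "a j = p2 (ri j * al) * norm (LPconv ph j u x)" for j
 have a: "0 <= a j" for j by (simp add: a_def)
 have "(NS j. en (H u j x powr (q / r))) <= (NS j. en (3 powr (q / r)) * (SUM i:?I. en (a (j + i) powr q)))"
 proof (rule nn_integral_mono)
 fix j
 have "H u j x powr (q / r) = (SUM i:?I. a (j + i) powr r) powr (q / r)" unfolding H_def lpow_def a_def ..
 also have "... <= real (card ?I) powr (q / r) * (SUM i:?I. (a (j + i) powr r) powr (q / r))"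
 using q r by (intro powr_sum_le) auto
 also have "... = 3 powr (q / r) * (SUM i:?I. a (j + i) powr q)" using r by (simp add: powr_powr)
 finally have "en (H u j x powr (q / r)) <= en (3 powr (q / r) * (SUM i:?I. a (j + i) powr q))" by (rule ennreal_leI)
 also have "... = en (3 powr (q / r)) * en (SUM i:?I. a (j + i) powr q)" by (intro ennreal_mult sum_nonneg) auto
 also have "en (SUM i:?I. a (j + i) powr q) = (SUM i:?I. en (a (j + i) powr q))" by (intro sum_ennreal[symmetric]) simp
 finally show "en (H u j x powr (q / r)) <= en (3 powr (q / r)) * (SUM i:?I. en (a (j + i) powr q))" .
 qed
 also have "... = en (3 powr (q / r)) * (SUM i:?I. (NS j. en (a (j + i) powr q)))"
 by (subst nn_integral_cmult, simp, subst nn_integral_sum) auto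
 also have "(SUM i:?I. (NS j. en (a (j + i) powr q))) = (SUM i:?I. (NS j. en (a j powr q)))"
 by (intro sum.cong refl nn_integral_count_shift[of "%j. en (a j powr q)"])
 also have "... = en 3 * (NS j. en (a j powr q))" by simp
 finally show ?thesis unfolding a_def C0_def by (subst ennreal_mult) (simp_all only: mult.assoc powr_ge_zero zero_le_numeral)
 qed
 have "(NI x. epow (NS j. en (H u j x powr (q / r))) (p / q)) <= en (C0 powr (p / q)) * TL_normp ph al q p u" if u: "u : SP" for u
 proof -
 let ?S = "%x. (NS j. en ((p2 (ri j * al) * norm (LPconv ph j u x)) powr q))"
 have [measurable]: "LPconv ph j u : BM" for j by (rule LPconv_measurable[OF ph ps PU u])
 have m: "?S : bm lborel" by (rule nn_integral_int_measurable) measurable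
 have "(NI x. epow (NS j. en (H u j x powr (q / r))) (p / q)) <= (NI x. epow (en C0 * ?S x) (p / q))"
 using p q by (intro nn_integral_mono epow_mono pt) auto
 also have "... = (NI x. en (C0 powr (p / q)) * epow (?S x) (p / q))"
 using p q C0 by (intro nn_integral_cong) (simp add: epow_mult epow_ennreal)
 also have "... = en (C0 powr (p / q)) * TL_normp ph al q p u"
 unfolding TL_normp_epow by (rule nn_integral_cmult) (rule epow_measurable[OF m])
 finally show ?thesis .
 qed
 thus ?thesis by (intro exI[of _ "C0 powr (p / q)"]) auto
qed

lemma DD_measurable [measurable]: "u : SP ==> DD u j : BM"
proof -
 assume u: "u : SP"
 have [measurable]: "bavg c (H u j) : BM" for c j by (rule LB_measurable[OF LB_bavg[OF LB_H[OF u]]])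
 have "DD u j = (%x. (NS l. (\<Sum>i. en (geo (de / 4) si (l, i)) * en (bavg (j + (min 0 l - int i)) (H u (j + l)) x powr (1 / r)))))"
 unfolding DD_def[abs_def] nn_integral_fst_count_space[symmetric] nn_integral_count_space_nat fst_conv snd_conv ..
 also have "... : BM" by (rule nn_integral_int_measurable) measurable
 finally show ?thesis .
qed

text \<open>\<open>epow_weighted_sum_le\<close> is applied for the inner and for the outer exponent,
  which reduces the sum over the pairs \<open>lp\<close> to single pairs. For each of them
  Fefferman-Stein holds with a constant independent of the displacement, and the difference of
  scales disappears by translating the sum over \<open>j\<close>.\<close>

lemma DD_TL:
 assumes q: "1 <= q" and p: "1 <= p"
 shows "EX C>=0. ALL u. u : SP --> (NI x. epow (NS j. epow (DD u j x) q) (p / q)) <= en C * TL_normp ph al q p u"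
proof -
 let ?C = "%K1 K2. K1 powr (p / q) * K2"
 let ?E = "%u x. NS j. epow (DD u j x) q"
 let ?G = "%u. NI x. epow (NS j. en (H u j x powr (q / r))) (p / q)"
 let ?H = "%CF CH u. en (CF * CH) * TL_normp ph al q p u"
 let ?J = "%Z lp. NI x. epow (Z lp x) (p / q)"
 have q0: "0 < q" and p0: "0 < p" and pq: "0 < p / q" using p q by auto
 have pr: "1 < p / r" and qr: "1 < q / r" using p q r by (simp_all add: less_divide_eq)
 \<comment> \<open>The outer exponent in Fefferman-Stein does not change when both exponents are
   divided by \<open>r\<close>.\<close>
 have prq: "(p / r) / (q / r) = p / q" using r by simp
 obtain CF where CF: "CF >= 0" "ALL c (h :: int => real^'n => real). (ALL j. LB (h j)) -->
 (NI x. epow (NS j. en (bavg (j + c) (h j) x powr (q / r))) (p / q))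
 <= en CF * (NI x. epow (NS j. en (h j x powr (q / r))) (p / q))"
 using fefferman_stein_int[OF pr qr, where 'a="real^'n"] unfolding prq by blast
 obtain CH where CH: "CH >= 0" "ALL u. u : SP --> (?G u) <= en CH * TL_normp ph al q p u"
 using lpow_TL[OF q0 p0] by blast
 define a b where "a = de / 4" and "b = si"
 let ?A = "%b lp. geo (a * (q / 2)) (b * (q / 2)) lp"
 let ?B = "%b Y j x. NS lp. en (?A b lp) * en (Y lp j x powr (q / r))"
 let ?D = "%t3 b lp. geo (a * t3) (b * t3) lp"
 let ?F = "%b Z x. NS lp. en (?A b lp) * Z lp x"
 have ab: "0 < a" "0 < b" using de si by (auto simp: a_def b_def)
 have geof: "(NS lp. en (geo (a * t) (b * t) lp)) < \<infinity>" if "0 < t" for t using that ab by (intro geo_finite) auto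
 have h0: "0 < (1::real)/2" by simp
 obtain K1 where K1: "K1 >= 0" "epow (NS lp. en (geo (a * (1/2)) (b * (1/2)) lp)) q <= en K1"
 using ennreal_bound[OF epow_finite[OF geof[OF h0]]] by blast
 have q4: "0 < q / 2 * (1/2)" using q by simp
 obtain K2 where K2: "K2 >= 0" "epow (NS lp. en (geo (a * (q / 2 * (1/2))) (b * (q / 2 * (1/2))) lp)) (p / q) <= en K2"
 using ennreal_bound[OF epow_finite[OF geof[OF q4]]] by blast
 \<comment> \<open>What is left of the decay after the two applications of
   \<open>epow_weighted_sum_le\<close>; its value is \<open>p / 4\<close>.\<close>
 define t3 where "t3 = q / 2 * (p / q / 2)"
 have t3: "0 < t3" unfolding t3_def using p0 q0 by (intro mult_pos_pos divide_pos_pos) auto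
 obtain K3 where K3: "K3 >= 0" "(NS lp. en (?D t3 b lp)) <= en K3"
 using ennreal_bound[OF geof[OF t3]] by blast
 define C where "C = K1 powr (p / q) * K2 * K3 * CF * CH"
 have C: "0 <= C" using K2 K3 CF CH by (simp add: C_def)
 have main: "(NI x. epow (?E u x) (p / q)) <= en C * TL_normp ph al q p u" if u: "u : SP" for u
 proof -
 define Y where "Y lp j x = bavg (j + (min 0 (fst lp) - int (snd lp))) (H u (j + fst lp)) x" for lp :: "int \<times> nat" and j x
 have Y0: "0 <= Y lp j x" for lp j x unfolding Y_def by (rule bavg_nonneg[OF LB_H[OF u]])
 have Ym [measurable]: "Y lp j : BM" for lp j unfolding Y_def[abs_def] by (rule LB_measurable[OF LB_bavg[OF LB_H[OF u]]])
 define Z where "Z lp x = (NS j. en (Y lp j x powr (q / r)))" for lp x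
 have Zm [measurable]: "Z lp : BM" for lp unfolding Z_def[abs_def] by (rule nn_integral_int_measurable) measurable
 have 1: "epow (DD u j x) q <= en K1 * ?B b Y j x" for j x
 proof -
 have "epow (DD u j x) q <= epow (NS lp. en (sqrt (geo a b lp))) q * (NS lp. en (geo a b lp powr (q / 2)) * epow (en (Y lp j x powr (1 / r))) q)"
 unfolding DD_def Y_def[symmetric] a_def[symmetric] b_def[symmetric] using q by (intro epow_weighted_sum_le geo_nonneg) auto
 also have "... <= en K1 * ?B b Y j x"
 unfolding geo_sqrt geo_powr using K1(2) by (intro mult_mono) (simp_all add: epow_ennreal powr_powr)
 finally show ?thesis .
 qed
 have 2: "?E u x <= en K1 * ?F b Z x" for x
 proof -
 have "?E u x <= (NS j. en K1 * ?B b Y j x)"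
 by (intro nn_integral_mono 1)
 also have "... = en K1 * (NS j. (?B b Y j x))"
 by (rule nn_integral_cmult) simp
 also have "(NS j. (?B b Y j x))
 = (NS lp. (NS j. en (?A b lp) * en (Y lp j x powr (q / r))))"
 by (rule nn_integral_count_swap)
 also have "... = ?F b Z x"
 unfolding Z_def by (intro nn_integral_cong nn_integral_cmult) simp
 finally show ?thesis .
 qed
 have 3: "epow (?E u x) (p / q) <= en (?C K1 K2) * (NS lp. en (?D t3 b lp) * epow (Z lp x) (p / q))" for x
 proof -
 have "epow (?E u x) (p / q) <= epow (en K1 * ?F b Z x) (p / q)"
 using pq by (intro epow_mono 2) simp
 also have "... = en (K1 powr (p / q)) * epow (?F b Z x) (p / q)"
 using K1(1) by (simp only: epow_mult[OF pq] epow_ennreal)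
 also have "... <= en (K1 powr (p / q)) * (epow (NS lp. en (sqrt (?A b lp))) (p / q) * (NS lp. en (geo (a * (q / 2)) (b * (q / 2)) lp powr (p / q / 2)) * epow (Z lp x) (p / q)))"
 by (intro mult_left_mono epow_weighted_sum_le pq geo_nonneg) simp
 also have "... <= en (K1 powr (p / q)) * (en K2 * (NS lp. en (?D t3 b lp) * epow (Z lp x) (p / q)))"
 unfolding geo_sqrt geo_powr mult.assoc[of a] mult.assoc[of b] t3_def[symmetric] using K2(2) by (intro mult_left_mono mult_right_mono) simp_all
 finally show ?thesis using K2(1) by (simp add: ennreal_mult mult.assoc)
 qed
 have 4: "?J Z lp <= en (CF * CH) * TL_normp ph al q p u" for lp
 proof -
 have "?J Z lp <= en CF * (NI x. epow (NS j. en (H u (j + fst lp) x powr (q / r))) (p / q))"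
 unfolding Z_def Y_def by (rule CF(2)[rule_format]) (rule LB_H[OF u])
 also have "... = en CF * ?G u"
 unfolding nn_integral_count_shift[of "%j. en (H u j _ powr (q / r))"] ..
 also have "... <= en CF * (en CH * TL_normp ph al q p u)" using CH(2) u by (intro mult_left_mono) auto
 finally show ?thesis using CF(1) CH(1) by (simp add: ennreal_mult mult.assoc)
 qed
 have "(NI x. epow (?E u x) (p / q))
 <= (NI x. (NS lp. en (?C K1 K2) * (en (?D t3 b lp) * epow (Z lp x) (p / q))))"
 using 3 by (intro nn_integral_mono) (simp add: nn_integral_cmult)
 also have "... = (NS lp. (NI x. en (?C K1 K2) * (en (?D t3 b lp) * epow (Z lp x) (p / q))))"
 by (rule nn_integral_count_space_nn_integral) (simp, measurable)
 also have "... = (NS lp. en (?C K1 K2) * (en (?D t3 b lp) * ?J Z lp))"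
 by (intro nn_integral_cong) (simp add: nn_integral_cmult)
 also have "... <= (NS lp. en (?C K1 K2) * (en (?D t3 b lp) * ?H CF CH u))"
 by (intro nn_integral_mono mult_left_mono 4) simp_all
 also have "... = en (?C K1 K2) * ((NS lp. en (?D t3 b lp)) * ?H CF CH u)"
 by (subst nn_integral_cmult, simp, subst nn_integral_multc) simp_all
 also have "... <= en (?C K1 K2) * (en K3 * ?H CF CH u)"
 by (intro mult_left_mono mult_right_mono K3) simp_all
 also have "... = (en (?C K1 K2) * en K3 * en (CF * CH)) * TL_normp ph al q p u" by (simp only: mult.assoc)
 also have "en (?C K1 K2) * en K3 * en (CF * CH) = en C"
 using K2(1) K3(1) CF(1) CH(1) by (simp add: C_def ennreal_mult[symmetric] mult.assoc)
 finally show ?thesis .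
 qed
 show ?thesis using C main by blast
qed

end

section \<open>Absolute convergence of the double series\<close>

lemma le_one_plus_epow: assumes "1 <= p" shows "x <= 1 + epow x p"
proof (cases x)
 case (real a)
 have "a <= 1 + a powr p"
 proof (cases "a <= 1")
 case False
 hence "a powr 1 <= a powr p" using assms by (intro powr_mono) auto
 thus ?thesis using False by simp
 qed (simp add: add_increasing2)
 hence "en a <= en (1 + a powr p)" by (rule ennreal_leI)
 thus ?thesis using real by (simp add: epow_ennreal)
qed simp

context lp_setting
begin

definition ss :: "('n fn => complex) => 'n cube => ennreal" where
 "ss u Q = (NS P. en (omega de P Q * norm (u (cubefn et P))))"

definition sexp :: "int => real" where
 "sexp j = ri j * (1 + al) + ri j * real CARD('n) / 2"

lemma dd_ss: "dd u Q = en (2 powr sexp (fst Q)) * ss u Q"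
 unfolding dd_def ss_def sexp_def ..

lemma ss_dd: "ss u Q = en (p2 (- sexp (fst Q))) * dd u Q"
proof -
 have "en (p2 (- sexp (fst Q))) * en (2 powr sexp (fst Q)) = 1" by (simp add: ennreal_mult[symmetric] powr_add[symmetric])
 thus ?thesis unfolding dd_ss mult.assoc[symmetric] by simp
qed

lemma DD_TL_single:
 assumes q: "0 < q" and p: "0 < p"
 shows "(NI x. epow (DD u j x) p) <= (NI x. epow (NS j. epow (DD u j x) q) (p / q))"
proof (rule nn_integral_mono)
 fix x
 have "epow (DD u j x) p = epow (epow (DD u j x) q) (p / q)" using p q by (simp add: epow_epow)
 also have "... <= epow (NS j. epow (DD u j x) q) (p / q)"
 using p q by (intro epow_mono nn_integral_ge_point) auto
 finally show "epow (DD u j x) p <= ..." .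
qed

text \<open>At each point of the cube of side \<open>tm j\<close> centred at
  \<open>corner (j, k)\<close> the value of \<open>DD\<close> bounds \<open>dd u (j, k)\<close> with
  one constant. These cubes tile the space, so integration turns the bounds into one for the sum
  over \<open>k\<close>.\<close>

lemma dd_lattice:
 assumes q: "1 <= q" and p: "1 <= p"
 shows "EX C>=0. ALL u j. u : SP --> (NS k. epow (dd u (j, k)) p) <= en (C * p2 (ri j * real CARD('n))) * TL_normp ph al q p u"
proof -
 let ?n = "real CARD('n)"
 have p0: "0 < p" and q0: "0 < q" using p q by auto
 obtain C1 where C1: "C1 >= 0" "ALL u Q x. u : SP --> dd u Q <= en (C1 * (1 + tp (fst Q) * norm (x - corner Q)) powr (?n + de)) * DD u (fst Q) x"
 using dd_le by blast
 obtain C2 where C2: "C2 >= 0" "ALL u. u : SP --> (NI x. epow (NS j. epow (DD u j x) q) (p / q)) <= en C2 * TL_normp ph al q p u"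
 using DD_TL[OF q p] by blast
 define K where "K = C1 * (1 + ?n) powr (?n + de)"
 have K: "0 <= K" using C1(1) by (simp add: K_def)
 define C where "C = K powr p * C2"
 have C: "0 <= C" using C2(1) by (simp add: C_def)
 have main: "(NS k. epow (dd u (j, k)) p) <= en (C * p2 (ri j * ?n)) * TL_normp ph al q p u" if u: "u : SP" for u j
 proof -
 let ?h = "tm j"
 let ?F = "%x. en (K powr p) * epow (DD u j (?h *R x)) p"
 have Dm [measurable]: "(%x. epow (DD u j x) p) : BM" by (rule epow_measurable[OF DD_measurable[OF u]])
 have Dh [measurable]: "(%x. epow (DD u j (?h *R x)) p) : BM" using measurable_compose[OF _ Dm, of "%x. ?h *R x" borel] by simp
 have h0: "0 < ?h" by simp
 have pt: "epow (dd u (j, k)) p <= ?F (y + cvec k)" if y: "y : ucube" for y k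
 proof -
 have "tp j * norm (?h *R (y + cvec k) - corner (j, k)) = norm y"
 by (simp add: corner_def scaleR_add_right powr_minus)
 also have "... <= ?n" by (rule ucube_norm[OF y])
 finally have "C1 * (1 + tp j * norm (?h *R (y + cvec k) - corner (j, k))) powr (?n + de) <= K"
 unfolding K_def using C1(1) de by (intro mult_left_mono powr_mono2) auto
 note le = mult_right_mono[OF ennreal_leI[OF this], of "DD u j (?h *R (y + cvec k))", OF zero_le]
 have "dd u (j, k) <= en K * DD u j (?h *R (y + cvec k))"
 using C1(2)[rule_format, OF u, of "(j, k)" "?h *R (y + cvec k)"] unfolding fst_conv by (rule order_trans[OF _ le])
 hence "epow (dd u (j, k)) p <= epow (en K * DD u j (?h *R (y + cvec k))) p" using p0 by (intro epow_mono) auto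
 thus ?thesis using K by (simp only: epow_mult[OF p0] epow_ennreal)
 qed
 let ?L = "(NS k. epow (dd u (j, k)) p)"
 have "?L = (NI y. ?L * ind ucube (y::real^'n))" by (simp add: nn_integral_cmult_indicator emeasure_ucube)
 also have "... <= (NI y. (NS k. ?F (y + cvec k)) * ind ucube y)"
 proof (rule nn_integral_mono)
 fix y :: "real^'n"
 show "?L * ind ucube y <= (NS k. ?F (y + cvec k)) * ind ucube y"
 proof (cases "y : ucube")
 case True
 thus ?thesis using pt by (intro mult_right_mono nn_integral_mono) auto
 qed simp
 qed
 also have "... = (NI x. ?F x)" by (rule nn_integral_lattice[symmetric]) measurable
 also have "... = en (K powr p) * (NI x. epow (DD u j (?h *R x)) p)" by (rule nn_integral_cmult) measurable
 also have "(NI x. epow (DD u j (?h *R x)) p) = en (1 / ?h ^ CARD('n)) * (NI x. epow (DD u j x) p)"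
 by (rule nn_integral_scale[OF Dm h0])
 also have "1 / ?h ^ CARD('n) = p2 (ri j * ?n)" unfolding two_powr_power mult_minus_right by (simp only: powr_minus_divide) (simp add: mult.commute)
 also have "en (K powr p) * (en (p2 (ri j * ?n)) * (NI x. epow (DD u j x) p)) <= en (K powr p) * (en (p2 (ri j * ?n)) * (en C2 * TL_normp ph al q p u))"
 using order_trans[OF DD_TL_single[OF q0 p0, of u j] C2(2)[rule_format, OF u]] by (intro mult_left_mono) auto
 also have "... = en (K powr p) * en (p2 (ri j * ?n)) * en C2 * TL_normp ph al q p u" by (simp only: mult.assoc)
 also have "en (K powr p) * en (p2 (ri j * ?n)) * en C2 = en (C * p2 (ri j * ?n))"
 using C2(1) by (simp add: C_def ennreal_mult[symmetric] mult_ac)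
 finally show ?thesis .
 qed
 show ?thesis using C main by blast
qed

lemma ss_finite:
 assumes q: "1 <= q" and p: "1 <= p" and u: "u : TL ph al q p"
 shows "ss u Q < \<infinity>"
proof -
 have uS: "u : SP" and uT: "TL_normp ph al q p u < \<infinity>" using u by (auto simp: TL_def)
 obtain C where C: "C >= 0" "ALL u j. u : SP --> (NS k. epow (dd u (j, k)) p) <= en (C * p2 (ri j * real CARD('n))) * TL_normp ph al q p u"
 using dd_lattice[OF q p] by blast
 obtain j k where Q: "Q = (j, k)" by (cases Q)
 have "epow (dd u Q) p <= (NS k. epow (dd u (j, k)) p)" unfolding Q by (rule nn_integral_ge_point) simp
 also have "... <= en (C * p2 (ri j * real CARD('n))) * TL_normp ph al q p u" using C(2) uS by blast
 also have "... < top" using uT by (simp add: ennreal_mult_less_top)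
 finally have "dd u Q < top" by (auto simp: epow_def less_top[symmetric] split: if_splits)
 thus ?thesis unfolding ss_dd by (simp add: ennreal_mult_less_top)
qed

text \<open>For \<open>dd\<close> only sums of p-th powers over \<open>k\<close> are under control.
  At fine scales the crude \<open>le_one_plus_epow\<close> is affordable because \<open>cbd\<close>
  is small; at coarse scales each term is bounded by the sum of p-th powers, which gives decay at
  the rate n / \<open>p\<close>. The rate \<open>min 1 (1 / p)\<close> serves both.\<close>

lemma ss_cbd_scale:
 assumes q: "1 <= q" and p: "1 <= p" and u: "u : TL ph al q p" and m: "CARD('n) < m"
 shows "EX C>=0. ALL j. (NS k. ss u (j, k) * en (cbd m j k)) <= en (C * p2 (- (min 1 (1 / p) * \<bar>ri j\<bar>)))"
proof -
 let ?n = "real CARD('n)"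
 let ?A = "%j. - (min 1 (1 / p) * \<bar>ri j\<bar>)"
 let ?B = "%k. 1 ^ CARD('n) * wt (real m) (1 *R cvec k + 0 :: real^'n)"
 let ?C = "%u j. NS k. epow (dd u (j, k)) p"
 let ?E = "%C1 j. C1 * p2 (ri j * ?n)"
 let ?F = "%j k. p2 (- sexp j) * cbd m j k"
 let ?G = "%u j. NS k. ss u (j, k) * en (cbd m j k)"
 let ?H = "%u j k. ss u (j, k) * en (cbd m j k)"
 have n1: "1 <= ?n" by simp
 have p0: "0 < p" using p by simp
 have uS: "u : SP" and uT: "TL_normp ph al q p u < \<infinity>" using u by (auto simp: TL_def)
 obtain C0 where C0: "C0 >= 0" "ALL u j. u : SP --> (?C u j) <= en (C0 * p2 (ri j * ?n)) * TL_normp ph al q p u"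
 using dd_lattice[OF q p] by blast
 obtain t where t: "t >= 0" "TL_normp ph al q p u <= en t" using ennreal_bound[OF uT] by blast
 define C1 where "C1 = C0 * t"
 have C1: "0 <= C1" using C0(1) t(1) by (simp add: C1_def)
 have dl: "?C u j <= en (?E C1 j)" for j
 proof -
 have "?C u j <= en (C0 * p2 (ri j * ?n)) * TL_normp ph al q p u" using C0(2) uS by blast
 also have "... <= en (C0 * p2 (ri j * ?n)) * en t" by (intro mult_left_mono t) simp
 also have "... = en (?E C1 j)" using C0(1) t(1) by (simp add: C1_def ennreal_mult[symmetric] mult_ac)
 finally show ?thesis .
 qed
 have mr: "?n < real m" using m by simp
 obtain C2 where C2: "C2 >= 0" "ALL h (x::real^'n). 0 < h & h <= 1 --> (NS k. en (h ^ CARD('n) * wt (real m) (h *R cvec k + x))) <= en C2"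
 using lattice_sum_wt_ex[OF mr] by blast
 define C where "C = (C2 + C1) + C1 powr (1 / p) * C2"
 have C: "0 <= C" using C1 C2(1) by (simp add: C_def)
 have main: "?G u j <= en (C * p2 (?A j))" for j
 proof (cases "0 <= j")
 case True
 let ?h = "tm j"
 have h: "0 < ?h" "?h <= 1" using True by (auto intro: two_powr_le_1)
 have hn: "?h ^ CARD('n) = p2 (- (ri j * ?n))" unfolding two_powr_power by (simp add: mult.commute)
 have c: "?F j k <= tm j * (?h ^ CARD('n) * wt (real m) (?h *R cvec k + 0))" for k :: "int^'n"
 proof -
 have cb: "cbd m j k = p2 (- ri j * (?n / 2 + 1)) * wt (real m) (?h *R cvec k)" using True by (simp only: cbd_def if_True powr_powr)
 have "?F j k = p2 (- sexp j + - ri j * (?n / 2 + 1)) * wt (real m) (?h *R cvec k)"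
 unfolding cb powr_add by (simp only: mult.assoc)
 also have "... <= p2 (- ri j + - (ri j * ?n)) * wt (real m) (?h *R cvec k)"
 proof (intro mult_right_mono powr_mono)
 have "0 <= ri j * (1 + al)" using True al by simp
 thus "- sexp j + - ri j * (?n / 2 + 1) <= - ri j + - (ri j * ?n)" unfolding sexp_def by (simp add: field_simps)
 qed simp_all
 finally show ?thesis unfolding hn powr_add by simp
 qed
 have "?G u j <= (NS k. en ?h * (en (?h ^ CARD('n) * wt (real m) (?h *R cvec k + 0)) + en (?h ^ CARD('n)) * epow (dd u (j, k)) p))"
 proof (rule nn_integral_mono)
 fix k :: "int^'n"
 let ?w = "?h ^ CARD('n) * wt (real m) (?h *R cvec k + 0)"
 have "?H u j k = en (p2 (- sexp j) * cbd m j k) * dd u (j, k)"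
 unfolding ss_dd fst_conv by (subst ennreal_mult) (simp_all add: cbd_nonneg mult_ac)
 also have "... <= en (?h * ?w) * (1 + epow (dd u (j, k)) p)" by (intro mult_mono ennreal_leI c le_one_plus_epow p) simp_all
 also have "... = en ?h * (en ?w + en ?w * epow (dd u (j, k)) p)" by (simp add: ennreal_mult distrib_left mult.assoc)
 also have "... <= en ?h * (en ?w + en (?h ^ CARD('n)) * epow (dd u (j, k)) p)"
 by (intro mult_left_mono add_left_mono mult_right_mono ennreal_leI) (simp_all add: mult_le_cancel_left1 wt_le_1)
 finally show "?H u j k <= ..." .
 qed
 also have "... = en ?h * ((NS k. en (?h ^ CARD('n) * wt (real m) (?h *R cvec k + 0 :: real^'n))) + en (?h ^ CARD('n)) * ?C u j)"
 by (subst nn_integral_cmult, simp, subst nn_integral_add, simp, simp, subst nn_integral_cmult) simp_all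
 also have "... <= en ?h * (en C2 + en (?h ^ CARD('n)) * en (?E C1 j))"
 by (rule mult_left_mono[OF add_mono[OF C2(2)[rule_format] mult_left_mono[OF dl]]]) (simp_all only: h zero_le simp_thms)
 also have "en (?h ^ CARD('n)) * en (?E C1 j) = en C1"
 proof -
 have "?h ^ CARD('n) * ?E C1 j = C1 * (p2 (- (ri j * ?n)) * p2 (ri j * ?n))" unfolding hn by simp
 also have "... = C1" unfolding powr_add[symmetric] by simp
 finally show ?thesis using C1 by (subst ennreal_mult[symmetric]) simp_all
 qed
 also have "en ?h * (en C2 + en C1) = en (?h * (C2 + C1))" using C1 C2(1) by (simp add: ennreal_mult ennreal_plus[symmetric] del: ennreal_plus)
 also have "... <= en (C * p2 (?A j))"
 proof (intro ennreal_leI)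
 have "min 1 (1 / p) * \<bar>ri j\<bar> <= 1 * ri j" using True p0 by (intro mult_mono) auto
 hence "?h <= p2 (?A j)" by (intro powr_mono) auto
 hence "?h * (C2 + C1) <= p2 (?A j) * C" using C1 C2(1) unfolding C_def by (intro mult_mono) auto
 thus "?h * (C2 + C1) <= C * p2 (?A j)" by (simp only: mult.commute)
 qed
 finally show ?thesis .
 next
 case False
 have c: "?F j k <= wt (real m) (cvec k)" for k :: "int^'n"
 proof -
 have cb: "cbd m j k = p2 (- ri j * (- ?n / 2 - 1)) * wt (real m) (cvec k)" using False by (simp only: cbd_def if_False powr_powr)
 have "?F j k = p2 (- sexp j + - ri j * (- ?n / 2 - 1)) * wt (real m) (cvec k)"
 unfolding cb powr_add by (simp only: mult.assoc)
 also have "... <= 1 * wt (real m) (cvec k)"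
 proof (intro mult_right_mono two_powr_le_1)
 have "0 <= ri j * al" using False al by (intro mult_nonpos_nonpos) auto
 thus "- sexp j + - ri j * (- ?n / 2 - 1) <= 0" unfolding sexp_def by (simp add: field_simps)
 qed simp
 finally show ?thesis by simp
 qed
 let ?D = "C1 powr (1 / p) * p2 (ri j * ?n / p)"
 have d: "dd u (j, k) <= en ?D" for k
 proof -
 have "epow (dd u (j, k)) p <= ?C u j" by (rule nn_integral_ge_point) simp
 also note dl[of j]
 finally have "dd u (j, k) <= epow (en (?E C1 j)) (1 / p)" unfolding epow_le_iff[OF p0] .
 also have "... = en ?D" using C1 by (subst epow_ennreal) (simp_all add: powr_mult powr_powr)
 finally show ?thesis .
 qed
 have "?G u j <= (NS k. en ?D * en (?B k))"
 proof (rule nn_integral_mono)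
 fix k :: "int^'n"
 have "?H u j k = en (p2 (- sexp j) * cbd m j k) * dd u (j, k)"
 unfolding ss_dd fst_conv by (subst ennreal_mult) (simp_all add: cbd_nonneg mult_ac)
 also have "... <= en (wt (real m) (cvec k)) * en ?D" by (intro mult_mono ennreal_leI c d) simp_all
 finally show "?H u j k <= en ?D * en (?B k)" by (simp add: mult.commute)
 qed
 also have "... = en ?D * (NS k. en (?B k))" by (rule nn_integral_cmult) simp
 also have "... <= en ?D * en C2"
 by (rule mult_left_mono[OF C2(2)[rule_format]]) simp_all
 also have "... = en (?D * C2)" using C2(1) by (simp add: ennreal_mult)
 also have "... <= en (C * p2 (?A j))"
 proof (intro ennreal_leI)
 have "min 1 (1 / p) * \<bar>ri j\<bar> <= (?n / p) * \<bar>ri j\<bar>" using p0 n1 by (intro mult_right_mono min.coboundedI2 divide_right_mono) auto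
 also have "... = - (ri j * ?n / p)" using False by simp
 finally have "p2 (ri j * ?n / p) <= p2 (?A j)" by (intro powr_mono) auto
 hence "(C1 powr (1 / p) * C2) * p2 (ri j * ?n / p) <= C * p2 (?A j)"
 using C1 C2(1) unfolding C_def by (intro mult_mono) auto
 thus "?D * C2 <= C * p2 (?A j)" by (simp only: mult_ac)
 qed
 finally show ?thesis .
 qed
 show ?thesis using C main by blast
qed

lemma ss_cbd_sum:
 assumes q: "1 <= q" and p: "1 <= p" and u: "u : TL ph al q p" and m: "CARD('n) < m"
 shows "(NS Q. ss u Q * en (cbd m (fst Q) (snd Q))) < \<infinity>"
proof -
 obtain C where C: "C >= 0" "ALL j. (NS k. ss u (j, k) * en (cbd m j k)) <= en (C * p2 (- (min 1 (1 / p) * \<bar>ri j\<bar>)))"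
 using ss_cbd_scale[OF q p u m] by blast
 have c: "0 < min 1 (1 / p)" using p by simp
 have "(NS Q. ss u Q * en (cbd m (fst Q) (snd Q))) = (NS j. (NS k. ss u (j, k) * en (cbd m j k)))"
 unfolding nn_integral_fst_count_space[symmetric] by simp
 also have "... <= (NS j. en (C * p2 (- (min 1 (1 / p) * \<bar>ri j\<bar>))))" using C(2) by (intro nn_integral_mono) blast
 also have "... = en C * (NS j. en (p2 (- (min 1 (1 / p) * \<bar>ri j\<bar>))))" by (rule nn_integral_count_cmult[OF C(1)])
 also have "... < top" using nn_integral_int_geometric[OF c] unfolding infinity_ennreal_def by (simp only: ennreal_mult_less_top ennreal_less_top simp_thms)
 finally show ?thesis by simp
qed

end

section \<open>The extension operator\<close>

lemma conv_far_zero: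
 fixes ph ze :: "'n::finite fn"
 assumes ze: "band ze" and ph: "band ph" and i: "i ~: {-1,0,1::int}"
 shows "conv (dil ze i) ph s = 0"
proof (rule ft_unique)
 show "dec (real CARD('n) + 1) (conv (dil ze i) ph)" by (intro rd_dec rd_conv rd_dil band_rd ze ph)
 fix xi
 show "ft (conv (dil ze i) ph) xi = 0"
 proof (rule ccontr)
 assume "ft (conv (dil ze i) ph) xi ~= 0"
 hence 1: "ft ze (tm i *R xi) ~= 0" "ft ph xi ~= 0"
 unfolding ft_conv[OF rd_dil[OF band_rd[OF ze]] band_rd[OF ph]] ft_dil by auto
 have 2: "1/2 < norm xi" "norm xi < 2" using band_supp[OF ph 1(2)] by auto
 have 3: "1/2 < tm i * norm xi" "tm i * norm xi < 2" using band_supp[OF ze 1(1)] by auto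
 consider "2 <= i" | "i <= -2" using i by fastforce
 thus False
 proof cases
 case 1
 hence "tm i <= p2 (-2)" by (intro powr_mono) auto
 hence "tm i * norm xi <= p2 (-2) * norm xi" by (intro mult_right_mono) auto
 also have "... < 1/2" using 2 by (simp add: powr_minus)
 finally show False using 3 by simp
 next
 case 2
 hence "2 powr 2 <= tm i" by (intro powr_mono) auto
 hence "2 powr 2 * norm xi <= tm i * norm xi" by (intro mult_right_mono) auto
 moreover have "2 < 2 powr 2 * norm xi" using \<open>1/2 < norm xi\<close> by simp
 ultimately show False using 3 by simp
 qed
 qed
qed simp

lemma coef_dil:
 fixes ph ze :: "'n::finite fn"
 assumes ze: "band ze"
 shows "coef (%z. dil ph nu (x - z)) ze (j, k) = cr (p2 (- (ri j * real CARD('n) / 2))) * conv (dil ze j) (dil ph nu) (x - corner (j, k))"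
proof -
 let ?c = "cr (p2 (- (ri j * real CARD('n) / 2)))" and ?a = "corner (j, k)"
 have e: "dil ze j (- z) = dil ze j z" for z by (simp add: dil_def band_even[OF ze])
 have "coef (%z. dil ph nu (x - z)) ze (j, k) = (LI z. dil ph nu (x - z) * (?c * dil ze j (?a - z)))"
 unfolding coef_def cubefn_eq_dil[OF ze] ..
 also have "... = (LI z. dil ph nu (x - (?a + z)) * (?c * dil ze j (?a - (?a + z))))"
 by (rule integral_shift[symmetric])
 also have "... = (LI z. ?c * (dil ze j z * dil ph nu (x - ?a - z)))"
 by (rule int_cong) (simp add: e diff_diff_eq)
 also have "... = ?c * conv (dil ze j) (dil ph nu) (x - ?a)" unfolding conv_def by (rule integral_mult_right_zero)
 finally show ?thesis .
qed

text \<open>Disjoint spectra leave only three scales, and there the decay is that of three fixed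
  convolutions, up to comparable dilations.\<close>

lemma coef_LP:
 fixes ph ze :: "'n::finite fn"
 assumes ze: "band ze" and ph: "band ph" and M: "0 <= M"
 shows "EX B>=0. ALL nu x j k. norm (coef (%z. dil ph nu (x - z)) ze (j, k)) <= (if j - nu : {-1,0,1} then B * p2 (ri j * real CARD('n) / 2) * wt M (tp j *R (x - corner (j, k))) else 0)"
proof -
 let ?n = "real CARD('n)" and ?I = "{-1,0,1::int}"
 have "EX B. 0 <= B & (ALL s. norm (conv (dil ze i) ph s) <= B * wt M s)" for i
 using decE[OF rd_dec[OF rd_conv[OF rd_dil[OF band_rd[OF ze]] band_rd[OF ph]]]] by metis
 then obtain B0 where B0: "!!i. 0 <= B0 i" "!!i s. norm (conv (dil ze i) ph s) <= B0 i * wt M s" by metis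
 define B1 where "B1 = B0 (-1) + B0 0 + B0 1"
 have B1: "0 <= B1" using B0(1)[of "-1"] B0(1)[of 0] B0(1)[of 1] by (simp add: B1_def)
 have BB: "B0 i <= B1" if "i : ?I" for i using that B0(1)[of "-1"] B0(1)[of 0] B0(1)[of 1] by (auto simp: B1_def)
 define B where "B = 2 powr ?n * (B1 * p2 M)"
 have B: "0 <= B" using B1 by (simp add: B_def)
 have main: "norm (coef (%z. dil ph nu (x - z)) ze (j, k)) <= (if j - nu : ?I then B * p2 (ri j * ?n / 2) * wt M (tp j *R (x - corner (j, k))) else 0)" for nu x j k
 proof -
 let ?y = "x - corner (j, k)"
 have cv: "conv (dil ze j) (dil ph nu) ?y = cr (p2 (ri nu * ?n)) * conv (dil ze (j - nu)) ph (tp nu *R ?y)"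
 using conv_dil[of ze nu "j - nu" ph ?y] by simp
 have nc: "norm (coef (%z. dil ph nu (x - z)) ze (j, k)) = p2 (- (ri j * ?n / 2)) * (p2 (ri nu * ?n) * norm (conv (dil ze (j - nu)) ph (tp nu *R ?y)))"
 unfolding coef_dil[OF ze] cv norm_mult norm_of_real by simp
 show ?thesis
 proof (cases "j - nu : ?I")
 case True
 have w: "wt M (tp nu *R ?y) <= 2 powr M * wt M (tp j *R ?y)"
 proof -
 have "j <= 1 + nu" using True by auto
 hence "ri j <= ri (1 + nu)" by (simp only: of_int_le_iff)
 hence "tp j <= p2 (1 + ri nu)" by (intro powr_mono) auto
 hence "tp j * norm ?y <= 2 * tp nu * norm ?y" by (intro mult_right_mono) (auto simp: powr_add)
 hence "1 + tp j * norm ?y <= 2 * (1 + tp nu * norm ?y)" by (simp add: algebra_simps)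
 hence "(2 * (1 + tp nu * norm ?y)) powr (- M) <= (1 + tp j * norm ?y) powr (- M)"
 using M by (intro powr_mono2') (auto intro: add_pos_nonneg)
 hence "p2 (- M) * wt M (tp nu *R ?y) <= wt M (tp j *R ?y)"
 unfolding wt_def powr_mult[of 2] norm_scaleR by (simp only: abs_of_nonneg powr_ge_zero)
 hence "2 powr M * (p2 (- M) * wt M (tp nu *R ?y)) <= 2 powr M * wt M (tp j *R ?y)" by simp
 moreover have "2 powr M * (p2 (- M) * wt M (tp nu *R ?y)) = wt M (tp nu *R ?y)"
 unfolding mult.assoc[symmetric] powr_add[symmetric] by simp
 ultimately show ?thesis by simp
 qed
 have pp: "p2 (- (ri j * ?n / 2)) * p2 (ri nu * ?n) <= 2 powr ?n * p2 (ri j * ?n / 2)"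
 proof -
 have "nu <= 1 + j" using True by auto
 hence "ri nu <= 1 + ri j" by (metis of_int_1 of_int_add of_int_le_iff)
 hence "ri nu * ?n <= (1 + ri j) * ?n" by (intro mult_right_mono) auto
 hence "- (ri j * ?n / 2) + ri nu * ?n <= ?n + ri j * ?n / 2" by (simp add: distrib_right)
 thus ?thesis unfolding powr_add[symmetric] by (intro powr_mono) auto
 qed
 have "norm (coef (%z. dil ph nu (x - z)) ze (j, k)) = (p2 (- (ri j * ?n / 2)) * p2 (ri nu * ?n)) * norm (conv (dil ze (j - nu)) ph (tp nu *R ?y))"
 unfolding nc by (simp only: mult.assoc)
 also have "... <= (2 powr ?n * p2 (ri j * ?n / 2)) * (B1 * (2 powr M * wt M (tp j *R ?y)))"
 proof (rule mult_mono[OF pp])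
 have "norm (conv (dil ze (j - nu)) ph (tp nu *R ?y)) <= B0 (j - nu) * wt M (tp nu *R ?y)" by (rule B0)
 also have "... <= B1 * (2 powr M * wt M (tp j *R ?y))" using BB[OF True] B1 w by (intro mult_mono) auto
 finally show "norm (conv (dil ze (j - nu)) ph (tp nu *R ?y)) <= B1 * (2 powr M * wt M (tp j *R ?y))" .
 qed simp_all
 finally show ?thesis unfolding B_def if_P[OF True] by (simp only: mult_ac)
 next
 case False
 thus ?thesis unfolding nc if_not_P[OF False] conv_far_zero[OF ze ph False] by simp
 qed
 qed
 show ?thesis using B main by blast
qed

lemma coef_integrable:
 fixes f ze :: "'n::finite fn"
 assumes f: "f : schwartz" and ze: "ze : schwartz"
 shows "intl (%x. f x * cubefn ze Q x)"
proof -
 have rc: "rd (cubefn ze Q)" by (rule schwartz_rd[OF schwartz_cubefn[OF ze]])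
 obtain B where B: "0 <= B" "!!x. norm (cubefn ze Q x) <= B * wt 0 x" using decE[OF rd_dec[OF rc]] by blast
 have m: "f : BM" "cubefn ze Q : BM" using rd_measurable[OF schwartz_rd[OF f]] rd_measurable[OF rc] .
 have "intl (%x. B * norm (f x))" by (intro integrable_mult_right integrable_norm rd_integrable schwartz_rd f)
 thus ?thesis
 proof (rule integrable_dominated)
 show "(%x. f x * cubefn ze Q x) : bm lborel" using m by measurable
 fix x
 have "norm (cubefn ze Q x) <= B" using B(2)[of x] B(1) wt_le_1[of 0 x] mult_left_le[of "wt 0 x" B] by (auto intro: order_trans)
 thus "norm (f x * cubefn ze Q x) <= B * norm (f x)" unfolding norm_mult mult.commute[of B] by (intro mult_left_mono) auto
 qed
qed

lemma coef_lin:
 fixes f g ze :: "'n::finite fn"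
 assumes f: "f : schwartz" and g: "g : schwartz" and ze: "ze : schwartz"
 shows "coef (%x. a * f x + b * g x) ze Q = a * coef f ze Q + b * coef g ze Q"
proof -
 have "coef (%x. a * f x + b * g x) ze Q = (LI x. a * (f x * cubefn ze Q x) + b * (g x * cubefn ze Q x))"
 unfolding coef_def by (simp only: distrib_right mult.assoc)
 also have "... = (LI x. a * (f x * cubefn ze Q x)) + (LI x. b * (g x * cubefn ze Q x))"
 by (intro Bochner_Integration.integral_add integrable_mult_right coef_integrable f g ze)
 finally show ?thesis unfolding coef_def by (simp only: integral_mult_right_zero)
qed

text \<open>In use, \<open>A Q P\<close> is the operator applied to \<open>cubefn ze P\<close> and
  paired with \<open>cubefn et Q\<close>: \<open>et\<close> analyses the input and \<open>ze\<close>
  synthesises it.\<close>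

locale adp_matrix = lp_setting ph ps et de al
 for ph ps et :: "'n::finite fn" and de al :: real +
 fixes ze :: "'n fn" and A :: "'n cube => 'n cube => complex" and p q CA :: real
 assumes ze: "band ze" and p: "1 <= p" and q: "1 <= q" and CA: "0 <= CA"
 and A: "!!P Q. norm (A Q P) <= CA * omega de P Q"
begin

definition tt :: "('n fn => complex) => 'n cube => complex" where
 "tt u Q = (LC P. A Q P * u (cubefn et P))"

definition c0 :: complex where "c0 = cr (1 / (2 * pi) ^ CARD('n))"

text \<open>Formally the operator applied to \<open>u\<close> and paired with \<open>g\<close>,
  where \<open>u\<close> is replaced by \<open>c0\<close> times the series of
  \<open>cubefn ze P\<close> with coefficients \<open>u (cubefn et P)\<close>, and \<open>g\<close>
  by \<open>c0\<close> times the series of \<open>cubefn et Q\<close> with coefficients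
  \<open>coef g ze Q\<close>. Written this way it makes sense for every \<open>u\<close> in
  \<open>TL\<close>.\<close>

definition E :: "('n fn => complex) => 'n fn => complex" where
 "E u g = c0 * c0 * (LC Q. tt u Q * coef g ze Q)"

lemma tt_nn: "(NS P. en (norm (A Q P * u (cubefn et P)))) <= en CA * ss u Q"
proof -
 have "(NS P. en (norm (A Q P * u (cubefn et P)))) <= (NS P. en (CA * (omega de P Q * norm (u (cubefn et P)))))"
 unfolding norm_mult mult.assoc[symmetric] by (intro nn_integral_mono ennreal_leI mult_right_mono A) simp
 also have "... = en CA * ss u Q" unfolding ss_def by (rule nn_integral_count_cmult[OF CA])
 finally show ?thesis .
qed

lemma tt_integrable:
 assumes "u : TL ph al q p" shows "intc (%P. A Q P * u (cubefn et P))"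
proof (rule integrableI_bounded)
 have "en CA * ss u Q < top" using ss_finite[OF q p assms, of Q] by (simp add: ennreal_mult_less_top)
 thus "(NS P. en (norm (A Q P * u (cubefn et P)))) < \<infinity>" using tt_nn[of Q u] by (simp add: order_le_less_trans)
qed simp

lemma tt_norm: assumes "u : TL ph al q p" shows "en (norm (tt u Q)) <= en CA * ss u Q"
 unfolding tt_def using integral_norm_bound_ennreal[OF tt_integrable[OF assms]] tt_nn by (rule order_trans)

lemma E_nn:
 assumes u: "u : TL ph al q p" and b: "!!Q. norm (coef g ze Q) <= b Q"
 shows "(NS Q. en (norm (tt u Q * coef g ze Q))) <= en CA * (NS Q. ss u Q * en (b Q))"
proof -
 have "(NS Q. en (norm (tt u Q * coef g ze Q))) <= (NS Q. en CA * (ss u Q * en (b Q)))"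
 unfolding norm_mult by (intro nn_integral_mono) (simp add: ennreal_mult mult.assoc[symmetric] mult_mono tt_norm[OF u] ennreal_leI b)
 also have "... = en CA * (NS Q. ss u Q * en (b Q))" by (rule nn_integral_cmult) simp
 finally show ?thesis .
qed

text \<open>The single bound by \<open>sobs\<close> yields both the convergence of the series
  defining \<open>E u g\<close> and the continuity of \<open>E u\<close>.\<close>

lemma E_nn_bound:
 assumes u: "u : TL ph al q p"
 shows "EX M C. 0 <= C & (ALL g:schwartz0. (NS Q. en (norm (tt u Q * coef g ze Q))) <= en (C * sobs M g))"
proof -
 define m where "m = CARD('n) + 2"
 have m: "CARD('n) + 1 < m" "CARD('n) < m" by (auto simp: m_def)
 let ?M = "m + CARD('n) + 1"
 obtain C1 where C1: "C1 >= 0" "ALL f nu k. f : schwartz & (LI x. f x) = 0 --> norm (LI x. f x * cubefn ze (nu, k) x) <= C1 * sobs ?M f * cbd m nu k"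
 using coefficient_cbd[OF ze m(1)] by blast
 obtain C2 where C2: "C2 >= 0" "(NS Q. ss u Q * en (cbd m (fst Q) (snd Q))) <= en C2"
 using ennreal_bound[OF ss_cbd_sum[OF q p u m(2)]] by blast
 have "(NS Q. en (norm (tt u Q * coef g ze Q))) <= en (CA * C1 * C2 * sobs ?M g)" if g: "g : schwartz0" for g
 proof -
 have s0: "0 <= sobs ?M g" by (rule sobs_nonneg[OF schwartz0_schwartz[OF g]])
 have b: "norm (coef g ze Q) <= C1 * sobs ?M g * cbd m (fst Q) (snd Q)" for Q
 using C1(2)[rule_format, of g "fst Q" "snd Q"] schwartz0_schwartz[OF g] schwartz0_integral[OF g] unfolding coef_def by simp
 have "(NS Q. en (norm (tt u Q * coef g ze Q))) <= en CA * (NS Q. ss u Q * en (C1 * sobs ?M g * cbd m (fst Q) (snd Q)))"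
 by (rule E_nn[OF u b])
 also have "(NS Q. ss u Q * en (C1 * sobs ?M g * cbd m (fst Q) (snd Q))) = (NS Q. en (C1 * sobs ?M g) * (ss u Q * en (cbd m (fst Q) (snd Q))))"
 using C1(1) s0 by (intro nn_integral_cong) (simp add: ennreal_mult cbd_nonneg mult_ac)
 also have "... = en (C1 * sobs ?M g) * (NS Q. ss u Q * en (cbd m (fst Q) (snd Q)))" by (rule nn_integral_cmult) simp
 also have "en CA * ... <= en CA * (en (C1 * sobs ?M g) * en C2)" by (intro mult_left_mono C2) simp_all
 also have "... = en (CA * C1 * C2 * sobs ?M g)" using CA C1(1) C2(1) s0 by (simp add: ennreal_mult[symmetric] mult_ac)
 finally show ?thesis .
 qed
 moreover have "0 <= CA * C1 * C2" using CA C1(1) C2(1) by simp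
 ultimately show ?thesis by blast
qed

lemma E_integrable:
 assumes u: "u : TL ph al q p" and g: "g : schwartz0"
 shows "intc (%Q. tt u Q * coef g ze Q)"
proof -
 obtain M C where "ALL g:schwartz0. (NS Q. en (norm (tt u Q * coef g ze Q))) <= en (C * sobs M g)" using E_nn_bound[OF u] by blast
 from count_integrableI(1)[OF this[rule_format, OF g]] show ?thesis .
qed

lemma E_lin_left:
 assumes u: "u : TL ph al q p" and v: "v : TL ph al q p" and g: "g : schwartz0"
 shows "E (%h. a * u h + b * v h) g = a * E u g + b * E v g"
proof -
 have t: "tt (%h. a * u h + b * v h) Q = a * tt u Q + b * tt v Q" for Q
 proof -
 have "tt (%h. a * u h + b * v h) Q = (LC P. a * (A Q P * u (cubefn et P)) + b * (A Q P * v (cubefn et P)))"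
 unfolding tt_def by (rule int_cong) (simp add: algebra_simps)
 also have "... = (LC P. a * (A Q P * u (cubefn et P))) + (LC P. b * (A Q P * v (cubefn et P)))"
 by (intro Bochner_Integration.integral_add integrable_mult_right tt_integrable u v)
 finally show ?thesis unfolding tt_def by (simp only: integral_mult_right_zero)
 qed
 have "(LC Q. tt (%h. a * u h + b * v h) Q * coef g ze Q) = (LC Q. a * (tt u Q * coef g ze Q) + b * (tt v Q * coef g ze Q))"
 unfolding t by (rule int_cong) (simp add: algebra_simps)
 also have "... = (LC Q. a * (tt u Q * coef g ze Q)) + (LC Q. b * (tt v Q * coef g ze Q))"
 by (intro Bochner_Integration.integral_add integrable_mult_right E_integrable u v g)
 also have "... = a * (LC Q. tt u Q * coef g ze Q) + b * (LC Q. tt v Q * coef g ze Q)" by (simp only: integral_mult_right_zero)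
 finally show ?thesis unfolding E_def by (simp add: algebra_simps)
qed

lemma E_SP: assumes u: "u : TL ph al q p" shows "E u : SP"
proof -
 have "E u (%x. a * f x + b * g x) = a * E u f + b * E u g" if f: "f : schwartz0" and g: "g : schwartz0" for f g a b
 proof -
 have "(LC Q. tt u Q * coef (%x. a * f x + b * g x) ze Q) = (LC Q. a * (tt u Q * coef f ze Q) + b * (tt u Q * coef g ze Q))"
 unfolding coef_lin[OF schwartz0_schwartz[OF f] schwartz0_schwartz[OF g] band_schwartz[OF ze]]
 by (rule int_cong) (simp add: algebra_simps)
 also have "... = (LC Q. a * (tt u Q * coef f ze Q)) + (LC Q. b * (tt u Q * coef g ze Q))"
 by (intro Bochner_Integration.integral_add integrable_mult_right E_integrable u f g)
 also have "... = a * (LC Q. tt u Q * coef f ze Q) + b * (LC Q. tt u Q * coef g ze Q)" by (simp only: integral_mult_right_zero)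
 finally show ?thesis unfolding E_def by (simp add: algebra_simps)
 qed
 moreover have "cont_on_S0 (E u)"
 proof -
 obtain M C where C: "0 <= C" "ALL g:schwartz0. (NS Q. en (norm (tt u Q * coef g ze Q))) <= en (C * sobs M g)"
 using E_nn_bound[OF u] by blast
 have "norm (E u g) <= (norm (c0 * c0) * C) * (\<Sum>m\<le>Suc M. SUM is:{is::'n list. length is <= Suc M}. seminorm_S m is g)" if g: "g : schwartz0" for g
 proof -
 have s0: "0 <= sobs M g" by (rule sobs_nonneg[OF schwartz0_schwartz[OF g]])
 have "norm (LC Q. tt u Q * coef g ze Q) <= max 0 (C * sobs M g)" by (rule count_integrableI(2)) (use C g in blast)
 also have "... = C * sobs M g" using C(1) s0 by simp
 also have "... <= C * (\<Sum>m\<le>Suc M. SUM is:{is::'n list. length is <= Suc M}. seminorm_S m is g)" by (intro mult_left_mono sobs_le_sum schwartz0_schwartz g C)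
 finally show ?thesis unfolding E_def norm_mult[of "c0 * c0"] by (simp add: mult.assoc mult_left_mono)
 qed
 thus ?thesis unfolding cont_on_S0_def by blast
 qed
 ultimately show ?thesis unfolding SP_def lin_on_S0_def by blast
qed

lemma E_LP_bound:
 "EX C>=0. ALL u nu x. u : TL ph al q p --> en (p2 (ri nu * (1 + al)) * norm (LPconv ph nu (E u) x)) <= en C * (SUM i:{-1,0,1}. DD u (i + nu) x)"
proof -
 let ?n = "real CARD('n)" and ?I = "{-1,0,1::int}"
 \<comment> \<open>The part n + \<open>de\<close> cancels the growth allowed in
   \<open>dd_le\<close>, and n + 1 bounds the sum over \<open>k\<close>.\<close>
 let ?M = "(?n + de) + (?n + 1)"
 let ?A = "%u b. NS Q. ss u Q * en (b Q)"
 let ?B = "%u j k b. ss u (j, k) * en (b (j, k))"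
 let ?C = "%j x k. 1 + tp j * norm (x - corner (j, k))"
 let ?D = "%j x k. wt (?n + 1) (tp j *R x - cvec k)"
 let ?E = "%u nu x. SUM i:?I. DD u (i + nu) x"
 let ?F = "%B j w. B * p2 (ri j * ?n / 2) * w"
 let ?G = "%nu u x. en (p2 (ri nu * (1 + al)) * norm (LPconv ph nu (E u) x))"
 have M: "0 <= ?M" using de by simp
 obtain B where B: "B >= 0" "ALL nu x j k. norm (coef (%z. dil ph nu (x - z)) ze (j, k)) <= (if j - nu : ?I then B * p2 (ri j * ?n / 2) * wt ?M (tp j *R (x - corner (j, k))) else 0)"
 using coef_LP[OF ze ph M] by blast
 obtain C1 where C1: "C1 >= 0" "ALL u Q x. u : SP --> dd u Q <= en (C1 * (1 + tp (fst Q) * norm (x - corner Q)) powr (?n + de)) * DD u (fst Q) x"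
 using dd_le by blast
 have n1: "?n < ?n + 1" by simp
 obtain C2 where C2: "C2 >= 0" "ALL x::real^'n. (NS k. en (wt (?n + 1) (x - cvec k))) <= en C2"
 using lattice_sum_wt_unit[OF n1] by blast
 define K where "K = norm (c0 * c0) * CA"
 have K: "0 <= K" using CA by (simp add: K_def)
 define C where "C = K * (2 * B * C1 * C2)"
 have C: "0 <= C" using K B C1 C2 by (simp add: C_def)
 have main: "?G nu u x <= en C * ?E u nu x" if u: "u : TL ph al q p" for u nu x
 proof -
 have uS: "u : SP" using u by (simp add: TL_def)
 let ?g = "%z. dil ph nu (x - z)"
 let ?e = "en (p2 (ri nu * (1 + al)))"
 have g: "?g : schwartz0" by (rule dil_reflect_schwartz0[OF ph])
 define b where "b Q = (if fst Q - nu : ?I then B * p2 (ri (fst Q) * ?n / 2) * wt ?M (tp (fst Q) *R (x - corner Q)) else 0)" for Q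
 have b: "norm (coef ?g ze Q) <= b Q" for Q using B(2)[rule_format, of nu x "fst Q" "snd Q"] unfolding b_def prod.collapse by (simp only:)
 have "en (norm (LC Q. tt u Q * coef ?g ze Q)) <= en CA * ?A u b"
 using integral_norm_bound_ennreal[OF E_integrable[OF u g]] E_nn[OF u b] by (rule order_trans)
 hence "en (norm (c0 * c0)) * en (norm (LC Q. tt u Q * coef ?g ze Q)) <= en (norm (c0 * c0)) * (en CA * ?A u b)"
 by (rule mult_left_mono) simp
 hence 1: "en (norm (LPconv ph nu (E u) x)) <= en K * ?A u b"
 unfolding LPconv_def E_def norm_mult[of "c0 * c0"] K_def using CA by (simp add: ennreal_mult mult.assoc)
 have 2: "?e * ?B u j k b <= (if j - nu : ?I then en (2 * B * C1) * DD u j x * en (?D j x k) else 0)" for j k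
 proof (cases "j - nu : ?I")
 case True
 define w where "w = wt ?M (tp j *R (x - corner (j, k)))"
 have w0: "0 <= w" by (simp add: w_def)
 have "?e * ?B u j k b = ss u (j, k) * en (p2 (ri nu * (1 + al)) * ?F B j w)"
 unfolding b_def fst_conv if_P[OF True] w_def[symmetric] using B(1) w0 by (subst ennreal_mult[of "p2 (ri nu * (1 + al))"]) (simp_all add: mult_ac)
 also have "... <= ss u (j, k) * en (2 powr sexp j * (2 * B * w))"
 proof (intro mult_left_mono ennreal_leI)
 have "ri nu * (1 + al) <= 1 + ri j * (1 + al)"
 proof -
 have "nu <= 1 + j" using True by auto
 hence "ri nu <= 1 + ri j" by (metis of_int_1 of_int_add of_int_le_iff)
 hence "ri nu * (1 + al) <= (1 + ri j) * (1 + al)" using al by (intro mult_right_mono) auto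
 also have "... <= 1 + ri j * (1 + al)" using al by (simp add: distrib_right)
 finally show ?thesis .
 qed
 hence "p2 (ri nu * (1 + al)) <= p2 (1 + ri j * (1 + al))" by (rule powr_mono) simp
 hence "p2 (ri nu * (1 + al)) * ?F B j w <= p2 (1 + ri j * (1 + al)) * ?F B j w"
 using B(1) w0 by (intro mult_right_mono) auto
 also have "... = 2 powr sexp j * (2 * B * w)" unfolding sexp_def powr_add powr_one_gt_zero_iff by simp
 finally show "p2 (ri nu * (1 + al)) * ?F B j w <= 2 powr sexp j * (2 * B * w)" .
 qed simp
 also have "... = dd u (j, k) * en (2 * B * w)" unfolding dd_ss fst_conv using B(1) w0 by (subst ennreal_mult) (simp_all add: mult_ac)
 also have "... <= (en (C1 * (?C j x k) powr (?n + de)) * DD u j x) * en (2 * B * w)"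
 using C1(2)[rule_format, OF uS, of "(j, k)" x] unfolding fst_conv by (rule mult_right_mono) simp
 also have "... = en (2 * B * C1 * ((?C j x k) powr (?n + de) * w)) * DD u j x"
 proof -
 let ?R = "(?C j x k) powr (?n + de)"
 have "en (C1 * ?R) * en (2 * B * w) = en (2 * B * C1 * ?R * w)" using B(1) C1(1) w0 by (subst ennreal_mult[symmetric]) (simp_all add: mult_ac)
 thus ?thesis by (simp only: mult_ac)
 qed
 also have "(?C j x k) powr (?n + de) * w = wt (?n + 1) (tp j *R x - cvec k)"
 proof -
 have z: "tp j *R (x - corner (j, k)) = tp j *R x - cvec k" by (simp add: corner_def scaleR_diff_right powr_minus)
 have nz: "tp j * norm (x - corner (j, k)) = norm (tp j *R x - cvec k)" unfolding z[symmetric] by simp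
 show ?thesis unfolding w_def z nz wt_def powr_add[symmetric] by simp
 qed
 also have "en (2 * B * C1 * wt (?n + 1) (tp j *R x - cvec k)) * DD u j x = en (2 * B * C1) * DD u j x * en (?D j x k)"
 using B(1) C1(1) by (subst ennreal_mult) (simp_all add: mult_ac)
 finally show ?thesis unfolding if_P[OF True] .
 next
 case False
 thus ?thesis unfolding b_def fst_conv if_not_P[OF False] by simp
 qed
 have 3: "(NS k. ?e * ?B u j k b) <= (if j - nu : ?I then en (2 * B * C1 * C2) * DD u j x else 0)" for j
 proof (cases "j - nu : ?I")
 case True
 have "(NS k. ?e * ?B u j k b) <= (NS k. en (2 * B * C1) * DD u j x * en (?D j x k))"
 using 2[of j, unfolded if_P[OF True]] by (rule nn_integral_mono)
 also have "... = en (2 * B * C1) * DD u j x * (NS k. en (?D j x k))" by (rule nn_integral_cmult) simp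
 also have "... <= en (2 * B * C1) * DD u j x * en C2" by (rule mult_left_mono[OF C2(2)[rule_format]]) simp
 also have "... = en (2 * B * C1 * C2) * DD u j x" using B(1) C1(1) C2(1) by (subst (2) ennreal_mult) (simp_all add: mult_ac)
 finally show ?thesis unfolding if_P[OF True] .
 next
 case False
 have "(NS k. ?e * ?B u j k b) = 0" unfolding b_def fst_conv if_not_P[OF False] by simp
 thus ?thesis unfolding if_not_P[OF False] by simp
 qed
 have "?e * ?A u b = (NS j. (NS k. ?e * ?B u j k b))"
 unfolding nn_integral_fst_count_space[symmetric] by (simp add: nn_integral_cmult)
 also have "... <= (NS j. (if j - nu : ?I then en (2 * B * C1 * C2) * DD u j x else 0))" by (intro nn_integral_mono 3)
 also have "... = (NS i. (if (i + nu) - nu : ?I then en (2 * B * C1 * C2) * DD u (i + nu) x else 0))"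
 by (rule nn_integral_count_shift[symmetric])
 also have "... = (SUM i:?I. en (2 * B * C1 * C2) * DD u (i + nu) x)"
 by (subst nn_integral_count_space'[of ?I]) auto
 also have "... = en (2 * B * C1 * C2) * ?E u nu x" by (rule sum_distrib_left[symmetric])
 finally have 4: "?e * ?A u b <= en (2 * B * C1 * C2) * ?E u nu x" .
 have "?G nu u x = ?e * en (norm (LPconv ph nu (E u) x))" by (rule ennreal_mult) simp_all
 also have "... <= ?e * (en K * ?A u b)" by (rule mult_left_mono[OF 1]) simp
 also have "... = en K * (?e * ?A u b)" by (simp only: mult_ac)
 also have "... <= en K * (en (2 * B * C1 * C2) * ?E u nu x)" by (rule mult_left_mono[OF 4]) simp
 also have "... = en C * ?E u nu x"
 unfolding C_def using K B(1) C1(1) C2(1) by (subst (2) ennreal_mult) (simp_all only: mult.assoc mult_nonneg_nonneg zero_le_numeral)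
 finally show ?thesis .
 qed
 show ?thesis using C main by blast
qed

lemma E_TL_bound:
 "EX C>=0. ALL u. u : TL ph al q p --> TL_normp ph (1 + al) q p (E u) <= en C * TL_normp ph al q p u"
proof -
 let ?I = "{-1,0,1::int}"
 let ?A = "%nu u x. p2 (ri nu * (1 + al)) * norm (LPconv ph nu (E u) x)"
 let ?B = "%u nu x. SUM i:?I. epow (DD u (i + nu) x) q"
 let ?C = "%u i x. NS nu. epow (DD u (i + nu) x) q"
 have q0: "0 < q" and p0: "0 < p" and pq: "0 < p / q" using p q by auto
 obtain C1 where C1: "C1 >= 0" "ALL u nu x. u : TL ph al q p --> en (?A nu u x) <= en C1 * (SUM i:?I. DD u (i + nu) x)"
 using E_LP_bound by blast
 obtain C2 where C2: "C2 >= 0" "ALL u. u : SP --> (NI x. epow (NS j. epow (DD u j x) q) (p / q)) <= en C2 * TL_normp ph al q p u"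
 using DD_TL[OF q p] by blast
 define K where "K = C1 powr q * 3 powr q * 3"
 have K: "0 <= K" by (simp add: K_def)
 define C where "C = K powr (p / q) * C2"
 have C: "0 <= C" using C2(1) by (simp add: C_def)
 have main: "TL_normp ph (1 + al) q p (E u) <= en C * TL_normp ph al q p u" if u: "u : TL ph al q p" for u
 proof -
 have uS: "u : SP" using u by (simp add: TL_def)
 let ?S = "%x. (NS j. epow (DD u j x) q)"
 have [measurable]: "?S : BM" by (rule nn_integral_int_measurable) (rule epow_measurable[OF DD_measurable[OF uS]])
 have pt: "(NS nu. en ((?A nu u x) powr q)) <= en K * ?S x" for x
 proof -
 have "(NS nu. en ((?A nu u x) powr q)) <= (NS nu. en (C1 powr q * 3 powr q) * ?B u nu x)"
 proof (rule nn_integral_mono)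
 fix nu
 have "en ((?A nu u x) powr q) = epow (en (?A nu u x)) q"
 by (rule epow_ennreal[symmetric]) simp
 also have "... <= epow (en C1 * (SUM i:?I. DD u (i + nu) x)) q" using C1(2) u q0 by (intro epow_mono) auto
 also have "... = en (C1 powr q) * epow (SUM i:?I. DD u (i + nu) x) q" using C1(1) by (simp only: epow_mult[OF q0] epow_ennreal)
 also have "... <= en (C1 powr q) * (en (real (card ?I) powr q) * ?B u nu x)"
 by (intro mult_left_mono epow_finite_sum_le q0) simp_all
 also have "... = en (C1 powr q * 3 powr q) * ?B u nu x" by (subst ennreal_mult) (simp_all add: mult.assoc)
 finally show "en ((?A nu u x) powr q) <= ..." .
 qed
 also have "... = en (C1 powr q * 3 powr q) * (SUM i:?I. (?C u i x))"
 by (subst nn_integral_cmult, simp, subst nn_integral_sum) simp_all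
 also have "(SUM i:?I. (?C u i x)) = (SUM i:?I. ?S x)"
 proof (intro sum.cong refl)
 fix i
 show "?C u i x = ?S x"
 using nn_integral_count_shift[of "%j. epow (DD u j x) q" i] by (simp only: add.commute)
 qed
 also have "... = en 3 * ?S x" by simp
 finally show ?thesis unfolding K_def by (subst ennreal_mult) (simp_all only: mult.assoc powr_ge_zero zero_le_numeral mult_nonneg_nonneg)
 qed
 have "TL_normp ph (1 + al) q p (E u) <= (NI x. epow (en K * ?S x) (p / q))"
 unfolding TL_normp_epow using pq by (intro nn_integral_mono epow_mono pt) simp
 also have "... = (NI x. en (K powr (p / q)) * epow (?S x) (p / q))" using K by (simp only: epow_mult[OF pq] epow_ennreal)
 also have "... = en (K powr (p / q)) * (NI x. epow (?S x) (p / q))" by (rule nn_integral_cmult) measurable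
 also have "... <= en (K powr (p / q)) * (en C2 * TL_normp ph al q p u)" by (rule mult_left_mono[OF C2(2)[rule_format, OF uS]]) simp
 also have "... = en C * TL_normp ph al q p u" unfolding C_def using C2(1) by (subst ennreal_mult) (simp_all add: mult.assoc)
 finally show ?thesis .
 qed
 show ?thesis using C main by blast
qed

lemma E_TL: "u : TL ph al q p ==> E u : TL ph (1 + al) q p"
proof -
 assume u: "u : TL ph al q p"
 obtain C where "C >= 0" "ALL u. u : TL ph al q p --> TL_normp ph (1 + al) q p (E u) <= en C * TL_normp ph al q p u" using E_TL_bound by blast
 hence "TL_normp ph (1 + al) q p (E u) <= en C * TL_normp ph al q p u" using u by blast
 also have "... < top" using u by (simp add: TL_def ennreal_mult_less_top)
 finally show ?thesis using E_SP[OF u] by (simp add: TL_def)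
qed

end

section \<open>Agreement of the extension with the given operator\<close>

lemma cubefn_L1:
 fixes ze :: "'n::finite fn"
 assumes ze: "ze : schwartz"
 shows "(NI x. en (norm (cubefn ze P x))) = en (side P powr (real CARD('n) / 2) * (LI x. norm (ze x)))"
proof -
 have c: "cubefn (%z. cr (norm (ze z))) P x = cr (norm (cubefn ze P x))" for x
 by (simp add: cubefn_def norm_mult)
 have "cr (LI x. norm (cubefn ze P x)) = (LI x. cubefn (%z. cr (norm (ze z))) P x)" unfolding c by simp
 also have "... = cr (side P powr (real CARD('n) / 2) * (LI x. norm (ze x)))" unfolding cubefn_integral_nofactor by simp
 finally have "(LI x. norm (cubefn ze P x)) = side P powr (real CARD('n) / 2) * (LI x. norm (ze x))" by (simp only: of_real_eq_iff)
 moreover have "(NI x. en (norm (cubefn ze P x))) = en (LI x. norm (cubefn ze P x))"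
 by (intro nn_integral_eq_integral integrable_norm rd_integrable schwartz_rd schwartz_cubefn ze) simp
 ultimately show ?thesis by simp
qed

text \<open>Integrates the pointwise Calderon formula against a bounded function. The interchange is
  justified by \<open>calderon(1)\<close>, because the weight there is, up to a constant, the
  integral of the modulus of \<open>cubefn ze P\<close>.\<close>

lemma calderon_pairing:
 fixes et ze f ka :: "'n::finite fn"
 assumes et: "band et" and ze: "band ze" and PU: "PU et ze" and f: "f : schwartz" "(LI x. f x) = 0"
 and ka [measurable]: "ka : BM" and B: "!!y. norm (ka y) <= B"
 shows "(LC P. coef f et P * (LI y. cubefn ze P y * ka y)) = cr ((2 * pi) ^ CARD('n)) * (LI y. f y * ka y)"
proof -
 let ?A = "%P. NI y. en (norm (coef f et P) * B) * en (norm (cubefn ze P y))"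
 let ?B = "%P. norm (coef f et P) * side P powr (real CARD('n) / 2)"
 let ?C = "count_space UNIV \<Otimes>\<^sub>M lborel"
 let ?D = "%P y. coef f et P * cubefn ze P y * ka y"
 let ?E = "%P. norm (coef f et P) * B"
 interpret A: sigma_finite_measure "count_space (UNIV::'n cube set)" by (rule sigma_finite_count_space)
 interpret pair_sigma_finite "count_space (UNIV::'n cube set)" "lborel :: (real^'n) measure" by standard
 have zeS: "ze : schwartz" by (rule band_schwartz[OF ze])
 have [measurable]: "cubefn ze P : BM" for P by (rule rd_measurable[OF schwartz_rd[OF schwartz_cubefn[OF zeS]]])
 have B0: "0 <= B" using norm_ge_zero B by (rule order_trans)
 define N where "N = (LI x. norm (ze x))"
 have N0: "0 <= N" unfolding N_def by (rule Bochner_Integration.integral_nonneg) simp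
 let ?h = "%(P, y). coef f et P * cubefn ze P y * ka y"
 have m: "?h : bm ?C"
 by (rule measurable_pair_measure_countable1) auto
 have "(\<integral>\<^sup>+p. norm (?h p) \<partial>?C) = (NS P. (NI y. norm (?D P y)))"
 using m by (subst lborel.nn_integral_fst[symmetric]) auto
 also have "... <= (NS P. (?A P))"
 proof (intro nn_integral_mono)
 fix P y
 have "norm (?D P y) <= norm (coef f et P) * norm (cubefn ze P y) * B" unfolding norm_mult by (intro mult_left_mono B) simp
 also have "... = ?E P * norm (cubefn ze P y)" by simp
 finally show "en (norm (?D P y)) <= en (?E P) * en (norm (cubefn ze P y))"
 using B0 by (subst ennreal_mult[symmetric]) (auto intro!: ennreal_leI)
 qed
 also have "... = (NS P. en ((B * N) * ?B P))"
 proof (rule nn_integral_cong)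
 fix P
 have "?A P = en (?E P) * en (side P powr (real CARD('n) / 2) * N)"
 unfolding N_def cubefn_L1[OF zeS, symmetric] by (rule nn_integral_cmult) measurable
 thus "?A P = en ((B * N) * ?B P)"
 using B0 N0 by (simp add: ennreal_mult[symmetric] mult_ac)
 qed
 also have "... = en (B * N) * (NS P. en (norm (?B P)))"
 using B0 N0 by (subst nn_integral_count_cmult) simp_all
 also have "... < \<infinity>" using calderon(1)[OF et ze PU f] unfolding integrable_iff_bounded by (simp add: ennreal_mult_less_top)
 finally have i: "integrable ?C ?h" using m by (intro integrableI_bounded)
 have "cr ((2 * pi) ^ CARD('n)) * (LI y. f y * ka y) = (LI y. (cr ((2 * pi) ^ CARD('n)) * f y) * ka y)"
 unfolding mult.assoc by (rule integral_mult_right_zero[symmetric])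
 also have "... = (LI y. (LC P. coef f et P * cubefn ze P y * ka y))"
 unfolding calderon(3)[OF et ze PU f, symmetric] by (simp only: integral_mult_left_zero)
 also have "... = (LC P. (LI y. coef f et P * cubefn ze P y * ka y))"
 by (rule Fubini_integral) (use i in simp)
 also have "... = (LC P. coef f et P * (LI y. cubefn ze P y * ka y))"
 by (simp only: mult.assoc integral_mult_right_zero)
 finally show ?thesis by simp
qed

lemma kernel_integral_measurable:
 fixes K :: "real^'n::finite => real^'n => complex"
 assumes K: "KB de C K" and g: "rd g"
 shows "(%y. LI x. K x y * g x) : BM"
proof -
 define K0 where "K0 x y = (if x = y then 0 else K x y)" for x y
 have [measurable]: "g : BM" by (rule rd_measurable[OF g])
 have [measurable]: "(%p. K0 (fst p) (snd p)) : bm (borel \<Otimes>\<^sub>M borel)"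
 using KB_measurable[OF K] by (simp add: K0_def borel_prod)
 have [measurable]: "(%x. K0 x y) : BM" for y
 proof -
 have "(%x. (x, y)) : borel \<rightarrow>\<^sub>M borel \<Otimes>\<^sub>M borel" by measurable
 from measurable_compose[OF this, of "%p. K0 (fst p) (snd p)" borel] show ?thesis by simp
 qed
 have [measurable]: "(%x. K x y) : BM" for y by (rule KB_measurable_1[OF K])
 have "(LI x. K x y * g x) = (LI x. K0 x y * g x)" for y
 proof (rule integral_cong_AE)
 show "AE x in lborel. K x y * g x = K0 x y * g x" using AE_neq_lborel[of y] by eventually_elim (simp add: K0_def)
 qed measurable
 moreover have "(%y. LI x. K0 x y * g x) : BM"
 proof (rule sigma_finite_measure.borel_measurable_lebesgue_integral)
 show "sigma_finite_measure (lborel :: (real^'n) measure)" by (rule lborel.sigma_finite_measure_axioms)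
 have "(%p. (snd p, fst p)) : borel \<Otimes>\<^sub>M lborel \<rightarrow>\<^sub>M borel \<Otimes>\<^sub>M (borel :: (real^'n) measure)" by measurable
 from measurable_compose[OF this, of "%p. K0 (fst p) (snd p)" borel]
 have [measurable]: "(%p. K0 (snd p) (fst p)) : bm (borel \<Otimes>\<^sub>M (lborel :: (real^'n) measure))" by simp
 show "(%(y, x). K0 x y * g x) : bm (borel \<Otimes>\<^sub>M lborel)" unfolding case_prod_beta' by measurable
 qed
 ultimately show ?thesis by simp
qed

text \<open>On embedded test functions both series in \<open>E\<close> are summed by
  \<open>calderon_pairing\<close>: first over the input cubes, against the transposed operator on
  \<open>cubefn et Q\<close>, then over the output cubes, against the operator on \<open>f\<close>.
  Each time the operator has to appear as a bounded function, which is the purpose of the two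
  representations \<open>B1\<close> and \<open>B2\<close>.\<close>

lemma bdd_ext_almost_diagonal:
 fixes ph ps et ze :: "'n::finite fn" and B :: "'n op"
 assumes ph: "band ph" "band ps" "PU ph ps" and etze: "band et" "band ze" "PU et ze"
 and de: "0 < de" and al: "-1 <= al" "al <= 0" and p: "1 <= p" and q: "1 <= q"
 and C: "0 <= C" "!!P Q. norm (B (cubefn ze P) (cubefn et Q)) <= C * omega de P Q"
 and m1: "!!g. g : schwartz0 ==> ka1 g : BM & (EX b. ALL y. norm (ka1 g y) <= b)"
 and m2: "!!f. f : schwartz0 ==> ka2 f : BM & (EX b. ALL y. norm (ka2 f y) <= b)"
 and B1: "!!f g. f : schwartz0 ==> g : schwartz0 ==> B f g = (LI y. f y * ka1 g y)"
 and B2: "!!f g. f : schwartz0 ==> g : schwartz0 ==> B f g = (LI x. g x * ka2 f x)"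
 shows "bdd_ext ph al q p B"
proof -
 interpret adp_matrix ph ps et de al ze "%Q P. B (cubefn ze P) (cubefn et Q)" p q C
 by unfold_locales (rule ph etze de al p q C)+
 let ?w = "cr ((2 * pi) ^ CARD('n))"
 have E: "E (emb f) g = B f g" if f: "f : schwartz0" and g: "g : schwartz0" for f g
 proof -
 have fS: "f : schwartz" "(LI x. f x) = 0" using schwartz0_schwartz[OF f] schwartz0_integral[OF f] .
 have gS: "g : schwartz" "(LI x. g x) = 0" using schwartz0_schwartz[OF g] schwartz0_integral[OF g] .
 have cz: "cubefn ze P : schwartz0" and ce: "cubefn et P : schwartz0" for P using etze by (auto intro: band_cubefn)
 have t: "tt (emb f) Q = ?w * B f (cubefn et Q)" for Q
 proof -
 obtain b where b: "ka1 (cubefn et Q) : BM" "!!y. norm (ka1 (cubefn et Q) y) <= b" using m1[OF ce[of Q]] by blast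
 have "tt (emb f) Q = (LC P. coef f et P * (LI y. cubefn ze P y * ka1 (cubefn et Q) y))"
 unfolding tt_def emb_def coef_def[symmetric] unfolding B1[OF cz ce] by (rule int_cong) (rule mult.commute)
 also have "... = ?w * B f (cubefn et Q)" unfolding B1[OF f ce] by (rule calderon_pairing[OF etze fS b])
 finally show ?thesis .
 qed
 obtain b where b: "ka2 f : BM" "!!y. norm (ka2 f y) <= b" using m2[OF f] by blast
 have "(LC Q. tt (emb f) Q * coef g ze Q) = (LC Q. ?w * (coef g ze Q * (LI x. cubefn et Q x * ka2 f x)))"
 unfolding t B2[OF f ce] by (simp only: mult_ac)
 also have "... = ?w * (LC Q. coef g ze Q * (LI x. cubefn et Q x * ka2 f x))" by (rule integral_mult_right_zero)
 also have "... = ?w * (?w * B f g)" unfolding B2[OF f g] calderon_pairing[OF etze(2,1) PU_commute[OF etze(3)] gS b] ..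
 finally have "E (emb f) g = (c0 * ?w) * (c0 * ?w) * B f g" unfolding E_def by (simp only: mult_ac)
 moreover have "c0 * ?w = 1" unfolding c0_def of_real_mult[symmetric] by simp
 ultimately show ?thesis by simp
 qed
 obtain D where D: "D >= 0" "ALL u. u : TL ph al q p --> TL_normp ph (1 + al) q p (E u) <= en D * TL_normp ph al q p u" using E_TL_bound by blast
 show ?thesis unfolding bdd_ext_def
 by (intro exI[of _ E] exI[of _ D] conjI ballI allI E E_lin_left E_TL D(2)[rule_format])
qed

lemma L1_functional_cont:
 fixes ka :: "'n::finite fn"
 assumes ka: "ka : BM" "!!y. norm (ka y) <= b"
 and F: "!!f. f : schwartz0 ==> F f = (LI y. f y * ka y)"
 shows "cont_on_S0 F"
proof -
 let ?m = "CARD('n) + 1"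
 define W where "W = (LI y. wt (real ?m) (y::real^'n))"
 have b0: "0 <= b" using norm_ge_zero ka(2) by (rule order_trans)
 have W0: "0 <= W" unfolding W_def by (rule Bochner_Integration.integral_nonneg) simp
 have "norm (F f) <= (b * W) * (\<Sum>k\<le>Suc ?m. SUM is:{is::'n list. length is <= Suc ?m}. seminorm_S k is f)" if f: "f : schwartz0" for f
 proof -
 have fS: "f : schwartz" by (rule schwartz0_schwartz[OF f])
 have "norm (F f) <= (LI y. (b * sobs ?m f) * wt (real ?m) (y::real^'n))"
 unfolding F[OF f]
 proof (rule norm_integral_le)
 show "intl (%y::real^'n. (b * sobs ?m f) * wt (real ?m) y)" by (intro integrable_mult_right integrable_wt) simp
 show "(%y. f y * ka y) : bm lborel" using ka(1) rd_measurable[OF schwartz_rd[OF fS]] by measurable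
 fix y
 have "norm (f y * ka y) <= (sobs ?m f * wt (real ?m) y) * b"
 unfolding norm_mult using b0 sobs_nonneg[OF fS, of ?m] by (intro mult_mono norm_le_sobs[OF fS] ka(2)) auto
 thus "norm (f y * ka y) <= (b * sobs ?m f) * wt (real ?m) y" by (simp only: mult_ac)
 qed
 also have "... = (b * W) * sobs ?m f" unfolding W_def by (simp add: mult_ac)
 also have "... <= (b * W) * (\<Sum>k\<le>Suc ?m. SUM is:{is::'n list. length is <= Suc ?m}. seminorm_S k is f)"
 using b0 W0 by (intro mult_left_mono sobs_le_sum fS) auto
 finally show ?thesis .
 qed
 thus ?thesis unfolding cont_on_S0_def by blast
qed

text \<open>Transposition interchanges the two halves of \<open>cont_op\<close>: continuity of each
  functional \<open>T f\<close>, and continuity in \<open>f\<close> for a fixed second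
  argument.\<close>

lemma cont_op_transp:
 assumes T: "cont_op T" shows "cont_op (transp T)"
proof -
 have lin: "T f : SP" if "f : schwartz0" for f using T that unfolding cont_op_def lin_op_def by blast
 have add: "T (%x. a * f x + b * g x) h = a * T f h + b * T g h" if "f : schwartz0" "g : schwartz0" "h : schwartz0" for f g h a b
 using T that unfolding cont_op_def lin_op_def by blast
 have cont: "cont_on_S0 (%f. T f g)" if "g : schwartz0" for g using T that unfolding cont_op_def by blast
 have "transp T f : SP" if "f : schwartz0" for f
 unfolding SP_def lin_on_S0_def transp_def using add cont that by blast
 moreover have "transp T (%x. a * f x + b * g x) h = a * transp T f h + b * transp T g h" if "f : schwartz0" "g : schwartz0" "h : schwartz0" for f g h a b
 using lin[OF that(3)] that(1,2) unfolding SP_def lin_on_S0_def transp_def by blast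
 moreover have "cont_on_S0 (%f. transp T f g)" if "g : schwartz0" for g
 using lin[OF that] unfolding SP_def transp_def by (simp add: eta_contract_eq)
 ultimately show ?thesis unfolding cont_op_def lin_op_def by blast
qed

theorem theorem4p10:
  fixes \<phi> \<psi> :: "real^'n::finite \<Rightarrow> complex"
    and T :: "(real^'n \<Rightarrow> complex) \<Rightarrow> (real^'n \<Rightarrow> complex) \<Rightarrow> complex"
    and K :: "real^'n \<Rightarrow> real^'n \<Rightarrow> complex"
    and \<delta> :: real
  assumes n2: "CARD('n) \<ge> 2"
    and pair: "dual_pair \<phi> \<psi>"
    and delta: "0 < \<delta>" "\<delta> \<le> 1"
    and SK: "SKm1 \<delta> T K"
    and int_T: "\<And>Q. integrable lborel (\<lambda>x. LINT y|lborel. K x y * cubefn \<psi> Q y) \<and>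
                     (LINT x|lborel. (LINT y|lborel. K x y * cubefn \<psi> Q y)) = 0"
    and int_Tt: "\<And>Q. integrable lborel (\<lambda>x. LINT y|lborel. K y x * cubefn \<phi> Q y) \<and>
                     (LINT x|lborel. (LINT y|lborel. K y x * cubefn \<phi> Q y)) = 0"
  shows "ADP \<phi> \<psi> \<delta> T \<and>
         (\<forall>p q \<alpha>. 1 \<le> p \<and> 1 \<le> q \<and> -1 \<le> \<alpha> \<and> \<alpha> \<le> 0 \<longrightarrow>
            bdd_ext \<phi> \<alpha> q p T \<and> bdd_ext \<phi> \<alpha> q p (transp T))"
proof -
  have \<phi>: "band \<phi>" and \<psi>: "band \<psi>" and PU: "PU \<phi> \<psi>" using dual_pair_props[OF pair] .
  obtain CK where KB: "KB \<delta> CK K" "KB \<delta> CK (\<lambda>x y. K y x)" using SKm1_KB[OF SK] by blast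
  \<comment> \<open>Represents the transpose of \<open>T\<close> on \<open>g\<close> by a bounded
    function, as \<kappa>2 does for \<open>T\<close> on \<open>f\<close>; the first representation
    needs \<open>kernel_fubini\<close>.\<close>
  define \<kappa>1 where "\<kappa>1 g y = (LINT x|lborel. K x y * g x)" for g :: "'n fn" and y
  define \<kappa>2 where "\<kappa>2 f x = (LINT y|lborel. K x y * f y)" for f :: "'n fn" and x
  have k1: "\<kappa>1 g \<in> borel_measurable borel \<and> (\<exists>b. \<forall>y. norm (\<kappa>1 g y) \<le> b)" if g: "g \<in> schwartz0" for g
  proof -
    have r: "rd g" by (rule schwartz_rd[OF schwartz0_schwartz[OF g]])
    show ?thesis using kernel_integral_measurable[OF KB(1) r] kernel_integral_bound[OF r, of \<delta>] KB(1) unfolding \<kappa>1_def[abs_def] by blast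
  qed
  have k2: "\<kappa>2 f \<in> borel_measurable borel \<and> (\<exists>b. \<forall>y. norm (\<kappa>2 f y) \<le> b)" if f: "f \<in> schwartz0" for f
  proof -
    have r: "rd f" by (rule schwartz_rd[OF schwartz0_schwartz[OF f]])
    show ?thesis using kernel_integral_measurable[OF KB(2) r] kernel_integral_bound[OF r, of \<delta>] KB(2) unfolding \<kappa>2_def[abs_def] by blast
  qed
  have T2: "T f g = (LINT x|lborel. g x * \<kappa>2 f x)" if "f \<in> schwartz0" "g \<in> schwartz0" for f g
  proof -
    have "T f g = (LINT x|lborel. (LINT y|lborel. K x y * f y) * g x)" using SK that unfolding SKm1_def by blast
    then show ?thesis unfolding \<kappa>2_def by (simp only: mult.commute)
  qed
  have T1: "T f g = (LINT y|lborel. f y * \<kappa>1 g y)" if "f \<in> schwartz0" "g \<in> schwartz0" for f g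
  proof -
    have "T f g = (LINT x|lborel. (LINT y|lborel. K x y * f y) * g x)" using SK that unfolding SKm1_def by blast
    also have "\<dots> = (LINT y|lborel. f y * \<kappa>1 g y)" unfolding \<kappa>1_def using that by (intro kernel_fubini[OF KB(1)] schwartz_rd schwartz0_schwartz)
    finally show ?thesis .
  qed
  have cont: "cont_op T"
  proof -
    have "lin_op T" using SK unfolding SKm1_def by blast
    moreover have "cont_on_S0 (\<lambda>f. T f g)" if g: "g \<in> schwartz0" for g
    proof -
      obtain b where b: "\<kappa>1 g \<in> borel_measurable borel" "\<And>y. norm (\<kappa>1 g y) \<le> b" using k1[OF g] by blast
      show ?thesis by (rule L1_functional_cont[OF b T1[OF _ g]])
    qed
    ultimately show ?thesis unfolding cont_op_def by blast
  qed
  obtain C where C: "C \<ge> 0" "\<forall>P Q. norm (T (cubefn \<psi> P) (cubefn \<phi> Q)) \<le> C * omega \<delta> P Q"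
    using almost_diagonal[OF delta SK band_schwartz[OF \<phi>] band_even[OF \<phi>] band_integral[OF \<phi>] band_schwartz[OF \<psi>] band_even[OF \<psi>] band_integral[OF \<psi>]
        band_cubefn[OF \<phi>] band_cubefn[OF \<psi>] int_T int_Tt] by blast
  have "ADP \<phi> \<psi> \<delta> T" unfolding ADP_def using cont cont_op_transp[OF cont] C(2) by blast
  moreover have "bdd_ext \<phi> \<alpha> q p T \<and> bdd_ext \<phi> \<alpha> q p (transp T)" if "1 \<le> p \<and> 1 \<le> q \<and> -1 \<le> \<alpha> \<and> \<alpha> \<le> 0" for p q \<alpha>
  proof
    have pq: "-1 \<le> \<alpha>" "\<alpha> \<le> 0" "1 \<le> p" "1 \<le> q" using that by auto
    show "bdd_ext \<phi> \<alpha> q p T"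
      by (rule bdd_ext_almost_diagonal[OF \<phi> \<psi> PU \<phi> \<psi> PU delta(1) pq C(1) C(2)[rule_format] k1 k2 T1 T2])
    have Ct: "norm (transp T (cubefn \<phi> P) (cubefn \<psi> Q)) \<le> C * omega \<delta> P Q" for P Q
      unfolding transp_def omega_commute[of \<delta> P] using C(2) by blast
    have t1: "transp T f g = (LINT y|lborel. f y * \<kappa>2 g y)" and t2: "transp T f g = (LINT x|lborel. g x * \<kappa>1 f x)" if "f \<in> schwartz0" "g \<in> schwartz0" for f g
      unfolding transp_def by (rule T2[OF that(2,1)], rule T1[OF that(2,1)])
    \<comment> \<open>The matrix of the transpose pairs its values on \<phi> wavelets with \<psi>
      wavelets, so \<phi> and \<psi> exchange their roles as \<open>et\<close> and
      \<open>ze\<close>; the norms keep \<phi>.\<close>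
    show "bdd_ext \<phi> \<alpha> q p (transp T)"
      by (rule bdd_ext_almost_diagonal[OF \<phi> \<psi> PU \<psi> \<phi> PU_commute[OF PU] delta(1) pq C(1) Ct k2 k1 t1 t2])
  qed
  ultimately show ?thesis by blast
qed

end
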